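(* Consider the linear structural error-in-variables model $y_i=\beta\xi_i+\alpha+\delta_i$, $x_i=\xi_i+\varepsilon_i$, $i\ge 1$, with real-valued slope $\beta$. Assume that the intercept $\alpha$ is known to be zero, that $\{\xi,\xi_i,\ i\ge 1\}$ are i.i.d. random variables, that $E|\xi|<\infty$, and that (A) and (C) of the context hold true. Then for $j=1$ and $2$, condition (B) of the context (that is, $\xi\in\mathrm{DAN}$) is equivalent to any one of the following central limit theorems: as $n\to\infty$, (a) $\displaystyle \sqrt{n}\,U(j,n)(\widehat{\beta}_{jn}-\beta)\Big(\sum_{i=1}^{n}\big(u_i(j,n)-\overline{u(j,n)}\big)^2/(n-1)\Big)^{-1/2}\xrightarrow{\mathcal{D}}N(0,1)$, (b) $\displaystyle n\,U(j,n)(\widehat{\beta}_{jn}-\beta)\Big(\sum_{i=1}^{n}u_i^2(j,n)\Big)^{-1/2}\xrightarrow{\mathcal{D}}N(0,1)$.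
   Context: Assumptions. (A) $\{(\delta,\varepsilon),(\delta_i,\varepsilon_i),i\ge1\}$ is a sequence of i.i.d. random vectors with mean zero, $E\delta^4<\infty$, $E\varepsilon^4<\infty$, and positive definite covariance matrix $\Gamma=\begin{pmatrix}\lambda\theta&\mu\\ \mu&\theta\end{pmatrix}$, i.e. $\mathrm{Var}\,\delta=\lambda\theta$, $\mathrm{Var}\,\varepsilon=\theta$, $\mathrm{cov}(\delta,\varepsilon)=\mu$. (B) $\{\xi,\xi_i,i\ge1\}$ are i.i.d. random variables in the domain of attraction of the normal law (DAN), i.e. there are constants $a_n$ and $b_n$, $b_n>0$, for which $(\sum_{i=1}^n\xi_i-a_n)b_n^{-1}\xrightarrow{\mathcal D}N(0,1)$ as $n\to\infty$. (C) $(\delta,\varepsilon)$ and $\xi$ are independent; in the structural model the explanatory variables $\xi_i$ are independent of the error terms $(\delta_i,\varepsilon_i)$. Notation. For real-valued variables $u_i,v_i$, $1\le i\le n$: $\overline u=\frac1n\sum_{i=1}^nu_i$, $s_{i,uv}=(u_i-c\,\overline u)(v_i-c\,\overline v)$, $S_{uv}=\frac1n\sum_{i=1}^ns_{i,uv}$, where $c=0$ if the intercept is known to be zero (the case here) and $c=1$ if the intercept is unknown. The case $j=1$ is used when $\lambda\theta$ and $\mu$ are known and $\theta$ is unknown: $\widehat\beta_{1n}=\dfrac{S_{yy}-\lambda\theta}{S_{xy}-\mu}$, if $S_{xy}-\mu\ne0$ and $S_{yy}-\lambda\theta>0$. The case $j=2$ is used when $\theta$ and $\mu$ are known and $\lambda\theta$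 is unknown: $\widehat\beta_{2n}=\dfrac{S_{xy}-\mu}{S_{xx}-\theta}$, if $S_{xx}-\theta>0$. Furthermore $$U(1,n)=S_{xy}-\mu,\quad U(2,n)=S_{xx}-\theta,$$ $$u_i(1,n)=(s_{i,yy}-\lambda\theta)-\beta(s_{i,xy}-\mu),\quad u_i(2,n)=(s_{i,xy}-\mu)-\beta(s_{i,xx}-\theta),$$ and $\overline{u(j,n)}=\frac1n\sum_{i=1}^nu_i(j,n)$.
   Formalization: The formal theorem additionally assumes that ξ is not almost surely constant and, for j=1, that β≠0; without these the equivalence fails (e.g. ξ=1 with j=2, or β=0 with j=1, where u_i(1,n) does not involve ξ). *)

theory Defs
  imports "HOL-Probability.Probability"
begin

definition pos_def_matrix :: "real ^ 'n ^ 'n \<Rightarrow> bool" where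
  "pos_def_matrix A \<longleftrightarrow> transpose A = A \<and> (\<forall>v. v \<noteq> 0 \<longrightarrow> v \<bullet> (A *v v) > 0)"

definition Gamma_matrix :: "real \<Rightarrow> real \<Rightarrow> real \<Rightarrow> real ^ 2 ^ 2" where
  "Gamma_matrix lam theta mu = vector [vector [lam * theta, mu], vector [mu, theta]]"

context prob_space
begin

definition covariance :: "('a \<Rightarrow> real) \<Rightarrow> ('a \<Rightarrow> real) \<Rightarrow> real" where
  "covariance X Y = expectation (\<lambda>\<omega>. (X \<omega> - expectation X) * (Y \<omega> - expectation Y))"

definition iid :: "'b measure \<Rightarrow> (nat \<Rightarrow> 'a \<Rightarrow> 'b) \<Rightarrow> bool" where
  "iid N X \<longleftrightarrow> indep_vars (\<lambda>_. N) X UNIV \<and> (\<forall>i. distr M N (X i) = distr M N (X 0))"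

text \<open>The library's \<open>indep_var\<close> requires both variables to have the same value type.\<close>

definition indep_rv :: "'b measure \<Rightarrow> ('a \<Rightarrow> 'b) \<Rightarrow> 'c measure \<Rightarrow> ('a \<Rightarrow> 'c) \<Rightarrow> bool" where
  "indep_rv S X T Y \<longleftrightarrow> random_variable S X \<and> random_variable T Y \<and>
     indep_set {X -` A \<inter> space M | A. A \<in> sets S} {Y -` B \<inter> space M | B. B \<in> sets T}"

definition conv_std_normal :: "(nat \<Rightarrow> 'a \<Rightarrow> real) \<Rightarrow> bool" where
  "conv_std_normal T \<longleftrightarrow>
     (\<forall>n. random_variable borel (T n)) \<and>
     weak_conv_m (\<lambda>n. distr M borel (T n)) std_normal_distribution"

text \<open>For an i.i.d. sequence \<open>X\<close> whose member \<open>X 0\<close> is the generic copy, this says that the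
  common law lies in the domain of attraction of the normal law.\<close>

definition DAN :: "(nat \<Rightarrow> 'a \<Rightarrow> real) \<Rightarrow> bool" where
  "DAN X \<longleftrightarrow> (\<exists>a b :: nat \<Rightarrow> real. (\<forall>n. b n > 0) \<and>
     conv_std_normal (\<lambda>n \<omega>. ((\<Sum>i=1..n. X i \<omega>) - a n) * inverse (b n)))"

end

text \<open>Samples are sequences \<open>u 1, u 2, \<dots>\<close>, of which only the first \<open>n\<close> terms are used; the
  term at index 0 is never part of a sample.\<close>

definition smean :: "(nat \<Rightarrow> real) \<Rightarrow> nat \<Rightarrow> real" where
  "smean u n = 1 / real n * (\<Sum>i=1..n. u i)"

text \<open>The constant \<open>c\<close> is 0 if the intercept is known to be zero and 1 if it is unknown.\<close>

definition s_dev :: "real \<Rightarrow> (nat \<Rightarrow> real) \<Rightarrow> (nat \<Rightarrow> real) \<Rightarrow> nat \<Rightarrow> nat \<Rightarrow> real" where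
  "s_dev c u v n i = (u i - c * smean u n) * (v i - c * smean v n)"

definition S_mom :: "real \<Rightarrow> (nat \<Rightarrow> real) \<Rightarrow> (nat \<Rightarrow> real) \<Rightarrow> nat \<Rightarrow> real" where
  "S_mom c u v n = 1 / real n * (\<Sum>i=1..n. s_dev c u v n i)"

text \<open>In the following definitions \<open>j\<close> ranges over 1 and 2. Outside the event on which an
  estimator is defined it takes the unspecified constant value \<open>undefined\<close>.\<close>

definition beta_hat ::
  "real \<Rightarrow> real \<Rightarrow> real \<Rightarrow> real \<Rightarrow> nat \<Rightarrow> (nat \<Rightarrow> real) \<Rightarrow> (nat \<Rightarrow> real) \<Rightarrow> nat \<Rightarrow> real" where
  "beta_hat c lam theta mu j x y n =
     (if j = 1 then
        (if S_mom c x y n - mu \<noteq> 0 \<and> S_mom c y y n - lam * theta > 0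
         then (S_mom c y y n - lam * theta) / (S_mom c x y n - mu) else undefined)
      else
        (if S_mom c x x n - theta > 0
         then (S_mom c x y n - mu) / (S_mom c x x n - theta) else undefined))"

definition U_stat ::
  "real \<Rightarrow> real \<Rightarrow> real \<Rightarrow> nat \<Rightarrow> (nat \<Rightarrow> real) \<Rightarrow> (nat \<Rightarrow> real) \<Rightarrow> nat \<Rightarrow> real" where
  "U_stat c theta mu j x y n =
     (if j = 1 then S_mom c x y n - mu else S_mom c x x n - theta)"

definition u_term ::
  "real \<Rightarrow> real \<Rightarrow> real \<Rightarrow> real \<Rightarrow> real \<Rightarrow> nat \<Rightarrow> (nat \<Rightarrow> real) \<Rightarrow> (nat \<Rightarrow> real) \<Rightarrow> nat \<Rightarrow> nat \<Rightarrow> real" where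
  "u_term c beta lam theta mu j x y n i =
     (if j = 1 then (s_dev c y y n i - lam * theta) - beta * (s_dev c x y n i - mu)
      else (s_dev c x y n i - mu) - beta * (s_dev c x x n i - theta))"

text \<open>The two normalized statistics; \<open>0 powr (-1/2) = 0\<close> is the convention for a vanishing
  sum of squares.\<close>

definition stat_a ::
  "real \<Rightarrow> real \<Rightarrow> real \<Rightarrow> real \<Rightarrow> real \<Rightarrow> nat \<Rightarrow> (nat \<Rightarrow> real) \<Rightarrow> (nat \<Rightarrow> real) \<Rightarrow> nat \<Rightarrow> real" where
  "stat_a c beta lam theta mu j x y n =
     sqrt (real n) * U_stat c theta mu j x y n * (beta_hat c lam theta mu j x y n - beta) *
     ((\<Sum>i=1..n. (u_term c beta lam theta mu j x y n i
                   - smean (u_term c beta lam theta mu j x y n) n)\<^sup>2) / (real n - 1)) powr (- 1 / 2)"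

definition stat_b ::
  "real \<Rightarrow> real \<Rightarrow> real \<Rightarrow> real \<Rightarrow> real \<Rightarrow> nat \<Rightarrow> (nat \<Rightarrow> real) \<Rightarrow> (nat \<Rightarrow> real) \<Rightarrow> nat \<Rightarrow> real" where
  "stat_b c beta lam theta mu j x y n =
     real n * U_stat c theta mu j x y n * (beta_hat c lam theta mu j x y n - beta) *
     (\<Sum>i=1..n. (u_term c beta lam theta mu j x y n i)\<^sup>2) powr (- 1 / 2)"

end

theory Submission
 imports Defs "HOL-Real_Asymp.Real_Asymp"
begin

text \<open>
  Put \<open>v = \<delta> - \<beta> \<epsilon>\<close>. Where the estimator is defined, \<open>n U\<close> times its error is the sum of the \<open>u\<^sub>i\<close>, and
  \<open>u = (k \<xi> + s \<delta> + t \<epsilon>) v - const\<close> has the form \<open>\<xi> \<eta> + \<zeta>\<close> in which \<open>(\<eta>, \<zeta>)\<close> is centred and independent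
  of \<open>\<xi>\<close>, with enough moments. The estimator is defined with probability tending to one, because the
  averages that must not vanish dominate averages with a positive mean. Hence statistic (b) agrees,
  up to a vanishing event, with \<open>T = S / V\<close>, where \<open>S\<close> is the sum of the \<open>u\<^sub>i\<close> and \<open>V\<^sup>2\<close> the sum of
  their squares. Statistic (a) is \<open>T\<close> divided by the square root of \<open>1 + (1 - T\<^sup>2) / (n - 1)\<close>, which tends to
  one in probability since \<open>E T\<^sup>2\<close> is bounded. It remains to show that \<open>\<xi>\<close> is in the domain of attraction
  of the normal law iff \<open>T\<close> is asymptotically standard normal (\<open>DAN_iff_self_normalized_clt\<close>).

  The link between both sides is a normal scale: positive constants \<open>b\<^sub>n\<close> for which
  \<open>n E min(1, (X / b\<^sub>n)\<^sup>2)\<close> stays between positive bounds while \<open>n E min(1, (X / b\<^sub>n)^4)\<close> tends to zero.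
  For integrable nonconstant \<open>X\<close> this is the domain of attraction: one direction reads the two
  quantities off the characteristic function of the symmetrized variable (\<open>DAN_imp_normal_scale\<close>), the
  other truncates at \<open>b\<^sub>n\<close> and applies Lindeberg's theorem (\<open>normal_scale_imp_DAN\<close>). Normal scales pass
  between \<open>\<xi>\<close> and \<open>u\<close>, because for large \<open>x\<close> the variable \<open>x \<eta> + \<zeta>\<close> is of the order of \<open>x\<close> with a
  probability bounded below. A normal scale of \<open>\<xi>\<close> gives the limit law of \<open>T\<close> by truncation in \<open>\<xi>\<close>
  (\<open>normal_scale_imp_clt\<close>).

  For the converse, \<open>E T\<^sup>2\<close> is first shown to be bounded: the mixed moments \<open>E u\<^sub>i u\<^sub>j / V\<^sup>2\<close> are of order
  \<open>1 / n\<^sup>2\<close> (\<open>pair_ratio_expectation\<close>, \<open>self_normalized_sum_second_moment\<close>). Next,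
  \<open>E exp(-s\<^sup>2 V\<^sup>2) cos(w S)\<close> is the real part of a power of one characteristic function, hence at most the
  value for variables symmetrized in pairs (\<open>iid_pair_cos_bound\<close>). Expanding the cosines to fourth order
  and integrating over \<open>ds / s\<close> makes the inequality scale free: it then only involves \<open>T\<close> and the shares
  of the squares and the fourth powers of the pair differences in \<open>V\<^sup>2\<close> and \<open>V^4\<close>
  (\<open>self_normalized_pair_inequality\<close>). If \<open>u\<close> has infinite variance, the former share tends to one, and
  normality of the limit forces the latter to zero (\<open>pair_fourth_ratio_tendsto_0\<close>). A vanishing fourth
  order share produces a normal scale (\<open>pair_fourth_ratio_lower\<close>); with finite variance there is one
  anyway.
\<close>

section \<open>Independent identically distributed sequences\<close>

text \<open>Short names for facts about the Lebesgue integral; the gauge integral has facts of the same names.\<close>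
lemmas L_integrable_add = Bochner_Integration.integrable_add
lemmas L_integrable_bound = Bochner_Integration.integrable_bound
lemmas L_integrable_cong = Bochner_Integration.integrable_cong
lemmas L_integrable_diff = Bochner_Integration.integrable_diff
lemmas L_integrable_sum = Bochner_Integration.integrable_sum
lemmas L_integral_add = Bochner_Integration.integral_add
lemmas L_integral_cong = Bochner_Integration.integral_cong
lemmas L_integral_diff = Bochner_Integration.integral_diff
lemmas L_integral_indicator = Bochner_Integration.integral_indicator
lemmas L_integral_sum = Bochner_Integration.integral_sum

context prob_space
begin

lemma iid_measurable:
 assumes "iid N W"
 shows "random_variable N (W i)" using assms by (auto simp: iid_def indep_vars_def)

lemma iid_distr:
 assumes "iid N W"
 shows "distr M N (W i) = distr M N (W 0)" using assms by (auto simp: iid_def)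

lemma iid_integrable:
 fixes g :: "'b \<Rightarrow> 'c::{banach,second_countable_topology}"
 assumes iid: "iid N W" and [measurable]: "g \<in> borel_measurable N"
 shows "integrable M (%om. g (W i om)) \<longleftrightarrow> integrable M (%om. g (W 0 om))"
proof -
 note [measurable] = iid_measurable[OF iid]
 show ?thesis using iid_distr[OF iid, of i] integrable_distr_eq[of "W i" M N g] integrable_distr_eq[of "W 0" M N g] by simp
qed

lemma iid_expectation:
 fixes g :: "'b \<Rightarrow> 'c::{banach,second_countable_topology}"
 assumes iid: "iid N W" and [measurable]: "g \<in> borel_measurable N"
 shows "expectation (%om. g (W i om)) = expectation (%om. g (W 0 om))"
proof -
 note [measurable] = iid_measurable[OF iid]
 show ?thesis using iid_distr[OF iid, of i] integral_distr[of "W i" M N g] integral_distr[of "W 0" M N g] by simp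
qed

lemma iid_compose:
 assumes iid: "iid N W" and [measurable]: "f \<in> N \<rightarrow>\<^sub>M K"
 shows "iid K (%i om. f (W i om))"
proof -
 note [measurable] = iid_measurable[OF iid]
 have "distr M K (%om. f (W i om)) = distr (distr M N (W i)) K f" for i by (subst distr_distr) (auto simp: comp_def)
 then have "distr M K (%om. f (W i om)) = distr M K (%om. f (W 0 om))" for i using iid_distr[OF iid, of i] by metis
 then show ?thesis using iid indep_vars_compose2[of "%_. N" W UNIV "%_. f" "%_. K"] by (auto simp: iid_def)
qed

text \<open>The laws of finitely many members of the sequence form a product measure, so expectations of products
  factor.\<close>
lemma iid_prod:
 fixes g :: "nat \<Rightarrow> 'b \<Rightarrow> 'c::{real_normed_field,banach,second_countable_topology}"
 assumes iid: "iid N W" and I: "finite I"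
  and [measurable]: "\<And>i. i \<in> I \<Longrightarrow> g i \<in> borel_measurable N"
  and int: "\<And>i. i \<in> I \<Longrightarrow> integrable M (%om. g i (W 0 om))"
 shows iid_prod_integrable: "integrable M (%om. \<Prod>i\<in>I. g i (W i om))"
  and iid_prod_expectation:
   "expectation (%om. \<Prod>i\<in>I. g i (W i om)) = (\<Prod>i\<in>I. expectation (%om. g i (W 0 om)))"
proof -
 have "indep_vars (%_. N) W I" by (rule indep_vars_subset[of _ _ UNIV]) (use iid in \<open>auto simp: iid_def\<close>)
 then have ind: "indep_vars (%_. borel) (%i om. g i (W i om)) I" by (rule indep_vars_compose2) auto
 have int': "integrable M (%om. g i (W i om))" if "i \<in> I" for i using iid_integrable[OF iid, of "g i" i] int that by auto
 show "integrable M (%om. \<Prod>i\<in>I. g i (W i om))" using I ind int' by (rule indep_vars_integrable)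
 have "expectation (%om. \<Prod>i\<in>I. g i (W i om)) = (\<Prod>i\<in>I. expectation (%om. g i (W i om)))" using I ind int' by (rule indep_vars_lebesgue_integral)
 also have "\<dots> = (\<Prod>i\<in>I. expectation (%om. g i (W 0 om)))" by (intro prod.cong refl iid_expectation[OF iid]) auto
 finally show "expectation (%om. \<Prod>i\<in>I. g i (W i om)) = (\<Prod>i\<in>I. expectation (%om. g i (W 0 om)))" .
qed

lemma indep_rv_iff_distr:
 "indep_rv S X T Y \<longleftrightarrow> random_variable S X \<and> random_variable T Y \<and>
   distr M (S \<Otimes>\<^sub>M T) (%om. (X om, Y om)) = distr M S X \<Otimes>\<^sub>M distr M T Y"
proof (cases "random_variable S X \<and> random_variable T Y")
 case True
 then have [measurable]: "random_variable S X" "random_variable T Y" by auto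
 interpret X: prob_space "distr M S X" by (rule prob_space_distr) simp
 interpret Y: prob_space "distr M T Y" by (rule prob_space_distr) simp
 interpret XY: pair_prob_space "distr M S X" "distr M T Y" ..
 have rect: "emeasure (distr M (S \<Otimes>\<^sub>M T) (%om. (X om, Y om))) (A \<times> B) =
   prob ((X -` A \<inter> space M) \<inter> (Y -` B \<inter> space M))" if "A \<in> sets S" "B \<in> sets T" for A B
  using that by (simp add: emeasure_distr emeasure_eq_measure) (intro arg_cong[where f = prob], auto)
 have prod: "emeasure (distr M S X) A * emeasure (distr M T Y) B =
   ennreal (prob (X -` A \<inter> space M) * prob (Y -` B \<inter> space M))" if "A \<in> sets S" "B \<in> sets T" for A B
  using that by (simp add: emeasure_distr emeasure_eq_measure ennreal_mult)
 have "indep_rv S X T Y \<longleftrightarrow> (\<forall>A\<in>sets S. \<forall>B\<in>sets T.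
   prob ((X -` A \<inter> space M) \<inter> (Y -` B \<inter> space M)) = prob (X -` A \<inter> space M) * prob (Y -` B \<inter> space M))"
  using True unfolding indep_rv_def indep_sets2_eq by (auto; blast)
 also have "\<dots> \<longleftrightarrow> distr M (S \<Otimes>\<^sub>M T) (%om. (X om, Y om)) = distr M S X \<Otimes>\<^sub>M distr M T Y" (is "?l = ?r")
 proof
  assume ?l
  show ?r
  proof (rule pair_measure_eqI[symmetric])
   fix A B assume "A \<in> sets (distr M S X)" "B \<in> sets (distr M T Y)"
   then show "emeasure (distr M S X) A * emeasure (distr M T Y) B =
     emeasure (distr M (S \<Otimes>\<^sub>M T) (%om. (X om, Y om))) (A \<times> B)" using \<open>?l\<close> by (simp add: rect prod)
  qed (auto intro: X.sigma_finite_measure_axioms Y.sigma_finite_measure_axioms)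
 next
  assume ?r
  show ?l
  proof (intro ballI)
   fix A B assume *: "A \<in> sets S" "B \<in> sets T"
   have "emeasure (distr M (S \<Otimes>\<^sub>M T) (%om. (X om, Y om))) (A \<times> B) =
     emeasure (distr M S X) A * emeasure (distr M T Y) B" unfolding \<open>?r\<close> using * by (intro Y.emeasure_pair_measure_Times) auto
   then show "prob ((X -` A \<inter> space M) \<inter> (Y -` B \<inter> space M)) = prob (X -` A \<inter> space M) * prob (Y -` B \<inter> space M)" using * by (simp add: rect prod)
  qed
 qed
 finally show ?thesis using True by auto
qed (auto simp: indep_rv_def)

lemma indep_rv_compose:
 assumes ind: "indep_rv S X T Y" and [measurable]: "f \<in> S \<rightarrow>\<^sub>M S'" "g \<in> T \<rightarrow>\<^sub>M T'"
 shows "indep_rv S' (%om. f (X om)) T' (%om. g (Y om))"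
proof -
 have [measurable]: "random_variable S X" "random_variable T Y"
  and eq: "indep_set {X -` A \<inter> space M |A. A \<in> sets S} {Y -` B \<inter> space M |B. B \<in> sets T}" using ind by (auto simp: indep_rv_def)
 have "\<exists>B. (%om. f (X om)) -` A \<inter> space M = X -` B \<inter> space M \<and> B \<in> sets S" if "A \<in> sets S'" for A using that measurable_space[of X M S]
  by (intro exI[of _ "f -` A \<inter> space S"]) (auto intro: measurable_sets)
 moreover have "\<exists>B. (%om. g (Y om)) -` A \<inter> space M = Y -` B \<inter> space M \<and> B \<in> sets T" if "A \<in> sets T'" for A using that measurable_space[of Y M T]
  by (intro exI[of _ "g -` A \<inter> space T"]) (auto intro: measurable_sets)
 ultimately have "indep_set {(%om. f (X om)) -` A \<inter> space M |A. A \<in> sets S'}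
   {(%om. g (Y om)) -` B \<inter> space M |B. B \<in> sets T'}" using eq unfolding indep_set_def by (elim indep_sets_mono_sets) (auto split: bool.split)
 then show ?thesis by (auto simp: indep_rv_def)
qed

text \<open>Functions of disjoint blocks of the sequence may take values in different types, which is why the
  statement uses \<open>indep_rv\<close>.\<close>
lemma iid_blocks_independent:
 assumes iid: "iid N W" and AB: "A \<inter> B = {}"
  and F: "F \<in> PiM A (%_. N) \<rightarrow>\<^sub>M S" and G: "G \<in> PiM B (%_. N) \<rightarrow>\<^sub>M T"
 shows "indep_rv S (%om. F (\<lambda>i\<in>A. W i om)) T (%om. G (\<lambda>i\<in>B. W i om))"
proof -
 have "indep_var (PiM A (%_. N)) (%om. \<lambda>i\<in>A. W i om) (PiM B (%_. N)) (%om. \<lambda>i\<in>B. W i om)"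
  using iid AB by (intro indep_var_restrict[where I = UNIV]) (auto simp: iid_def)
 then have "indep_rv (PiM A (%_. N)) (%om. \<lambda>i\<in>A. W i om) (PiM B (%_. N)) (%om. \<lambda>i\<in>B. W i om)"
  by (simp add: indep_var_distribution_eq indep_rv_iff_distr)
 from indep_rv_compose[OF this F G] show ?thesis .
qed

lemma iid_independent:
 assumes iid: "iid N W" and "i \<noteq> j"
 shows "indep_rv N (W i) N (W j)" using iid_blocks_independent[OF iid, of "{i}" "{j}" "%x. x i" N "%x. x j" N] assms by auto

lemma indep_rv_nn_integral:
 assumes ind: "indep_rv S X T Y" and [measurable]: "(%(x, y). f x y) \<in> borel_measurable (S \<Otimes>\<^sub>M T)"
 shows "(\<integral>\<^sup>+om. f (X om) (Y om) \<partial>M) = (\<integral>\<^sup>+om. (\<integral>\<^sup>+om'. f (X om) (Y om') \<partial>M) \<partial>M)"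
proof -
 have X: "random_variable S X" and Y: "random_variable T Y"
  and eq: "distr M (S \<Otimes>\<^sub>M T) (%om. (X om, Y om)) = distr M S X \<Otimes>\<^sub>M distr M T Y" using ind by (auto simp: indep_rv_iff_distr)
 note [measurable] = X Y
 interpret Y: prob_space "distr M T Y" by (rule prob_space_distr) simp
 have inner: "(\<integral>\<^sup>+y. f x y \<partial>distr M T Y) = (\<integral>\<^sup>+om'. f x (Y om') \<partial>M)" if "x \<in> space S" for x using that by (subst nn_integral_distr) auto
 have "(\<integral>\<^sup>+om. f (X om) (Y om) \<partial>M) = (\<integral>\<^sup>+p. (%(x, y). f x y) p \<partial>distr M (S \<Otimes>\<^sub>M T) (%om. (X om, Y om)))" by (subst nn_integral_distr) auto
 also have "\<dots> = (\<integral>\<^sup>+x. \<integral>\<^sup>+y. f x y \<partial>distr M T Y \<partial>distr M S X)" unfolding eq by (subst Y.nn_integral_fst[symmetric]) auto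
 also have "\<dots> = (\<integral>\<^sup>+om. (\<integral>\<^sup>+y. f (X om) y \<partial>distr M T Y) \<partial>M)" by (subst nn_integral_distr) auto
 also have "\<dots> = (\<integral>\<^sup>+om. (\<integral>\<^sup>+om'. f (X om) (Y om') \<partial>M) \<partial>M)" by (intro nn_integral_cong inner measurable_space[OF X])
 finally show ?thesis .
qed

lemma
 fixes f :: "'b \<Rightarrow> 'c \<Rightarrow> real"
 assumes ind: "indep_rv S X T Y" and [measurable]: "(%(x, y). f x y) \<in> borel_measurable (S \<Otimes>\<^sub>M T)"
  and int: "integrable M (%om. f (X om) (Y om))"
 shows indep_rv_expectation: "expectation (%om. f (X om) (Y om)) = (\<integral>om. (\<integral>om'. f (X om) (Y om') \<partial>M) \<partial>M)"
  and indep_rv_integrable_inner: "integrable M (%om. \<integral>om'. f (X om) (Y om') \<partial>M)"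
proof -
 have X: "random_variable S X" and Y: "random_variable T Y"
  and eq: "distr M (S \<Otimes>\<^sub>M T) (%om. (X om, Y om)) = distr M S X \<Otimes>\<^sub>M distr M T Y" using ind by (auto simp: indep_rv_iff_distr)
 note [measurable] = X Y
 interpret X: prob_space "distr M S X" by (rule prob_space_distr) simp
 interpret Y: prob_space "distr M T Y" by (rule prob_space_distr) simp
 interpret XY: pair_prob_space "distr M S X" "distr M T Y" ..
 have int': "integrable (distr M S X \<Otimes>\<^sub>M distr M T Y) (%(x, y). f x y)" unfolding eq[symmetric] using int by (simp add: integrable_distr_eq)
 have inner: "(\<integral>y. f x y \<partial>distr M T Y) = (\<integral>om'. f x (Y om') \<partial>M)" if "x \<in> space S" for x using that by (subst integral_distr) auto
 have "expectation (%om. f (X om) (Y om)) = (\<integral>p. (%(x, y). f x y) p \<partial>distr M (S \<Otimes>\<^sub>M T) (%om. (X om, Y om)))" by (subst integral_distr) auto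
 also have "\<dots> = (\<integral>x. \<integral>y. f x y \<partial>distr M T Y \<partial>distr M S X)" unfolding eq using XY.integral_fst'[OF int'] by simp
 also have "\<dots> = (\<integral>om. (\<integral>y. f (X om) y \<partial>distr M T Y) \<partial>M)" by (subst integral_distr) auto
 also have "\<dots> = (\<integral>om. (\<integral>om'. f (X om) (Y om') \<partial>M) \<partial>M)" by (intro L_integral_cong refl inner measurable_space[OF X])
 finally show "expectation (%om. f (X om) (Y om)) = (\<integral>om. (\<integral>om'. f (X om) (Y om') \<partial>M) \<partial>M)" .
 have "integrable (distr M S X) (%x. \<integral>y. f x y \<partial>distr M T Y)" using XY.integrable_fst'[OF int'] by simp
 then have "integrable M (%om. \<integral>y. f (X om) y \<partial>distr M T Y)" by (subst (asm) integrable_distr_eq) auto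
 then show "integrable M (%om. \<integral>om'. f (X om) (Y om') \<partial>M)" by (rule L_integrable_cong[OF refl, THEN iffD1, rotated])
    (intro inner measurable_space[OF X])
qed

text \<open>Exchangeability: both families have the same product law.\<close>
lemma iid_expectation_reindex:
 fixes F :: "(nat \<Rightarrow> 'b) \<Rightarrow> real"
 assumes iid: "iid N W" and "finite I" "inj_on f I" and [measurable]: "F \<in> borel_measurable (PiM I (%_. N))"
 shows "expectation (%om. F (\<lambda>i\<in>I. W (f i) om)) = expectation (%om. F (\<lambda>i\<in>I. W i om))"
proof (cases "I = {}")
 case True then show ?thesis by (simp add: restrict_def)
next
 case False
 note [measurable] = iid_measurable[OF iid]
 have ind: "indep_vars (%_. N) W I" for I by (rule indep_vars_subset[of _ _ UNIV]) (use iid in \<open>auto simp: iid_def\<close>)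
 have "indep_vars (%i. PiM {f i} (%_. N)) (%i om. \<lambda>j\<in>{f i}. W j om) I"
  using assms by (intro indep_vars_restrict[OF ind[of UNIV]]) (auto simp: disjoint_family_on_def inj_on_def)
 from indep_vars_compose2[OF this, of "%i x. x (f i)" "%_. N"]
 have ind': "indep_vars (%_. N) (%i. W (f i)) I" by (simp add: restrict_def)
 have "distr M (PiM I (%_. N)) (%om. \<lambda>i\<in>I. W (f i) om) = PiM I (%i. distr M N (W (f i)))"
  using False ind' by (subst indep_vars_iff_distr_eq_PiM[symmetric]) auto
 also have "\<dots> = PiM I (%i. distr M N (W i))" using iid_distr[OF iid] by (intro PiM_cong) metis+
 also have "\<dots> = distr M (PiM I (%_. N)) (%om. \<lambda>i\<in>I. W i om)" using indep_vars_iff_distr_eq_PiM[THEN iffD1, OF False _ ind[of I]] by simp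
 finally have eq: "distr M (PiM I (%_. N)) (%om. \<lambda>i\<in>I. W (f i) om) = distr M (PiM I (%_. N)) (%om. \<lambda>i\<in>I. W i om)" .
 have "expectation (%om. F (\<lambda>i\<in>I. W (f i) om)) = (\<integral>x. F x \<partial>distr M (PiM I (%_. N)) (%om. \<lambda>i\<in>I. W (f i) om))" by (subst integral_distr) auto
 also have "\<dots> = expectation (%om. F (\<lambda>i\<in>I. W i om))" unfolding eq by (subst integral_distr) auto
 finally show ?thesis .
qed

lemma iid_consecutive_pairs:
 assumes iid: "iid N W"
 shows "iid (N \<Otimes>\<^sub>M N) (%i om. (W (2 * i + 1) om, W (2 * i + 2) om))"
proof -
 note [measurable] = iid_measurable[OF iid]
 let ?K = "%i::nat. {2 * i + 1, 2 * i + 2}"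
 have K: "x \<in> ?K i \<Longrightarrow> i = (x - 1) div 2" for x i by auto
 have disj: "disjoint_family ?K" unfolding disjoint_family_on_def using K by blast
 have "indep_vars (%i. PiM (?K i) (%_. N)) (%i om. \<lambda>j\<in>?K i. W j om) UNIV"
  using iid disj by (intro indep_vars_restrict[where I = UNIV]) (auto simp: iid_def)
 from indep_vars_compose2[OF this, of "%i x. (x (2 * i + 1), x (2 * i + 2))" "%_. N \<Otimes>\<^sub>M N"]
 have "indep_vars (%_. N \<Otimes>\<^sub>M N) (%i om. (W (2 * i + 1) om, W (2 * i + 2) om)) UNIV" by simp
 moreover have law: "distr M (N \<Otimes>\<^sub>M N) (%om. (W (2 * i + 1) om, W (2 * i + 2) om)) =
   distr M N (W 0) \<Otimes>\<^sub>M distr M N (W 0)" for i using iid_independent[OF iid, of "2 * i + 1" "2 * i + 2"]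
  by (simp add: indep_rv_iff_distr iid_distr[OF iid, of "Suc (2 * i)"] iid_distr[OF iid, of "Suc (Suc (2 * i))"])
 ultimately show ?thesis unfolding iid_def by (simp only: law simp_thms)
qed

lemma iid_sum_square:
 fixes g :: "'b \<Rightarrow> real"
 assumes iid: "iid N W" and [measurable]: "g \<in> borel_measurable N" and I: "finite I"
  and int: "integrable M (%om. (g (W 0 om))\<^sup>2)" and mean: "expectation (%om. g (W 0 om)) = 0"
 shows "integrable M (%om. (\<Sum>i\<in>I. g (W i om))\<^sup>2)"
  and "expectation (%om. (\<Sum>i\<in>I. g (W i om))\<^sup>2) = real (card I) * expectation (%om. (g (W 0 om))\<^sup>2)"
proof -
 note [measurable] = iid_measurable[OF iid]
 have int1: "integrable M (%om. g (W 0 om))" using int by (rule square_integrable_imp_integrable[rotated]) auto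
 have *: "integrable M (%om. g (W i om) * g (W j om)) \<and>
   expectation (%om. g (W i om) * g (W j om)) = (if i = j then expectation (%om. (g (W 0 om))\<^sup>2) else 0)" for i j
 proof (cases "i = j")
  case True
  then show ?thesis using iid_integrable[OF iid, of "%w. (g w)\<^sup>2" j] iid_expectation[OF iid, of "%w. (g w)\<^sup>2" j] int by (simp add: power2_eq_square)
 next
  case False
  then show ?thesis using iid_prod_integrable[OF iid, of "{i, j}" "%_. g"] iid_prod_expectation[OF iid, of "{i, j}" "%_. g"] int1 mean by simp
 qed
 have sq: "(\<Sum>i\<in>I. g (W i om))\<^sup>2 = (\<Sum>i\<in>I. \<Sum>j\<in>I. g (W i om) * g (W j om))" for om by (simp add: power2_eq_square sum_product)
 show "integrable M (%om. (\<Sum>i\<in>I. g (W i om))\<^sup>2)" unfolding sq using * by auto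
 have "expectation (%om. (\<Sum>i\<in>I. g (W i om))\<^sup>2) =
   (\<Sum>i\<in>I. \<Sum>j\<in>I. if i = j then expectation (%om. (g (W 0 om))\<^sup>2) else 0)" unfolding sq using * by (subst L_integral_sum; simp)+
 also have "\<dots> = real (card I) * expectation (%om. (g (W 0 om))\<^sup>2)" using I by simp
 finally show "expectation (%om. (\<Sum>i\<in>I. g (W i om))\<^sup>2) = real (card I) * expectation (%om. (g (W 0 om))\<^sup>2)" .
qed

end

section \<open>Convergence in probability and in law\<close>

lemma iexp_diff_le: "cmod (iexp a - iexp b) \<le> \<bar>a - b\<bar>"
proof -
 have "iexp a - iexp b = iexp b * (iexp (a - b) - 1)" by (simp add: algebra_simps flip: exp_add)
 then have "cmod (iexp a - iexp b) = cmod (iexp (a - b) - 1)" by (simp add: norm_mult)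
 also have "\<dots> \<le> \<bar>a - b\<bar>" using iexp_approx1[of "a - b" 0] by simp
 finally show ?thesis .
qed

context prob_space
begin

text \<open>Convergence in probability to zero.\<close>
definition vanishes :: "(nat \<Rightarrow> 'a \<Rightarrow> real) \<Rightarrow> bool" where
 "vanishes T \<longleftrightarrow> (\<forall>\<epsilon>>0. (%n. prob {om\<in>space M. \<epsilon> \<le> \<bar>T n om\<bar>}) \<longlonglongrightarrow> 0)"

lemma prob_le_tendsto_0:
 assumes "(%n. prob (B n)) \<longlonglongrightarrow> 0" "eventually (%n. A n \<subseteq> B n \<and> B n \<in> events) sequentially"
 shows "(%n. prob (A n)) \<longlonglongrightarrow> 0" by (rule tendsto_sandwich[OF _ _ tendsto_const assms(1)])
   (use assms(2) in \<open>auto elim!: eventually_mono intro: finite_measure_mono\<close>)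

lemma prob_Un_tendsto_0:
 assumes "(%n. prob (A n)) \<longlonglongrightarrow> 0" "(%n. prob (B n)) \<longlonglongrightarrow> 0" "\<And>n. A n \<in> events" "\<And>n. B n \<in> events"
 shows "(%n. prob (A n \<union> B n)) \<longlonglongrightarrow> 0"
proof (rule tendsto_sandwich[OF _ _ tendsto_const])
 show "\<forall>\<^sub>F n in sequentially. prob (A n \<union> B n) \<le> prob (A n) + prob (B n)" using assms by (auto intro!: always_eventually measure_Un_le)
 show "(%n. prob (A n) + prob (B n)) \<longlonglongrightarrow> 0" using tendsto_add[OF assms(1,2)] by simp
qed auto

lemma prob_abs_ge_le_expectation:
 fixes Z :: "'a \<Rightarrow> real"
 assumes int: "integrable M Z" and "0 < \<epsilon>"
 shows "prob {om\<in>space M. \<epsilon> \<le> \<bar>Z om\<bar>} \<le> expectation (%om. \<bar>Z om\<bar>) / \<epsilon>"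
 using integral_Markov_inequality_measure[of M "%om. \<bar>Z om\<bar>" "{}" \<epsilon>] assms by auto

lemma vanishesD:
 "vanishes T \<Longrightarrow> 0 < \<epsilon> \<Longrightarrow> (%n. prob {om\<in>space M. \<epsilon> \<le> \<bar>T n om\<bar>}) \<longlonglongrightarrow> 0" by (simp add: vanishes_def)

lemma vanishes_L1:
 assumes "\<And>n. integrable M (T n)" "(%n. expectation (%om. \<bar>T n om\<bar>)) \<longlonglongrightarrow> 0"
 shows "vanishes T" unfolding vanishes_def
proof safe
 fix \<epsilon> :: real assume "\<epsilon> > 0"
 have "(%n. expectation (%om. \<bar>T n om\<bar>) / \<epsilon>) \<longlonglongrightarrow> 0" using tendsto_divide[OF assms(2) tendsto_const[of \<epsilon>]] \<open>\<epsilon> > 0\<close> by simp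
 then show "(%n. prob {om\<in>space M. \<epsilon> \<le> \<bar>T n om\<bar>}) \<longlonglongrightarrow> 0" by (rule tendsto_sandwich[OF _ _ tendsto_const, rotated 2])
    (auto intro!: always_eventually prob_abs_ge_le_expectation assms \<open>\<epsilon> > 0\<close>)
qed

text \<open>Lets a sequence be replaced by one that agrees with it outside events of vanishing probability; the value
  on those events is arbitrary.\<close>
lemma vanishes_cong_event:
 assumes "vanishes S" and [measurable]: "\<And>n. random_variable borel (S n)"
  and "(%n. prob (B n)) \<longlonglongrightarrow> 0" "\<And>n. B n \<in> events"
  and eq: "eventually (%n. \<forall>om\<in>space M. om \<notin> B n \<longrightarrow> T n om = S n om) sequentially"
 shows "vanishes T" unfolding vanishes_def
proof safe
 fix \<epsilon> :: real assume "\<epsilon> > 0"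
 have "(%n. prob ({om\<in>space M. \<epsilon> \<le> \<bar>S n om\<bar>} \<union> B n)) \<longlonglongrightarrow> 0" using assms(1,3,4) \<open>\<epsilon> > 0\<close> by (intro prob_Un_tendsto_0 vanishesD) auto
 then show "(%n. prob {om\<in>space M. \<epsilon> \<le> \<bar>T n om\<bar>}) \<longlonglongrightarrow> 0" by (rule prob_le_tendsto_0) (use eq assms(4) in \<open>auto elim!: eventually_mono\<close>)
qed

lemma vanishes_zero: "vanishes (%_ _. 0)"
proof -
 have "{om \<in> space M. \<epsilon> \<le> \<bar>0::real\<bar>} = {}" if "\<epsilon> > 0" for \<epsilon> using that by auto
 then show ?thesis by (auto simp: vanishes_def)
qed

lemma vanishes_continuous:
 assumes "vanishes (%n om. S n om - c)" and [measurable]: "\<And>n. random_variable borel (S n)"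
  and f: "isCont f c"
 shows "vanishes (%n om. f (S n om) - f c)" unfolding vanishes_def
proof safe
 fix \<epsilon> :: real assume "\<epsilon> > 0"
 with f obtain \<delta> where "\<delta> > 0" and \<delta>: "\<And>x. \<bar>x - c\<bar> < \<delta> \<Longrightarrow> \<bar>f x - f c\<bar> < \<epsilon>" unfolding continuous_at_eps_delta by (auto simp: dist_real_def)
 then have sub: "{om\<in>space M. \<epsilon> \<le> \<bar>f (S n om) - f c\<bar>} \<subseteq> {om\<in>space M. \<delta> \<le> \<bar>S n om - c\<bar>}" for n by (auto simp flip: not_less)
 show "(%n. prob {om\<in>space M. \<epsilon> \<le> \<bar>f (S n om) - f c\<bar>}) \<longlonglongrightarrow> 0" by (rule prob_le_tendsto_0[OF vanishesD[OF assms(1) \<open>\<delta> > 0\<close>]]) (use sub in auto)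
qed

lemma conv_std_normal_iff_char:
 assumes [measurable]: "\<And>n. random_variable borel (T n)"
 shows "conv_std_normal T \<longleftrightarrow>
  (\<forall>t. (%n. expectation (%om. iexp (t * T n om))) \<longlonglongrightarrow> complex_of_real (exp (- (t\<^sup>2) / 2)))"
proof -
 have char: "char (distr M borel (T n)) t = expectation (%om. iexp (t * T n om))" for n t unfolding char_def by (subst integral_distr) auto
 have rd: "real_distribution (distr M borel (T n))" for n by (rule real_distribution_distr) simp
 show ?thesis unfolding conv_std_normal_def using levy_continuity1[OF rd real_dist_normal_dist] levy_continuity[OF rd real_dist_normal_dist] assms
  unfolding char char_std_normal_distribution by auto
qed

lemma conv_std_normal_measurable: "conv_std_normal T \<Longrightarrow> random_variable borel (T n)" by (simp add: conv_std_normal_def)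

text \<open>Slutsky's theorem, by comparing characteristic functions: the map \<open>x \<mapsto> exp(i t x)\<close>
  is bounded and Lipschitz.\<close>
lemma conv_std_normal_slutsky:
 assumes T: "conv_std_normal T" and S[measurable]: "\<And>n. random_variable borel (S n)"
  and v: "vanishes (%n om. S n om - T n om)"
 shows "conv_std_normal S"
proof -
 note [measurable] = conv_std_normal_measurable[OF T]
 have "(%n. expectation (%om. iexp (t * S n om))) \<longlonglongrightarrow> complex_of_real (exp (- (t\<^sup>2) / 2))" for t
 proof -
  have int: "integrable M (%om. iexp (t * T n om))" "integrable M (%om. iexp (t * S n om))" for n by (intro integrable_iexp; simp)+
  have bound: "cmod (expectation (%om. iexp (t * S n om)) - expectation (%om. iexp (t * T n om)))
    \<le> \<bar>t\<bar> * \<epsilon> + 2 * prob {om\<in>space M. \<epsilon> \<le> \<bar>S n om - T n om\<bar>}" if "\<epsilon> > 0" for n \<epsilon>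
  proof -
   let ?B = "{om\<in>space M. \<epsilon> \<le> \<bar>S n om - T n om\<bar>}"
   have "cmod (expectation (%om. iexp (t * S n om)) - expectation (%om. iexp (t * T n om))) =
     cmod (expectation (%om. iexp (t * S n om) - iexp (t * T n om)))" using int by (subst L_integral_diff) auto
   also have "\<dots> \<le> expectation (%om. cmod (iexp (t * S n om) - iexp (t * T n om)))" by (rule integral_norm_bound)
   also have "\<dots> \<le> expectation (%om. \<bar>t\<bar> * \<epsilon> + 2 * indicator ?B om)"
   proof (rule integral_mono)
    show "integrable M (%om. cmod (iexp (t * S n om) - iexp (t * T n om)))" using int by auto
    show "integrable M (%om. \<bar>t\<bar> * \<epsilon> + 2 * indicat_real ?B om)" by (auto simp: integrable_indicator_iff emeasure_eq_measure)
    fix om assume om: "om \<in> space M"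
    show "cmod (iexp (t * S n om) - iexp (t * T n om)) \<le> \<bar>t\<bar> * \<epsilon> + 2 * indicator ?B om"
    proof (cases "om \<in> ?B")
     case True
     have "cmod (iexp (t * S n om) - iexp (t * T n om)) \<le> 1 + 1" by (rule order.trans[OF norm_triangle_ineq4]) simp
     then show ?thesis using True \<open>\<epsilon> > 0\<close> by (simp add: add_increasing)
    next
     case False
     have "cmod (iexp (t * S n om) - iexp (t * T n om)) \<le> \<bar>t * S n om - t * T n om\<bar>" by (rule iexp_diff_le)
     also have "\<dots> = \<bar>t\<bar> * \<bar>S n om - T n om\<bar>" by (simp add: abs_mult flip: right_diff_distrib)
     also have "\<dots> \<le> \<bar>t\<bar> * \<epsilon>" using False om by (intro mult_left_mono) auto
     finally show ?thesis using False by simp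
    qed
   qed
   also have "\<dots> = \<bar>t\<bar> * \<epsilon> + 2 * prob ?B" by (subst L_integral_add) (auto simp: integrable_indicator_iff emeasure_eq_measure prob_space)
   finally show ?thesis .
  qed
  have "(%n. expectation (%om. iexp (t * S n om)) - expectation (%om. iexp (t * T n om))) \<longlonglongrightarrow> 0"
  proof (rule tendstoI)
   fix e :: real assume "e > 0"
   define \<epsilon> where "\<epsilon> = e / (2 * (\<bar>t\<bar> + 1))"
   have "\<epsilon> > 0" using \<open>e > 0\<close> by (auto simp: \<epsilon>_def)
   have te: "\<bar>t\<bar> * \<epsilon> < e / 2"
   proof -
    have "\<bar>t\<bar> * \<epsilon> < (\<bar>t\<bar> + 1) * \<epsilon>" using \<open>\<epsilon> > 0\<close> by (simp add: algebra_simps)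
    also have "\<dots> = e / 2" by (simp add: \<epsilon>_def field_simps)
    finally show ?thesis .
   qed
   have "\<forall>\<^sub>F n in sequentially. prob {om\<in>space M. \<epsilon> \<le> \<bar>S n om - T n om\<bar>} < e / 4"
    using order_tendstoD(2)[OF vanishesD[OF v \<open>\<epsilon> > 0\<close>], of "e / 4"] \<open>e > 0\<close> by simp
   then show "\<forall>\<^sub>F n in sequentially. dist (expectation (%om. iexp (t * S n om)) - expectation (%om. iexp (t * T n om))) 0 < e"
   proof eventually_elim
    case (elim n)
    then have "cmod (expectation (%om. iexp (t * S n om)) - expectation (%om. iexp (t * T n om))) < e"
     using bound[OF \<open>\<epsilon> > 0\<close>, of n] te by linarith
    then show ?case by simp
   qed
  qed
  moreover have "(%n. expectation (%om. iexp (t * T n om))) \<longlonglongrightarrow> complex_of_real (exp (- (t\<^sup>2) / 2))" using T conv_std_normal_iff_char[of T] by auto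
  ultimately have "(%n. (expectation (%om. iexp (t * S n om)) - expectation (%om. iexp (t * T n om)))
    + expectation (%om. iexp (t * T n om))) \<longlonglongrightarrow> 0 + complex_of_real (exp (- (t\<^sup>2) / 2))" by (rule tendsto_add)
  then show ?thesis by simp
 qed
 then show ?thesis by (simp add: conv_std_normal_iff_char)
qed

lemma conv_std_normal_tight:
 assumes T: "conv_std_normal T" and "\<epsilon> > 0"
 obtains K where "K > 0" "\<forall>\<^sub>F n in sequentially. prob {om\<in>space M. K \<le> \<bar>T n om\<bar>} < \<epsilon>"
proof -
 note [measurable] = conv_std_normal_measurable[OF T]
 define K where "K = sqrt (2 / \<epsilon>)"
 have "K > 0" using \<open>\<epsilon> > 0\<close> by (simp add: K_def)
 let ?f = "%x::real. min 1 ((x / K)\<^sup>2)"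
 interpret N: real_distribution std_normal_distribution by (rule real_dist_normal_dist)
 have rd: "real_distribution (distr M borel (T n))" for n by (rule real_distribution_distr) simp
 have "(%n. integral\<^sup>L (distr M borel (T n)) ?f) \<longlonglongrightarrow> integral\<^sup>L std_normal_distribution ?f"
  using T by (intro weak_conv_imp_integral_bdd_continuous_conv[of _ _ _ 1] rd N.real_distribution_axioms)
    (use \<open>K > 0\<close> in \<open>auto simp: conv_std_normal_def intro!: continuous_intros\<close>)
 moreover have "integral\<^sup>L std_normal_distribution ?f < \<epsilon>"
 proof -
  have "integral\<^sup>L std_normal_distribution ?f \<le> integral\<^sup>L std_normal_distribution (%x. x^2 / K\<^sup>2)"
   using integrable_std_normal_distribution_moment[of 2]
   by (intro integral_mono) (auto simp: power_divide intro!: N.integrable_const_bound[where f = ?f and B = 1])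
  also have "\<dots> = 1 / K\<^sup>2" using std_normal_distribution_even_moments(1)[of 1] by (simp add: fact_numeral)
  also have "\<dots> < \<epsilon>" using \<open>\<epsilon> > 0\<close> by (simp add: K_def field_simps)
  finally show ?thesis .
 qed
 ultimately have "\<forall>\<^sub>F n in sequentially. integral\<^sup>L (distr M borel (T n)) ?f < \<epsilon>" by (rule order_tendstoD(2))
 then have "\<forall>\<^sub>F n in sequentially. prob {om\<in>space M. K \<le> \<bar>T n om\<bar>} < \<epsilon>"
 proof eventually_elim
  case (elim n)
  have "prob {om\<in>space M. K \<le> \<bar>T n om\<bar>} = expectation (indicator {om\<in>space M. K \<le> \<bar>T n om\<bar>})" by simp
  also have "\<dots> \<le> expectation (%om. ?f (T n om))"
  proof (rule integral_mono)
   fix om assume "om \<in> space M"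
   have "1 \<le> (T n om / K)\<^sup>2" if "K \<le> \<bar>T n om\<bar>" using that \<open>K > 0\<close> power_mono[of K "\<bar>T n om\<bar>" 2] by (simp add: power_divide)
   then show "indicator {om\<in>space M. K \<le> \<bar>T n om\<bar>} om \<le> ?f (T n om)" by (auto simp: indicator_def)
  qed (auto intro!: integrable_const_bound[where B = 1] simp: integrable_indicator_iff emeasure_eq_measure)
  also have "\<dots> = integral\<^sup>L (distr M borel (T n)) ?f" by (subst integral_distr) auto
  finally show ?case using elim by simp
 qed
 then show ?thesis using that \<open>K > 0\<close> by blast
qed

lemma vanishes_mult_conv_std_normal:
 assumes T: "conv_std_normal T" and "vanishes R" and [measurable]: "\<And>n. random_variable borel (R n)"
 shows "vanishes (%n om. T n om * R n om)" unfolding vanishes_def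
proof safe
 note [measurable] = conv_std_normal_measurable[OF T]
 fix \<epsilon> :: real assume "\<epsilon> > 0"
 show "(%n. prob {om\<in>space M. \<epsilon> \<le> \<bar>T n om * R n om\<bar>}) \<longlonglongrightarrow> 0"
 proof (rule tendstoI)
  fix e :: real assume "e > 0"
  then obtain K where "K > 0" and K: "\<forall>\<^sub>F n in sequentially. prob {om\<in>space M. K \<le> \<bar>T n om\<bar>} < e / 2"
   using conv_std_normal_tight[OF T, of "e / 2"] by auto
  have "\<forall>\<^sub>F n in sequentially. prob {om\<in>space M. \<epsilon> / K \<le> \<bar>R n om\<bar>} < e / 2"
   using order_tendstoD(2)[OF vanishesD[OF assms(2), of "\<epsilon> / K"], of "e / 2"] \<open>\<epsilon> > 0\<close> \<open>K > 0\<close> \<open>e > 0\<close> by simp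
  with K show "\<forall>\<^sub>F n in sequentially. dist (prob {om\<in>space M. \<epsilon> \<le> \<bar>T n om * R n om\<bar>}) 0 < e"
  proof eventually_elim
   case (elim n)
   have "prob {om\<in>space M. \<epsilon> \<le> \<bar>T n om * R n om\<bar>} \<le>
     prob ({om\<in>space M. K \<le> \<bar>T n om\<bar>} \<union> {om\<in>space M. \<epsilon> / K \<le> \<bar>R n om\<bar>})"
   proof (rule finite_measure_mono, safe)
    fix om assume *: "\<epsilon> \<le> \<bar>T n om * R n om\<bar>" "\<not> \<epsilon> / K \<le> \<bar>R n om\<bar>"
    show "K \<le> \<bar>T n om\<bar>"
    proof (rule ccontr)
     assume "\<not> K \<le> \<bar>T n om\<bar>"
     then have "\<bar>T n om\<bar> * \<bar>R n om\<bar> < K * (\<epsilon> / K)" using * \<open>K > 0\<close> \<open>\<epsilon> > 0\<close> by (intro mult_strict_mono') auto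
     then show False using * \<open>K > 0\<close> by (simp add: abs_mult)
    qed
   qed simp
   also have "\<dots> \<le> prob {om\<in>space M. K \<le> \<bar>T n om\<bar>} + prob {om\<in>space M. \<epsilon> / K \<le> \<bar>R n om\<bar>}" by (rule measure_Un_le) auto
   finally show ?case using elim by simp
  qed
 qed
qed

lemma expectation_abs_le_sqrt:
 fixes Z :: "'a \<Rightarrow> real"
 assumes [measurable]: "random_variable borel Z" and int: "integrable M (%om. (Z om)\<^sup>2)"
 shows "expectation (%om. \<bar>Z om\<bar>) \<le> sqrt (expectation (%om. (Z om)\<^sup>2))"
proof -
 have "integrable M Z" using square_integrable_imp_integrable[OF _ int] by simp
 then have "0 \<le> expectation (%om. (Z om)\<^sup>2) - (expectation (%om. \<bar>Z om\<bar>))\<^sup>2"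
  using variance_positive[of "%om. \<bar>Z om\<bar>"] int by (subst (asm) variance_eq) auto
 then show ?thesis by (simp add: real_le_rsqrt)
qed

lemma iid_abs_sum_le_sqrt:
 fixes g :: "'b \<Rightarrow> real"
 assumes iid: "iid N W" and [measurable]: "g \<in> borel_measurable N" and "finite I"
  and int: "integrable M (%om. (g (W 0 om))\<^sup>2)"
 shows "expectation (%om. \<bar>(\<Sum>i\<in>I. g (W i om)) - real (card I) * expectation (%om. g (W 0 om))\<bar>)
   \<le> sqrt (real (card I) * expectation (%om. (g (W 0 om))\<^sup>2))"
proof -
 note [measurable] = iid_measurable[OF iid]
 let ?m = "expectation (%om. g (W 0 om))"
 let ?h = "%w. g w - ?m"
 have int1: "integrable M (%om. g (W 0 om))" using int by (rule square_integrable_imp_integrable[rotated]) auto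
 have int2: "integrable M (%om. (?h (W 0 om))\<^sup>2)" using int int1 by (auto simp: power2_diff)
 have mean: "expectation (%om. ?h (W 0 om)) = 0" using int1 by (simp add: prob_space)
 have "(\<Sum>i\<in>I. g (W i om)) - real (card I) * ?m = (\<Sum>i\<in>I. ?h (W i om))" for om by (simp add: sum_subtractf)
 then have "expectation (%om. \<bar>(\<Sum>i\<in>I. g (W i om)) - real (card I) * ?m\<bar>) = expectation (%om. \<bar>\<Sum>i\<in>I. ?h (W i om)\<bar>)" by simp
 also have "\<dots> \<le> sqrt (expectation (%om. (\<Sum>i\<in>I. ?h (W i om))\<^sup>2))"
  using iid_sum_square(1)[OF iid _ \<open>finite I\<close> int2 mean] by (intro expectation_abs_le_sqrt) auto
 also have "expectation (%om. (\<Sum>i\<in>I. ?h (W i om))\<^sup>2) = real (card I) * expectation (%om. (?h (W 0 om))\<^sup>2)"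
  using iid_sum_square(2)[OF iid _ \<open>finite I\<close> int2 mean] by auto
 also have "\<dots> \<le> real (card I) * expectation (%om. (g (W 0 om))\<^sup>2)" using variance_eq[OF int1 int] by (intro mult_left_mono) auto
 finally show ?thesis by simp
qed

lemma truncated_mean_tendsto_0:
 fixes Z :: "'a \<Rightarrow> real"
 assumes int: "integrable M Z"
  and K: "filterlim (K :: nat \<Rightarrow> real) at_top sequentially"
  and [measurable]: "X \<in> borel_measurable M"
 shows "(%n. expectation (%om. Z om * indicator {K n<..} \<bar>X om :: real\<bar>)) \<longlonglongrightarrow> 0"
proof -
 note [measurable] = borel_measurable_integrable[OF int]
 have "(%n. expectation (%om. Z om * indicator {K n<..} \<bar>X om\<bar>)) \<longlonglongrightarrow> expectation (%_. 0)"
 proof (rule integral_dominated_convergence[where w = "%om. \<bar>Z om\<bar>"])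
  show "AE om in M. (%n. Z om * indicator {K n<..} \<bar>X om\<bar>) \<longlonglongrightarrow> 0"
  proof (intro AE_I2 tendsto_eventually)
   fix om
   show "\<forall>\<^sub>F n in sequentially. Z om * indicator {K n<..} \<bar>X om\<bar> = 0"
    using K[unfolded filterlim_at_top, rule_format, of "\<bar>X om\<bar>"] by eventually_elim simp
  qed
 qed (use int in \<open>auto simp: indicator_def\<close>)
 then show ?thesis by simp
qed

text \<open>At a fixed truncation level the variance of the mean vanishes, while the discarded part is
  small in mean, uniformly in \<open>n\<close>, by integrability.\<close>
lemma weak_law_L1:
 fixes X :: "nat \<Rightarrow> 'a \<Rightarrow> real"
 assumes iid: "iid borel X" and int: "integrable M (X 0)"
 shows "(%n. expectation (%om. \<bar>(\<Sum>i=1..n. X i om) / real n - expectation (X 0)\<bar>)) \<longlonglongrightarrow> 0"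
proof (rule tendstoI)
 fix e :: real assume "e > 0"
 note [measurable] = iid_measurable[OF iid]
 have intX: "integrable M (X i)" for i using iid_integrable[OF iid, of "%x. x" i] int by simp
 let ?r = "%K x::real. x * indicator {K<..} \<bar>x\<bar>" and ?t = "%K x::real. x * indicator {..K} \<bar>x\<bar>"
 have split: "x = ?t K x + ?r K x" for K x :: real by (auto simp: indicator_def)
 have "(%n. expectation (%om. \<bar>X 0 om\<bar> * indicator {real n<..} \<bar>X 0 om\<bar>)) \<longlonglongrightarrow> 0"
  using int by (intro truncated_mean_tendsto_0 filterlim_real_sequentially) auto
 then have "\<forall>\<^sub>F n in sequentially. expectation (%om. \<bar>X 0 om\<bar> * indicator {real n<..} \<bar>X 0 om\<bar>) < e / 4"
  using \<open>e > 0\<close> by (intro order_tendstoD(2)) auto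
 then obtain m where m: "expectation (%om. \<bar>X 0 om\<bar> * indicator {real m<..} \<bar>X 0 om\<bar>) < e / 4" by (auto simp: eventually_sequentially)
 define K where "K = real m"
 have int_r: "integrable M (%om. ?r K (X i om))" and int_t: "integrable M (%om. ?t K (X i om))" for i
  by (rule L_integrable_bound[OF intX[of i]]; auto simp: indicator_def)+
 have int_t2: "integrable M (%om. (?t K (X 0 om))\<^sup>2)"
  by (rule integrable_const_bound[where B = "K\<^sup>2"]) (auto simp: indicator_def K_def abs_le_square_iff[symmetric])
 have r: "expectation (%om. \<bar>?r K (X i om)\<bar>) < e / 4" for i using m iid_expectation[OF iid, of "%x. \<bar>?r K x\<bar>" i] by (simp add: K_def abs_mult)
 have t2: "expectation (%om. (?t K (X 0 om))\<^sup>2) \<le> K\<^sup>2"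
  by (rule integral_le_const[OF int_t2]) (auto simp: indicator_def K_def abs_le_square_iff[symmetric])
 have bound: "expectation (%om. \<bar>(\<Sum>i=1..n. X i om) / real n - expectation (X 0)\<bar>) \<le> K / sqrt n + e / 2" if "n > 0" for n
 proof -
  have mean: "expectation (X 0) = expectation (%om. ?t K (X 0 om)) + expectation (%om. ?r K (X 0 om))"
   using int_t int_r by (subst L_integral_add[symmetric]) (auto simp flip: split)
  let ?A = "%om. \<bar>(\<Sum>i=1..n. ?t K (X i om)) - real n * expectation (%om. ?t K (X 0 om))\<bar>"
  let ?B = "%om. (\<Sum>i=1..n. \<bar>?r K (X i om)\<bar>) + real n * \<bar>expectation (%om. ?r K (X 0 om))\<bar>"
  have sum_split: "(\<Sum>i=1..n. X i om) = (\<Sum>i=1..n. ?t K (X i om)) + (\<Sum>i=1..n. ?r K (X i om))" for om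
   by (subst sum.distrib[symmetric]) (simp flip: split)
  then have pw: "real n * \<bar>(\<Sum>i=1..n. X i om) / real n - expectation (X 0)\<bar> \<le> ?A om + ?B om" for om
  proof -
   have "real n * \<bar>(\<Sum>i=1..n. X i om) / real n - expectation (X 0)\<bar> = \<bar>(\<Sum>i=1..n. X i om) - real n * expectation (X 0)\<bar>"
    using \<open>n > 0\<close> by (simp add: abs_mult_pos' right_diff_distrib)
   also have "\<dots> = \<bar>((\<Sum>i=1..n. ?t K (X i om)) - real n * expectation (%om. ?t K (X 0 om)))
     + ((\<Sum>i=1..n. ?r K (X i om)) - real n * expectation (%om. ?r K (X 0 om)))\<bar>" using sum_split[of om] by (simp add: mean algebra_simps)
   also have "\<dots> \<le> ?A om + (\<bar>\<Sum>i=1..n. ?r K (X i om)\<bar> + \<bar>real n * expectation (%om. ?r K (X 0 om))\<bar>)" by linarith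
   also have "\<dots> \<le> ?A om + ?B om" by (intro add_mono order_refl sum_abs) (simp add: abs_mult)
   finally show ?thesis .
  qed
  have "real n * expectation (%om. \<bar>(\<Sum>i=1..n. X i om) / real n - expectation (X 0)\<bar>) =
    expectation (%om. real n * \<bar>(\<Sum>i=1..n. X i om) / real n - expectation (X 0)\<bar>)" by simp
  also have "\<dots> \<le> expectation (%om. ?A om + ?B om)" by (intro integral_mono pw L_integrable_add integrable_abs L_integrable_diff
      L_integrable_sum integrable_mult_right integrable_divide_zero integrable_const intX int_t int_r)
  also have "\<dots> = expectation ?A + expectation ?B" by (intro L_integral_add L_integrable_add integrable_abs L_integrable_diff
      L_integrable_sum integrable_mult_right integrable_const int_t int_r)
  also have "expectation ?B = (\<Sum>i=1..n. expectation (%om. \<bar>?r K (X i om)\<bar>)) + real n * \<bar>expectation (%om. ?r K (X 0 om))\<bar>"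
   using int_r by (simp add: prob_space)
  also have "\<dots> \<le> (\<Sum>i=1..n. e / 4) + real n * (e / 4)"
  proof (intro add_mono sum_mono mult_left_mono)
   show "\<bar>expectation (%om. ?r K (X 0 om))\<bar> \<le> e / 4" using integral_abs_bound[of M "%om. ?r K (X 0 om)"] r[of 0] by linarith
  qed (use r in \<open>auto intro: less_imp_le\<close>)
  also have "expectation ?A \<le> sqrt (real n * expectation (%om. (?t K (X 0 om))\<^sup>2))"
   using iid_abs_sum_le_sqrt[OF iid, of "?t K" "{1..n}"] int_t2 by simp
  also have "\<dots> \<le> sqrt (real n * K\<^sup>2)" using t2 by (intro real_sqrt_le_mono mult_left_mono) auto
  also have "\<dots> = sqrt n * K" by (simp add: real_sqrt_mult K_def)
  finally have "real n * expectation (%om. \<bar>(\<Sum>i=1..n. X i om) / real n - expectation (X 0)\<bar>) \<le> sqrt n * K + real n * (e / 2)"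
   by (simp add: algebra_simps)
  then have "expectation (%om. \<bar>(\<Sum>i=1..n. X i om) / real n - expectation (X 0)\<bar>) \<le> (sqrt n * K + real n * (e / 2)) / real n"
   using \<open>n > 0\<close> by (simp add: field_simps)
  also have "\<dots> = K / sqrt n + e / 2" using \<open>n > 0\<close> by (simp add: add_divide_distrib) (simp add: divide_eq_eq eq_divide_eq flip: power2_eq_square)
  finally show ?thesis .
 qed
 have "(%n. K / sqrt (real n)) \<longlonglongrightarrow> 0" by real_asymp
 then have "\<forall>\<^sub>F n in sequentially. K / sqrt (real n) < e / 2" using \<open>e > 0\<close> by (intro order_tendstoD(2)) auto
 then show "\<forall>\<^sub>F n in sequentially. dist (expectation (%om. \<bar>(\<Sum>i=1..n. X i om) / real n - expectation (X 0)\<bar>)) 0 < e" using eventually_gt_at_top[of 0]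
 proof eventually_elim
  case (elim n)
  have "expectation (%om. \<bar>(\<Sum>i=1..n. X i om) / real n - expectation (X 0)\<bar>) < e" using bound[of n] elim by linarith
  then show ?case by simp
 qed
qed

lemma weak_law:
 fixes X :: "nat \<Rightarrow> 'a \<Rightarrow> real"
 assumes iid: "iid borel X" and int: "integrable M (X 0)"
 shows "vanishes (%n om. (\<Sum>i=1..n. X i om) / real n - expectation (X 0))"
proof (rule vanishes_L1[OF _ weak_law_L1[OF assms]])
 have "integrable M (X i)" for i using iid_integrable[OF iid, of "%x. x" i] int iid_measurable[OF iid] by simp
 then show "integrable M (%om. (\<Sum>i=1..n. X i om) / real n - expectation (X 0))" for n by auto
qed

end

section \<open>Row sums\<close>

context prob_space
begin

lemma iid_char_sum:
 fixes g :: "'b \<Rightarrow> real"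
 assumes iid: "iid N W" and [measurable]: "g \<in> borel_measurable N" and "finite I"
 shows "expectation (%om. iexp (t * (\<Sum>i\<in>I. g (W i om)))) = expectation (%om. iexp (t * g (W 0 om))) ^ card I"
proof -
 note [measurable] = iid_measurable[OF iid]
 have "iexp (t * (\<Sum>i\<in>I. g (W i om))) = (\<Prod>i\<in>I. iexp (t * g (W i om)))" for om using \<open>finite I\<close> by (simp add: exp_sum sum_distrib_left)
 then show ?thesis using iid_prod_expectation[OF iid \<open>finite I\<close>, of "%_ w. iexp (t * g w)"]
  by (simp add: integrable_iexp[of "%om. t * g (W 0 om)", simplified])
qed

context
 fixes N :: "'b measure" and W :: "nat \<Rightarrow> 'a \<Rightarrow> 'b" and g :: "nat \<Rightarrow> 'b \<Rightarrow> real"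
 assumes iid: "iid N W" and g_meas[measurable]: "\<And>n. g n \<in> borel_measurable N"
  and sq: "\<And>n. integrable M (%om. (g n (W 0 om))\<^sup>2)"
  and mean: "\<And>n. expectation (%om. g n (W 0 om)) = 0"
  and var: "\<forall>\<^sub>F n in sequentially. real n * expectation (%om. (g n (W 0 om))\<^sup>2) = 1"
  and lindeberg: "\<And>\<epsilon>. 0 < \<epsilon> \<Longrightarrow>
   (%n. real n * expectation (%om. (g n (W 0 om))\<^sup>2 * indicator {\<epsilon><..} \<bar>g n (W 0 om)\<bar>)) \<longlonglongrightarrow> 0"
begin

text \<open>Lindeberg's theorem for rows that apply a function depending on \<open>n\<close> to one fixed sequence.\<close>
lemma iid_row_clt: "conv_std_normal (%n om. \<Sum>i=1..n. g n (W i om))"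
proof -
 note [measurable] = iid_measurable[OF iid]
 have int1: "integrable M (%om. g n (W 0 om))" for n using sq[of n] by (rule square_integrable_imp_integrable[rotated]) auto
 define s where "s n = expectation (%om. (g n (W 0 om))\<^sup>2)" for n
 define L where "L \<epsilon> n = expectation (%om. (g n (W 0 om))\<^sup>2 * indicator {\<epsilon><..} \<bar>g n (W 0 om)\<bar>)" for \<epsilon> n
 define \<phi> where "\<phi> t n = expectation (%om. iexp (t * g n (W 0 om)))" for t n
 have intL: "integrable M (%om. (g n (W 0 om))\<^sup>2 * indicator {\<epsilon><..} \<bar>g n (W 0 om)\<bar>)" for n \<epsilon>
  by (rule L_integrable_bound[OF sq[of n]]) (auto simp: indicator_def)
 have approx: "cmod (\<phi> t n - (1 - t\<^sup>2 * s n / 2)) \<le> t\<^sup>2 * L \<epsilon> n + \<bar>t\<bar>^3 * \<epsilon> / 6 * s n" if "\<epsilon> > 0" for t n \<epsilon>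
 proof -
  let ?X = "%om. g n (W 0 om)"
  have "\<phi> t n = char (distr M borel ?X) t" unfolding char_def \<phi>_def by (subst integral_distr) auto
  then have "cmod (\<phi> t n - (1 - t\<^sup>2 * s n / 2)) \<le> (t\<^sup>2 / 6) * expectation (%om. min (6 * (?X om)\<^sup>2) (\<bar>t\<bar> * \<bar>?X om\<bar>^3))"
   using char_approx3'[of ?X "s n" "distr M borel ?X" t] int1[of n] sq[of n] mean[of n] by (simp add: s_def)
  also have "\<dots> \<le> (t\<^sup>2 / 6) * expectation (%om. 6 * ((?X om)\<^sup>2 * indicator {\<epsilon><..} \<bar>?X om\<bar>) + \<bar>t\<bar> * \<epsilon> * (?X om)\<^sup>2)"
  proof (intro mult_left_mono integral_mono)
   show "integrable M (%om. min (6 * (?X om)\<^sup>2) (\<bar>t\<bar> * \<bar>?X om\<bar>^3))" by (rule L_integrable_bound[of M "%om. 6 * (?X om)\<^sup>2"]) (use sq[of n] in auto)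
   show "integrable M (%om. 6 * ((?X om)\<^sup>2 * indicator {\<epsilon><..} \<bar>?X om\<bar>) + \<bar>t\<bar> * \<epsilon> * (?X om)\<^sup>2)" using intL sq by auto
   fix om
   show "min (6 * (?X om)\<^sup>2) (\<bar>t\<bar> * \<bar>?X om\<bar>^3) \<le> 6 * ((?X om)\<^sup>2 * indicator {\<epsilon><..} \<bar>?X om\<bar>) + \<bar>t\<bar> * \<epsilon> * (?X om)\<^sup>2"
   proof (cases "\<bar>?X om\<bar> \<le> \<epsilon>")
    case True
    have "\<bar>t\<bar> * \<bar>?X om\<bar>^3 = \<bar>t\<bar> * \<bar>?X om\<bar> * (?X om)\<^sup>2" by (simp add: power3_eq_cube power2_eq_square)
    also have "\<dots> \<le> \<bar>t\<bar> * \<epsilon> * (?X om)\<^sup>2" using True by (intro mult_right_mono mult_left_mono) auto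
    finally show ?thesis using True by auto
   qed (use \<open>\<epsilon> > 0\<close> in \<open>auto intro!: min.coboundedI1\<close>)
  qed auto
  also have "\<dots> = (t\<^sup>2 / 6) * (6 * L \<epsilon> n + \<bar>t\<bar> * \<epsilon> * s n)" using intL[of n \<epsilon>] sq[of n] by (simp add: L_def s_def)
  also have "\<dots> = t\<^sup>2 * L \<epsilon> n + \<bar>t\<bar>^3 * \<epsilon> / 6 * s n" by (simp add: field_simps power3_eq_cube power2_eq_square)
  finally show ?thesis .
 qed
 have \<phi>_le: "cmod (\<phi> t n) \<le> 1" for t n
 proof -
  have "cmod (\<phi> t n) \<le> expectation (%om. cmod (iexp (t * g n (W 0 om))))" unfolding \<phi>_def by (rule integral_norm_bound)
  then show ?thesis by (simp add: prob_space)
 qed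
 have "(%n. \<phi> t n ^ n) \<longlonglongrightarrow> complex_of_real (exp (- (t\<^sup>2) / 2))" for t
 proof -
  have lim: "(%n. complex_of_real ((1 + (- (t\<^sup>2) / 2) / real n) ^ n)) \<longlonglongrightarrow> complex_of_real (exp (- (t\<^sup>2) / 2))"
   by (intro tendsto_of_real tendsto_exp_limit_sequentially)
  have "(%n. \<phi> t n ^ n - complex_of_real ((1 + (- (t\<^sup>2) / 2) / real n) ^ n)) \<longlonglongrightarrow> 0"
  proof (rule tendstoI)
   fix e :: real assume "e > 0"
   define \<epsilon> where "\<epsilon> = 3 * e / (\<bar>t\<bar>^3 + 1)"
   have "\<epsilon> > 0" using \<open>e > 0\<close> by (auto simp: \<epsilon>_def add_pos_pos add_nonneg_pos)
   have "\<bar>t\<bar>^3 * \<epsilon> / 6 < (\<bar>t\<bar>^3 + 1) * \<epsilon> / 6" using \<open>\<epsilon> > 0\<close> by (simp add: algebra_simps)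
   also have "\<dots> = e / 2"
   proof -
    have "\<bar>t\<bar>^3 + 1 \<noteq> 0" using zero_le_power[of "\<bar>t\<bar>" 3] by linarith
    then show ?thesis by (simp add: \<epsilon>_def)
   qed
   finally have e2: "\<bar>t\<bar>^3 * \<epsilon> / 6 < e / 2" .
   have "(%n. t\<^sup>2 * (real n * L \<epsilon> n)) \<longlonglongrightarrow> t\<^sup>2 * 0" using lindeberg[OF \<open>\<epsilon> > 0\<close>] unfolding L_def by (intro tendsto_mult tendsto_const)
   then have "\<forall>\<^sub>F n in sequentially. t\<^sup>2 * (real n * L \<epsilon> n) < e / 2" using \<open>e > 0\<close> by (intro order_tendstoD(2)) auto
   moreover have "\<forall>\<^sub>F n in sequentially. t\<^sup>2 / 4 < real n" using filterlim_real_sequentially unfolding filterlim_at_top_dense by blast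
   ultimately show "\<forall>\<^sub>F n in sequentially. dist (\<phi> t n ^ n - complex_of_real ((1 + (- (t\<^sup>2) / 2) / real n) ^ n)) 0 < e"
    using var eventually_gt_at_top[of 0]
   proof eventually_elim
    case (elim n)
    have sn: "s n = 1 / real n" using elim by (simp add: s_def field_simps)
    let ?w = "complex_of_real (1 - t\<^sup>2 * s n / 2)"
    have "\<bar>1 - t\<^sup>2 * s n / 2\<bar> \<le> 1"
    proof -
     have "t\<^sup>2 / real n \<le> 4" using elim by (simp add: field_simps)
     moreover have "0 \<le> t\<^sup>2 / real n" by simp
     ultimately show ?thesis unfolding sn by (auto simp: abs_le_iff)
    qed
    then have w: "norm ?w \<le> 1" by (simp only: norm_of_real)
    have "norm (\<phi> t n ^ n - ?w ^ n) \<le> real n * norm (\<phi> t n - ?w)" using norm_power_diff[OF \<phi>_le w] by simp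
    also have "\<dots> \<le> real n * (t\<^sup>2 * L \<epsilon> n + \<bar>t\<bar>^3 * \<epsilon> / 6 * s n)" using approx[OF \<open>\<epsilon> > 0\<close>, of t n] by (intro mult_left_mono) auto
    also have "\<dots> = t\<^sup>2 * (real n * L \<epsilon> n) + \<bar>t\<bar>^3 * \<epsilon> / 6" using elim by (simp add: sn field_simps)
    also have "\<dots> < e" using e2 elim by linarith
    finally show ?case by (simp add: sn mult.commute)
   qed
  qed
  from tendsto_add[OF this lim] show ?thesis by simp
 qed
 moreover have "expectation (%om. iexp (t * (\<Sum>i=1..n. g n (W i om)))) = \<phi> t n ^ n" for t n
  using iid_char_sum[OF iid g_meas, of "{1..n}"] by (simp add: \<phi>_def)
 ultimately show ?thesis by (subst conv_std_normal_iff_char) auto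
qed

text \<open>The squares obey a law of large numbers under the Lindeberg condition; this is what makes normalization
  by the empirical sum of squares harmless.\<close>
lemma iid_row_sum_squares:
 "(%n. expectation (%om. \<bar>(\<Sum>i=1..n. (g n (W i om))\<^sup>2) - 1\<bar>)) \<longlonglongrightarrow> 0"
proof (rule tendstoI)
 fix e :: real assume "e > 0"
 note [measurable] = iid_measurable[OF iid]
 have sqi: "integrable M (%om. (g n (W i om))\<^sup>2)" for n i using sq[of n] iid_integrable[OF iid, of "%w. (g n w)\<^sup>2" i] by simp
 define \<epsilon> where "\<epsilon> = e / 2"
 have "\<epsilon> > 0" using \<open>e > 0\<close> by (simp add: \<epsilon>_def)
 define L where "L n = expectation (%om. (g n (W 0 om))\<^sup>2 * indicator {\<epsilon><..} \<bar>g n (W 0 om)\<bar>)" for n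
 have intL: "integrable M (%om. (g n (W i om))\<^sup>2 * indicator {\<epsilon><..} \<bar>g n (W i om)\<bar>)" for n i
  by (rule L_integrable_bound[OF sqi[of n i]]) (auto simp: indicator_def)
 have "(%n. real n * L n) \<longlonglongrightarrow> 0" using lindeberg[OF \<open>\<epsilon> > 0\<close>] by (simp add: L_def)
 then have "\<forall>\<^sub>F n in sequentially. real n * L n < e / 4" using \<open>e > 0\<close> by (intro order_tendstoD(2)) auto
 then show "\<forall>\<^sub>F n in sequentially. dist (expectation (%om. \<bar>(\<Sum>i=1..n. (g n (W i om))\<^sup>2) - 1\<bar>)) 0 < e" using var
 proof eventually_elim
  case (elim n)
  define h where "h w = (g n w)\<^sup>2 * indicator {..\<epsilon>} \<bar>g n w\<bar>" for w
  define r where "r w = (g n w)\<^sup>2 * indicator {\<epsilon><..} \<bar>g n w\<bar>" for w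
  have [measurable]: "h \<in> borel_measurable N" "r \<in> borel_measurable N" unfolding h_def[abs_def] r_def[abs_def] by auto
  have hr: "(g n w)\<^sup>2 = h w + r w" for w by (auto simp: h_def r_def indicator_def)
  have h_nn: "0 \<le> h w" and r_nn: "0 \<le> r w" for w by (auto simp: h_def r_def)
  have int_r: "integrable M (%om. r (W i om))" for i using intL[of n i] by (simp add: r_def)
  have int_h: "integrable M (%om. h (W i om))" for i by (rule L_integrable_bound[OF sqi[of n i]]) (auto simp: h_def indicator_def)
  have h2: "(h w)\<^sup>2 \<le> \<epsilon>\<^sup>2 * (g n w)\<^sup>2" for w
  proof (cases "\<bar>g n w\<bar> \<le> \<epsilon>")
   case True
   then have "(g n w)\<^sup>2 \<le> \<epsilon>\<^sup>2" using abs_le_square_iff[of "g n w" \<epsilon>] \<open>\<epsilon> > 0\<close> by simp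
   then have "(g n w)\<^sup>2 * (g n w)\<^sup>2 \<le> \<epsilon>\<^sup>2 * (g n w)\<^sup>2" by (intro mult_right_mono) auto
   then show ?thesis using True by (simp add: h_def power2_eq_square[of "(g n w)\<^sup>2"])
  qed (simp add: h_def)
  have int_h2: "integrable M (%om. (h (W 0 om))\<^sup>2)" using h2 by (intro L_integrable_bound[OF integrable_mult_right[OF sq[of n], of "\<epsilon>\<^sup>2"]]) auto
  have Er: "expectation (%om. r (W i om)) = L n" for i using iid_expectation[OF iid, of r i] by (simp add: L_def r_def)
  have "expectation (%om. (g n (W 0 om))\<^sup>2) = expectation (%om. h (W 0 om)) + L n" unfolding hr using int_h int_r Er by simp
  then have Eh: "real n * expectation (%om. h (W 0 om)) = 1 - real n * L n" using elim by (simp add: algebra_simps)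
  have L_nn: "0 \<le> real n * L n" by (simp add: L_def)
  have split: "(\<Sum>i=1..n. (g n (W i om))\<^sup>2) = (\<Sum>i=1..n. h (W i om)) + (\<Sum>i=1..n. r (W i om))" for om unfolding hr by (rule sum.distrib)
  have r_sum: "0 \<le> (\<Sum>i=1..n. r (W i om))" for om by (intro sum_nonneg r_nn)
  have "\<bar>(\<Sum>i=1..n. (g n (W i om))\<^sup>2) - 1\<bar> \<le>
    \<bar>(\<Sum>i=1..n. h (W i om)) - real n * expectation (%om. h (W 0 om))\<bar> + ((\<Sum>i=1..n. r (W i om)) + real n * L n)" for om
   using split[of om] r_sum[of om] L_nn Eh by linarith
  then have "expectation (%om. \<bar>(\<Sum>i=1..n. (g n (W i om))\<^sup>2) - 1\<bar>) \<le>
    expectation (%om. \<bar>(\<Sum>i=1..n. h (W i om)) - real n * expectation (%om. h (W 0 om))\<bar> + ((\<Sum>i=1..n. r (W i om)) + real n * L n))"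
   by (intro integral_mono) (use sqi int_h int_r in auto)
  also have "\<dots> = expectation (%om. \<bar>(\<Sum>i=1..n. h (W i om)) - real n * expectation (%om. h (W 0 om))\<bar>) + (real n * L n + real n * L n)"
   using int_h int_r Er by (simp add: prob_space)
  also have "expectation (%om. \<bar>(\<Sum>i=1..n. h (W i om)) - real n * expectation (%om. h (W 0 om))\<bar>) \<le>
    sqrt (real n * expectation (%om. (h (W 0 om))\<^sup>2))" using iid_abs_sum_le_sqrt[OF iid, of h "{1..n}"] int_h2 by simp
  also have "\<dots> \<le> sqrt (real n * expectation (%om. \<epsilon>\<^sup>2 * (g n (W 0 om))\<^sup>2))"
   by (intro real_sqrt_le_mono mult_left_mono integral_mono int_h2 integrable_mult_right sq h2) auto
  also have "real n * expectation (%om. \<epsilon>\<^sup>2 * (g n (W 0 om))\<^sup>2) = \<epsilon>\<^sup>2" using elim by simp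
  finally have "expectation (%om. \<bar>(\<Sum>i=1..n. (g n (W i om))\<^sup>2) - 1\<bar>) \<le> \<epsilon> + 2 * (real n * L n)" using \<open>\<epsilon> > 0\<close> by (simp add: mult.commute)
  moreover have "0 \<le> expectation (%om. \<bar>(\<Sum>i=1..n. (g n (W i om))\<^sup>2) - 1\<bar>)" by simp
  ultimately show ?case using elim by (simp add: \<epsilon>_def)
 qed
qed

end

end

section \<open>Estimates for characteristic functions\<close>

lemma cos_le_taylor4: "cos (x::real) \<le> 1 - x\<^sup>2 / 2 + x^4 / 24"
proof -
 have "Re (iexp x - (\<Sum>k\<le>3. (\<i> * x)^k / fact k)) \<le> cmod (iexp x - (\<Sum>k\<le>3. (\<i> * x)^k / fact k))" by (rule complex_Re_le_cmod)
 also have "\<dots> \<le> \<bar>x\<bar>^4 / 24" using iexp_approx1[of x 3] by (simp add: fact_numeral)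
 finally show ?thesis by (simp add: Re_exp eval_nat_numeral power_mult_distrib)
qed

lemma one_minus_cos_ge:
 fixes u :: real
 assumes "\<bar>u\<bar> \<le> 1"
 shows "u\<^sup>2 / 4 \<le> 1 - cos u"
proof -
 have "u\<^sup>2 \<le> 1" using assms by (simp add: abs_square_le_1)
 then have "u\<^sup>2 * u\<^sup>2 \<le> u\<^sup>2" by (intro mult_left_le) auto
 then have "u^4 \<le> u\<^sup>2" by (simp add: power2_eq_square eval_nat_numeral)
 then show ?thesis using cos_le_taylor4[of u] zero_le_power2[of u] by linarith
qed

lemma one_minus_cos_le: "1 - cos (u::real) \<le> u\<^sup>2 / 2"
proof -
 have "(sin (u / 2))\<^sup>2 \<le> (u / 2)\<^sup>2" using abs_sin_x_le_abs_x[of "u / 2"] by (simp only: abs_le_square_iff)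
 then show ?thesis using cos_double_sin[of "u / 2"] by (simp add: power_divide)
qed

lemma one_minus_cos_abs: "\<bar>1 - cos (x::real)\<bar> \<le> 2" using cos_ge_minus_one[of x] cos_le_one[of x] by linarith

text \<open>Taking logarithms, \<open>- n ln f\<close> tends to \<open>c\<close>, and \<open>1 - f\<close> is
  squeezed between \<open>- f ln f\<close> and \<open>- ln f\<close>.\<close>
lemma pow_exp_limit:
 fixes f :: "nat \<Rightarrow> real"
 assumes f: "\<And>n. 0 \<le> f n" "\<And>n. f n \<le> 1" and lim: "(%n. f n ^ n) \<longlonglongrightarrow> exp (- c)"
 shows "(%n. real n * (1 - f n)) \<longlonglongrightarrow> c"
proof -
 have "\<forall>\<^sub>F n in sequentially. 0 < f n ^ n" using lim by (rule order_tendstoD) simp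
 then have pos: "\<forall>\<^sub>F n in sequentially. 0 < f n \<and> 0 < n" using eventually_gt_at_top[of 0]
 proof eventually_elim
  case (elim n)
  then have "f n \<noteq> 0" by (auto simp: zero_power)
  then show ?case using f(1)[of n] elim by (auto intro: order.not_eq_order_implies_strict)
 qed
 have "(%n. ln (f n ^ n)) \<longlonglongrightarrow> ln (exp (- c))" using lim by (rule tendsto_ln) simp
 moreover have "\<forall>\<^sub>F n in sequentially. ln (f n ^ n) = real n * ln (f n)" using pos by eventually_elim (simp add: ln_realpow)
 ultimately have nln: "(%n. real n * ln (f n)) \<longlonglongrightarrow> - c" by (simp add: filterlim_cong)
 have "(%n. (real n * ln (f n)) * (1 / real n)) \<longlonglongrightarrow> - c * 0" by (intro tendsto_mult nln lim_1_over_n)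
 moreover have "\<forall>\<^sub>F n in sequentially. (real n * ln (f n)) * (1 / real n) = ln (f n)" using pos by eventually_elim simp
 ultimately have "(%n. ln (f n)) \<longlonglongrightarrow> 0" by (simp add: filterlim_cong)
 then have "(%n. exp (ln (f n))) \<longlonglongrightarrow> exp 0" by (rule tendsto_exp)
 moreover have "\<forall>\<^sub>F n in sequentially. exp (ln (f n)) = f n" using pos by eventually_elim simp
 ultimately have f1: "f \<longlonglongrightarrow> 1" by (simp add: filterlim_cong)
 show ?thesis
 proof (rule tendsto_sandwich)
  show "\<forall>\<^sub>F n in sequentially. - (real n * ln (f n)) * f n \<le> real n * (1 - f n)" using pos
  proof eventually_elim
   case (elim n)
   have "- ln (f n) = ln (1 / f n)" using elim by (simp add: ln_div)
   also have "\<dots> \<le> 1 / f n - 1" using elim by (intro ln_le_minus_one) auto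
   finally have "- ln (f n) * f n \<le> 1 - f n" using elim by (simp add: field_simps)
   then have "real n * (- ln (f n) * f n) \<le> real n * (1 - f n)" by (intro mult_left_mono) auto
   then show ?case by (simp add: mult_ac)
  qed
  show "\<forall>\<^sub>F n in sequentially. real n * (1 - f n) \<le> - (real n * ln (f n))" using pos
  proof eventually_elim
   case (elim n)
   have "1 - f n \<le> - ln (f n)" using ln_le_minus_one[of "f n"] elim by simp
   then have "real n * (1 - f n) \<le> real n * (- ln (f n))" by (intro mult_left_mono) auto
   then show ?case by simp
  qed
  show "(%n. - (real n * ln (f n)) * f n) \<longlonglongrightarrow> c" using tendsto_mult[OF tendsto_minus[OF nln] f1] by simp
  show "(%n. - (real n * ln (f n))) \<longlonglongrightarrow> c" using tendsto_minus[OF nln] by simp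
 qed
qed

text \<open>By convexity \<open>exp(- z)\<close> lies below the chord over \<open>[0, q]\<close>.\<close>
lemma exp_chord:
 fixes z q :: real
 assumes "0 \<le> z" "z \<le> q" "0 < q"
 shows "z * (1 - exp (- q)) / q \<le> 1 - exp (- z)"
proof -
 have "convex_on UNIV (%x::real. exp x)" by (rule exp_convex)
 then have "exp ((1 - z / q) * 0 + z / q * (- q)) \<le> (1 - z / q) * exp 0 + z / q * exp (- q)"
  using assms convex_onD[of UNIV exp "z / q" 0 "- q"] by simp
 then have "exp (- z) \<le> 1 - z / q + z / q * exp (- q)" using assms by simp
 then show ?thesis by (simp add: algebra_simps diff_divide_distrib)
qed

lemma integral_one_minus_cos:
 fixes y d :: real
 assumes "0 \<le> d" "y \<noteq> 0"
 shows "(LBINT t:{0..d}. 1 - cos (t * y)) = d - sin (d * y) / y"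
proof -
 have "(\<integral>t. (1 - cos (t * y)) * indicator {0..d} t \<partial>lborel) = (d - sin (d * y) / y) - (0 - sin (0 * y) / y)" using assms
  by (intro integral_FTC_Icc_real)
    (auto intro!: derivative_eq_intros continuous_intros)
 then show ?thesis by (simp add: set_lebesgue_integral_def mult.commute)
qed

context prob_space
begin

lemma iid_symmetrized_product:
 fixes g :: "'b \<Rightarrow> complex"
 assumes iid: "iid N W" and [measurable]: "g \<in> borel_measurable N" and int: "integrable M (%om. g (W 0 om))" and "i \<noteq> j"
 shows "integrable M (%om. g (W i om) * cnj (g (W j om)))"
  and "expectation (%om. g (W i om) * cnj (g (W j om))) = of_real ((cmod (expectation (%om. g (W 0 om))))\<^sup>2)"
proof -
 let ?h = "%k w. if k = i then g w else cnj (g w)"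
 have int': "integrable M (%om. ?h k (W 0 om))" for k using int by (cases "k = i") auto
 have "cnj \<in> borel_measurable borel" by (intro borel_measurable_continuous_onI continuous_intros)
 then have meas: "?h k \<in> borel_measurable N" for k by (cases "k = i") auto
 have prod: "(\<Prod>k\<in>{i, j}. ?h k (W k om)) = g (W i om) * cnj (g (W j om))" for om using \<open>i \<noteq> j\<close> by auto
 show "integrable M (%om. g (W i om) * cnj (g (W j om)))" using iid_prod_integrable[OF iid, of "{i, j}" ?h, OF _ meas int'] unfolding prod by simp
 have "expectation (%om. g (W i om) * cnj (g (W j om))) = (\<Prod>k\<in>{i, j}. expectation (%om. ?h k (W 0 om)))"
  using iid_prod_expectation[OF iid, of "{i, j}" ?h, OF _ meas int'] unfolding prod by simp
 also have "\<dots> = expectation (%om. g (W 0 om)) * cnj (expectation (%om. g (W 0 om)))" using \<open>i \<noteq> j\<close> by auto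
 finally show "expectation (%om. g (W i om) * cnj (g (W j om))) = of_real ((cmod (expectation (%om. g (W 0 om))))\<^sup>2)"
  by (simp only: complex_norm_square)
qed

text \<open>The mean of \<open>1 - cos(t D)\<close> over \<open>t \<le> d\<close> is at least one half where
  \<open>|D| > 2 / d\<close>. Replacing \<open>1 - f\<close> by \<open>1 - f ^ n\<close> costs only a
  concave distortion, so a power of the characteristic function controls \<open>n\<close> times the tail,
  and no bound on that product is needed beforehand.\<close>
lemma tail_le_char_integral:
 fixes D :: "'a \<Rightarrow> real"
 assumes [measurable]: "random_variable borel D" and "0 < d"
  and f: "\<And>t. f t = expectation (%om. cos (t * D om))" "\<And>t. 0 \<le> f t"
 shows "1 - exp (- (2 * real n * prob {om\<in>space M. 2 / d < \<bar>D om\<bar>})) \<le> 4 / d * (LBINT t:{0..d}. 1 - f t ^ n)"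
proof (cases "real n * prob {om\<in>space M. 2 / d < \<bar>D om\<bar>} = 0")
 case True
 have "f t \<le> 1" for t
 proof -
  have "f t \<le> expectation (%om. 1)" unfolding f(1) by (intro integral_mono integrable_const_bound[where B = 1]) auto
  then show ?thesis by (simp add: prob_space)
 qed
 then have "0 \<le> (LBINT t:{0..d}. 1 - f t ^ n)"
  unfolding set_lebesgue_integral_def using f(2) by (intro integral_nonneg_AE AE_I2) (auto simp: indicator_def power_le_one)
 then show ?thesis using True \<open>0 < d\<close> by auto
next
 case False
 let ?A = "{om\<in>space M. 2 / d < \<bar>D om\<bar>}"
 define p where "p = prob ?A"
 have np: "0 < real n * p" using False mult_nonneg_nonneg[OF of_nat_0_le_iff measure_nonneg, of n M ?A] by (intro order.not_eq_order_implies_strict) (auto simp: p_def)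
 define z where "z t = real n * expectation (%om. (1 - cos (t * D om)) * indicator ?A om)" for t
 have intc: "integrable M (%om. cos (t * D om))" for t by (rule integrable_const_bound[where B = 1]) auto
 have intz: "integrable M (%om. (1 - cos (t * D om)) * indicator ?A om)" for t
  by (rule integrable_const_bound[where B = 2]) (auto simp: indicator_def one_minus_cos_abs)
 have z_le: "z t \<le> 2 * (real n * p)" for t
 proof -
  have "expectation (%om. (1 - cos (t * D om)) * indicator ?A om) \<le> expectation (%om. 2 * indicator ?A om)"
   by (intro integral_mono intz mult_right_mono order.trans[OF abs_ge_self one_minus_cos_abs])
     (auto simp: integrable_indicator_iff emeasure_eq_measure)
  then have "z t \<le> real n * (2 * p)" unfolding z_def p_def by (intro mult_left_mono) auto
  then show ?thesis by simp
 qed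
 have z_nn: "0 \<le> z t" for t unfolding z_def by (intro mult_nonneg_nonneg integral_nonneg_AE AE_I2) auto
 have pw: "z t * ((1 - exp (- (2 * (real n * p)))) / (2 * (real n * p))) \<le> 1 - f t ^ n" for t
 proof -
  have z_f: "z t \<le> real n * (1 - f t)"
  proof -
   have "expectation (%om. (1 - cos (t * D om)) * indicator ?A om) \<le> expectation (%om. 1 - cos (t * D om))"
    using intc by (intro integral_mono intz) (auto simp: indicator_def)
   also have "\<dots> = 1 - f t" using intc by (simp add: f(1) prob_space)
   finally show ?thesis unfolding z_def by (intro mult_left_mono) auto
  qed
  have "f t \<le> exp (- (1 - f t))" using exp_ge_add_one_self[of "- (1 - f t)"] by simp
  then have "f t ^ n \<le> exp (- (1 - f t)) ^ n" using f(2) by (intro power_mono)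
  also have "\<dots> = exp (- (real n * (1 - f t)))" by (simp add: exp_of_nat_mult[symmetric] algebra_simps)
  also have "\<dots> \<le> exp (- z t)" using z_f by simp
  finally have "1 - exp (- z t) \<le> 1 - f t ^ n" by simp
  moreover have "z t * (1 - exp (- (2 * (real n * p)))) / (2 * (real n * p)) \<le> 1 - exp (- z t)" using z_nn z_le np by (intro exp_chord) auto
  ultimately show ?thesis by simp
 qed
 have [measurable]: "f \<in> borel_measurable borel" unfolding f(1)[abs_def] by measurable
 have [measurable]: "z \<in> borel_measurable borel" unfolding z_def[abs_def] by measurable
 have int_z: "real n * p * d / 2 \<le> (LBINT t:{0..d}. z t)"
 proof -
  interpret P: pair_sigma_finite lborel M ..
  let ?H = "%t om. indicator {0..d} t * ((1 - cos (t * D om)) * indicator ?A om) :: real"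
  have H_bound: "\<bar>?H t om\<bar> \<le> 2 * indicator {0..d} t" for t om by (auto simp: indicator_def one_minus_cos_abs)
  have intH: "integrable M (?H t)" for t using intz[of t] by simp
  have "integrable (lborel \<Otimes>\<^sub>M M) (%(t, om). ?H t om)"
  proof (rule P.Fubini_integrable)
   show "integrable lborel (%t. \<integral>om. norm ((%(t, om). ?H t om) (t, om)) \<partial>M)"
   proof (rule L_integrable_bound[of lborel "%t. 2 * indicator {0..d} t :: real"])
    show "AE t in lborel. norm (\<integral>om. norm ((%(t, om). ?H t om) (t, om)) \<partial>M) \<le> norm (2 * indicator {0..d} t :: real)"
    proof (intro AE_I2)
     fix t
     have "(\<integral>om. \<bar>?H t om\<bar> \<partial>M) \<le> (\<integral>om. 2 * indicator {0..d} t \<partial>M)" by (intro integral_mono integrable_abs intH integrable_const H_bound)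
     then show "norm (\<integral>om. norm ((%(t, om). ?H t om) (t, om)) \<partial>M) \<le> norm (2 * indicator {0..d} t :: real)" by (simp add: prob_space)
    qed
   qed (use \<open>0 < d\<close> in auto)
  qed (use intH in auto)
  then have "(\<integral>om. (\<integral>t. ?H t om \<partial>lborel) \<partial>M) = (\<integral>t. (\<integral>om. ?H t om \<partial>M) \<partial>lborel)" and
   int_outer: "integrable M (%om. \<integral>t. ?H t om \<partial>lborel)" by (rule P.Fubini_integral, rule P.integrable_snd)
  then have eq: "real n * expectation (%om. \<integral>t. ?H t om \<partial>lborel) = (LBINT t:{0..d}. z t)" by (simp add: z_def set_lebesgue_integral_def mult_ac)
  have inner: "d / 2 * indicator ?A om \<le> (\<integral>t. ?H t om \<partial>lborel)" for om
  proof (cases "om \<in> ?A")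
   case True
   then have D: "2 / d < \<bar>D om\<bar>" and D0: "D om \<noteq> 0" using \<open>0 < d\<close> by (auto dest: less_trans[of 0 "2 / d", rotated])
   have "(\<integral>t. ?H t om \<partial>lborel) = d - sin (d * D om) / D om"
    using True integral_one_minus_cos[of d "D om"] D0 \<open>0 < d\<close> by (simp add: set_lebesgue_integral_def)
   moreover have "sin (d * D om) / D om \<le> d / 2"
   proof -
    have "\<bar>sin (d * D om) / D om\<bar> \<le> 1 / \<bar>D om\<bar>" by (simp add: abs_divide divide_right_mono)
    also have "\<dots> \<le> d / 2" using D D0 \<open>0 < d\<close> by (simp add: field_simps)
    finally show ?thesis by (rule order.trans[OF abs_ge_self])
   qed
   ultimately show ?thesis using True by simp
  qed simp
  have "d / 2 * p = expectation (%om. d / 2 * indicator ?A om)" by (simp add: p_def)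
  also have "\<dots> \<le> expectation (%om. \<integral>t. ?H t om \<partial>lborel)"
   by (intro integral_mono int_outer inner) (auto simp: integrable_indicator_iff emeasure_eq_measure)
  finally have "real n * (d / 2 * p) \<le> real n * expectation (%om. \<integral>t. ?H t om \<partial>lborel)" by (intro mult_left_mono) auto
  then show ?thesis using eq by (simp add: mult_ac)
 qed
 define q where "q = 2 * (real n * p)"
 have "0 < q" using np by (simp add: q_def)
 have f1: "f t \<le> 1" for t
 proof -
  have "f t \<le> expectation (%om. 1)" unfolding f(1) by (intro integral_mono intc) auto
  then show ?thesis by (simp add: prob_space)
 qed
 have set_int: "set_integrable lborel {0..d} h" if [measurable]: "h \<in> borel_measurable borel" and "\<And>t. \<bar>h t\<bar> \<le> B" for h :: "real \<Rightarrow> real" and B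
  unfolding set_integrable_def
 proof (rule L_integrable_bound[of lborel "%t. B * indicator {0..d} t"])
  show "integrable lborel (%t. B * indicat_real {0..d} t)" using \<open>0 < d\<close> by auto
  show "AE t in lborel. norm (indicat_real {0..d} t *\<^sub>R h t) \<le> norm (B * indicat_real {0..d} t)"
   by (intro AE_I2) (auto simp: indicator_def intro: order.trans[OF that(2) abs_ge_self])
 qed simp
 have "(1 - exp (- q)) / q * (q * d / 4) \<le> (1 - exp (- q)) / q * (LBINT t:{0..d}. z t)"
  using int_z \<open>0 < q\<close> by (intro mult_left_mono) (auto simp: q_def mult_ac)
 also have "\<dots> = (LBINT t:{0..d}. z t * ((1 - exp (- q)) / q))" by (simp add: mult.commute)
 also have "\<dots> \<le> (LBINT t:{0..d}. 1 - f t ^ n)"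
 proof (rule set_integral_mono)
  show "set_integrable lborel {0..d} (%t. z t * ((1 - exp (- q)) / q))"
  proof (rule set_int)
   show "\<bar>z t * ((1 - exp (- q)) / q)\<bar> \<le> q * ((1 - exp (- q)) / q)" for t
    using z_nn[of t] z_le[of t] \<open>0 < q\<close> unfolding abs_mult by (intro mult_mono) (auto simp: q_def)
  qed simp
  show "set_integrable lborel {0..d} (%t. 1 - f t ^ n)"
  proof (rule set_int)
   show "\<bar>1 - f t ^ n\<bar> \<le> 1" for t using f(2)[of t] f1[of t] power_le_one[of "f t" n] zero_le_power[of "f t" n] by linarith
  qed simp
  show "z t * ((1 - exp (- q)) / q) \<le> 1 - f t ^ n" for t using pw[of t] by (simp add: q_def)
 qed
 finally have "(1 - exp (- q)) * d / 4 \<le> (LBINT t:{0..d}. 1 - f t ^ n)" using \<open>0 < q\<close> by simp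
 then have "4 / d * ((1 - exp (- q)) * d / 4) \<le> 4 / d * (LBINT t:{0..d}. 1 - f t ^ n)" using \<open>0 < d\<close> by (intro mult_left_mono) auto
 then show ?thesis using \<open>0 < d\<close> by (simp add: q_def p_def mult_ac)
qed

end

section \<open>Normal scales and characteristic functions\<close>

context prob_space
begin

text \<open>Truncated moments in units of \<open>b\<close>; the minimum makes them finite for every variable.\<close>
definition tmom :: "nat \<Rightarrow> ('a \<Rightarrow> real) \<Rightarrow> real \<Rightarrow> real" where
 "tmom k X b = expectation (%om. min 1 (\<bar>X om / b\<bar> ^ k))"

text \<open>The second condition prevents \<open>b\<close> from growing too fast, the third from growing too slowly,
  and the last one is the Lindeberg condition.\<close>
definition normal_scale :: "('a \<Rightarrow> real) \<Rightarrow> (nat \<Rightarrow> real) \<Rightarrow> bool" where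
 "normal_scale X b \<longleftrightarrow> (\<forall>n. 0 < b n) \<and>
   (\<exists>c>0. \<forall>\<^sub>F n in sequentially. c \<le> real n * tmom 2 X (b n)) \<and>
   (\<exists>C. \<forall>\<^sub>F n in sequentially. real n * tmom 2 X (b n) \<le> C) \<and>
   (%n. real n * tmom 4 X (b n)) \<longlonglongrightarrow> 0"

lemma tmom_integrable:
 fixes X :: "'a \<Rightarrow> real"
 assumes [measurable]: "random_variable borel X"
 shows "integrable M (%om. min 1 (\<bar>X om / b\<bar> ^ k))" by (rule integrable_const_bound[where B = 1]) auto

lemma tmom_nonneg: "0 \<le> tmom k X b" unfolding tmom_def by (intro integral_nonneg_AE AE_I2) auto

lemma prob_le_tmom:
 assumes [measurable]: "random_variable borel X" and "0 < b"
 shows "prob {om\<in>space M. b < \<bar>X om\<bar>} \<le> tmom k X b"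
proof -
 have "prob {om\<in>space M. b < \<bar>X om\<bar>} = expectation (indicator {om\<in>space M. b < \<bar>X om\<bar>})" by simp
 also have "\<dots> \<le> tmom k X b" unfolding tmom_def using \<open>0 < b\<close> by (intro integral_mono tmom_integrable assms)
   (auto simp: integrable_indicator_iff emeasure_eq_measure indicator_def intro!: one_le_power)
 finally show ?thesis .
qed

lemma iid_symmetrized_char:
 fixes X :: "nat \<Rightarrow> 'a \<Rightarrow> real"
 assumes iid: "iid borel X" and "i \<noteq> j"
 shows "expectation (%om. cos (s * (X i om - X j om))) = (cmod (expectation (%om. iexp (s * X 0 om))))\<^sup>2"
proof -
 note [measurable] = iid_measurable[OF iid]
 have eq: "iexp (s * X i om) * cnj (iexp (s * X j om)) = iexp (s * (X i om - X j om))" for om by (simp add: exp_cnj right_diff_distrib flip: exp_add)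
 have int: "integrable M (%om. iexp (s * (X i om - X j om)))" by (rule integrable_iexp) auto
 have "expectation (%om. iexp (s * (X i om - X j om))) = of_real ((cmod (expectation (%om. iexp (s * X 0 om))))\<^sup>2)"
  using iid_symmetrized_product(2)[OF iid, of "%x. iexp (s * x)" i j] \<open>i \<noteq> j\<close>
   integrable_iexp[of "%om. s * X 0 om"] unfolding eq by simp
 then have "Re (expectation (%om. iexp (s * (X i om - X j om)))) = (cmod (expectation (%om. iexp (s * X 0 om))))\<^sup>2"
  by (simp only: Re_complex_of_real)
 moreover have "Re (expectation (%om. iexp (s * (X i om - X j om)))) = expectation (%om. cos (s * (X i om - X j om)))"
  using int by (subst integral_Re[symmetric]) (auto simp: Re_exp)
 ultimately show ?thesis by simp
qed

text \<open>Symmetrizing removes the centring constants and makes all characteristic functions real and nonnegative.\<close>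
lemma DAN_symmetrized_char:
 fixes X :: "nat \<Rightarrow> 'a \<Rightarrow> real"
 assumes iid: "iid borel X" and DAN: "DAN X"
 obtains b where "\<And>n. 0 < b n"
  "\<And>t. (%n. expectation (%om. cos (t * ((X 0 om - X 1 om) / b n))) ^ n) \<longlonglongrightarrow> exp (- (t\<^sup>2))"
proof -
 note [measurable] = iid_measurable[OF iid]
 obtain a b where b: "\<And>n. 0 < b n"
  and conv: "conv_std_normal (%n om. ((\<Sum>i=1..n. X i om) - a n) * inverse (b n))" using DAN by (auto simp: DAN_def)
 have "(%n. expectation (%om. cos (t * ((X 0 om - X 1 om) / b n))) ^ n) \<longlonglongrightarrow> exp (- (t\<^sup>2))" for t
 proof -
  define \<phi> where "\<phi> n = expectation (%om. iexp (t / b n * X 0 om))" for n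
  have E: "expectation (%om. iexp (t * (((\<Sum>i=1..n. X i om) - a n) * inverse (b n)))) = iexp (- (t * a n / b n)) * \<phi> n ^ n" for n
  proof -
   have "iexp (t * (((\<Sum>i=1..n. X i om) - a n) * inverse (b n))) =
     iexp (- (t * a n / b n)) * iexp (t / b n * (\<Sum>i=1..n. X i om))" for om
   proof -
    have "t * (((\<Sum>i=1..n. X i om) - a n) * inverse (b n)) = - (t * a n / b n) + t / b n * (\<Sum>i=1..n. X i om)"
     by (simp add: divide_inverse algebra_simps)
    then show ?thesis by (simp only: of_real_add distrib_left exp_add)
   qed
   then have "expectation (%om. iexp (t * (((\<Sum>i=1..n. X i om) - a n) * inverse (b n)))) =
     iexp (- (t * a n / b n)) * expectation (%om. iexp (t / b n * (\<Sum>i=1..n. X i om)))" by simp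
   then show ?thesis using iid_char_sum[OF iid, of "%x. x" "{1..n}" "t / b n"] by (simp add: \<phi>_def)
  qed
  have "(%n. iexp (- (t * a n / b n)) * \<phi> n ^ n) \<longlonglongrightarrow> complex_of_real (exp (- (t\<^sup>2) / 2))"
   using conv_std_normal_iff_char[THEN iffD1, OF conv_std_normal_measurable[OF conv] conv] unfolding E[symmetric] by blast
  then have "(%n. (cmod (iexp (- (t * a n / b n)) * \<phi> n ^ n))\<^sup>2) \<longlonglongrightarrow> (cmod (complex_of_real (exp (- (t\<^sup>2) / 2))))\<^sup>2"
   by (intro tendsto_power tendsto_norm)
  moreover have "(cmod (iexp (- (t * a n / b n)) * \<phi> n ^ n))\<^sup>2 = expectation (%om. cos (t * ((X 0 om - X 1 om) / b n))) ^ n" for n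
  proof -
   have "cmod (iexp (- (t * a n / b n))) = 1" by (rule norm_exp_i_times)
   then have "(cmod (iexp (- (t * a n / b n)) * \<phi> n ^ n))\<^sup>2 = ((cmod (\<phi> n))\<^sup>2) ^ n"
    by (simp only: norm_mult norm_power mult_1) (simp flip: power_mult add: mult.commute)
   then show ?thesis using iid_symmetrized_char[OF iid, of 0 1 "t / b n"] by (simp add: \<phi>_def)
  qed
  moreover have "(cmod (complex_of_real (exp (- (t\<^sup>2) / 2))))\<^sup>2 = exp (- (t\<^sup>2))" by (simp add: power2_eq_square flip: exp_add)
  ultimately show ?thesis by simp
 qed
 with b show ?thesis by (rule that)
qed

text \<open>With \<open>Y = D / b\<^sub>n\<close>, convergence of the powers gives \<open>n E (1 - cos(t Y))
  \<longlonglongrightarrow> t\<^sup>2\<close>. As \<open>(1 - cos y)\<^sup>2 = 2 (1 - cos y) - (1 - cos(2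
  y)) / 2\<close>, the limits cancel in \<open>n E (1 - cos(t Y))\<^sup>2\<close>, which therefore tends to
  zero: this is the quadratic form of the Gaussian exponent at work. Since \<open>1 - cos y\<close> is
  comparable to \<open>y\<^sup>2\<close> for small \<open>y\<close>, the truncated moments follow once
  \<open>n P(|Y| > 1)\<close> is known to vanish.\<close>
lemma normal_scale_of_char_powers:
 fixes D :: "'a \<Rightarrow> real" and b :: "nat \<Rightarrow> real"
 assumes [measurable]: "random_variable borel D" and b: "\<And>n. 0 < b n"
  and nn: "\<And>s. 0 \<le> expectation (%om. cos (s * D om))"
  and lim: "\<And>t. (%n. expectation (%om. cos (t * (D om / b n))) ^ n) \<longlonglongrightarrow> exp (- (t\<^sup>2))"
 shows "normal_scale D b"
proof -
 define f where "f n t = expectation (%om. cos (t * (D om / b n)))" for n t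
 have intc: "integrable M (%om. cos (t * (D om / b n)))" for t n by (rule integrable_const_bound[where B = 1]) auto
 have f0: "0 \<le> f n t" for n t using nn[of "t / b n"] by (simp add: f_def)
 have f1: "f n t \<le> 1" for n t
 proof -
  have "f n t \<le> expectation (%om. 1)" unfolding f_def by (intro integral_mono intc) auto
  then show ?thesis by (simp add: prob_space)
 qed
 have f_lim: "(%n. f n t ^ n) \<longlonglongrightarrow> exp (- (t\<^sup>2))" for t using lim[of t] by (simp add: f_def)
 define z where "z n t = real n * expectation (%om. 1 - cos (t * (D om / b n)))" for n t
 have z_eq: "z n t = real n * (1 - f n t)" for n t using intc by (simp add: z_def f_def prob_space)
 have z_lim: "(%n. z n t) \<longlonglongrightarrow> t\<^sup>2" for t unfolding z_eq by (intro pow_exp_limit f0 f1 f_lim)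
 define v where "v n t = real n * expectation (%om. (1 - cos (t * (D om / b n)))\<^sup>2)" for n t
 have int2: "integrable M (%om. (1 - cos (t * (D om / b n)))\<^sup>2)" for t n
 proof (rule integrable_const_bound[where B = 4])
  have "(1 - cos x)\<^sup>2 \<le> 2\<^sup>2" for x :: real using cos_ge_minus_one[of x] cos_le_one[of x] by (intro power_mono) auto
  then show "AE om in M. norm ((1 - cos (t * (D om / b n)))\<^sup>2) \<le> 4" by auto
 qed auto
 have v_lim: "(%n. v n t) \<longlonglongrightarrow> 0" for t
 proof -
  have id: "(1 - cos x)\<^sup>2 = 2 * (1 - cos x) - (1 - cos (2 * x)) / 2" for x :: real using cos_double_cos[of x] by (simp add: power2_diff field_simps)
  have "v n t = 2 * z n t - z n (2 * t) / 2" for n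
  proof -
   have "expectation (%om. (1 - cos (t * (D om / b n)))\<^sup>2) =
     expectation (%om. 2 * (1 - cos (t * (D om / b n))) - (1 - cos (2 * t * (D om / b n))) / 2)" by (subst id) (simp add: mult.assoc)
   also have "\<dots> = 2 * expectation (%om. 1 - cos (t * (D om / b n))) - expectation (%om. 1 - cos (2 * t * (D om / b n))) / 2"
    by (subst L_integral_diff;
      (intro L_integrable_diff integrable_mult_right integrable_divide_zero intc integrable_const)?)
      (simp only: integral_mult_right_zero integral_divide_zero)
   finally show ?thesis unfolding v_def z_def by (simp only: right_diff_distrib times_divide_eq_right mult.left_commute)
  qed
  moreover have "(%n. 2 * z n t - z n (2 * t) / 2) \<longlonglongrightarrow> 2 * t\<^sup>2 - (2 * t)\<^sup>2 / 2" by (intro tendsto_intros z_lim) simp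
  ultimately show ?thesis by (simp add: power_mult_distrib)
 qed
 define P where "P n = real n * prob {om\<in>space M. b n < \<bar>D om\<bar>}" for n
 have P_lim: "P \<longlonglongrightarrow> 0"
 proof (rule tendstoI)
  fix e :: real assume "e > 0"
    \<comment> \<open>The far tail contributes at most \<open>5 d\<^sup>2\<close>, which this choice keeps below \<open>e / 8\<close>; the part between the levels 1 and \<open>2 / d\<close> vanishes for fixed \<open>d\<close>.\<close>
  define d where "d = min (1/4) (sqrt (e / 40))"
  have d: "0 < d" "d \<le> 1/4" "d\<^sup>2 \<le> e / 40" "d\<^sup>2 \<le> 1/16"
  proof -
   show "0 < d" "d \<le> 1/4" using \<open>e > 0\<close> by (auto simp: d_def)
   then have "d\<^sup>2 \<le> (sqrt (e / 40))\<^sup>2" "d\<^sup>2 \<le> (1/4)\<^sup>2" by (intro power_mono; auto simp: d_def)+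
   then show "d\<^sup>2 \<le> e / 40" "d\<^sup>2 \<le> 1/16" using \<open>e > 0\<close> by (auto simp: power_divide)
  qed
  have [measurable]: "f n \<in> borel_measurable borel" for n unfolding f_def[abs_def] by measurable
  have "(%n. LBINT t:{0..d}. 1 - f n t ^ n) \<longlonglongrightarrow> (LBINT t:{0..d}. 1 - exp (- (t\<^sup>2)))" unfolding set_lebesgue_integral_def
  proof (rule integral_dominated_convergence[where w = "%t. indicator {0..d} t"])
   show "AE t in lborel. (%n. indicat_real {0..d} t *\<^sub>R (1 - f n t ^ n)) \<longlonglongrightarrow> indicat_real {0..d} t *\<^sub>R (1 - exp (- (t\<^sup>2)))"
    by (intro AE_I2 tendsto_intros f_lim)
   show "AE t in lborel. norm (indicat_real {0..d} t *\<^sub>R (1 - f n t ^ n)) \<le> indicat_real {0..d} t" for n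
    using f0 f1 by (intro AE_I2) (auto simp: indicator_def power_le_one)
  qed (use d in auto)
  then have "(%n. 4 / d * (LBINT t:{0..d}. 1 - f n t ^ n)) \<longlonglongrightarrow> 4 / d * (LBINT t:{0..d}. 1 - exp (- (t\<^sup>2)))" by (intro tendsto_intros)
  moreover have "4 / d * (LBINT t:{0..d}. 1 - exp (- (t\<^sup>2))) \<le> 4 * d\<^sup>2"
  proof -
   have "(LBINT t:{0..d}. 1 - exp (- (t\<^sup>2))) \<le> (LBINT t:{0..d}. d\<^sup>2)"
   proof (rule set_integral_mono)
    show "set_integrable lborel {0..d} (%t. 1 - exp (- t\<^sup>2))"
     unfolding set_integrable_def by (intro borel_integrable_compact continuous_intros) auto
    show "set_integrable lborel {0..d} (%t. d\<^sup>2)" unfolding set_integrable_def by (intro borel_integrable_compact continuous_intros) auto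
    fix t assume "t \<in> {0..d}"
    then have "t\<^sup>2 \<le> d\<^sup>2" by (intro power_mono) auto
    then show "1 - exp (- t\<^sup>2) \<le> d\<^sup>2" using exp_ge_add_one_self[of "- (t\<^sup>2)"] by simp
   qed
   also have "\<dots> = d * d\<^sup>2" using d by (simp add: set_lebesgue_integral_def)
   finally show ?thesis using d by (simp add: field_simps)
  qed
  moreover have "0 < d\<^sup>2" using d by simp
  ultimately have ev1: "\<forall>\<^sub>F n in sequentially. 4 / d * (LBINT t:{0..d}. 1 - f n t ^ n) < 5 * d\<^sup>2"
   by (rule_tac order_tendstoD(2)) (assumption, linarith)
  have "(%n. v n (d / 2) * (256 / d^4)) \<longlonglongrightarrow> 0 * (256 / d^4)" by (intro tendsto_mult v_lim tendsto_const)
  then have ev2: "\<forall>\<^sub>F n in sequentially. v n (d / 2) * (256 / d^4) < e / 2" using \<open>e > 0\<close> by (intro order_tendstoD(2)) auto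
  show "\<forall>\<^sub>F n in sequentially. dist (P n) 0 < e" using ev1 ev2
  proof eventually_elim
   case (elim n)
   let ?Y = "%om. D om / b n"
   let ?A = "{om\<in>space M. 2 / d < \<bar>?Y om\<bar>}" and ?B = "{om\<in>space M. 1 < \<bar>?Y om\<bar> \<and> \<bar>?Y om\<bar> \<le> 2 / d}"
   have A: "2 * real n * prob ?A \<le> 10 * d\<^sup>2"
   proof -
    have "1 - exp (- (2 * real n * prob ?A)) \<le> 4 / d * (LBINT t:{0..d}. 1 - f n t ^ n)"
     using d f0 by (intro tail_le_char_integral) (auto simp: f_def)
    then have *: "1 - 5 * d\<^sup>2 \<le> exp (- (2 * real n * prob ?A))" using elim by simp
    have "exp (- (10 * d\<^sup>2)) \<le> 1 / (1 + 10 * d\<^sup>2)" using exp_ge_add_one_self[of "10 * d\<^sup>2"] d by (simp add: exp_minus field_simps add_pos_nonneg)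
    also have "\<dots> \<le> 1 - 5 * d\<^sup>2"
    proof -
     have "10 * d\<^sup>2 * d\<^sup>2 \<le> d\<^sup>2" using d by (intro mult_left_le_one_le) auto
     then have "1 \<le> (1 - 5 * d\<^sup>2) * (1 + 10 * d\<^sup>2)" using d by (simp add: algebra_simps)
     then show ?thesis by (simp add: divide_le_eq add_pos_nonneg)
    qed
    finally have "exp (- (10 * d\<^sup>2)) \<le> exp (- (2 * real n * prob ?A))" using * by (rule order.trans)
    then show ?thesis by (simp only: exp_le_cancel_iff neg_le_iff_le)
   qed
   have B: "real n * prob ?B \<le> v n (d / 2) * (256 / d^4)"
   proof -
    have pt: "indicator ?B om \<le> (1 - cos (d / 2 * ?Y om))\<^sup>2 * (256 / d^4)" for om
    proof (cases "om \<in> ?B")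
     case True
     then have y: "1 < \<bar>?Y om\<bar>" "\<bar>?Y om\<bar> \<le> 2 / d" by (simp_all only: mem_Collect_eq)
     have "\<bar>d / 2 * ?Y om\<bar> = d / 2 * \<bar>?Y om\<bar>" using d by (simp add: abs_mult)
     also have "\<dots> \<le> d / 2 * (2 / d)" using y d by (intro mult_left_mono) auto
     finally have "\<bar>d / 2 * ?Y om\<bar> \<le> 1" using d by simp
     then have "(d / 2 * ?Y om)\<^sup>2 / 4 \<le> 1 - cos (d / 2 * ?Y om)" by (rule one_minus_cos_ge)
     moreover have "(d / 2)\<^sup>2 \<le> (d / 2 * ?Y om)\<^sup>2"
     proof -
      have "1 \<le> (?Y om)\<^sup>2" using y(1) one_le_power[of "\<bar>?Y om\<bar>" 2] by (simp only: power2_abs)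
      then have "(d / 2)\<^sup>2 * 1 \<le> (d / 2)\<^sup>2 * (?Y om)\<^sup>2" by (intro mult_left_mono) auto
      then show ?thesis by (simp only: power_mult_distrib mult_1_right)
     qed
     ultimately have "d\<^sup>2 / 16 \<le> 1 - cos (d / 2 * ?Y om)" by (simp add: power_divide)
     then have "(d\<^sup>2 / 16)\<^sup>2 \<le> (1 - cos (d / 2 * ?Y om))\<^sup>2" by (intro power_mono) auto
     then have "d^4 / 256 \<le> (1 - cos (d / 2 * ?Y om))\<^sup>2" by (simp add: power_divide flip: power_mult)
     then have "1 \<le> (1 - cos (d / 2 * ?Y om))\<^sup>2 * (256 / d^4)" using d by (simp add: field_simps)
     then show ?thesis using True by (simp only: indicator_simps)
    qed (use d in auto)
    have "prob ?B = expectation (indicator ?B)" by simp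
    also have "\<dots> \<le> expectation (%om. (1 - cos (d / 2 * ?Y om))\<^sup>2 * (256 / d^4))"
     by (intro integral_mono integrable_mult_left int2 pt) (auto simp: integrable_indicator_iff emeasure_eq_measure)
    finally have "real n * prob ?B \<le> real n * (expectation (%om. (1 - cos (d / 2 * ?Y om))\<^sup>2) * (256 / d^4))" by (intro mult_left_mono) auto
    then show ?thesis by (simp add: v_def)
   qed
   have "{om\<in>space M. b n < \<bar>D om\<bar>} \<subseteq> ?A \<union> ?B" using b[of n] by (auto simp: field_simps)
   then have "prob {om\<in>space M. b n < \<bar>D om\<bar>} \<le> prob (?A \<union> ?B)" by (intro finite_measure_mono) auto
   also have "\<dots> \<le> prob ?A + prob ?B" by (rule measure_Un_le) auto
   finally have "P n \<le> real n * prob ?A + real n * prob ?B" by (simp add: P_def distrib_left[symmetric] mult_left_mono)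
   then have "P n < e" using A B elim d \<open>e > 0\<close> by linarith
   then show ?case by (simp add: P_def)
  qed
 qed
 have m4: "real n * tmom 4 D (b n) \<le> 16 * v n 1 + P n" for n
 proof -
  have pt: "min 1 (\<bar>D om / b n\<bar> ^ 4) \<le> 16 * (1 - cos (1 * (D om / b n)))\<^sup>2 + indicator {om\<in>space M. b n < \<bar>D om\<bar>} om" if "om \<in> space M" for om
  proof (cases "b n < \<bar>D om\<bar>")
   case False
   then have "\<bar>D om / b n\<bar> \<le> 1" using b[of n] by simp
   then have "(D om / b n)\<^sup>2 / 4 \<le> 1 - cos (D om / b n)" by (rule one_minus_cos_ge)
   then have "((D om / b n)\<^sup>2 / 4)\<^sup>2 \<le> (1 - cos (D om / b n))\<^sup>2" by (intro power_mono) auto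
   then have "\<bar>D om / b n\<bar> ^ 4 \<le> 16 * (1 - cos (D om / b n))\<^sup>2" by (simp add: power_divide flip: power_mult)
   then show ?thesis using False by (auto intro: min.coboundedI2)
  qed (use that in \<open>auto intro: min.coboundedI1 simp: add_increasing\<close>)
  have "tmom 4 D (b n) \<le> expectation (%om. 16 * (1 - cos (1 * (D om / b n)))\<^sup>2 + indicator {om\<in>space M. b n < \<bar>D om\<bar>} om)" unfolding tmom_def
   by (intro integral_mono tmom_integrable L_integrable_add integrable_mult_right int2 pt)
     (auto simp: integrable_indicator_iff emeasure_eq_measure)
  also have "\<dots> = 16 * expectation (%om. (1 - cos (1 * (D om / b n)))\<^sup>2) + prob {om\<in>space M. b n < \<bar>D om\<bar>}" by (subst L_integral_add;
     (intro integrable_mult_right int2)?) (auto simp: integrable_indicator_iff emeasure_eq_measure)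
  finally have "real n * tmom 4 D (b n) \<le> real n * (16 * expectation (%om. (1 - cos (1 * (D om / b n)))\<^sup>2) + prob {om\<in>space M. b n < \<bar>D om\<bar>})"
   by (intro mult_left_mono) auto
  then show ?thesis by (simp add: v_def P_def algebra_simps)
 qed
 have quarter: "x \<le> 4 * y" if "x / 4 \<le> y" for x y :: real using that by simp
 have m2: "real n * tmom 2 D (b n) \<le> 4 * z n 1 + P n" for n
 proof -
  have pt: "min 1 (\<bar>D om / b n\<bar> ^ 2) \<le> 4 * (1 - cos (1 * (D om / b n))) + indicator {om\<in>space M. b n < \<bar>D om\<bar>} om" if "om \<in> space M" for om
  proof (cases "b n < \<bar>D om\<bar>")
   case False
   then have "\<bar>D om / b n\<bar> \<le> 1" using b[of n] by simp
   then have "(D om / b n)\<^sup>2 / 4 \<le> 1 - cos (D om / b n)" by (rule one_minus_cos_ge)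
   then have "\<bar>D om / b n\<bar>\<^sup>2 \<le> 4 * (1 - cos (1 * (D om / b n)))" unfolding power2_abs mult_1 by (rule quarter)
   then show ?thesis using False by (intro min.coboundedI2) (simp only: indicator_simps mem_Collect_eq simp_thms add_0_right)
  qed (use that in \<open>auto intro: min.coboundedI1 simp: add_increasing\<close>)
  have "tmom 2 D (b n) \<le> expectation (%om. 4 * (1 - cos (1 * (D om / b n))) + indicator {om\<in>space M. b n < \<bar>D om\<bar>} om)" unfolding tmom_def
   by (intro integral_mono tmom_integrable L_integrable_add integrable_mult_right
      L_integrable_diff integrable_const intc pt)
     (auto simp: integrable_indicator_iff emeasure_eq_measure)
  also have "\<dots> = 4 * expectation (%om. 1 - cos (1 * (D om / b n))) + prob {om\<in>space M. b n < \<bar>D om\<bar>}"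
   by (subst L_integral_add[OF integrable_mult_right[OF L_integrable_diff[OF integrable_const intc]]];
     (simp only: integral_mult_right_zero)?) (auto simp: integrable_indicator_iff emeasure_eq_measure)
  finally have "real n * tmom 2 D (b n) \<le> real n * (4 * expectation (%om. 1 - cos (1 * (D om / b n))) + prob {om\<in>space M. b n < \<bar>D om\<bar>})"
   by (intro mult_left_mono) auto
  then show ?thesis by (simp add: z_def P_def algebra_simps)
 qed
 have m2': "z n 1 \<le> 2 * (real n * tmom 2 D (b n))" for n
 proof -
  have pt: "1 - cos (1 * (D om / b n)) \<le> 2 * min 1 (\<bar>D om / b n\<bar> ^ 2)" for om
  proof (cases "\<bar>D om / b n\<bar> ^ 2 \<le> 1")
   case True
   have "1 - cos (D om / b n) \<le> (D om / b n)\<^sup>2 / 2" by (rule one_minus_cos_le)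
   also have "\<dots> \<le> 2 * (D om / b n)\<^sup>2" by simp
   finally have "1 - cos (1 * (D om / b n)) \<le> 2 * \<bar>D om / b n\<bar>\<^sup>2" unfolding power2_abs mult_1 .
   then show ?thesis using True by (simp only: min_absorb2)
  next
   case False
   then have "min 1 (\<bar>D om / b n\<bar>\<^sup>2) = 1" by (simp only: min_def) auto
   then show ?thesis using cos_ge_minus_one[of "D om / b n"] by simp
  qed
  have "expectation (%om. 1 - cos (1 * (D om / b n))) \<le> expectation (%om. 2 * min 1 (\<bar>D om / b n\<bar> ^ 2))"
   by (intro integral_mono integrable_mult_right tmom_integrable L_integrable_diff integrable_const intc pt) auto
  then have "expectation (%om. 1 - cos (1 * (D om / b n))) \<le> 2 * tmom 2 D (b n)" by (simp add: tmom_def)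
  then have "z n 1 \<le> real n * (2 * tmom 2 D (b n))" unfolding z_def by (intro mult_left_mono) auto
  then show ?thesis by simp
 qed
 have z1: "\<forall>\<^sub>F n in sequentially. 1 / 2 < z n 1" "\<forall>\<^sub>F n in sequentially. z n 1 < 2"
  using order_tendstoD(1)[OF z_lim[of 1], of "1/2"] order_tendstoD(2)[OF z_lim[of 1], of 2] by simp_all
 have P1: "\<forall>\<^sub>F n in sequentially. P n < 1" using P_lim by (rule order_tendstoD) simp
 show ?thesis unfolding normal_scale_def
 proof (intro conjI allI b)
  have "\<forall>\<^sub>F n in sequentially. 1 / 4 \<le> real n * tmom 2 D (b n)" using z1(1)
  proof eventually_elim
   case (elim n) then show ?case using m2'[of n] by linarith
  qed
  then show "\<exists>c>0. \<forall>\<^sub>F n in sequentially. c \<le> real n * tmom 2 D (b n)" by (intro exI[of _ "1/4"]) auto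
  have "\<forall>\<^sub>F n in sequentially. real n * tmom 2 D (b n) \<le> 9" using z1(2) P1
  proof eventually_elim
   case (elim n) then show ?case using m2[of n] by linarith
  qed
  then show "\<exists>C. \<forall>\<^sub>F n in sequentially. real n * tmom 2 D (b n) \<le> C" by blast
  show "(%n. real n * tmom 4 D (b n)) \<longlonglongrightarrow> 0"
  proof (rule tendsto_sandwich[OF _ _ tendsto_const])
   show "(%n. 16 * v n 1 + P n) \<longlonglongrightarrow> 0" using tendsto_add[OF tendsto_mult[OF tendsto_const v_lim] P_lim, of 16 1] by simp
  qed (auto intro!: always_eventually m4 mult_nonneg_nonneg tmom_nonneg)
 qed
qed

end

section \<open>Comparison of scales\<close>

context prob_space
begin

lemma prob_abs_gt_small:
 fixes X :: "'a \<Rightarrow> real"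
 assumes [measurable]: "random_variable borel X" and "0 < e"
 obtains K where "0 < K" "prob {om\<in>space M. K < \<bar>X om\<bar>} < e"
proof -
 have "(%n. expectation (%om. (1::real) * indicator {real n<..} \<bar>X om\<bar>)) \<longlonglongrightarrow> 0"
  by (rule truncated_mean_tendsto_0[where Z = "%_. 1", OF _ filterlim_real_sequentially]) auto
 then have "\<forall>\<^sub>F n in sequentially. expectation (%om. (1::real) * indicator {real n<..} \<bar>X om\<bar>) < e" using \<open>0 < e\<close> by (rule order_tendstoD)
 then obtain m where m: "expectation (%om. (1::real) * indicator {real m<..} \<bar>X om\<bar>) < e" "m > 0"
  unfolding eventually_sequentially by (metis gt_ex le_cases less_le_trans)
 have "expectation (%om. (1::real) * indicator {real m<..} \<bar>X om\<bar>) = expectation (indicator {om\<in>space M. real m < \<bar>X om\<bar>})"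
  by (intro L_integral_cong) (auto simp: indicator_def)
 then show ?thesis using m by (intro that[of "real m"]) auto
qed

text \<open>If, for each large \<open>x\<close>, the variable \<open>F x Y\<close> is at least of size
  \<open>\<kappa> |x|\<close> with probability \<open>p\<close>, then integrating over \<open>Y\<close>
  first loses no more than the factor \<open>p\<close>. All comparisons of \<open>\<xi>\<close> with
  \<open>u\<close>, and of a variable with its symmetrization, are instances.\<close>
lemma expectation_ge_of_conditional_size:
 fixes X :: "'a \<Rightarrow> real" and F :: "real \<Rightarrow> 'c \<Rightarrow> real" and h :: "real \<Rightarrow> real"
 assumes ind: "indep_rv borel X T Y"
  and F[measurable]: "(%(x, y). F x y) \<in> borel_measurable (borel \<Otimes>\<^sub>M T)"
  and size: "\<And>x. K \<le> \<bar>x\<bar> \<Longrightarrow> p \<le> prob {om\<in>space M. \<kappa> * \<bar>x\<bar> \<le> \<bar>F x (Y om)\<bar>}"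
  and H[measurable]: "(%(x, y). H x y) \<in> borel_measurable (borel \<Otimes>\<^sub>M T)" and h[measurable]: "h \<in> borel_measurable borel"
  and H_nn: "\<And>x y. 0 \<le> H x y" and h_nn: "\<And>x. 0 \<le> h x" and "0 \<le> p"
  and le: "\<And>x y. K \<le> \<bar>x\<bar> \<Longrightarrow> \<kappa> * \<bar>x\<bar> \<le> \<bar>F x y\<bar> \<Longrightarrow> h x \<le> H x y"
  and intH: "integrable M (%om. H (X om) (Y om))"
  and inth: "integrable M (%om. h (X om) * indicator {K..} \<bar>X om\<bar>)"
 shows "p * expectation (%om. h (X om) * indicator {K..} \<bar>X om\<bar>) \<le> expectation (%om. H (X om) (Y om))"
proof -
 have X[measurable]: "random_variable borel X" and Y[measurable]: "random_variable T Y" using ind by (auto simp: indep_rv_def)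
 have inner: "ennreal (p * (h x * indicator {K..} \<bar>x\<bar>)) \<le> (\<integral>\<^sup>+om'. ennreal (H x (Y om')) \<partial>M)" for x
 proof (cases "K \<le> \<bar>x\<bar>")
  case True
  let ?A = "{om\<in>space M. \<kappa> * \<bar>x\<bar> \<le> \<bar>F x (Y om)\<bar>}"
  have [measurable]: "?A \<in> events" by measurable
  have "ennreal (p * (h x * indicator {K..} \<bar>x\<bar>)) \<le> ennreal (h x * prob ?A)"
   using mult_right_mono[OF size[OF True] h_nn[of x]] True by (intro ennreal_leI) (simp add: mult.commute)
  also have "\<dots> = (\<integral>\<^sup>+om'. ennreal (h x) * indicator ?A om' \<partial>M)"
   using h_nn[of x] by (simp add: ennreal_mult emeasure_eq_measure nn_integral_cmult_indicator)
  also have "\<dots> \<le> (\<integral>\<^sup>+om'. ennreal (H x (Y om')) \<partial>M)" using le[OF True] by (intro nn_integral_mono) (auto simp: indicator_def intro!: ennreal_leI)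
  finally show ?thesis .
 qed simp
 have "ennreal (p * expectation (%om. h (X om) * indicator {K..} \<bar>X om\<bar>)) =
   (\<integral>\<^sup>+om. ennreal (p * (h (X om) * indicator {K..} \<bar>X om\<bar>)) \<partial>M)" using inth h_nn \<open>0 \<le> p\<close> by (subst nn_integral_eq_integral) (auto intro!: AE_I2)
 also have "\<dots> \<le> (\<integral>\<^sup>+om. (\<integral>\<^sup>+om'. ennreal (H (X om) (Y om')) \<partial>M) \<partial>M)" by (intro nn_integral_mono inner)
 also have "\<dots> = (\<integral>\<^sup>+om. ennreal (H (X om) (Y om)) \<partial>M)" by (subst indep_rv_nn_integral[OF ind]) auto
 also have "\<dots> = ennreal (expectation (%om. H (X om) (Y om)))" using intH H_nn by (intro nn_integral_eq_integral) auto
 finally show ?thesis using H_nn by (simp add: ennreal_le_iff integral_nonneg_AE)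
qed

lemma tmom_le_of_conditional_size:
 fixes X :: "'a \<Rightarrow> real" and F :: "real \<Rightarrow> 'c \<Rightarrow> real"
 assumes ind: "indep_rv borel X T Y"
  and F[measurable]: "(%(x, y). F x y) \<in> borel_measurable (borel \<Otimes>\<^sub>M T)"
  and size: "\<And>x. K \<le> \<bar>x\<bar> \<Longrightarrow> p \<le> prob {om\<in>space M. \<kappa> * \<bar>x\<bar> \<le> \<bar>F x (Y om)\<bar>}"
  and "0 \<le> K" "0 < p" "0 < \<kappa>" "\<kappa> \<le> 1" "0 < b"
 shows "tmom k X b \<le> (K / b) ^ k + tmom k (%om. F (X om) (Y om)) b / (p * \<kappa> ^ k)"
proof -
 have X[measurable]: "random_variable borel X" and Y[measurable]: "random_variable T Y" using ind by (auto simp: indep_rv_def)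
 let ?h = "%x. \<kappa> ^ k * min 1 (\<bar>x / b\<bar> ^ k)"
 have h_le: "?h x \<le> min 1 (\<bar>F x y / b\<bar> ^ k)" if "\<kappa> * \<bar>x\<bar> \<le> \<bar>F x y\<bar>" for x y
 proof -
  have "\<kappa> * \<bar>x / b\<bar> \<le> \<bar>F x y / b\<bar>" using that \<open>0 < b\<close> by (simp add: abs_divide divide_right_mono)
  then have "(\<kappa> * \<bar>x / b\<bar>) ^ k \<le> \<bar>F x y / b\<bar> ^ k" using \<open>0 < \<kappa>\<close> by (intro power_mono) auto
  then have "\<kappa> ^ k * \<bar>x / b\<bar> ^ k \<le> \<bar>F x y / b\<bar> ^ k" by (simp only: power_mult_distrib)
  moreover have "\<kappa> ^ k \<le> 1" using assms by (intro power_le_one) auto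
  moreover have "?h x \<le> \<kappa> ^ k * 1" "?h x \<le> \<kappa> ^ k * \<bar>x / b\<bar> ^ k" using \<open>0 < \<kappa>\<close> by (intro mult_left_mono; simp)+
  ultimately show ?thesis by (intro min.boundedI) linarith+
 qed
 have int1: "integrable M (%om. ?h (X om) * indicator {K..} \<bar>X om\<bar>)"
  using \<open>0 < \<kappa>\<close> by (intro integrable_const_bound[where B = "\<kappa> ^ k"]) (auto simp: indicator_def abs_mult intro!: AE_I2 mult_left_le)
 have main: "p * expectation (%om. ?h (X om) * indicator {K..} \<bar>X om\<bar>) \<le> tmom k (%om. F (X om) (Y om)) b" unfolding tmom_def using assms h_le int1
  by (intro expectation_ge_of_conditional_size[OF ind F size] tmom_integrable) (auto intro!: mult_nonneg_nonneg)
 have "tmom k X b \<le> expectation (%om. (K / b) ^ k + (?h (X om) * indicator {K..} \<bar>X om\<bar>) / \<kappa> ^ k)" unfolding tmom_def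
 proof (intro integral_mono tmom_integrable X)
  show "integrable M (%om. (K / b) ^ k + (?h (X om) * indicator {K..} \<bar>X om\<bar>) / \<kappa> ^ k)"
   by (intro L_integrable_add integrable_const integrable_divide_zero int1)
  fix om
  show "min 1 (\<bar>X om / b\<bar> ^ k) \<le> (K / b) ^ k + (?h (X om) * indicator {K..} \<bar>X om\<bar>) / \<kappa> ^ k"
  proof (cases "K \<le> \<bar>X om\<bar>")
   case False
   then have "\<bar>X om / b\<bar> ^ k \<le> (K / b) ^ k" using \<open>0 < b\<close> by (intro power_mono) (auto simp: abs_divide divide_right_mono)
   then show ?thesis using False by (auto intro: min.coboundedI2)
  next
   case True
   have "0 \<le> (K / b) ^ k" using assms by auto
   then show ?thesis using True \<open>0 < \<kappa>\<close> by simp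
  qed
 qed
 also have "\<dots> = (K / b) ^ k + expectation (%om. ?h (X om) * indicator {K..} \<bar>X om\<bar>) / \<kappa> ^ k" using prob_space
  by (simp only: L_integral_add[OF integrable_const integrable_divide_zero[OF int1]]
    integral_divide_zero lebesgue_integral_const scaleR_one)
 also have "\<dots> \<le> (K / b) ^ k + (tmom k (%om. F (X om) (Y om)) b / p) / \<kappa> ^ k"
  using main assms by (intro add_left_mono divide_right_mono) (auto simp: field_simps)
 finally show ?thesis by (simp add: field_simps)
qed

lemma tmom_lower_scaling:
 fixes X :: "'a \<Rightarrow> real"
 assumes X[measurable]: "random_variable borel X" and "0 < b"
 shows "min 1 (1 / b\<^sup>2) * tmom 2 X 1 \<le> tmom 2 X b"
proof -
 have "min 1 (1 / b\<^sup>2) * min 1 (\<bar>x / 1\<bar>\<^sup>2) \<le> min 1 (\<bar>x / b\<bar>\<^sup>2)" for x :: real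
 proof (rule min.boundedI)
  show "min 1 (1 / b\<^sup>2) * min 1 (\<bar>x / 1\<bar>\<^sup>2) \<le> 1" by (intro mult_le_one) auto
  have "min 1 (1 / b\<^sup>2) * min 1 (\<bar>x / 1\<bar>\<^sup>2) \<le> 1 / b\<^sup>2 * x\<^sup>2" by (intro mult_mono) auto
  then show "min 1 (1 / b\<^sup>2) * min 1 (\<bar>x / 1\<bar>\<^sup>2) \<le> \<bar>x / b\<bar>\<^sup>2" by (simp add: power_divide)
 qed
 then have "expectation (%om. min 1 (1 / b\<^sup>2) * min 1 (\<bar>X om / 1\<bar>\<^sup>2)) \<le> tmom 2 X b"
  unfolding tmom_def by (intro integral_mono integrable_mult_right tmom_integrable X)
 then show ?thesis by (simp only: tmom_def integral_mult_right_zero)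
qed

lemma tmom_pos:
 fixes X :: "'a \<Rightarrow> real"
 assumes X[measurable]: "random_variable borel X" and "\<not> (AE om in M. X om = 0)" "0 < b"
 shows "0 < tmom k X b"
proof (rule ccontr)
 assume "\<not> 0 < tmom k X b"
 then have "tmom k X b = 0" using tmom_nonneg[of k X b] by linarith
 then have "expectation (%om. min 1 (\<bar>X om / b\<bar> ^ k)) = 0" by (simp only: tmom_def)
 then have "AE om in M. min 1 (\<bar>X om / b\<bar> ^ k) = 0" using tmom_integrable[OF X] by (subst (asm) integral_nonneg_eq_0_iff_AE) auto
 then have "AE om in M. X om = 0"
 proof eventually_elim
  case (elim om)
  then have "\<bar>X om / b\<bar> ^ k = 0" by (auto simp: min_def split: if_splits)
  then show ?case using \<open>0 < b\<close> by simp
 qed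
 then show False using assms by simp
qed

text \<open>A nonzero variable has \<open>tmom 2 X b\<close> at least of order \<open>1 / b\<^sup>2\<close>, so a
  bound on \<open>n tmom 2 X (b n)\<close> forces \<open>b n\<close> to grow at least like the square root
  of \<open>n\<close>.\<close>
lemma scale_growth:
 fixes X :: "'a \<Rightarrow> real" and b :: "nat \<Rightarrow> real"
 assumes X[measurable]: "random_variable borel X" and nz: "\<not> (AE om in M. X om = 0)"
  and b: "\<And>n. 0 < b n" and bd: "\<forall>\<^sub>F n in sequentially. real n * tmom 2 X (b n) \<le> C"
 obtains C' where "0 < C'" "\<forall>\<^sub>F n in sequentially. real n / (b n)\<^sup>2 \<le> C'" and "filterlim b at_top sequentially"
proof -
 define t where "t = tmom 2 X 1"
 have "0 < t" unfolding t_def by (rule tmom_pos[OF X nz]) simp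
 define C' where "C' = \<bar>C\<bar> / t + 1"
 have "0 < C'" using \<open>0 < t\<close> by (simp add: C'_def add_nonneg_pos)
 have ev: "\<forall>\<^sub>F n in sequentially. real n * min 1 (1 / (b n)\<^sup>2) \<le> C'" using bd
 proof eventually_elim
  case (elim n)
  have "real n * min 1 (1 / (b n)\<^sup>2) * t = real n * (min 1 (1 / (b n)\<^sup>2) * tmom 2 X 1)" by (simp add: t_def)
  also have "\<dots> \<le> real n * tmom 2 X (b n)" by (intro mult_left_mono tmom_lower_scaling X b) auto
  also have "\<dots> \<le> \<bar>C\<bar>" using elim by simp
  finally have "real n * min 1 (1 / (b n)\<^sup>2) \<le> \<bar>C\<bar> / t" using \<open>0 < t\<close> by (simp add: pos_le_divide_eq)
  then show ?case by (simp add: C'_def)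
 qed
 have big: "\<forall>\<^sub>F n in sequentially. C' < real n" using filterlim_real_sequentially unfolding filterlim_at_top_dense by blast
 have ev': "\<forall>\<^sub>F n in sequentially. real n / (b n)\<^sup>2 \<le> C'" using ev big
 proof eventually_elim
  case (elim n)
  then have "min 1 (1 / (b n)\<^sup>2) \<noteq> 1" by (metis mult_1_right not_le)
  then have "min 1 (1 / (b n)\<^sup>2) = 1 / (b n)\<^sup>2" by (metis min_def)
  then show ?case using elim(1) by (simp only: times_divide_eq_right mult_1_right)
 qed
 have "filterlim (%n. sqrt (real n / C')) at_top sequentially" using \<open>0 < C'\<close> by real_asymp
 moreover have "\<forall>\<^sub>F n in sequentially. sqrt (real n / C') \<le> b n" using ev'
 proof eventually_elim
  case (elim n)
  have "real n \<le> C' * (b n)\<^sup>2" using elim b[of n] by (simp add: pos_divide_le_eq)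
  then have "real n / C' \<le> (b n)\<^sup>2" using \<open>0 < C'\<close> by (simp add: pos_divide_le_eq mult.commute)
  then show ?case using b[of n] by (intro real_le_lsqrt) auto
 qed
 ultimately have "filterlim b at_top sequentially" by (rule filterlim_at_top_mono)
 with \<open>0 < C'\<close> ev' show ?thesis by (rule that)
qed

lemma scale_power_tendsto_0:
 assumes "\<forall>\<^sub>F n in sequentially. real n / (b n)\<^sup>2 \<le> C" "filterlim b at_top sequentially"
 shows "(%n. real n * (K / b n) ^ 4) \<longlonglongrightarrow> 0"
proof -
 have "((%n. K / b n) \<longlongrightarrow> 0) sequentially" by (rule tendsto_divide_0[OF tendsto_const filterlim_at_top_imp_at_infinity[OF assms(2)]])
 then have "(%n. \<bar>C\<bar> * K\<^sup>2 * (K / b n)\<^sup>2) \<longlonglongrightarrow> \<bar>C\<bar> * K\<^sup>2 * 0\<^sup>2" by (intro tendsto_intros)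
 then have lim: "(%n. \<bar>C\<bar> * K\<^sup>2 * (K / b n)\<^sup>2) \<longlonglongrightarrow> 0" by simp
 show ?thesis
 proof (rule tendsto_sandwich[OF _ _ tendsto_const lim])
  show "\<forall>\<^sub>F n in sequentially. real n * (K / b n) ^ 4 \<le> \<bar>C\<bar> * K\<^sup>2 * (K / b n)\<^sup>2" using assms(1)
  proof eventually_elim
   case (elim n)
   have "real n * (K / b n) ^ 4 = real n / (b n)\<^sup>2 * (K\<^sup>2 * (K / b n)\<^sup>2)" by (simp add: power_divide power2_eq_square eval_nat_numeral)
   also have "\<dots> \<le> \<bar>C\<bar> * (K\<^sup>2 * (K / b n)\<^sup>2)" using elim by (intro mult_right_mono) auto
   finally show ?case by (simp add: mult.assoc)
  qed
 qed (auto intro!: always_eventually mult_nonneg_nonneg)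
qed

text \<open>The additive error \<open>(K / b)^k\<close> in the upper comparison is harmless: for \<open>k = 2\<close>
  it is \<open>O(1 / n)\<close> by the growth of the scale, and for \<open>k = 4\<close> it is \<open>o(1 /
  n)\<close>.\<close>
lemma normal_scale_transfer:
 fixes X Z :: "'a \<Rightarrow> real"
 assumes Z: "normal_scale Z b" and rv: "random_variable borel X" "random_variable borel Z"
  and upper: "\<And>k b. k \<in> {2, 4} \<Longrightarrow> 0 < b \<Longrightarrow> tmom k X b \<le> (K / b) ^ k + A * tmom k Z b"
  and lower: "\<And>n. tmom 2 Z (b n) \<le> B * tmom 2 X (b n)" and "0 \<le> A" "0 < B"
 shows "normal_scale X b"
proof -
 have b: "\<And>n. 0 < b n" using Z by (simp add: normal_scale_def)
 obtain c C where "0 < c" and c: "\<forall>\<^sub>F n in sequentially. c \<le> real n * tmom 2 Z (b n)"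
  and C: "\<forall>\<^sub>F n in sequentially. real n * tmom 2 Z (b n) \<le> C"
  and z4: "(%n. real n * tmom 4 Z (b n)) \<longlonglongrightarrow> 0" using Z by (auto simp: normal_scale_def)
 have nz: "\<not> (AE om in M. Z om = 0)"
 proof
  assume AE: "AE om in M. Z om = 0"
  have "tmom 2 Z (b n) = expectation (%_. 0)" for n unfolding tmom_def using AE rv(2) by (intro integral_cong_AE) (auto elim: eventually_mono)
  then have "\<forall>\<^sub>F n :: nat in sequentially. c \<le> 0" using c by simp
  then show False using \<open>0 < c\<close> by simp
 qed
 obtain C' where C': "\<forall>\<^sub>F n in sequentially. real n / (b n)\<^sup>2 \<le> C'" and b_inf: "filterlim b at_top sequentially"
  using scale_growth[OF rv(2) nz b C] by metis
 show ?thesis unfolding normal_scale_def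
 proof (intro conjI allI b)
  have "\<forall>\<^sub>F n in sequentially. c / B \<le> real n * tmom 2 X (b n)" using c
  proof eventually_elim
   case (elim n)
   have "c \<le> B * (real n * tmom 2 X (b n))" using elim mult_left_mono[OF lower[of n], of "real n"] by (simp add: mult_ac)
   then show ?case using \<open>0 < B\<close> by (simp add: pos_divide_le_eq mult.commute)
  qed
  then show "\<exists>c>0. \<forall>\<^sub>F n in sequentially. c \<le> real n * tmom 2 X (b n)" using \<open>0 < c\<close> \<open>0 < B\<close> by (intro exI[of _ "c / B"]) auto
  have "\<forall>\<^sub>F n in sequentially. real n * tmom 2 X (b n) \<le> C' * K\<^sup>2 + A * C" using C C'
  proof eventually_elim
   case (elim n)
   have "real n * tmom 2 X (b n) \<le> real n * ((K / b n)\<^sup>2 + A * tmom 2 Z (b n))" using upper[of 2 "b n"] b[of n] by (intro mult_left_mono) auto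
   also have "\<dots> = real n / (b n)\<^sup>2 * K\<^sup>2 + A * (real n * tmom 2 Z (b n))" by (simp add: power_divide algebra_simps)
   also have "\<dots> \<le> C' * K\<^sup>2 + A * C" using elim \<open>0 \<le> A\<close> by (intro add_mono mult_right_mono mult_left_mono) auto
   finally show ?case .
  qed
  then show "\<exists>C. \<forall>\<^sub>F n in sequentially. real n * tmom 2 X (b n) \<le> C" by blast
  have lim: "(%n. real n * (K / b n) ^ 4 + A * (real n * tmom 4 Z (b n))) \<longlonglongrightarrow> 0"
   using tendsto_add[OF scale_power_tendsto_0[OF C' b_inf] tendsto_mult[OF tendsto_const z4]] by simp
  show "(%n. real n * tmom 4 X (b n)) \<longlonglongrightarrow> 0"
  proof (rule tendsto_sandwich[OF _ _ tendsto_const lim])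
   show "\<forall>\<^sub>F n in sequentially. real n * tmom 4 X (b n) \<le> real n * (K / b n) ^ 4 + A * (real n * tmom 4 Z (b n))"
   proof (intro always_eventually allI)
    fix n
    have "real n * tmom 4 X (b n) \<le> real n * ((K / b n) ^ 4 + A * tmom 4 Z (b n))" using upper[of 4 "b n"] b[of n] by (intro mult_left_mono) auto
    then show "real n * tmom 4 X (b n) \<le> real n * (K / b n) ^ 4 + A * (real n * tmom 4 Z (b n))" by (simp add: algebra_simps)
   qed
  qed (auto intro!: always_eventually mult_nonneg_nonneg tmom_nonneg)
 qed
qed

text \<open>The characteristic function handles the difference of two copies; the comparison of a variable with its
  symmetrization then removes the second copy.\<close>
lemma DAN_imp_normal_scale:
 fixes X :: "nat \<Rightarrow> 'a \<Rightarrow> real"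
 assumes iid: "iid borel X" and DAN: "DAN X"
 obtains b where "normal_scale (X 0) b"
proof -
 note [measurable] = iid_measurable[OF iid]
 let ?D = "%om. X 0 om - X 1 om"
 obtain b where b: "\<And>n. 0 < b n"
  and lim: "\<And>t. (%n. expectation (%om. cos (t * ((X 0 om - X 1 om) / b n))) ^ n) \<longlonglongrightarrow> exp (- (t\<^sup>2))" by (rule DAN_symmetrized_char[OF iid DAN]) blast
 have D: "normal_scale ?D b" using iid_symmetrized_char[OF iid, of 0 1] by (intro normal_scale_of_char_powers b lim) auto
 obtain K where "0 < K" and K: "prob {om\<in>space M. K < \<bar>X 1 om\<bar>} < 1 / 2" using prob_abs_gt_small[of "X 1" "1 / 2"] by auto
 have size: "1 / 2 \<le> prob {om\<in>space M. 1 / 2 * \<bar>x\<bar> \<le> \<bar>x - X 1 om\<bar>}" if "2 * K \<le> \<bar>x\<bar>" for x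
 proof -
  have "1 / 2 \<le> 1 - prob {om\<in>space M. K < \<bar>X 1 om\<bar>}" using K by simp
  also have "\<dots> = prob (space M - {om\<in>space M. K < \<bar>X 1 om\<bar>})" by (subst prob_compl) auto
  also have "\<dots> \<le> prob {om\<in>space M. 1 / 2 * \<bar>x\<bar> \<le> \<bar>x - X 1 om\<bar>}"
  proof (rule finite_measure_mono, safe)
   fix om assume "\<not> K < \<bar>X 1 om\<bar>"
   then show "1 / 2 * \<bar>x\<bar> \<le> \<bar>x - X 1 om\<bar>" using that by linarith
  qed simp
  finally show ?thesis .
 qed
 have upper: "tmom k (X 0) r \<le> (2 * K / r) ^ k + (2 * 2 ^ 4) * tmom k ?D r" if "k \<in> {2, 4}" "0 < r" for k r
 proof -
  have "tmom k (X 0) r \<le> (2 * K / r) ^ k + tmom k ?D r / (1 / 2 * (1 / 2) ^ k)" using \<open>0 < K\<close> \<open>0 < r\<close> size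
   by (intro tmom_le_of_conditional_size[OF iid_independent[OF iid], where F = "%x y. x - y"]) auto
  also have "tmom k ?D r / (1 / 2 * (1 / 2) ^ k) = (2 * 2 ^ k) * tmom k ?D r" by (simp add: power_divide)
  also have "\<dots> \<le> (2 * 2 ^ 4) * tmom k ?D r" using that by (intro mult_right_mono tmom_nonneg) auto
  finally show ?thesis by simp
 qed
 have lower: "tmom 2 ?D (b n) \<le> 4 * tmom 2 (X 0) (b n)" for n
 proof -
  have pt: "min 1 (\<bar>(x - y) / r\<bar>\<^sup>2) \<le> 2 * min 1 (\<bar>x / r\<bar>\<^sup>2) + 2 * min 1 (\<bar>y / r\<bar>\<^sup>2)" for x y r :: real
  proof -
   have "((x - y) / r)\<^sup>2 \<le> 2 * (x / r)\<^sup>2 + 2 * (y / r)\<^sup>2"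
    using zero_le_power2[of "x / r + y / r"] by (simp add: diff_divide_distrib power2_sum power2_diff)
   moreover have "0 \<le> (x / r)\<^sup>2" "0 \<le> (y / r)\<^sup>2" by simp_all
   moreover have "min 1 c \<le> 2 * min 1 a + 2 * min 1 b" if "c \<le> 2 * a + 2 * b" "0 \<le> a" "0 \<le> b" for a b c :: real using that by (auto simp: min_def)
   ultimately show ?thesis unfolding power2_abs by blast
  qed
  have "tmom 2 ?D (b n) \<le> expectation (%om. 2 * min 1 (\<bar>X 0 om / b n\<bar>\<^sup>2) + 2 * min 1 (\<bar>X 1 om / b n\<bar>\<^sup>2))" unfolding tmom_def
   by (intro integral_mono tmom_integrable L_integrable_add integrable_mult_right pt) auto
  also have "\<dots> = 2 * tmom 2 (X 0) (b n) + 2 * tmom 2 (X 1) (b n)" unfolding tmom_def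
   by (subst L_integral_add; (intro integrable_mult_right tmom_integrable)?; simp)
  also have "tmom 2 (X 1) (b n) = tmom 2 (X 0) (b n)" unfolding tmom_def by (rule iid_expectation[OF iid, of "%x. min 1 (\<bar>x / b n\<bar>\<^sup>2)"]) simp
  finally show ?thesis by simp
 qed
 have "normal_scale (X 0) b" by (rule normal_scale_transfer[OF D, where K = "2 * K" and A = "2 * 2 ^ 4" and B = 4]) (use upper lower in auto)
 then show ?thesis by (rule that)
qed

end

section \<open>Truncation and the domain of attraction\<close>

context prob_space
begin

text \<open>Fatou's lemma in the form needed to pick a truncation level with a large truncated moment.\<close>
lemma integrable_of_bounded_truncations:
 fixes Z X :: "'a \<Rightarrow> real"
 assumes [measurable]: "random_variable borel Z" "random_variable borel X" and nn: "\<And>om. 0 \<le> Z om"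
  and int: "\<And>k::nat. integrable M (%om. Z om * indicator {..real k} \<bar>X om\<bar>)"
  and bd: "\<And>k::nat. expectation (%om. Z om * indicator {..real k} \<bar>X om\<bar>) \<le> B"
 shows "integrable M Z"
proof -
 let ?f = "%k om. Z om * indicator {..real k} \<bar>X om\<bar>"
 have mono: "mono (%k. ?f k om)" for om using nn[of om] by (intro monoI) (auto simp: indicator_def)
 have "incseq (%k. expectation (?f k))" by (intro incseq_SucI integral_mono int) (rule monoD[OF mono], simp)
 then obtain L where L: "(%k. expectation (?f k)) \<longlonglongrightarrow> L" using incseq_convergent[of "%k. expectation (?f k)" B] bd by blast
 show ?thesis
 proof (rule integrable_monotone_convergence[OF int _ _ L])
  show "AE om in M. (%k. ?f k om) \<longlonglongrightarrow> Z om"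
  proof (intro AE_I2 tendsto_eventually)
   fix om
   obtain k0 where "\<bar>X om\<bar> \<le> real k0" using real_arch_simple by blast
   show "\<forall>\<^sub>F k in sequentially. ?f k om = Z om" using eventually_ge_at_top[of k0]
   proof eventually_elim
    case (elim k)
    then have "\<bar>X om\<bar> \<le> real k" using \<open>\<bar>X om\<bar> \<le> real k0\<close> by linarith
    then show ?case by simp
   qed
  qed
 qed (use mono in auto)
qed

lemma iid_prob:
 assumes iid: "iid N W" and [measurable]: "Measurable.pred N P"
 shows "prob {om\<in>space M. P (W i om)} = prob {om\<in>space M. P (W 0 om)}"
proof -
 note [measurable] = iid_measurable[OF iid]
 have "prob {om\<in>space M. P (W i om)} = measure (distr M N (W i)) {w\<in>space N. P w}" for i using measurable_space[OF iid_measurable[OF iid, of i]]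
  by (subst measure_distr) (auto intro!: arg_cong[where f = prob])
 then show ?thesis using iid_distr[OF iid, of i] by simp
qed

lemma iid_exceedance_tendsto_0:
 fixes f :: "'b \<Rightarrow> real"
 assumes iid: "iid N W" and [measurable]: "f \<in> borel_measurable N" and b: "\<And>n. 0 < b n"
  and lim: "(%n. real n * tmom k (%om. f (W 0 om)) (b n)) \<longlonglongrightarrow> 0"
 shows "(%n. prob (\<Union>i\<in>{1..n}. {om\<in>space M. b n < \<bar>f (W i om)\<bar>})) \<longlonglongrightarrow> 0"
proof (rule tendsto_sandwich[OF _ _ tendsto_const lim])
 note [measurable] = iid_measurable[OF iid]
 show "\<forall>\<^sub>F n in sequentially. prob (\<Union>i\<in>{1..n}. {om\<in>space M. b n < \<bar>f (W i om)\<bar>}) \<le> real n * tmom k (%om. f (W 0 om)) (b n)"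
 proof (intro always_eventually allI)
  fix n
  have "prob (\<Union>i\<in>{1..n}. {om\<in>space M. b n < \<bar>f (W i om)\<bar>}) \<le> (\<Sum>i\<in>{1..n}. prob {om\<in>space M. b n < \<bar>f (W i om)\<bar>})"
   by (intro finite_measure_subadditive_finite) auto
  also have "\<dots> = (\<Sum>i\<in>{1..n}. prob {om\<in>space M. b n < \<bar>f (W 0 om)\<bar>})" by (intro sum.cong refl iid_prob[OF iid]) simp
  also have "\<dots> = real n * prob {om\<in>space M. b n < \<bar>f (W 0 om)\<bar>}" by simp
  also have "\<dots> \<le> real n * tmom k (%om. f (W 0 om)) (b n)" by (intro mult_left_mono prob_le_tmom b) auto
  finally show "prob (\<Union>i\<in>{1..n}. {om\<in>space M. b n < \<bar>f (W i om)\<bar>}) \<le> real n * tmom k (%om. f (W 0 om)) (b n)" .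
 qed
qed auto

lemma square_expectation_le:
 fixes Z :: "'a \<Rightarrow> real"
 assumes [measurable]: "random_variable borel Z" and "integrable M (%om. (Z om)\<^sup>2)"
 shows "(expectation Z)\<^sup>2 \<le> expectation (%om. (Z om)\<^sup>2)"
proof -
 have "integrable M Z" using square_integrable_imp_integrable assms by blast
 then show ?thesis using variance_positive[of Z] variance_eq[of Z] assms by simp
qed

lemma truncated_integrable:
 fixes X :: "'a \<Rightarrow> real"
 assumes [measurable]: "random_variable borel X"
 shows "integrable M (%om. X om ^ k * indicator {..b} \<bar>X om\<bar>)"
proof (rule integrable_const_bound[where B = "\<bar>b\<bar> ^ k"])
 show "AE om in M. norm (X om ^ k * indicator {..b} \<bar>X om\<bar>) \<le> \<bar>b\<bar> ^ k" by (intro AE_I2) (auto simp: indicator_def power_abs intro!: power_mono)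
qed simp

text \<open>Beyond \<open>b\<close> both minima equal one, so the difference of the truncated moments only sees
  \<open>|X| \<le> b\<close>.\<close>
lemma truncated_square_ge:
 fixes X :: "'a \<Rightarrow> real"
 assumes [measurable]: "random_variable borel X" and "0 < b"
 shows "b\<^sup>2 * (tmom 2 X b - tmom 4 X b) \<le> expectation (%om. X om ^ 2 * indicator {..b} \<bar>X om\<bar>)"
proof -
 have "b\<^sup>2 * (tmom 2 X b - tmom 4 X b) = expectation (%om. b\<^sup>2 * (min 1 (\<bar>X om / b\<bar> ^ 2) - min 1 (\<bar>X om / b\<bar> ^ 4)))" unfolding tmom_def
  by (simp only: integral_mult_right_zero
    L_integral_diff[OF tmom_integrable[OF assms(1)] tmom_integrable[OF assms(1)]])
 also have "\<dots> \<le> expectation (%om. X om ^ 2 * indicator {..b} \<bar>X om\<bar>)"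
 proof (rule integral_mono)
  show "integrable M (%om. b\<^sup>2 * (min 1 (\<bar>X om / b\<bar> ^ 2) - min 1 (\<bar>X om / b\<bar> ^ 4)))"
   by (intro integrable_mult_right L_integrable_diff tmom_integrable assms)
  show "integrable M (%om. X om ^ 2 * indicator {..b} \<bar>X om\<bar>)" by (rule truncated_integrable[OF assms(1)])
  fix om
  show "b\<^sup>2 * (min 1 (\<bar>X om / b\<bar> ^ 2) - min 1 (\<bar>X om / b\<bar> ^ 4)) \<le> X om ^ 2 * indicator {..b} \<bar>X om\<bar>"
  proof (cases "\<bar>X om\<bar> \<le> b")
   case True
   have "b\<^sup>2 * (min 1 (\<bar>X om / b\<bar> ^ 2) - min 1 (\<bar>X om / b\<bar> ^ 4)) \<le> b\<^sup>2 * (\<bar>X om / b\<bar> ^ 2)"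
   proof (rule mult_left_mono)
    have "min 1 x - min 1 y \<le> x" if "0 \<le> y" for x y :: real using that by (auto simp: min_def)
    then show "min 1 (\<bar>X om / b\<bar> ^ 2) - min 1 (\<bar>X om / b\<bar> ^ 4) \<le> \<bar>X om / b\<bar> ^ 2" by simp
   qed simp
   also have "\<dots> = (X om)\<^sup>2" using \<open>0 < b\<close> by (simp add: power_divide)
   finally show ?thesis using True by simp
  next
   case False
   then have "1 \<le> \<bar>X om / b\<bar>" using \<open>0 < b\<close> by (simp add: abs_divide)
   then have "1 \<le> \<bar>X om / b\<bar> ^ 2" "1 \<le> \<bar>X om / b\<bar> ^ 4" by (intro one_le_power; assumption)+
   then have "min 1 (\<bar>X om / b\<bar> ^ 2) = 1" "min 1 (\<bar>X om / b\<bar> ^ 4) = 1" by (simp_all only: min_absorb1)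
   then show ?thesis by simp
  qed
 qed
 finally show ?thesis .
qed

lemma truncated_fourth_le:
 fixes X :: "'a \<Rightarrow> real"
 assumes X[measurable]: "random_variable borel X" and "0 < b"
 shows "expectation (%om. X om ^ 4 * indicator {..b} \<bar>X om\<bar>) \<le> b ^ 4 * tmom 4 X b"
proof -
 have "expectation (%om. X om ^ 4 * indicator {..b} \<bar>X om\<bar>) \<le> expectation (%om. b ^ 4 * min 1 (\<bar>X om / b\<bar> ^ 4))"
 proof (rule integral_mono)
  show "integrable M (%om. X om ^ 4 * indicator {..b} \<bar>X om\<bar>)" by (rule truncated_integrable[OF X])
  show "integrable M (%om. b ^ 4 * min 1 (\<bar>X om / b\<bar> ^ 4))" by (intro integrable_mult_right tmom_integrable X)
  fix om
  show "X om ^ 4 * indicator {..b} \<bar>X om\<bar> \<le> b ^ 4 * min 1 (\<bar>X om / b\<bar> ^ 4)"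
  proof (cases "\<bar>X om\<bar> \<le> b")
   case True
   then have "\<bar>X om / b\<bar> ^ 4 \<le> 1" using \<open>0 < b\<close> by (intro power_le_one) (auto simp: abs_divide)
   then have "b ^ 4 * min 1 (\<bar>X om / b\<bar> ^ 4) = X om ^ 4" using \<open>0 < b\<close> by (subst min_absorb2) (auto simp: power_divide)
   then show ?thesis using True by simp
  qed (use \<open>0 < b\<close> in auto)
 qed
 then show ?thesis by (simp only: tmom_def integral_mult_right_zero)
qed

lemma normal_scale_truncated_square:
 fixes X :: "'a \<Rightarrow> real"
 assumes X[measurable]: "random_variable borel X" and "normal_scale X b"
 obtains c where "0 < c" "\<forall>\<^sub>F n in sequentially. c * (b n)\<^sup>2 \<le> real n * expectation (%om. X om ^ 2 * indicator {..b n} \<bar>X om\<bar>)"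
proof -
 have b: "\<And>n. 0 < b n" and z4: "(%n. real n * tmom 4 X (b n)) \<longlonglongrightarrow> 0" using assms(2) by (auto simp: normal_scale_def)
 obtain c where "0 < c" and c: "\<forall>\<^sub>F n in sequentially. c \<le> real n * tmom 2 X (b n)" using assms(2) by (auto simp: normal_scale_def)
 have "\<forall>\<^sub>F n in sequentially. real n * tmom 4 X (b n) < c / 2" using z4 \<open>0 < c\<close> by (intro order_tendstoD(2)) auto
 with c have "\<forall>\<^sub>F n in sequentially. c / 2 * (b n)\<^sup>2 \<le> real n * expectation (%om. X om ^ 2 * indicator {..b n} \<bar>X om\<bar>)"
 proof eventually_elim
  case (elim n)
  have "c / 2 * (b n)\<^sup>2 \<le> (real n * tmom 2 X (b n) - real n * tmom 4 X (b n)) * (b n)\<^sup>2" using elim by (intro mult_right_mono) auto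
  also have "\<dots> = real n * ((b n)\<^sup>2 * (tmom 2 X (b n) - tmom 4 X (b n)))" by (simp add: algebra_simps)
  also have "\<dots> \<le> real n * expectation (%om. X om ^ 2 * indicator {..b n} \<bar>X om\<bar>)"
   using truncated_square_ge[OF X b[of n]] by (intro mult_left_mono) auto
  finally show ?case .
 qed
 with \<open>0 < c\<close> show ?thesis by (intro that[of "c / 2"]) auto
qed

lemma normal_scale_at_top:
 fixes X :: "'a \<Rightarrow> real"
 assumes X[measurable]: "random_variable borel X" and sc: "normal_scale X b"
 obtains C where "\<forall>\<^sub>F n in sequentially. real n / (b n)\<^sup>2 \<le> C" "filterlim b at_top sequentially"
proof -
 have b: "\<And>n. 0 < b n" using sc by (auto simp: normal_scale_def)
 obtain c where "0 < c" and c: "\<forall>\<^sub>F n in sequentially. c \<le> real n * tmom 2 X (b n)" using sc by (auto simp: normal_scale_def)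
 obtain C where C: "\<forall>\<^sub>F n in sequentially. real n * tmom 2 X (b n) \<le> C" using sc by (auto simp: normal_scale_def)
 have nz: "\<not> (AE om in M. X om = 0)"
 proof
  assume AE: "AE om in M. X om = 0"
  have "tmom 2 X (b n) = expectation (%_. 0)" for n unfolding tmom_def using AE X by (intro integral_cong_AE) (auto elim: eventually_mono)
  then have "\<forall>\<^sub>F n :: nat in sequentially. c \<le> 0" using c by simp
  then show False using \<open>0 < c\<close> by simp
 qed
 show ?thesis by (rule scale_growth[OF X nz b C]) (rule that)
qed

text \<open>If \<open>X\<close> has finite variance, the truncated variances tend to the variance, which is positive.
  Otherwise the truncated second moments are unbounded whereas the truncated means stay below \<open>E
  |X|\<close>.\<close>
lemma truncated_variance_lower:
 fixes X :: "'a \<Rightarrow> real"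
 assumes int: "integrable M X" and nonconst: "\<not> (\<exists>c. AE om in M. X om = c)"
  and b: "filterlim b at_top sequentially"
 obtains c where "0 < c" "\<forall>\<^sub>F n in sequentially. c * expectation (%om. X om ^ 2 * indicator {..b n} \<bar>X om\<bar>) \<le>
   expectation (%om. X om ^ 2 * indicator {..b n} \<bar>X om\<bar>) - (expectation (%om. X om ^ 1 * indicator {..b n} \<bar>X om\<bar>))\<^sup>2"
proof -
 note [measurable] = borel_measurable_integrable[OF int]
 define s where "s n = expectation (%om. X om ^ 2 * indicator {..b n} \<bar>X om\<bar>)" for n
 define m where "m n = expectation (%om. X om ^ 1 * indicator {..b n} \<bar>X om\<bar>)" for n
 have s_nn: "0 \<le> s n" for n unfolding s_def by (intro integral_nonneg_AE AE_I2) auto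
 have "\<exists>c>0. \<forall>\<^sub>F n in sequentially. c * s n \<le> s n - (m n)\<^sup>2"
 proof (cases "integrable M (%om. (X om)\<^sup>2)")
  case True
  have trunc: "(%n. expectation (%om. Z om * indicator {..b n} \<bar>X om\<bar>)) \<longlonglongrightarrow> expectation Z" if Z: "integrable M Z" for Z :: "'a \<Rightarrow> real"
  proof -
   note [measurable] = borel_measurable_integrable[OF Z]
   have "Z om * indicator {..b n} \<bar>X om\<bar> = Z om - Z om * indicator {b n<..} \<bar>X om\<bar>" for om n by (auto simp: indicator_def)
   moreover have "integrable M (%om. Z om * indicator {b n<..} \<bar>X om\<bar>)" for n by (rule L_integrable_bound[OF Z]) (auto simp: indicator_def)
   ultimately have "expectation (%om. Z om * indicator {..b n} \<bar>X om\<bar>) = expectation Z - expectation (%om. Z om * indicator {b n<..} \<bar>X om\<bar>)" for n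
    using Z by simp
   then show ?thesis using tendsto_diff[OF tendsto_const truncated_mean_tendsto_0[OF Z b, of X], of "expectation Z"] by simp
  qed
  have s: "s \<longlonglongrightarrow> expectation (%om. (X om)\<^sup>2)" using trunc[OF True] by (simp add: s_def[abs_def])
  have m: "m \<longlonglongrightarrow> expectation X" using trunc[OF int] by (simp add: m_def[abs_def])
  have v: "(%n. s n - (m n)\<^sup>2) \<longlonglongrightarrow> variance X" unfolding variance_eq[OF int True] by (intro tendsto_intros s m)
  have var_pos: "0 < variance X"
  proof (rule ccontr)
   assume "\<not> 0 < variance X"
   then have "variance X = 0" using variance_positive[of X] by linarith
   moreover have "integrable M (%om. (X om - expectation X)\<^sup>2)" using int True by (simp add: power2_diff)
   ultimately have "AE om in M. (X om - expectation X)\<^sup>2 = 0" by (subst (asm) integral_nonneg_eq_0_iff_AE) auto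
   then have "AE om in M. X om = expectation X" by eventually_elim simp
   then show False using nonconst by blast
  qed
  define E2 where "E2 = expectation (%om. (X om)\<^sup>2) + 1"
  have E2: "0 < E2" unfolding E2_def by (intro add_nonneg_pos) auto
  have "\<forall>\<^sub>F n in sequentially. s n < E2" using s by (rule order_tendstoD) (simp add: E2_def)
  moreover have "\<forall>\<^sub>F n in sequentially. variance X / 2 < s n - (m n)\<^sup>2" using v var_pos by (intro order_tendstoD(1)) auto
  ultimately have "\<forall>\<^sub>F n in sequentially. variance X / 2 / E2 * s n \<le> s n - (m n)\<^sup>2"
  proof eventually_elim
   case (elim n)
   have "variance X / 2 / E2 * s n \<le> variance X / 2 / E2 * E2" using elim E2 var_pos by (intro mult_left_mono) auto
   also have "\<dots> = variance X / 2" using E2 by simp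
   finally show ?case using elim by linarith
  qed
  moreover have "0 < variance X / 2 / E2" using var_pos E2 by simp
  ultimately show ?thesis by blast
 next
  case False
  define B where "B = 2 * (expectation (%om. \<bar>X om\<bar>))\<^sup>2"
  have "\<exists>k::nat. B < expectation (%om. (X om)\<^sup>2 * indicator {..real k} \<bar>X om\<bar>)"
  proof (rule ccontr)
   assume "\<not> ?thesis"
   then have "integrable M (%om. (X om)\<^sup>2)" by (rule_tac integrable_of_bounded_truncations[where X = X and B = B])
      (auto simp: not_less intro: truncated_integrable)
   then show False using False by simp
  qed
  then obtain k :: nat where k: "B < expectation (%om. (X om)\<^sup>2 * indicator {..real k} \<bar>X om\<bar>)" by blast
  have "\<forall>\<^sub>F n in sequentially. real k \<le> b n" using b unfolding filterlim_at_top by blast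
  then have "\<forall>\<^sub>F n in sequentially. 1 / 2 * s n \<le> s n - (m n)\<^sup>2"
  proof eventually_elim
   case (elim n)
   have "expectation (%om. (X om)\<^sup>2 * indicator {..real k} \<bar>X om\<bar>) \<le> s n"
    unfolding s_def using elim by (intro integral_mono truncated_integrable[where X = X]) (auto simp: indicator_def)
   then have "B \<le> s n" using k by simp
   moreover have "\<bar>m n\<bar> \<le> expectation (%om. \<bar>X om\<bar>)"
   proof -
    have "\<bar>m n\<bar> \<le> expectation (%om. \<bar>X om ^ 1 * indicator {..b n} \<bar>X om\<bar>\<bar>)" unfolding m_def by (rule integral_abs_bound)
    also have "\<dots> \<le> expectation (%om. \<bar>X om\<bar>)"
     using int by (intro integral_mono integrable_abs truncated_integrable[where X = X]) (auto simp: indicator_def)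
    finally show ?thesis .
   qed
   then have "\<bar>m n\<bar>\<^sup>2 \<le> (expectation (%om. \<bar>X om\<bar>))\<^sup>2" by (intro power_mono) auto
   ultimately show ?case by (simp add: B_def)
  qed
  then show ?thesis by (intro exI[of _ "1 / 2"]) auto
 qed
 then obtain c where "0 < c" "\<forall>\<^sub>F n in sequentially. c * s n \<le> s n - (m n)\<^sup>2" by blast
 then show ?thesis by (intro that[of c]) (simp_all only: s_def m_def)
qed

text \<open>Truncate at \<open>b n\<close> and centre. The fourth moment of the truncated variable is at most of
  order \<open>b^4 tmom 4\<close>, hence Lyapunov's, and therefore Lindeberg's condition holds after
  division by the standard deviation of the truncated sum, which is of order \<open>b n\<close>. The
  truncation is invisible with probability tending to one.\<close>
lemma normal_scale_imp_DAN:
 fixes X :: "nat \<Rightarrow> 'a \<Rightarrow> real"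
 assumes iid: "iid borel X" and int: "integrable M (X 0)" and nonconst: "\<not> (\<exists>c. AE om in M. X 0 om = c)"
  and sc: "normal_scale (X 0) b"
 shows "DAN X"
proof -
 note [measurable] = iid_measurable[OF iid]
 have b: "\<And>n. 0 < b n" and z4: "(%n. real n * tmom 4 (X 0) (b n)) \<longlonglongrightarrow> 0" using sc by (auto simp: normal_scale_def)
 have b_inf: "filterlim b at_top sequentially" by (rule normal_scale_at_top[OF iid_measurable[OF iid] sc]) blast
 define Y where "Y n x = x * indicator {..b n} \<bar>x\<bar>" for n and x :: real
 have [measurable]: "Y n \<in> borel_measurable borel" for n unfolding Y_def[abs_def] by measurable
 have Y_pow: "Y n x ^ k = x ^ k * indicator {..b n} \<bar>x\<bar>" if "k > 0" for n x k using that by (auto simp: Y_def indicator_def)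
 have Y_le: "\<bar>Y n x\<bar> \<le> b n" for n x using b[of n] by (auto simp: Y_def indicator_def)
 have intY: "integrable M (%om. Y n (X 0 om) ^ k)" if "k > 0" for n k unfolding Y_pow[OF that] by (rule truncated_integrable) simp
 define m where "m n = expectation (%om. Y n (X 0 om))" for n
 define s where "s n = expectation (%om. (Y n (X 0 om))\<^sup>2)" for n
 define v where "v n = s n - (m n)\<^sup>2" for n
 have s_eq: "s n = expectation (%om. X 0 om ^ 2 * indicator {..b n} \<bar>X 0 om\<bar>)" for n by (simp add: s_def Y_pow)
 have m_eq: "m n = expectation (%om. X 0 om ^ 1 * indicator {..b n} \<bar>X 0 om\<bar>)" for n by (simp add: m_def Y_def)
 obtain c1 where "0 < c1" and c1: "\<forall>\<^sub>F n in sequentially. c1 * (b n)\<^sup>2 \<le> real n * s n"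
  unfolding s_eq by (rule normal_scale_truncated_square[OF iid_measurable[OF iid] sc]) blast
 obtain c2 where "0 < c2" and c2: "\<forall>\<^sub>F n in sequentially. c2 * s n \<le> v n"
  unfolding v_def s_eq m_eq by (rule truncated_variance_lower[OF int nonconst b_inf]) blast
 have v_ge: "\<forall>\<^sub>F n in sequentially. c1 * c2 * (b n)\<^sup>2 \<le> real n * v n" using c1 c2
 proof eventually_elim
  case (elim n)
  have "c2 * (c1 * (b n)\<^sup>2) \<le> c2 * (real n * s n)" using elim \<open>0 < c2\<close> by (intro mult_left_mono) auto
  also have "\<dots> = real n * (c2 * s n)" by simp
  also have "\<dots> \<le> real n * v n" using elim by (intro mult_left_mono) auto
  finally show ?case by (simp add: mult_ac)
 qed
 have int1: "integrable M (%om. Y n (X 0 om))" for n using intY[of 1 n] by simp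
 have v_eq: "expectation (%om. (Y n (X 0 om) - m n)\<^sup>2) = v n" for n using variance_eq[OF int1 intY[of 2 n]] by (simp add: v_def s_def m_def)
 have v_nn: "0 \<le> v n" for n unfolding v_eq[symmetric] by simp
 define g where "g n x = (Y n x - m n) / sqrt (real n * v n)" for n x
 have [measurable]: "g n \<in> borel_measurable borel" for n unfolding g_def[abs_def] by measurable
 have int_m: "integrable M (%om. (Y n (X 0 om) - m n) ^ k)" for n k
 proof (rule integrable_const_bound[where B = "(b n + \<bar>m n\<bar>) ^ k"])
  have "\<bar>Y n x - m n\<bar> \<le> b n + \<bar>m n\<bar>" for x using Y_le[of n x] by linarith
  from power_mono[OF this abs_ge_zero]
  show "AE om in M. norm ((Y n (X 0 om) - m n) ^ k) \<le> (b n + \<bar>m n\<bar>) ^ k" by (intro AE_I2) (simp only: real_norm_def power_abs)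
 qed simp
 have fourth: "expectation (%om. (Y n (X 0 om) - m n) ^ 4) \<le> 16 * ((b n) ^ 4 * tmom 4 (X 0) (b n))" for n
 proof -
  have "(m n)\<^sup>2 \<le> s n" unfolding m_def s_def using intY[of 2 n] by (intro square_expectation_le) auto
  then have "((m n)\<^sup>2)\<^sup>2 \<le> (s n)\<^sup>2" by (intro power_mono) auto
  also have "(s n)\<^sup>2 \<le> expectation (%om. ((Y n (X 0 om))\<^sup>2)\<^sup>2)"
   unfolding s_def using intY[of 4 n] by (intro square_expectation_le) (auto simp flip: power_mult)
  finally have m4: "(m n) ^ 4 \<le> expectation (%om. Y n (X 0 om) ^ 4)" by (simp flip: power_mult)
  have pt: "(x - y) ^ 4 \<le> 8 * x ^ 4 + 8 * y ^ 4" for x y :: real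
  proof -
   have "(x - y)\<^sup>2 \<le> 2 * x\<^sup>2 + 2 * y\<^sup>2" using zero_le_power2[of "x + y"] by (simp add: power2_sum power2_diff)
   then have "((x - y)\<^sup>2)\<^sup>2 \<le> (2 * x\<^sup>2 + 2 * y\<^sup>2)\<^sup>2" by (intro power_mono) auto
   also have "\<dots> \<le> 8 * (x\<^sup>2)\<^sup>2 + 8 * (y\<^sup>2)\<^sup>2" using zero_le_power2[of "x\<^sup>2 - y\<^sup>2"] by (simp add: power2_sum power2_diff power_mult_distrib)
   finally show ?thesis by (simp flip: power_mult)
  qed
  have "expectation (%om. (Y n (X 0 om) - m n) ^ 4) \<le> expectation (%om. 8 * Y n (X 0 om) ^ 4 + 8 * m n ^ 4)"
   using intY[of 4 n] by (intro integral_mono int_m pt) auto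
  also have "\<dots> = 8 * expectation (%om. Y n (X 0 om) ^ 4) + 8 * m n ^ 4" using intY[of 4 n] by (simp add: prob_space)
  also have "\<dots> \<le> 16 * expectation (%om. Y n (X 0 om) ^ 4)" using m4 by simp
  also have "expectation (%om. Y n (X 0 om) ^ 4) \<le> (b n) ^ 4 * tmom 4 (X 0) (b n)"
   using truncated_fourth_le[of "X 0" "b n"] b[of n] by (simp add: Y_pow)
  finally show ?thesis by simp
 qed
 have clt: "conv_std_normal (%n om. \<Sum>i=1..n. g n (X i om))"
 proof (rule iid_row_clt[OF iid])
  show "integrable M (%om. (g n (X 0 om))\<^sup>2)" for n using int_m[of n 2] by (simp add: g_def power_divide)
  show "expectation (%om. g n (X 0 om)) = 0" for n using int1[of n] by (simp add: g_def prob_space m_def)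
  show "\<forall>\<^sub>F n in sequentially. real n * expectation (%om. (g n (X 0 om))\<^sup>2) = 1" using v_ge
  proof eventually_elim
   case (elim n)
   have "0 < c1 * c2 * (b n)\<^sup>2" using \<open>0 < c1\<close> \<open>0 < c2\<close> b[of n] by simp
   then have pos: "0 < real n * v n" using elim by linarith
   have "expectation (%om. (g n (X 0 om))\<^sup>2) = v n / (real n * v n)" using v_nn[of n] by (simp add: g_def power_divide v_eq)
   then show ?case using pos by (simp add: zero_less_mult_iff)
  qed
  fix \<epsilon> :: real assume "0 < \<epsilon>"
  define A where "A = 16 / (\<epsilon>\<^sup>2 * (c1 * c2)\<^sup>2)"
  have lim: "(%n. A * (real n * tmom 4 (X 0) (b n))) \<longlonglongrightarrow> 0" using tendsto_mult[OF tendsto_const z4, of A] by simp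
  show "(%n. real n * expectation (%om. (g n (X 0 om))\<^sup>2 * indicator {\<epsilon><..} \<bar>g n (X 0 om)\<bar>)) \<longlonglongrightarrow> 0"
  proof (rule tendsto_sandwich[OF _ _ tendsto_const lim])
   show "\<forall>\<^sub>F n in sequentially. real n * expectation (%om. (g n (X 0 om))\<^sup>2 * indicator {\<epsilon><..} \<bar>g n (X 0 om)\<bar>)
     \<le> A * (real n * tmom 4 (X 0) (b n))" using v_ge
   proof eventually_elim
    case (elim n)
    have pos0: "0 < c1 * c2 * (b n)\<^sup>2" using \<open>0 < c1\<close> \<open>0 < c2\<close> b[of n] by simp
    have pt: "y\<^sup>2 * indicator {\<epsilon><..} \<bar>y\<bar> \<le> y ^ 4 / \<epsilon>\<^sup>2" for y :: real
    proof (cases "\<epsilon> < \<bar>y\<bar>")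
     case True
     then have "\<epsilon>\<^sup>2 \<le> \<bar>y\<bar>\<^sup>2" using \<open>0 < \<epsilon>\<close> by (intro power_mono) auto
     then have "y\<^sup>2 * \<epsilon>\<^sup>2 \<le> y\<^sup>2 * y\<^sup>2" by (intro mult_left_mono) auto
     then have "y\<^sup>2 \<le> y ^ 4 / \<epsilon>\<^sup>2" using \<open>0 < \<epsilon>\<close> by (simp add: pos_le_divide_eq eval_nat_numeral mult_ac)
     then show ?thesis using True by simp
    qed (use \<open>0 < \<epsilon>\<close> in auto)
    have int_g: "integrable M (%om. g n (X 0 om) ^ k)" for k using int_m[of n k] by (simp add: g_def power_divide)
    have "expectation (%om. (g n (X 0 om))\<^sup>2 * indicator {\<epsilon><..} \<bar>g n (X 0 om)\<bar>) \<le> expectation (%om. g n (X 0 om) ^ 4 / \<epsilon>\<^sup>2)"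
     by (intro integral_mono pt integrable_divide_zero int_g L_integrable_bound[OF int_g[of 2]])
       (auto simp: indicator_def)
    also have "\<dots> = expectation (%om. (Y n (X 0 om) - m n) ^ 4) / ((real n * v n)\<^sup>2 * \<epsilon>\<^sup>2)"
    proof -
     have "sqrt (real n * v n) ^ 4 = (real n * v n)\<^sup>2" using v_nn[of n] by (simp add: power4_eq_xxxx power2_eq_square)
     then have "g n x ^ 4 / \<epsilon>\<^sup>2 = (Y n x - m n) ^ 4 / ((real n * v n)\<^sup>2 * \<epsilon>\<^sup>2)" for x by (simp only: g_def power_divide divide_divide_eq_left)
     then show ?thesis by (simp only: integral_divide_zero)
    qed
    also have "\<dots> \<le> 16 * ((b n) ^ 4 * tmom 4 (X 0) (b n)) / ((c1 * c2 * (b n)\<^sup>2)\<^sup>2 * \<epsilon>\<^sup>2)"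
    proof (rule frac_le[OF _ fourth])
     show "0 \<le> 16 * ((b n) ^ 4 * tmom 4 (X 0) (b n))" using tmom_nonneg[of 4 "X 0" "b n"] by simp
     show "0 < (c1 * c2 * (b n)\<^sup>2)\<^sup>2 * \<epsilon>\<^sup>2" by (rule mult_pos_pos[OF zero_less_power[OF pos0] zero_less_power[OF \<open>0 < \<epsilon>\<close>]])
     show "(c1 * c2 * (b n)\<^sup>2)\<^sup>2 * \<epsilon>\<^sup>2 \<le> (real n * v n)\<^sup>2 * \<epsilon>\<^sup>2" using elim pos0 by (intro mult_right_mono power_mono) simp_all
    qed
    also have "\<dots> = A * tmom 4 (X 0) (b n)"
    proof -
     have e: "(c1 * c2 * (b n)\<^sup>2)\<^sup>2 * \<epsilon>\<^sup>2 = b n ^ 4 * (\<epsilon>\<^sup>2 * (c1 * c2)\<^sup>2)" by (simp add: power_mult_distrib mult_ac flip: power_mult)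
     have "b n \<noteq> 0" using b[of n] by simp
     then show ?thesis unfolding A_def e by simp
    qed
    finally have "real n * expectation (%om. (g n (X 0 om))\<^sup>2 * indicator {\<epsilon><..} \<bar>g n (X 0 om)\<bar>) \<le> real n * (A * tmom 4 (X 0) (b n))"
     by (intro mult_left_mono) auto
    then show ?case by (simp add: mult_ac)
   qed
  qed (auto intro!: always_eventually mult_nonneg_nonneg)
 qed simp
 define B where "B n = (if 0 < real n * v n then sqrt (real n * v n) else 1)" for n
 have "conv_std_normal (%n om. ((\<Sum>i=1..n. X i om) - real n * m n) * inverse (B n))"
 proof (rule conv_std_normal_slutsky[OF clt])
  show "vanishes (%n om. ((\<Sum>i=1..n. X i om) - real n * m n) * inverse (B n) - (\<Sum>i=1..n. g n (X i om)))"
  proof (rule vanishes_cong_event[OF vanishes_zero])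
   show "(%n. prob (\<Union>i\<in>{1..n}. {om\<in>space M. b n < \<bar>X i om\<bar>})) \<longlonglongrightarrow> 0"
    by (rule iid_exceedance_tendsto_0[OF iid, where f = "%x. x" and k = 4]) (use b z4 in auto)
   show "\<forall>\<^sub>F n in sequentially. \<forall>om\<in>space M. om \<notin> (\<Union>i\<in>{1..n}. {om\<in>space M. b n < \<bar>X i om\<bar>}) \<longrightarrow>
     ((\<Sum>i=1..n. X i om) - real n * m n) * inverse (B n) - (\<Sum>i=1..n. g n (X i om)) = 0" using v_ge
   proof eventually_elim
    case (elim n)
    have "0 < c1 * c2 * (b n)\<^sup>2" using \<open>0 < c1\<close> \<open>0 < c2\<close> b[of n] by simp
    then have pos: "0 < real n * v n" using elim by linarith
    show ?case
    proof (intro ballI impI)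
     fix om assume "om \<in> space M" "om \<notin> (\<Union>i\<in>{1..n}. {om\<in>space M. b n < \<bar>X i om\<bar>})"
     then have "Y n (X i om) = X i om" if "i \<in> {1..n}" for i using that by (auto simp: Y_def indicator_def not_less)
     then have "(\<Sum>i=1..n. g n (X i om)) = (\<Sum>i=1..n. (X i om - m n) / sqrt (real n * v n))" by (intro sum.cong) (auto simp: g_def)
     also have "\<dots> = ((\<Sum>i=1..n. X i om) - real n * m n) / sqrt (real n * v n)" by (simp add: sum_subtractf flip: sum_divide_distrib)
     finally show "((\<Sum>i=1..n. X i om) - real n * m n) * inverse (B n) - (\<Sum>i=1..n. g n (X i om)) = 0"
      using pos by (simp add: B_def divide_inverse)
    qed
   qed
  qed auto
 qed simp
 moreover have "0 < B n" for n by (simp add: B_def)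
 ultimately show ?thesis unfolding DAN_def by (intro exI[of _ "%n. real n * m n"] exI[of _ B] conjI allI)
qed

end

section \<open>Products with independent noise\<close>

locale product_noise = prob_space M for M :: "'a measure" +
 fixes \<xi> \<eta> \<zeta> :: "nat \<Rightarrow> 'a \<Rightarrow> real"
 assumes iid_W: "iid (borel \<Otimes>\<^sub>M (borel \<Otimes>\<^sub>M borel)) (%i om. (\<xi> i om, \<eta> i om, \<zeta> i om))"
  and indep_\<xi>: "indep_rv borel (\<xi> 0) (borel \<Otimes>\<^sub>M borel) (%om. (\<eta> 0 om, \<zeta> 0 om))"
  and \<xi>_int: "integrable M (\<xi> 0)" and \<xi>_nonconst: "\<not> (\<exists>c. AE om in M. \<xi> 0 om = c)"
  and \<eta>_mean: "expectation (\<eta> 0) = 0" and \<eta>_int4: "integrable M (%om. \<eta> 0 om ^ 4)"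
  and \<eta>_nonzero: "\<not> (AE om in M. \<eta> 0 om = 0)"
  and \<zeta>_mean: "expectation (\<zeta> 0) = 0" and \<zeta>_int2: "integrable M (%om. (\<zeta> 0 om)\<^sup>2)"
begin

definition u :: "nat \<Rightarrow> 'a \<Rightarrow> real" where
 "u i om = \<xi> i om * \<eta> i om + \<zeta> i om"

lemma rv[measurable]: "random_variable borel (\<xi> i)" "random_variable borel (\<eta> i)" "random_variable borel (\<zeta> i)"
proof -
 note [measurable] = iid_measurable[OF iid_W, of i]
 have "(%om. fst (\<xi> i om, \<eta> i om, \<zeta> i om)) \<in> borel_measurable M" by measurable
 moreover have "(%om. fst (snd (\<xi> i om, \<eta> i om, \<zeta> i om))) \<in> borel_measurable M" by measurable
 moreover have "(%om. snd (snd (\<xi> i om, \<eta> i om, \<zeta> i om))) \<in> borel_measurable M" by measurable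
 ultimately show "random_variable borel (\<xi> i)" "random_variable borel (\<eta> i)" "random_variable borel (\<zeta> i)" by simp_all
qed

lemma u_measurable[measurable]: "random_variable borel (u i)" unfolding u_def[abs_def] by measurable

lemma iid_\<xi>: "iid borel \<xi>" using iid_compose[OF iid_W, of fst borel] by simp

lemma iid_u: "iid borel u" using iid_compose[OF iid_W, of "%w. fst w * fst (snd w) + snd (snd w)" borel] by (simp add: u_def[abs_def])

lemma \<eta>_int2: "integrable M (%om. (\<eta> 0 om)\<^sup>2)" using square_integrable_imp_integrable[of "%om. (\<eta> 0 om)\<^sup>2"] \<eta>_int4 by (simp flip: power_mult)

lemma \<eta>_int: "integrable M (\<eta> 0)" by (rule square_integrable_imp_integrable[OF rv(2) \<eta>_int2])

lemma \<zeta>_int: "integrable M (\<zeta> 0)" by (rule square_integrable_imp_integrable[OF rv(3) \<zeta>_int2])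

lemma \<xi>_times:
 assumes [measurable]: "f \<in> borel_measurable borel" "g \<in> borel_measurable (borel \<Otimes>\<^sub>M borel)"
  and "integrable M (%om. f (\<xi> 0 om))" "integrable M (%om. g (\<eta> 0 om, \<zeta> 0 om))"
 shows "integrable M (%om. f (\<xi> 0 om) * g (\<eta> 0 om, \<zeta> 0 om) :: real)"
  and "expectation (%om. f (\<xi> 0 om) * g (\<eta> 0 om, \<zeta> 0 om)) = expectation (%om. f (\<xi> 0 om)) * expectation (%om. g (\<eta> 0 om, \<zeta> 0 om))"
proof -
 have "indep_rv borel (%om. f (\<xi> 0 om)) borel (%om. g (\<eta> 0 om, \<zeta> 0 om))" by (rule indep_rv_compose[OF indep_\<xi>]) auto
 then have "indep_var borel (%om. f (\<xi> 0 om)) borel (%om. g (\<eta> 0 om, \<zeta> 0 om))" by (simp add: indep_rv_iff_distr indep_var_distribution_eq)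
 from indep_var_integrable[OF this assms(3,4)] indep_var_lebesgue_integral[OF this assms(3,4)]
 show "integrable M (%om. f (\<xi> 0 om) * g (\<eta> 0 om, \<zeta> 0 om) :: real)"
  "expectation (%om. f (\<xi> 0 om) * g (\<eta> 0 om, \<zeta> 0 om)) = expectation (%om. f (\<xi> 0 om)) * expectation (%om. g (\<eta> 0 om, \<zeta> 0 om))" by auto
qed

lemma u_int: "integrable M (u 0)" and u_mean: "expectation (u 0) = 0"
proof -
 have 1: "integrable M (%om. \<xi> 0 om * \<eta> 0 om)" "expectation (%om. \<xi> 0 om * \<eta> 0 om) = 0" using \<xi>_times[of "%x. x" fst] \<xi>_int \<eta>_int \<eta>_mean by auto
 show "integrable M (u 0)" "expectation (u 0) = 0" unfolding u_def[abs_def] using 1 \<zeta>_int \<zeta>_mean by auto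
qed

text \<open>Truncation by \<open>\<xi>\<close> commutes with integrating out the centred noise, so no recentring is
  ever needed.\<close>
lemma u_truncated_mean: "expectation (%om. u 0 om * indicator {..r} \<bar>\<xi> 0 om\<bar>) = 0"
proof -
 have 1: "integrable M (%om. (\<xi> 0 om * indicator {..r} \<bar>\<xi> 0 om\<bar>) * \<eta> 0 om)"
  "expectation (%om. (\<xi> 0 om * indicator {..r} \<bar>\<xi> 0 om\<bar>) * \<eta> 0 om) = 0"
  using \<xi>_times[of "%x. x * indicator {..r} \<bar>x\<bar>" fst] truncated_integrable[of "\<xi> 0" 1 r] \<eta>_int \<eta>_mean by auto
 have 2: "integrable M (%om. indicator {..r} \<bar>\<xi> 0 om\<bar> * \<zeta> 0 om)"
  "expectation (%om. indicator {..r} \<bar>\<xi> 0 om\<bar> * \<zeta> 0 om) = 0"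
  using \<xi>_times[of "%x. indicator {..r} \<bar>x\<bar>" snd] truncated_integrable[of "\<xi> 0" 0 r] \<zeta>_int \<zeta>_mean by auto
 have "u 0 om * indicator {..r} \<bar>\<xi> 0 om\<bar> = (\<xi> 0 om * indicator {..r} \<bar>\<xi> 0 om\<bar>) * \<eta> 0 om + indicator {..r} \<bar>\<xi> 0 om\<bar> * \<zeta> 0 om" for om
  by (simp add: u_def algebra_simps)
 then show ?thesis using 1 2 by simp
qed

lemma u_truncated_square:
 "integrable M (%om. (u 0 om)\<^sup>2 * indicator {..r} \<bar>\<xi> 0 om\<bar>)"
 "expectation (%om. (u 0 om)\<^sup>2 * indicator {..r} \<bar>\<xi> 0 om\<bar>) \<le>
   2 * expectation (%om. (\<eta> 0 om)\<^sup>2) * expectation (%om. \<xi> 0 om ^ 2 * indicator {..r} \<bar>\<xi> 0 om\<bar>) + 2 * expectation (%om. (\<zeta> 0 om)\<^sup>2)"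
proof -
 have 1: "integrable M (%om. (\<xi> 0 om ^ 2 * indicator {..r} \<bar>\<xi> 0 om\<bar>) * (\<eta> 0 om)\<^sup>2)"
  "expectation (%om. (\<xi> 0 om ^ 2 * indicator {..r} \<bar>\<xi> 0 om\<bar>) * (\<eta> 0 om)\<^sup>2) =
   expectation (%om. \<xi> 0 om ^ 2 * indicator {..r} \<bar>\<xi> 0 om\<bar>) * expectation (%om. (\<eta> 0 om)\<^sup>2)"
  using \<xi>_times[of "%x. x ^ 2 * indicator {..r} \<bar>x\<bar>" "%p. (fst p)\<^sup>2"] truncated_integrable[of "\<xi> 0" 2 r] \<eta>_int2 by auto
 have pt: "(u 0 om)\<^sup>2 * indicator {..r} \<bar>\<xi> 0 om\<bar> \<le> 2 * ((\<xi> 0 om ^ 2 * indicator {..r} \<bar>\<xi> 0 om\<bar>) * (\<eta> 0 om)\<^sup>2) + 2 * (\<zeta> 0 om)\<^sup>2" for om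
 proof -
  have "(u 0 om)\<^sup>2 \<le> 2 * (\<xi> 0 om * \<eta> 0 om)\<^sup>2 + 2 * (\<zeta> 0 om)\<^sup>2"
   using zero_le_power2[of "\<xi> 0 om * \<eta> 0 om - \<zeta> 0 om"] unfolding u_def power2_sum power2_diff by linarith
  then show ?thesis by (auto simp: indicator_def power_mult_distrib)
 qed
 have int2: "integrable M (%om. 2 * ((\<xi> 0 om ^ 2 * indicator {..r} \<bar>\<xi> 0 om\<bar>) * (\<eta> 0 om)\<^sup>2) + 2 * (\<zeta> 0 om)\<^sup>2)"
  by (intro L_integrable_add integrable_mult_right 1 \<zeta>_int2)
 show int1: "integrable M (%om. (u 0 om)\<^sup>2 * indicator {..r} \<bar>\<xi> 0 om\<bar>)"
 proof (rule L_integrable_bound[OF int2])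
  show "AE om in M. norm ((u 0 om)\<^sup>2 * indicator {..r} \<bar>\<xi> 0 om\<bar>) \<le> norm (2 * ((\<xi> 0 om ^ 2 * indicator {..r} \<bar>\<xi> 0 om\<bar>) * (\<eta> 0 om)\<^sup>2) + 2 * (\<zeta> 0 om)\<^sup>2)"
  proof (rule AE_I2)
   fix om
   have "0 \<le> (u 0 om)\<^sup>2 * indicator {..r} \<bar>\<xi> 0 om\<bar>" by simp
   then show "norm ((u 0 om)\<^sup>2 * indicator {..r} \<bar>\<xi> 0 om\<bar>) \<le> norm (2 * ((\<xi> 0 om ^ 2 * indicator {..r} \<bar>\<xi> 0 om\<bar>) * (\<eta> 0 om)\<^sup>2) + 2 * (\<zeta> 0 om)\<^sup>2)"
    using pt[of om] unfolding real_norm_def by linarith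
  qed
 qed simp
 have "expectation (%om. (u 0 om)\<^sup>2 * indicator {..r} \<bar>\<xi> 0 om\<bar>) \<le>
   expectation (%om. 2 * ((\<xi> 0 om ^ 2 * indicator {..r} \<bar>\<xi> 0 om\<bar>) * (\<eta> 0 om)\<^sup>2) + 2 * (\<zeta> 0 om)\<^sup>2)" by (intro integral_mono int1 int2 pt)
 also have "\<dots> = 2 * (expectation (%om. \<xi> 0 om ^ 2 * indicator {..r} \<bar>\<xi> 0 om\<bar>) * expectation (%om. (\<eta> 0 om)\<^sup>2)) + 2 * expectation (%om. (\<zeta> 0 om)\<^sup>2)"
  by (simp only: L_integral_add[OF integrable_mult_right[OF 1(1)] integrable_mult_right[OF \<zeta>_int2]]
    integral_mult_right_zero 1(2))
 finally show "expectation (%om. (u 0 om)\<^sup>2 * indicator {..r} \<bar>\<xi> 0 om\<bar>) \<le>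
   2 * expectation (%om. (\<eta> 0 om)\<^sup>2) * expectation (%om. \<xi> 0 om ^ 2 * indicator {..r} \<bar>\<xi> 0 om\<bar>) + 2 * expectation (%om. (\<zeta> 0 om)\<^sup>2)"
  by (simp add: mult_ac)
qed

text \<open>If \<open>\<eta>\<close> is not zero, \<open>|\<eta>|\<close> exceeds some positive level with positive
  probability, while \<open>\<zeta>\<close> is negligible against a large \<open>x\<close>.\<close>
lemma conditional_size:
 obtains \<kappa> p K where "0 < \<kappa>" "\<kappa> \<le> 1" "0 < p" "0 < K"
  "\<And>x. K \<le> \<bar>x\<bar> \<Longrightarrow> p \<le> prob {om\<in>space M. \<kappa> * \<bar>x\<bar> \<le> \<bar>x * \<eta> 0 om + \<zeta> 0 om\<bar>}"
proof -
 have "\<exists>k::nat. prob {om\<in>space M. 1 / real (Suc k) < \<bar>\<eta> 0 om\<bar>} \<noteq> 0"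
 proof (rule ccontr)
  assume "\<not> ?thesis"
  then have "AE om in M. \<not> 1 / real (Suc k) < \<bar>\<eta> 0 om\<bar>" for k :: nat by (subst AE_iff_measurable[OF _ refl]) (auto simp: emeasure_eq_measure)
  then have "AE om in M. \<forall>k::nat. \<not> 1 / real (Suc k) < \<bar>\<eta> 0 om\<bar>" by (subst AE_all_countable) auto
  then have "AE om in M. \<eta> 0 om = 0"
  proof eventually_elim
   case (elim om)
   show ?case
   proof (rule ccontr)
    assume "\<eta> 0 om \<noteq> 0"
    then obtain k :: nat where "inverse (real (Suc k)) < \<bar>\<eta> 0 om\<bar>" using reals_Archimedean[of "\<bar>\<eta> 0 om\<bar>"] by auto
    then show False using elim by (simp add: inverse_eq_divide)
   qed
  qed
  then show False using \<eta>_nonzero by simp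
 qed
 then obtain k :: nat where k: "prob {om\<in>space M. 1 / real (Suc k) < \<bar>\<eta> 0 om\<bar>} \<noteq> 0" by blast
 define \<kappa> where "\<kappa> = 1 / real (Suc k) / 2"
 define p where "p = prob {om\<in>space M. 2 * \<kappa> < \<bar>\<eta> 0 om\<bar>} / 2"
 have \<kappa>: "0 < \<kappa>" "\<kappa> \<le> 1" by (auto simp: \<kappa>_def field_simps)
 have "2 * \<kappa> = 1 / real (Suc k)" by (simp add: \<kappa>_def del: of_nat_Suc)
 then have "0 < p" using k unfolding p_def by (simp add: zero_less_measure_iff)
 obtain L where "0 < L" and L: "prob {om\<in>space M. L < \<bar>\<zeta> 0 om\<bar>} < p" using prob_abs_gt_small[of "\<zeta> 0" p] \<open>0 < p\<close> by auto
 have "p \<le> prob {om\<in>space M. \<kappa> * \<bar>x\<bar> \<le> \<bar>x * \<eta> 0 om + \<zeta> 0 om\<bar>}" if "L / \<kappa> \<le> \<bar>x\<bar>" for x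
 proof -
  let ?A = "{om\<in>space M. 2 * \<kappa> < \<bar>\<eta> 0 om\<bar>}" and ?B = "{om\<in>space M. L < \<bar>\<zeta> 0 om\<bar>}" and ?C = "{om\<in>space M. \<kappa> * \<bar>x\<bar> \<le> \<bar>x * \<eta> 0 om + \<zeta> 0 om\<bar>}"
  have L\<kappa>: "L \<le> \<kappa> * \<bar>x\<bar>" using that \<kappa> by (simp add: pos_divide_le_eq mult.commute)
  have "?A \<subseteq> ?B \<union> ?C"
  proof
   fix om assume om: "om \<in> ?A"
   show "om \<in> ?B \<union> ?C"
   proof (cases "L < \<bar>\<zeta> 0 om\<bar>")
    case False
    have "2 * (\<kappa> * \<bar>x\<bar>) \<le> \<bar>x * \<eta> 0 om\<bar>" using mult_right_mono[of "2 * \<kappa>" "\<bar>\<eta> 0 om\<bar>" "\<bar>x\<bar>"] om by (simp add: abs_mult mult_ac)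
    then have "\<kappa> * \<bar>x\<bar> \<le> \<bar>x * \<eta> 0 om + \<zeta> 0 om\<bar>" using False L\<kappa> by linarith
    then show ?thesis using om by simp
   qed (use om in simp)
  qed
  then have "prob ?A \<le> prob (?B \<union> ?C)" by (intro finite_measure_mono) auto
  also have "\<dots> \<le> prob ?B + prob ?C" by (rule measure_Un_le) auto
  finally show ?thesis using L by (simp add: p_def)
 qed
 then show ?thesis using \<kappa> \<open>0 < p\<close> \<open>0 < L\<close> by (intro that[of \<kappa> p "L / \<kappa>"]) auto
qed

text \<open>If \<open>u\<close> vanished almost surely, then by independence \<open>x \<eta> + \<zeta> = 0\<close>
  for almost every value \<open>x\<close> of \<open>\<xi>\<close>. Two different values would make
  \<open>\<eta>\<close> zero, so \<open>\<xi>\<close> would be constant.\<close>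
lemma u_nonzero: "\<not> (AE om in M. u 0 om = 0)"
proof
 assume AE: "AE om in M. u 0 om = 0"
 define q where "q x = (\<integral>\<^sup>+om. ennreal (min 1 \<bar>x * \<eta> 0 om + \<zeta> 0 om\<bar>) \<partial>M)" for x
 have "(\<integral>\<^sup>+om. ennreal (min 1 \<bar>\<xi> 0 om * \<eta> 0 om + \<zeta> 0 om\<bar>) \<partial>M) = (\<integral>\<^sup>+om. 0 \<partial>M)"
  using AE by (intro nn_integral_cong_AE) (auto simp: u_def elim: eventually_mono)
 moreover have "(\<integral>\<^sup>+om. ennreal (min 1 \<bar>\<xi> 0 om * \<eta> 0 om + \<zeta> 0 om\<bar>) \<partial>M) = (\<integral>\<^sup>+om. q (\<xi> 0 om) \<partial>M)"
  using indep_rv_nn_integral[OF indep_\<xi>, of "%x p. ennreal (min 1 \<bar>x * fst p + snd p\<bar>)"] by (simp add: q_def)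
 moreover have [measurable]: "q \<in> borel_measurable borel" unfolding q_def[abs_def] by measurable
 ultimately have "(\<integral>\<^sup>+om. q (\<xi> 0 om) \<partial>M) = 0" and [measurable]: "(%om. q (\<xi> 0 om)) \<in> borel_measurable M" by simp_all
 then have AEq: "AE om in M. q (\<xi> 0 om) = 0" by (subst (asm) nn_integral_0_iff_AE) auto
 have zero: "AE om in M. x * \<eta> 0 om + \<zeta> 0 om = 0" if "q x = 0" for x
 proof -
  have "AE om in M. ennreal (min 1 \<bar>x * \<eta> 0 om + \<zeta> 0 om\<bar>) = 0" using that unfolding q_def by (subst (asm) nn_integral_0_iff_AE) auto
  then show ?thesis
  proof eventually_elim
   case (elim om)
   then have "min 1 \<bar>x * \<eta> 0 om + \<zeta> 0 om\<bar> \<le> 0" by (simp add: ennreal_eq_0_iff)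
   then show ?case by (auto simp: min_def split: if_splits)
  qed
 qed
 have unique: "x = y" if "q x = 0" "q y = 0" for x y
 proof (rule ccontr)
  assume "x \<noteq> y"
  have "AE om in M. \<eta> 0 om = 0" using zero[OF that(1)] zero[OF that(2)]
  proof eventually_elim
   case (elim om)
   have "(x - y) * \<eta> 0 om = (x * \<eta> 0 om + \<zeta> 0 om) - (y * \<eta> 0 om + \<zeta> 0 om)" by (simp add: algebra_simps)
   then have "(x - y) * \<eta> 0 om = 0" using elim by simp
   then show ?case using \<open>x \<noteq> y\<close> by simp
  qed
  then show False using \<eta>_nonzero by simp
 qed
 have "\<exists>om. q (\<xi> 0 om) = 0" using eventually_happens'[OF _ AEq] by (auto simp: ae_filter_eq_bot_iff emeasure_space_1)
 then obtain c where "q c = 0" by blast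
 have "AE om in M. \<xi> 0 om = c" using AEq by eventually_elim (rule unique[OF _ \<open>q c = 0\<close>])
 then show False using \<xi>_nonconst by blast
qed

lemma \<xi>_nonzero: "\<not> (AE om in M. \<xi> 0 om = 0)" using \<xi>_nonconst by blast

lemma tmom_\<xi>_le_u:
 obtains K A where "0 < K" "0 < A" "\<And>k b. k \<in> {2, 4} \<Longrightarrow> 0 < b \<Longrightarrow> tmom k (\<xi> 0) b \<le> (K / b) ^ k + A * tmom k (u 0) b"
proof -
 obtain \<kappa> p K where *: "0 < \<kappa>" "\<kappa> \<le> 1" "0 < p" "0 < K"
  "\<And>x. K \<le> \<bar>x\<bar> \<Longrightarrow> p \<le> prob {om\<in>space M. \<kappa> * \<bar>x\<bar> \<le> \<bar>x * \<eta> 0 om + \<zeta> 0 om\<bar>}" by (rule conditional_size) blast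
 have "tmom k (\<xi> 0) b \<le> (K / b) ^ k + 1 / (p * \<kappa> ^ 4) * tmom k (u 0) b" if "k \<in> {2, 4}" "0 < b" for k b
 proof -
  have "tmom k (\<xi> 0) b \<le> (K / b) ^ k + tmom k (%om. \<xi> 0 om * \<eta> 0 om + \<zeta> 0 om) b / (p * \<kappa> ^ k)"
   using tmom_le_of_conditional_size[OF indep_\<xi>, of "%x y. x * fst y + snd y" K p \<kappa> b k] * that by simp
  also have "tmom k (%om. \<xi> 0 om * \<eta> 0 om + \<zeta> 0 om) b / (p * \<kappa> ^ k) \<le> tmom k (u 0) b / (p * \<kappa> ^ 4)" unfolding u_def[abs_def]
   using * that by (intro divide_left_mono mult_left_mono power_decreasing tmom_nonneg) auto
  finally show ?thesis by simp
 qed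
 then show ?thesis using * by (intro that[of K "1 / (p * \<kappa> ^ 4)"]) auto
qed

text \<open>The noise \<open>\<zeta>\<close> contributes \<open>O(1 / b\<^sup>2)\<close>, and this is dominated by
  the truncated moment of any nonzero variable once \<open>b \<ge> 1\<close>.\<close>
lemma tmom_u_le_\<xi>:
 obtains B where "0 < B" "\<And>b. 1 \<le> b \<Longrightarrow> tmom 2 (u 0) b \<le> B * tmom 2 (\<xi> 0) b"
proof -
 define t where "t = tmom 2 (\<xi> 0) 1"
 have "0 < t" unfolding t_def by (rule tmom_pos[OF rv(1) \<xi>_nonzero]) simp
 define B where "B = 2 * (1 + expectation (%om. (\<eta> 0 om)\<^sup>2)) + 2 * expectation (%om. (\<zeta> 0 om)\<^sup>2) / t"
 have "0 < B" using \<open>0 < t\<close> by (auto simp: B_def intro!: add_pos_nonneg)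
 have "tmom 2 (u 0) b \<le> B * tmom 2 (\<xi> 0) b" if "1 \<le> b" for b
 proof -
  have pt: "min 1 (\<bar>u 0 om / b\<bar>\<^sup>2) \<le> 2 * (min 1 (\<bar>\<xi> 0 om / b\<bar>\<^sup>2) * (1 + (\<eta> 0 om)\<^sup>2)) + 2 * (1 / b\<^sup>2 * (\<zeta> 0 om)\<^sup>2)" for om
  proof (cases "\<bar>\<xi> 0 om / b\<bar>\<^sup>2 \<le> 1")
   case True
   have "(u 0 om)\<^sup>2 \<le> 2 * (\<xi> 0 om * \<eta> 0 om)\<^sup>2 + 2 * (\<zeta> 0 om)\<^sup>2"
    using zero_le_power2[of "\<xi> 0 om * \<eta> 0 om - \<zeta> 0 om"] unfolding u_def power2_sum power2_diff by linarith
   then have "(u 0 om)\<^sup>2 / b\<^sup>2 \<le> (2 * (\<xi> 0 om * \<eta> 0 om)\<^sup>2 + 2 * (\<zeta> 0 om)\<^sup>2) / b\<^sup>2" by (rule divide_right_mono) simp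
   also have "\<dots> = 2 * (\<bar>\<xi> 0 om / b\<bar>\<^sup>2 * (\<eta> 0 om)\<^sup>2) + 2 * (1 / b\<^sup>2 * (\<zeta> 0 om)\<^sup>2)" by (simp add: power_divide power_mult_distrib add_divide_distrib)
   also have "\<dots> \<le> 2 * (\<bar>\<xi> 0 om / b\<bar>\<^sup>2 * (1 + (\<eta> 0 om)\<^sup>2)) + 2 * (1 / b\<^sup>2 * (\<zeta> 0 om)\<^sup>2)" by (intro add_right_mono mult_left_mono) auto
   finally show ?thesis using True by (intro min.coboundedI2) (simp add: min_absorb2 power_divide)
  next
   case False
   have "1 * 1 \<le> 2 * (1 + (\<eta> 0 om)\<^sup>2)" by (intro mult_mono) auto
   moreover have "0 \<le> 2 * (1 / b\<^sup>2 * (\<zeta> 0 om)\<^sup>2)" by simp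
   ultimately have "1 \<le> 2 * (1 * (1 + (\<eta> 0 om)\<^sup>2)) + 2 * (1 / b\<^sup>2 * (\<zeta> 0 om)\<^sup>2)" by linarith
   then show ?thesis using False by (intro min.coboundedI1) (simp only: min_absorb1 not_le less_imp_le)
  qed
  have 1: "integrable M (%om. min 1 (\<bar>\<xi> 0 om / b\<bar>\<^sup>2) * (1 + (\<eta> 0 om)\<^sup>2))"
   "expectation (%om. min 1 (\<bar>\<xi> 0 om / b\<bar>\<^sup>2) * (1 + (\<eta> 0 om)\<^sup>2)) = tmom 2 (\<xi> 0) b * (1 + expectation (%om. (\<eta> 0 om)\<^sup>2))" unfolding tmom_def
   using \<xi>_times[of "%x. min 1 (\<bar>x / b\<bar>\<^sup>2)" "%p. 1 + (fst p)\<^sup>2"] \<eta>_int2 tmom_integrable[OF rv(1), where b = b and k = 2] by (auto simp: prob_space)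
  have "tmom 2 (u 0) b \<le> expectation (%om. 2 * (min 1 (\<bar>\<xi> 0 om / b\<bar>\<^sup>2) * (1 + (\<eta> 0 om)\<^sup>2)) + 2 * (1 / b\<^sup>2 * (\<zeta> 0 om)\<^sup>2))" unfolding tmom_def
   by (intro integral_mono pt tmom_integrable u_measurable L_integrable_add integrable_mult_right 1 \<zeta>_int2)
  also have "\<dots> = 2 * (tmom 2 (\<xi> 0) b * (1 + expectation (%om. (\<eta> 0 om)\<^sup>2))) + 2 * (1 / b\<^sup>2 * expectation (%om. (\<zeta> 0 om)\<^sup>2))"
   by (simp only: L_integral_add[OF integrable_mult_right[OF 1(1)] integrable_mult_right[OF integrable_mult_right[OF \<zeta>_int2]]]
     integral_mult_right_zero 1(2))
  also have "\<dots> \<le> 2 * (tmom 2 (\<xi> 0) b * (1 + expectation (%om. (\<eta> 0 om)\<^sup>2))) + 2 * (tmom 2 (\<xi> 0) b / t * expectation (%om. (\<zeta> 0 om)\<^sup>2))"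
  proof -
   have "min 1 (1 / b\<^sup>2) = 1 / b\<^sup>2" using that by (intro min_absorb2) (simp add: one_le_power)
   then have "1 / b\<^sup>2 * t \<le> tmom 2 (\<xi> 0) b" using tmom_lower_scaling[OF rv(1), of b 0] that by (simp only: t_def)
   then have "1 / b\<^sup>2 \<le> tmom 2 (\<xi> 0) b / t" using \<open>0 < t\<close> by (simp only: pos_le_divide_eq)
   then show ?thesis by (intro add_left_mono mult_left_mono mult_right_mono) simp_all
  qed
  finally show ?thesis by (simp add: B_def algebra_simps)
 qed
 with \<open>0 < B\<close> show ?thesis by (rule that)
qed

text \<open>The truncated second moment of \<open>\<xi>\<close> is bounded by that of \<open>u\<close> up to a
  constant, and the constant is absorbed because the latter is eventually bounded away from zero.\<close>
lemma u_truncated_square_lower: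
 assumes sc: "normal_scale (\<xi> 0) b"
 obtains c where "0 < c" "\<forall>\<^sub>F n in sequentially. c * (b n)\<^sup>2 \<le> real n * expectation (%om. (u 0 om)\<^sup>2 * indicator {..b n} \<bar>\<xi> 0 om\<bar>)"
proof -
 have b: "\<And>n. 0 < b n" using sc by (auto simp: normal_scale_def)
 have b_inf: "filterlim b at_top sequentially" by (rule normal_scale_at_top[OF rv(1) sc]) blast
 obtain \<kappa> p K where *: "0 < \<kappa>" "\<kappa> \<le> 1" "0 < p" "0 < K"
  "\<And>x. K \<le> \<bar>x\<bar> \<Longrightarrow> p \<le> prob {om\<in>space M. \<kappa> * \<bar>x\<bar> \<le> \<bar>x * \<eta> 0 om + \<zeta> 0 om\<bar>}" by (rule conditional_size) blast
 define v where "v r = expectation (%om. (u 0 om)\<^sup>2 * indicator {..r} \<bar>\<xi> 0 om\<bar>)" for r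
 define s where "s r = expectation (%om. \<xi> 0 om ^ 2 * indicator {..r} \<bar>\<xi> 0 om\<bar>)" for r
 have s_le: "s r \<le> K\<^sup>2 + v r / (p * \<kappa>\<^sup>2)" for r
 proof -
  let ?h = "%x. \<kappa>\<^sup>2 * (x ^ 2 * indicator {..r} \<bar>x\<bar>)"
  have int_h: "integrable M (%om. \<xi> 0 om ^ 2 * indicator {..r} \<bar>\<xi> 0 om\<bar> * indicator {K..} \<bar>\<xi> 0 om\<bar>)"
   by (rule L_integrable_bound[OF truncated_integrable[OF rv(1), where i1 = 0 and k = 2 and b = r]]) (auto simp: indicator_def)
  have "p * expectation (%om. ?h (\<xi> 0 om) * indicator {K..} \<bar>\<xi> 0 om\<bar>) \<le>
    expectation (%om. (%x y. (x * fst y + snd y)\<^sup>2 * indicator {..r} \<bar>x\<bar>) (\<xi> 0 om) (\<eta> 0 om, \<zeta> 0 om))"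
  proof (rule expectation_ge_of_conditional_size[OF indep_\<xi>, where F = "%x y. x * fst y + snd y"])
   show "p \<le> prob {om \<in> space M. \<kappa> * \<bar>x\<bar> \<le> \<bar>x * fst (\<eta> 0 om, \<zeta> 0 om) + snd (\<eta> 0 om, \<zeta> 0 om)\<bar>}" if "K \<le> \<bar>x\<bar>" for x using *(5)[OF that] by simp
   show "integrable M (%om. (\<xi> 0 om * fst (\<eta> 0 om, \<zeta> 0 om) + snd (\<eta> 0 om, \<zeta> 0 om))\<^sup>2 * indicator {..r} \<bar>\<xi> 0 om\<bar>)"
    using u_truncated_square(1)[of r] by (simp add: u_def)
   show "integrable M (%om. ?h (\<xi> 0 om) * indicator {K..} \<bar>\<xi> 0 om\<bar>)" using integrable_mult_right[OF int_h, of "\<kappa>\<^sup>2"] by (simp only: mult.assoc)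
   fix x :: real and y :: "real \<times> real" assume "\<kappa> * \<bar>x\<bar> \<le> \<bar>x * fst y + snd y\<bar>"
   then have "(\<kappa> * \<bar>x\<bar>)\<^sup>2 \<le> \<bar>x * fst y + snd y\<bar>\<^sup>2" using * by (intro power_mono) auto
   then have "\<kappa>\<^sup>2 * x\<^sup>2 \<le> (x * fst y + snd y)\<^sup>2" by (simp add: power_mult_distrib)
   then show "?h x \<le> (x * fst y + snd y)\<^sup>2 * indicator {..r} \<bar>x\<bar>" by (auto simp: indicator_def)
  qed (use * in auto)
  also have "\<dots> = v r" by (simp add: v_def u_def)
  also have "(%om. ?h (\<xi> 0 om) * indicator {K..} \<bar>\<xi> 0 om\<bar>) = (%om. \<kappa>\<^sup>2 * (\<xi> 0 om ^ 2 * indicator {..r} \<bar>\<xi> 0 om\<bar> * indicator {K..} \<bar>\<xi> 0 om\<bar>))"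
   by (simp only: mult.assoc)
  finally have main: "p * \<kappa>\<^sup>2 * expectation (%om. \<xi> 0 om ^ 2 * indicator {..r} \<bar>\<xi> 0 om\<bar> * indicator {K..} \<bar>\<xi> 0 om\<bar>) \<le> v r"
   by (simp only: integral_mult_right_zero mult.assoc)
  have "s r \<le> expectation (%om. K\<^sup>2 + \<xi> 0 om ^ 2 * indicator {..r} \<bar>\<xi> 0 om\<bar> * indicator {K..} \<bar>\<xi> 0 om\<bar>)" unfolding s_def
  proof (rule integral_mono[OF truncated_integrable[OF rv(1)]])
   show "integrable M (%om. K\<^sup>2 + \<xi> 0 om ^ 2 * indicator {..r} \<bar>\<xi> 0 om\<bar> * indicator {K..} \<bar>\<xi> 0 om\<bar>)"
    by (intro L_integrable_add integrable_const int_h)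
   fix om
   have "(\<xi> 0 om)\<^sup>2 \<le> K\<^sup>2" if "\<bar>\<xi> 0 om\<bar> < K" using power_mono[of "\<bar>\<xi> 0 om\<bar>" K 2] that by simp
   then show "\<xi> 0 om ^ 2 * indicator {..r} \<bar>\<xi> 0 om\<bar> \<le> K\<^sup>2 + \<xi> 0 om ^ 2 * indicator {..r} \<bar>\<xi> 0 om\<bar> * indicator {K..} \<bar>\<xi> 0 om\<bar>"
    by (auto simp: indicator_def)
  qed
  also have "\<dots> = K\<^sup>2 + expectation (%om. \<xi> 0 om ^ 2 * indicator {..r} \<bar>\<xi> 0 om\<bar> * indicator {K..} \<bar>\<xi> 0 om\<bar>)"
   using prob_space by (simp only: L_integral_add[OF integrable_const int_h] lebesgue_integral_const scaleR_one)
  also have "\<dots> \<le> K\<^sup>2 + v r / (p * \<kappa>\<^sup>2)" using main * by (intro add_left_mono) (simp add: pos_le_divide_eq mult_ac)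
  finally show ?thesis .
 qed
 have "\<exists>k::nat. v (real k) \<noteq> 0"
 proof (rule ccontr)
  assume "\<not> ?thesis"
  then have "AE om in M. (u 0 om)\<^sup>2 * indicator {..real k} \<bar>\<xi> 0 om\<bar> = 0" for k :: nat
   using u_truncated_square(1)[of "real k"] unfolding v_def by (subst integral_nonneg_eq_0_iff_AE[symmetric]) auto
  then have "AE om in M. \<forall>k::nat. (u 0 om)\<^sup>2 * indicator {..real k} \<bar>\<xi> 0 om\<bar> = 0" by (subst AE_all_countable) auto
  then have "AE om in M. u 0 om = 0"
  proof eventually_elim
   case (elim om)
   obtain k :: nat where "\<bar>\<xi> 0 om\<bar> \<le> real k" using real_arch_simple by blast
   then show ?case using spec[OF elim, of k] by simp
  qed
  then show False using u_nonzero by simp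
 qed
 then obtain k :: nat where "v (real k) \<noteq> 0" by blast
 moreover have "0 \<le> v (real k)" unfolding v_def by (intro integral_nonneg_AE AE_I2) auto
 ultimately have k: "0 < v (real k)" by simp
 define D where "D = K\<^sup>2 / v (real k) + 1 / (p * \<kappa>\<^sup>2)"
 have "0 < D" using k * by (auto simp: D_def intro!: add_nonneg_pos)
 obtain c where "0 < c" and c: "\<forall>\<^sub>F n in sequentially. c * (b n)\<^sup>2 \<le> real n * s (b n)"
  unfolding s_def by (rule normal_scale_truncated_square[OF rv(1) sc]) blast
 have "\<forall>\<^sub>F n in sequentially. real k \<le> b n" using b_inf unfolding filterlim_at_top by blast
 with c have "\<forall>\<^sub>F n in sequentially. c / D * (b n)\<^sup>2 \<le> real n * v (b n)"
 proof eventually_elim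
  case (elim n)
  have "v (real k) \<le> v (b n)" unfolding v_def using elim by (intro integral_mono u_truncated_square) (auto simp: indicator_def)
  then have "K\<^sup>2 * v (real k) \<le> K\<^sup>2 * v (b n)" by (intro mult_left_mono) auto
  then have "K\<^sup>2 \<le> K\<^sup>2 / v (real k) * v (b n)" using k by (simp add: pos_le_divide_eq)
  then have "s (b n) \<le> D * v (b n)" using s_le[of "b n"] by (simp add: D_def distrib_right)
  then have "real n * s (b n) \<le> real n * (D * v (b n))" by (intro mult_left_mono) auto
  then have "c * (b n)\<^sup>2 \<le> D * (real n * v (b n))" using elim by (simp add: mult_ac)
  then show ?case using \<open>0 < D\<close> by (simp add: pos_divide_le_eq mult_ac)
 qed
 moreover have "0 < c / D" using \<open>0 < c\<close> \<open>0 < D\<close> by simp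
 ultimately show ?thesis using that unfolding v_def by blast
qed

end

section \<open>The self-normalized limit theorem\<close>

context product_noise
begin

definition self_normalized_sum :: "nat \<Rightarrow> 'a \<Rightarrow> real" where
 "self_normalized_sum n om = (\<Sum>i=1..n. u i om) * (\<Sum>i=1..n. (u i om)\<^sup>2) powr (- 1 / 2)"

lemma self_normalized_sum_measurable[measurable]: "random_variable borel (self_normalized_sum n)"
 unfolding self_normalized_sum_def[abs_def] by measurable

text \<open>Truncate \<open>u\<close> where \<open>|\<xi>| \<le> b n\<close>. On \<open>\<xi> \<eta>\<close> the
  fourth moment of \<open>\<eta>\<close> yields the Lindeberg condition from \<open>n tmom 4 \<xi> (b n)
  \<longlonglongrightarrow> 0\<close>, and \<open>\<zeta>\<close> has finite variance. The row sums are
  asymptotically normal, the row sums of squares tend to one, and the common normalizing constant cancels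
  in \<open>S / V\<close>.\<close>
lemma normal_scale_imp_clt:
 assumes sc: "normal_scale (\<xi> 0) b"
 shows "conv_std_normal self_normalized_sum"
proof -
 let ?N = "borel \<Otimes>\<^sub>M (borel \<Otimes>\<^sub>M borel) :: (real \<times> real \<times> real) measure"
 let ?W = "%i om. (\<xi> i om, \<eta> i om, \<zeta> i om)"
 have b: "\<And>n. 0 < b n" and z4: "(%n. real n * tmom 4 (\<xi> 0) (b n)) \<longlonglongrightarrow> 0" using sc by (auto simp: normal_scale_def)
 have b_inf: "filterlim b at_top sequentially" by (rule normal_scale_at_top[OF rv(1) sc]) blast
 obtain C where C: "\<forall>\<^sub>F n in sequentially. real n / (b n)\<^sup>2 \<le> C" by (rule normal_scale_at_top[OF rv(1) sc]) blast
 define v where "v n = expectation (%om. (u 0 om)\<^sup>2 * indicator {..b n} \<bar>\<xi> 0 om\<bar>)" for n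
 obtain c where "0 < c" and c: "\<forall>\<^sub>F n in sequentially. c * (b n)\<^sup>2 \<le> real n * v n" unfolding v_def by (rule u_truncated_square_lower[OF sc]) blast
  \<comment> \<open>Truncation in \<open>\<xi>\<close> instead of \<open>u\<close> keeps the mean equal to zero.\<close>
 define Y where "Y n w = (fst w * fst (snd w) + snd (snd w)) * indicator {..b n} \<bar>fst w\<bar>" for n and w :: "real \<times> real \<times> real"
 define g where "g n w = Y n w / sqrt (real n * v n)" for n w
 have [measurable]: "Y n \<in> borel_measurable ?N" for n unfolding Y_def[abs_def] by measurable
 have [measurable]: "g n \<in> borel_measurable ?N" for n unfolding g_def[abs_def] by measurable
 have Y_eq: "Y n (?W i om) = u i om * indicator {..b n} \<bar>\<xi> i om\<bar>" for n i om by (simp add: Y_def u_def)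
 have Y_sq: "(Y n (?W 0 om))\<^sup>2 = (u 0 om)\<^sup>2 * indicator {..b n} \<bar>\<xi> 0 om\<bar>" for n om by (auto simp: Y_eq indicator_def)
 have v_nn: "0 \<le> v n" for n unfolding v_def by (intro integral_nonneg_AE AE_I2) auto
 have int_Y: "integrable M (%om. (Y n (?W 0 om))\<^sup>2)" for n unfolding Y_sq by (rule u_truncated_square)
 have pos: "\<forall>\<^sub>F n in sequentially. 0 < real n * v n" using c
 proof eventually_elim
  case (elim n)
  have "0 < c * (b n)\<^sup>2" using \<open>0 < c\<close> b[of n] by simp
  then show ?case using elim by linarith
 qed
 have g_sq: "integrable M (%om. (g n (?W 0 om))\<^sup>2)" for n using int_Y[of n] by (simp add: g_def power_divide)
 have g_mean: "expectation (%om. g n (?W 0 om)) = 0" for n using u_truncated_mean[of "b n"] by (simp add: g_def Y_eq)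
 have g_var: "\<forall>\<^sub>F n in sequentially. real n * expectation (%om. (g n (?W 0 om))\<^sup>2) = 1" using pos
 proof eventually_elim
  case (elim n)
  have "expectation (%om. (g n (?W 0 om))\<^sup>2) = v n / (real n * v n)" using v_nn[of n] by (simp add: g_def power_divide Y_sq v_def)
  then show ?case using elim by (simp add: zero_less_mult_iff)
 qed
 have lindeberg: "(%n. real n * expectation (%om. (g n (?W 0 om))\<^sup>2 * indicator {\<epsilon><..} \<bar>g n (?W 0 om)\<bar>)) \<longlonglongrightarrow> 0" if "0 < \<epsilon>" for \<epsilon>
 proof -
    \<comment> \<open>As \<open>c (b n)\<^sup>2 \<le> n v n\<close>, a normalized term above \<open>\<epsilon>\<close> has numerator above this level.\<close>
  define \<delta> where "\<delta> n = \<epsilon> * sqrt c * b n" for n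
  have \<delta>: "0 < \<delta> n" for n using that \<open>0 < c\<close> b by (simp add: \<delta>_def)
  define E4 where "E4 = expectation (%om. \<eta> 0 om ^ 4)"
  define Z where "Z n = expectation (%om. (\<zeta> 0 om)\<^sup>2 * indicator {\<delta> n / 2<..} \<bar>\<zeta> 0 om\<bar>)" for n
  have Z_nn: "0 \<le> Z n" for n unfolding Z_def by (intro integral_nonneg_AE AE_I2) auto
  have int_Z: "integrable M (%om. (\<zeta> 0 om)\<^sup>2 * indicator {\<delta> n / 2<..} \<bar>\<zeta> 0 om\<bar>)" for n
   by (rule L_integrable_bound[OF \<zeta>_int2]) (auto simp: indicator_def)
  have "filterlim (%n. \<delta> n / 2) at_top sequentially"
  proof -
   have "filterlim (%n. \<epsilon> * sqrt c / 2 * b n) at_top sequentially"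
    using that \<open>0 < c\<close> by (intro filterlim_tendsto_pos_mult_at_top[OF tendsto_const _ b_inf]) auto
   then show ?thesis by (simp add: \<delta>_def)
  qed
  then have Z_lim: "Z \<longlonglongrightarrow> 0" unfolding Z_def[abs_def] by (intro truncated_mean_tendsto_0 \<zeta>_int2 rv)
  have fourth: "integrable M (%om. (\<xi> 0 om ^ 4 * indicator {..b n} \<bar>\<xi> 0 om\<bar>) * \<eta> 0 om ^ 4)"
   "expectation (%om. (\<xi> 0 om ^ 4 * indicator {..b n} \<bar>\<xi> 0 om\<bar>) * \<eta> 0 om ^ 4) \<le> (b n) ^ 4 * tmom 4 (\<xi> 0) (b n) * E4" for n
  proof -
   have *: "integrable M (%om. (\<xi> 0 om ^ 4 * indicator {..b n} \<bar>\<xi> 0 om\<bar>) * \<eta> 0 om ^ 4)"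
    "expectation (%om. (\<xi> 0 om ^ 4 * indicator {..b n} \<bar>\<xi> 0 om\<bar>) * \<eta> 0 om ^ 4) =
     expectation (%om. \<xi> 0 om ^ 4 * indicator {..b n} \<bar>\<xi> 0 om\<bar>) * E4" unfolding E4_def
    using \<xi>_times[of "%x. x ^ 4 * indicator {..b n} \<bar>x\<bar>" "%p. fst p ^ 4"] truncated_integrable[OF rv(1), where i1 = 0 and k = 4 and b = "b n"] \<eta>_int4 by auto
   show "integrable M (%om. (\<xi> 0 om ^ 4 * indicator {..b n} \<bar>\<xi> 0 om\<bar>) * \<eta> 0 om ^ 4)" by (rule *)
   have "0 \<le> E4" unfolding E4_def by (intro integral_nonneg_AE AE_I2) auto
   then show "expectation (%om. (\<xi> 0 om ^ 4 * indicator {..b n} \<bar>\<xi> 0 om\<bar>) * \<eta> 0 om ^ 4) \<le> (b n) ^ 4 * tmom 4 (\<xi> 0) (b n) * E4"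
    unfolding *(2) by (intro mult_right_mono truncated_fourth_le[OF rv(1) b])
  qed
  have pt: "(Y n (?W 0 om))\<^sup>2 * indicator {\<delta> n<..} \<bar>Y n (?W 0 om)\<bar> \<le>
    16 / (\<delta> n)\<^sup>2 * ((\<xi> 0 om ^ 4 * indicator {..b n} \<bar>\<xi> 0 om\<bar>) * \<eta> 0 om ^ 4) + 4 * ((\<zeta> 0 om)\<^sup>2 * indicator {\<delta> n / 2<..} \<bar>\<zeta> 0 om\<bar>)" for n om
  proof (cases "\<delta> n < \<bar>Y n (?W 0 om)\<bar>")
   case True
   then have "\<bar>\<xi> 0 om\<bar> \<le> b n" using \<delta>[of n] by (cases "\<bar>\<xi> 0 om\<bar> \<le> b n") (simp_all add: Y_eq)
   then have Y: "Y n (?W 0 om) = u 0 om" and ind: "indicator {..b n} \<bar>\<xi> 0 om\<bar> = (1::real)" by (auto simp: Y_eq)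
   define p where "p = \<xi> 0 om * \<eta> 0 om"
   have u: "u 0 om = p + \<zeta> 0 om" by (simp add: u_def p_def)
   have p4: "(\<xi> 0 om ^ 4 * indicator {..b n} \<bar>\<xi> 0 om\<bar>) * \<eta> 0 om ^ 4 = p ^ 4" by (simp add: ind p_def power_mult_distrib)
   have lhs: "(Y n (?W 0 om))\<^sup>2 * indicator {\<delta> n<..} \<bar>Y n (?W 0 om)\<bar> = (p + \<zeta> 0 om)\<^sup>2" using True by (simp add: Y u)
   have big: "\<delta> n < \<bar>p + \<zeta> 0 om\<bar>" using True by (simp add: Y u)
   show ?thesis
   proof (cases "\<bar>\<zeta> 0 om\<bar> \<le> \<bar>p\<bar>")
    case T: True
    then have "\<bar>p + \<zeta> 0 om\<bar> \<le> 2 * \<bar>p\<bar>" by linarith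
    then have "\<bar>p + \<zeta> 0 om\<bar>\<^sup>2 \<le> (2 * \<bar>p\<bar>)\<^sup>2" by (intro power_mono) auto
    then have 1: "(p + \<zeta> 0 om)\<^sup>2 \<le> 4 * p\<^sup>2" by (simp add: power_mult_distrib)
    have "\<delta> n \<le> 2 * \<bar>p\<bar>" using big \<open>\<bar>p + \<zeta> 0 om\<bar> \<le> 2 * \<bar>p\<bar>\<close> by linarith
    then have "(\<delta> n)\<^sup>2 \<le> (2 * \<bar>p\<bar>)\<^sup>2" using \<delta>[of n] by (intro power_mono) auto
    then have "(\<delta> n)\<^sup>2 * p\<^sup>2 \<le> 4 * p\<^sup>2 * p\<^sup>2" by (intro mult_right_mono) (auto simp: power_mult_distrib)
    then have "p\<^sup>2 \<le> 4 * p ^ 4 / (\<delta> n)\<^sup>2" using \<delta>[of n] by (simp add: pos_le_divide_eq mult_ac eval_nat_numeral)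
    then have "(p + \<zeta> 0 om)\<^sup>2 \<le> 16 / (\<delta> n)\<^sup>2 * p ^ 4" using 1 by simp
    moreover have "0 \<le> 4 * ((\<zeta> 0 om)\<^sup>2 * indicator {\<delta> n / 2<..} \<bar>\<zeta> 0 om\<bar>)" by simp
    ultimately show ?thesis unfolding lhs p4 by linarith
   next
    case F: False
    then have "\<bar>p + \<zeta> 0 om\<bar> \<le> 2 * \<bar>\<zeta> 0 om\<bar>" by linarith
    then have "\<bar>p + \<zeta> 0 om\<bar>\<^sup>2 \<le> (2 * \<bar>\<zeta> 0 om\<bar>)\<^sup>2" by (intro power_mono) auto
    then have "(p + \<zeta> 0 om)\<^sup>2 \<le> 4 * (\<zeta> 0 om)\<^sup>2" by (simp add: power_mult_distrib)
    moreover have "(\<zeta> 0 om)\<^sup>2 * indicator {\<delta> n / 2<..} \<bar>\<zeta> 0 om\<bar> = (\<zeta> 0 om)\<^sup>2" using big F by simp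
    moreover have "0 \<le> 16 / (\<delta> n)\<^sup>2 * p ^ 4" by simp
    ultimately show ?thesis unfolding lhs p4 by linarith
   qed
  qed (auto intro!: add_nonneg_nonneg mult_nonneg_nonneg)
  define A where "A = 16 * E4 / (\<epsilon>\<^sup>2 * c\<^sup>2)"
  have lim: "(%n. A * (real n * tmom 4 (\<xi> 0) (b n)) + 4 * (\<bar>C\<bar> / c) * Z n) \<longlonglongrightarrow> 0"
   using tendsto_add[OF tendsto_mult[OF tendsto_const z4, of A] tendsto_mult[OF tendsto_const Z_lim, of "4 * (\<bar>C\<bar> / c)"]] by simp
  show ?thesis
  proof (rule tendsto_sandwich[OF _ _ tendsto_const lim])
   show "\<forall>\<^sub>F n in sequentially. real n * expectation (%om. (g n (?W 0 om))\<^sup>2 * indicator {\<epsilon><..} \<bar>g n (?W 0 om)\<bar>)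
     \<le> A * (real n * tmom 4 (\<xi> 0) (b n)) + 4 * (\<bar>C\<bar> / c) * Z n" using c C pos
   proof eventually_elim
    case (elim n)
    have cb: "0 < c * (b n)\<^sup>2" using \<open>0 < c\<close> b[of n] by simp
    have \<delta>_le: "\<delta> n \<le> \<epsilon> * sqrt (real n * v n)"
    proof -
     have "sqrt c * b n = sqrt (c * (b n)\<^sup>2)" using b[of n] by (simp add: real_sqrt_mult)
     also have "\<dots> \<le> sqrt (real n * v n)" using elim by (intro real_sqrt_le_mono)
     finally show ?thesis using that by (simp add: \<delta>_def mult.assoc)
    qed
    have pt2: "(g n w)\<^sup>2 * indicator {\<epsilon><..} \<bar>g n w\<bar> \<le> ((Y n w)\<^sup>2 * indicator {\<delta> n<..} \<bar>Y n w\<bar>) / (c * (b n)\<^sup>2)" for w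
    proof (cases "\<epsilon> < \<bar>g n w\<bar>")
     case True
     have "0 < sqrt (real n * v n)" using elim by simp
     then have "\<epsilon> * sqrt (real n * v n) < \<bar>Y n w\<bar>" using True by (simp add: g_def abs_divide pos_less_divide_eq)
     then have "\<delta> n < \<bar>Y n w\<bar>" using \<delta>_le by linarith
     moreover have "(g n w)\<^sup>2 = (Y n w)\<^sup>2 / (real n * v n)" using elim v_nn[of n] by (simp add: g_def power_divide)
     moreover have "(Y n w)\<^sup>2 / (real n * v n) \<le> (Y n w)\<^sup>2 / (c * (b n)\<^sup>2)"
      using elim cb by (intro divide_left_mono mult_pos_pos) (auto simp: zero_less_mult_iff)
     ultimately show ?thesis using True by simp
    qed (use cb in auto)
    have int_Y': "integrable M (%om. (Y n (?W 0 om))\<^sup>2 * indicator {\<delta> n<..} \<bar>Y n (?W 0 om)\<bar>)"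
     by (rule L_integrable_bound[OF int_Y[of n]]) (auto simp: indicator_def Y_eq)
    have int_g': "integrable M (%om. (g n (?W 0 om))\<^sup>2 * indicator {\<epsilon><..} \<bar>g n (?W 0 om)\<bar>)"
    proof (rule L_integrable_bound[OF g_sq[of n]])
     show "(%om. (g n (?W 0 om))\<^sup>2 * indicator {\<epsilon><..} \<bar>g n (?W 0 om)\<bar>) \<in> borel_measurable M" by (simp add: g_def Y_eq)
    qed (auto simp: indicator_def)
    have "expectation (%om. (g n (?W 0 om))\<^sup>2 * indicator {\<epsilon><..} \<bar>g n (?W 0 om)\<bar>)
      \<le> expectation (%om. ((Y n (?W 0 om))\<^sup>2 * indicator {\<delta> n<..} \<bar>Y n (?W 0 om)\<bar>) / (c * (b n)\<^sup>2))"
     by (intro integral_mono pt2 integrable_divide_zero int_Y' int_g')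
    also have "\<dots> = expectation (%om. (Y n (?W 0 om))\<^sup>2 * indicator {\<delta> n<..} \<bar>Y n (?W 0 om)\<bar>) / (c * (b n)\<^sup>2)" by (rule integral_divide_zero)
    also have "\<dots> \<le> (16 / (\<delta> n)\<^sup>2 * ((b n) ^ 4 * tmom 4 (\<xi> 0) (b n) * E4) + 4 * Z n) / (c * (b n)\<^sup>2)"
    proof (rule divide_right_mono)
     have "expectation (%om. (Y n (?W 0 om))\<^sup>2 * indicator {\<delta> n<..} \<bar>Y n (?W 0 om)\<bar>) \<le>
       expectation (%om. 16 / (\<delta> n)\<^sup>2 * ((\<xi> 0 om ^ 4 * indicator {..b n} \<bar>\<xi> 0 om\<bar>) * \<eta> 0 om ^ 4) + 4 * ((\<zeta> 0 om)\<^sup>2 * indicator {\<delta> n / 2<..} \<bar>\<zeta> 0 om\<bar>))"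
      by (intro integral_mono pt int_Y' L_integrable_add integrable_mult_right fourth int_Z)
     also have "\<dots> = 16 / (\<delta> n)\<^sup>2 * expectation (%om. (\<xi> 0 om ^ 4 * indicator {..b n} \<bar>\<xi> 0 om\<bar>) * \<eta> 0 om ^ 4) + 4 * Z n"
      by (simp only: L_integral_add[OF integrable_mult_right[OF fourth(1)] integrable_mult_right[OF int_Z]]
        integral_mult_right_zero Z_def)
     also have "\<dots> \<le> 16 / (\<delta> n)\<^sup>2 * ((b n) ^ 4 * tmom 4 (\<xi> 0) (b n) * E4) + 4 * Z n" by (intro add_right_mono mult_left_mono fourth(2)) auto
     finally show "expectation (%om. (Y n (?W 0 om))\<^sup>2 * indicator {\<delta> n<..} \<bar>Y n (?W 0 om)\<bar>) \<le>
       16 / (\<delta> n)\<^sup>2 * ((b n) ^ 4 * tmom 4 (\<xi> 0) (b n) * E4) + 4 * Z n" .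
    qed (use cb in simp)
    also have "\<dots> = A * tmom 4 (\<xi> 0) (b n) + 4 * (1 / (b n)\<^sup>2 / c) * Z n"
    proof -
     have d2: "(\<delta> n)\<^sup>2 = \<epsilon>\<^sup>2 * c * (b n)\<^sup>2" using \<open>0 < c\<close> by (simp add: \<delta>_def power_mult_distrib)
     have b4: "(b n) ^ 4 = (b n)\<^sup>2 * (b n)\<^sup>2" by (simp flip: power_add)
     define B where "B = (b n)\<^sup>2"
     have "B \<noteq> 0" using b[of n] by (simp add: B_def)
     then show ?thesis unfolding d2 b4 A_def B_def[symmetric] using that \<open>0 < c\<close> by (simp add: add_divide_distrib power2_eq_square mult_ac)
    qed
    finally have "real n * expectation (%om. (g n (?W 0 om))\<^sup>2 * indicator {\<epsilon><..} \<bar>g n (?W 0 om)\<bar>) \<le>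
      real n * (A * tmom 4 (\<xi> 0) (b n) + 4 * (1 / (b n)\<^sup>2 / c) * Z n)" by (intro mult_left_mono) auto
    also have "\<dots> = A * (real n * tmom 4 (\<xi> 0) (b n)) + 4 * (real n / (b n)\<^sup>2 / c) * Z n" by (simp add: distrib_left mult_ac)
    also have "\<dots> \<le> A * (real n * tmom 4 (\<xi> 0) (b n)) + 4 * (\<bar>C\<bar> / c) * Z n"
     using elim \<open>0 < c\<close> by (intro add_left_mono mult_right_mono mult_left_mono divide_right_mono Z_nn) auto
    finally show ?case .
   qed
  qed (auto intro!: always_eventually mult_nonneg_nonneg)
 qed
 have g_meas: "g n \<in> borel_measurable ?N" for n by simp
 have Zc: "conv_std_normal (%n om. \<Sum>i=1..n. g n (?W i om))" using iid_row_clt[OF iid_W g_meas g_sq g_mean g_var lindeberg] .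
 have Ql: "(%n. expectation (%om. \<bar>(\<Sum>i=1..n. (g n (?W i om))\<^sup>2) - 1\<bar>)) \<longlonglongrightarrow> 0" using iid_row_sum_squares[OF iid_W g_meas g_sq g_mean g_var lindeberg] .
 define Z where "Z n om = (\<Sum>i=1..n. g n (?W i om))" for n om
 define Q where "Q n om = (\<Sum>i=1..n. (g n (?W i om))\<^sup>2)" for n om
 have gW_meas[measurable]: "(%om. g n (?W i om)) \<in> borel_measurable M" for n i by measurable
 have Z_meas[measurable]: "random_variable borel (Z n)" and Q_meas[measurable]: "random_variable borel (Q n)" for n
  unfolding Z_def[abs_def] Q_def[abs_def] by (intro borel_measurable_sum borel_measurable_power gW_meas)+
 have Z: "conv_std_normal Z" using Zc by (simp add: Z_def[abs_def])
 have "vanishes (%n om. Q n om - 1)"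
 proof (rule vanishes_L1)
  have "integrable M (%om. (g n (?W i om))\<^sup>2)" for n i using g_sq[of n] iid_integrable[OF iid_W, of "%w. (g n w)\<^sup>2" i] by simp
  then show "integrable M (%om. Q n om - 1)" for n unfolding Q_def by auto
  show "(%n. expectation (%om. \<bar>Q n om - 1\<bar>)) \<longlonglongrightarrow> 0" using Ql by (simp add: Q_def)
 qed
 then have Qv: "vanishes (%n om. Q n om powr (- 1 / 2) - 1 powr (- 1 / 2))"
  by (rule vanishes_continuous[where f = "%q. q powr (- 1 / 2)"]) (auto intro!: continuous_intros)
 have ZQ: "conv_std_normal (%n om. Z n om * Q n om powr (- 1 / 2))"
 proof (rule conv_std_normal_slutsky[OF Z])
  have "vanishes (%n om. Z n om * (Q n om powr (- 1 / 2) - 1 powr (- 1 / 2)))" by (rule vanishes_mult_conv_std_normal[OF Z Qv]) simp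
  then show "vanishes (%n om. Z n om * Q n om powr (- 1 / 2) - Z n om)" by (simp add: right_diff_distrib)
 qed simp
 show ?thesis
 proof (rule conv_std_normal_slutsky[OF ZQ])
  show "vanishes (%n om. self_normalized_sum n om - Z n om * Q n om powr (- 1 / 2))"
  proof (rule vanishes_cong_event[OF vanishes_zero])
   show "(%n. prob (\<Union>i\<in>{1..n}. {om\<in>space M. b n < \<bar>\<xi> i om\<bar>})) \<longlonglongrightarrow> 0"
    by (rule iid_exceedance_tendsto_0[OF iid_\<xi>, where f = "%x. x" and k = 4]) (use b z4 in auto)
   show "\<forall>\<^sub>F n in sequentially. \<forall>om\<in>space M. om \<notin> (\<Union>i\<in>{1..n}. {om\<in>space M. b n < \<bar>\<xi> i om\<bar>}) \<longrightarrow>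
     self_normalized_sum n om - Z n om * Q n om powr (- 1 / 2) = 0" using pos
   proof eventually_elim
    case (elim n)
    show ?case
    proof (intro ballI impI)
     fix om assume "om \<in> space M" "om \<notin> (\<Union>i\<in>{1..n}. {om\<in>space M. b n < \<bar>\<xi> i om\<bar>})"
     then have "Y n (?W i om) = u i om" if "i \<in> {1..n}" for i using that by (auto simp: Y_eq indicator_def not_less)
     then have gu: "g n (?W i om) = u i om / sqrt (real n * v n)" if "i \<in> {1..n}" for i using that unfolding g_def by simp
     define B where "B = sqrt (real n * v n)"
     have "0 < B" using elim by (simp add: B_def)
     have Z: "Z n om = (\<Sum>i=1..n. u i om) / B" unfolding Z_def sum_divide_distrib using gu by (intro sum.cong) (auto simp: B_def)
     have Q: "Q n om = (\<Sum>i=1..n. (u i om)\<^sup>2) / B\<^sup>2"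
      unfolding Q_def sum_divide_distrib using gu by (intro sum.cong) (auto simp: B_def power_divide)
     have "B\<^sup>2 powr (- 1 / 2) = 1 / B" using \<open>0 < B\<close> by (simp add: powr_minus_divide powr_half_sqrt)
     then have "Q n om powr (- 1 / 2) = (\<Sum>i=1..n. (u i om)\<^sup>2) powr (- 1 / 2) * B"
      unfolding Q using \<open>0 < B\<close> by (subst powr_divide) (auto intro: sum_nonneg)
     then show "self_normalized_sum n om - Z n om * Q n om powr (- 1 / 2) = 0" using \<open>0 < B\<close> by (simp add: Z self_normalized_sum_def)
    qed
   qed
  qed auto
 qed simp
qed

end

section \<open>Mixed moments of self-normalized summands\<close>

lemma abs_mult_le_sum_squares: "\<bar>x * y\<bar> \<le> (x\<^sup>2 + y\<^sup>2) / (2::real)"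
proof -
 have "0 \<le> (\<bar>x\<bar> - \<bar>y\<bar>)\<^sup>2" by simp
 then show ?thesis by (simp add: power2_diff abs_mult)
qed

lemma fraction_le_one:
 fixes a q :: real
 assumes "0 \<le> a" "a \<le> q"
 shows "a / q \<le> 1"
proof (cases "q = 0")
 case False
 then have "0 < q" using assms by linarith
 then show ?thesis using assms by simp
qed simp

lemma pair_ratio_bound: "0 \<le> r \<Longrightarrow> \<bar>x * y / (r + x\<^sup>2 + y\<^sup>2)\<bar> \<le> (1::real)"
proof -
 assume "0 \<le> r"
 then have "0 \<le> r + x\<^sup>2 + y\<^sup>2" by simp
 moreover have "\<bar>x * y\<bar> \<le> r + x\<^sup>2 + y\<^sup>2"
 proof -
  have "a \<le> r + p + q" if "a \<le> (p + q) / 2" "0 \<le> p" "0 \<le> q" for a p q :: real using that \<open>0 \<le> r\<close> by simp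
  then show ?thesis using abs_mult_le_sum_squares[of x y] by simp
 qed
 ultimately show ?thesis using fraction_le_one[of "\<bar>x * y\<bar>" "r + x\<^sup>2 + y\<^sup>2"] by (simp add: abs_divide)
qed

lemma pair_ratio_first_difference:
 fixes x y r :: real
 assumes "0 < r"
 shows "\<bar>x * y / (r + x\<^sup>2 + y\<^sup>2) - x * (y / (r + y\<^sup>2))\<bar> \<le> x\<^sup>2 / r"
proof -
 have p: "0 < r + y\<^sup>2" "0 < r + x\<^sup>2 + y\<^sup>2" using assms by (auto intro!: add_pos_nonneg)
 have "x * y / (r + x\<^sup>2 + y\<^sup>2) - x * (y / (r + y\<^sup>2)) = - (x * y / (r + x\<^sup>2 + y\<^sup>2)) * (x\<^sup>2 / (r + y\<^sup>2))"
  using p by (simp add: divide_simps) (simp add: algebra_simps)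
 then have "\<bar>x * y / (r + x\<^sup>2 + y\<^sup>2) - x * (y / (r + y\<^sup>2))\<bar> = \<bar>x * y / (r + x\<^sup>2 + y\<^sup>2)\<bar> * (x\<^sup>2 / (r + y\<^sup>2))" using p by (simp add: abs_mult)
 also have "\<dots> \<le> 1 * (x\<^sup>2 / r)" using assms by (intro mult_mono pair_ratio_bound divide_left_mono) (auto intro!: add_pos_nonneg mult_pos_pos)
 finally show ?thesis by simp
qed

text \<open>As a function of \<open>x\<close> and \<open>y\<close> the ratio differs from a sum of terms linear in
  one variable by a product of two small squares.\<close>
lemma pair_ratio_second_difference:
 fixes x y r :: real
 assumes "0 < r"
 shows "\<bar>x * y / (r + x\<^sup>2 + y\<^sup>2) - (x / (r + x\<^sup>2)) * y - x * (y / (r + y\<^sup>2)) + x * (y / r)\<bar> \<le> x\<^sup>2 / r * (y\<^sup>2 / r)"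
proof -
 have p: "0 < r + y\<^sup>2" "0 < r + x\<^sup>2" "0 < r + x\<^sup>2 + y\<^sup>2" using assms by (auto intro!: add_pos_nonneg)
 define q where "q = r + x\<^sup>2 + y\<^sup>2"
 define a where "a = r + x\<^sup>2"
 define b where "b = r + y\<^sup>2"
 have "0 < q" "0 < a" "0 < b" using p by (auto simp: q_def a_def b_def)
 have x2: "x\<^sup>2 = q - b" and y2: "y\<^sup>2 = q - a" and r: "r = a + b - q" by (auto simp: q_def a_def b_def)
 have "1 / q - 1 / a - 1 / b + 1 / r = x\<^sup>2 * y\<^sup>2 * (r + q) / (r * a * b * q)"
 proof -
  have "1 / q - 1 / a - 1 / b + 1 / r = (r * a * b - r * b * q - r * a * q + a * b * q) / (r * a * b * q)"
   using \<open>0 < q\<close> \<open>0 < a\<close> \<open>0 < b\<close> assms by (simp add: divide_simps) (simp add: algebra_simps)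
  also have "r * a * b - r * b * q - r * a * q + a * b * q = x\<^sup>2 * y\<^sup>2 * (r + q)"
   unfolding q_def a_def b_def by (simp add: algebra_simps power2_eq_square)
  finally show ?thesis .
 qed
 moreover have "x * y / q - (x / a) * y - x * (y / b) + x * (y / r) = x * y * (1 / q - 1 / a - 1 / b + 1 / r)" by (simp add: algebra_simps)
 ultimately have eq: "x * y / q - (x / a) * y - x * (y / b) + x * (y / r) = (x * y) * (x\<^sup>2 * y\<^sup>2 * (r + q) / (r * a * b * q))" by simp
 have "r + q \<le> 2 * q" by (simp add: q_def)
 then have 1: "x\<^sup>2 * y\<^sup>2 * (r + q) / (r * a * b * q) \<le> x\<^sup>2 * y\<^sup>2 * (2 * q) / (r * a * b * q)"
  using \<open>0 < q\<close> \<open>0 < a\<close> \<open>0 < b\<close> assms by (intro divide_right_mono mult_left_mono) auto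
 have 2: "x\<^sup>2 * y\<^sup>2 * (2 * q) / (r * a * b * q) = x\<^sup>2 * y\<^sup>2 * 2 / (r * a * b)" using \<open>0 < q\<close> by simp
 have 3: "\<bar>x * y\<bar> * (2 * r) \<le> a * b"
 proof -
  have "2 * r * \<bar>x * y\<bar> \<le> r * (x\<^sup>2 + y\<^sup>2)" using abs_mult_le_sum_squares[of x y] assms by (simp add: mult.assoc mult_left_mono)
  also have "\<dots> \<le> a * b" using assms by (simp add: a_def b_def algebra_simps)
  finally show ?thesis by (simp add: mult_ac)
 qed
 have "\<bar>x * y / q - (x / a) * y - x * (y / b) + x * (y / r)\<bar> = \<bar>x * y\<bar> * (x\<^sup>2 * y\<^sup>2 * (r + q) / (r * a * b * q))"
  unfolding eq using \<open>0 < q\<close> \<open>0 < a\<close> \<open>0 < b\<close> assms by (simp add: abs_mult)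
 also have "\<dots> \<le> \<bar>x * y\<bar> * (x\<^sup>2 * y\<^sup>2 * 2 / (r * a * b))" using 1 unfolding 2 by (intro mult_left_mono) auto
 also have "\<dots> = (\<bar>x * y\<bar> * (2 * r)) * (x\<^sup>2 * y\<^sup>2) / (r * r * (a * b))" using assms by (simp add: field_simps)
 also have "\<dots> \<le> (a * b) * (x\<^sup>2 * y\<^sup>2) / (r * r * (a * b))" using \<open>0 < a\<close> \<open>0 < b\<close> assms by (intro divide_right_mono mult_right_mono 3) auto
 also have "\<dots> = x\<^sup>2 / r * (y\<^sup>2 / r)" using \<open>0 < a\<close> \<open>0 < b\<close> by simp
 finally show ?thesis by (simp add: q_def a_def b_def)
qed

context prob_space
begin

text \<open>The shares of all summands in the total add up to at most one and, by exchangeability, have the same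
  mean.\<close>
lemma iid_share_expectation:
 fixes X :: "nat \<Rightarrow> 'a \<Rightarrow> real"
 assumes iid: "iid borel X" and A: "finite A" "m \<notin> A"
 shows "expectation (%om. (X m om)\<^sup>2 / ((\<Sum>i\<in>A. (X i om)\<^sup>2) + (X m om)\<^sup>2)) \<le> 1 / (real (card A) + 1)"
proof -
 note [measurable] = iid_measurable[OF iid]
 let ?I = "insert m A"
 let ?share = "%j om. (X j om)\<^sup>2 / (\<Sum>i\<in>?I. (X i om)\<^sup>2)"
 have fin: "finite ?I" using A by simp
 have share_le: "\<bar>?share j om\<bar> \<le> 1" if "j \<in> ?I" for j om
 proof -
  have "(X j om)\<^sup>2 \<le> (\<Sum>i\<in>?I. (X i om)\<^sup>2)" by (rule member_le_sum[OF that _ fin]) auto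
  then have "?share j om \<le> 1" by (intro fraction_le_one) simp
  moreover have "0 \<le> ?share j om" by (intro divide_nonneg_nonneg sum_nonneg) simp_all
  ultimately show ?thesis by (simp only: abs_of_nonneg)
 qed
 have int: "integrable M (?share j)" if "j \<in> ?I" for j by (rule integrable_const_bound[where B = 1]) (use share_le[OF that] in auto)
 have same: "expectation (?share j) = expectation (?share m)" if j: "j \<in> ?I" for j
 proof -
  define f where "f = id(m := j, j := m)"
  have inj: "inj_on f ?I" by (auto simp: f_def inj_on_def)
  have img: "f ` ?I = ?I" using j by (auto simp: f_def image_iff)
  have "expectation (%om. (%x. (x m)\<^sup>2 / (\<Sum>i\<in>?I. (x i)\<^sup>2)) (\<lambda>i\<in>?I. X (f i) om)) =
    expectation (%om. (%x. (x m)\<^sup>2 / (\<Sum>i\<in>?I. (x i)\<^sup>2)) (\<lambda>i\<in>?I. X i om))" by (rule iid_expectation_reindex[OF iid fin inj]) (use fin in measurable)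
  moreover have "(\<Sum>i\<in>?I. (X (f i) om)\<^sup>2) = (\<Sum>i\<in>?I. (X i om)\<^sup>2)" for om using sum.reindex[OF inj, of "%i. (X i om)\<^sup>2"] img by simp
  moreover have "f m = j" by (simp add: f_def)
  ultimately show ?thesis by simp
 qed
 have "(\<Sum>j\<in>?I. ?share j om) \<le> 1" for om by (simp add: divide_le_eq_1 flip: sum_divide_distrib)
 then have "expectation (%om. \<Sum>j\<in>?I. ?share j om) \<le> 1" using int by (intro integral_le_const L_integrable_sum AE_I2) auto
 moreover have "expectation (%om. \<Sum>j\<in>?I. ?share j om) = (\<Sum>j\<in>?I. expectation (?share j))" using int by (rule L_integral_sum)
 moreover have "(\<Sum>j\<in>?I. expectation (?share j)) = (\<Sum>j\<in>?I. expectation (?share m))" using same by (rule sum.cong[OF refl])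
 ultimately have "real (card ?I) * expectation (?share m) \<le> 1" by simp
 then show ?thesis using A by (simp add: add.commute field_simps)
qed

end

context product_noise
begin

text \<open>The mean share of one further square in a total whose other part is \<open>r\<close>; it is the rate at
  which both the tail and the truncated second moment of \<open>u\<close> at level \<open>sqrt r\<close>
  are measured.\<close>
definition share :: "real \<Rightarrow> real" where
 "share r = expectation (%om. (u 0 om)\<^sup>2 / (r + (u 0 om)\<^sup>2))"

lemma share_integrand: "0 \<le> r \<Longrightarrow> 0 \<le> x\<^sup>2 / (r + x\<^sup>2) \<and> x\<^sup>2 / (r + x\<^sup>2) \<le> (1::real)" by (auto intro!: fraction_le_one)

lemma share_integrable: "0 \<le> r \<Longrightarrow> integrable M (%om. (u i om)\<^sup>2 / (r + (u i om)\<^sup>2))"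
 by (rule integrable_const_bound[where B = 1]) (use share_integrand in auto)

lemma share_nonneg: "0 \<le> r \<Longrightarrow> 0 \<le> share r" unfolding share_def using share_integrand by (intro integral_nonneg_AE AE_I2) auto

lemma share_antimono:
 assumes "0 \<le> r" "r \<le> s"
 shows "share s \<le> share r" unfolding share_def
proof (intro integral_mono share_integrable)
 fix om
 show "(u 0 om)\<^sup>2 / (s + (u 0 om)\<^sup>2) \<le> (u 0 om)\<^sup>2 / (r + (u 0 om)\<^sup>2)"
  using assms by (cases "u 0 om = 0") (auto intro!: divide_left_mono mult_pos_pos add_nonneg_pos)
qed (use assms in auto)

lemma share_pos: "0 \<le> r \<Longrightarrow> 0 < share r"
proof (rule ccontr)
 assume "0 \<le> r" "\<not> 0 < share r"
 then have "share r = 0" using share_nonneg[of r] by linarith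
 then have "AE om in M. (u 0 om)\<^sup>2 / (r + (u 0 om)\<^sup>2) = 0" unfolding share_def using share_integrable[OF \<open>0 \<le> r\<close>] share_integrand[OF \<open>0 \<le> r\<close>]
  by (subst (asm) integral_nonneg_eq_0_iff_AE) auto
 then have "AE om in M. u 0 om = 0"
 proof eventually_elim
  case (elim om)
  then have "r + (u 0 om)\<^sup>2 = 0 \<or> u 0 om = 0" by auto
  then show ?case using \<open>0 \<le> r\<close> by (auto simp: add_nonneg_eq_0_iff)
 qed
 then show False using u_nonzero by simp
qed

lemma truncation_le_share:
 obtains C where "0 < C" "\<And>r. 1 \<le> r \<Longrightarrow> prob {om\<in>space M. sqrt r < \<bar>\<xi> 0 om\<bar>} \<le> C * share r"
  "\<And>r. 1 \<le> r \<Longrightarrow> expectation (%om. (u 0 om)\<^sup>2 * indicator {..sqrt r} \<bar>\<xi> 0 om\<bar>) / r \<le> C * share r"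
proof -
 define tu where "tu = tmom 2 (u 0) 1"
 have "0 < tu" unfolding tu_def by (rule tmom_pos[OF u_measurable u_nonzero]) simp
 obtain K A where KA: "0 < K" "0 < A" "\<And>k b. k \<in> {2, 4} \<Longrightarrow> 0 < b \<Longrightarrow> tmom k (\<xi> 0) b \<le> (K / b) ^ k + A * tmom k (u 0) b" by (rule tmom_\<xi>_le_u) blast
 have tmom_share: "tmom 2 (u 0) (sqrt r) \<le> 2 * share r" if "1 \<le> r" for r
 proof -
  have pt: "min 1 (\<bar>x / sqrt r\<bar>\<^sup>2) \<le> 2 * (x\<^sup>2 / (r + x\<^sup>2))" for x :: real
  proof -
   have *: "\<bar>x / sqrt r\<bar>\<^sup>2 = x\<^sup>2 / r" using that by (simp add: power_divide)
   show ?thesis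
   proof (cases "x\<^sup>2 \<le> r")
    case True
    have "x\<^sup>2 / r = 2 * (x\<^sup>2 / (r + r))" using that by simp
    also have "\<dots> \<le> 2 * (x\<^sup>2 / (r + x\<^sup>2))" using True that by (intro mult_left_mono divide_left_mono) (auto intro!: mult_pos_pos add_pos_nonneg)
    finally show ?thesis unfolding * by (rule min.coboundedI2)
   next
    case False
    then have "1 \<le> 2 * (x\<^sup>2 / (r + x\<^sup>2))" using that by (simp add: field_simps add_pos_nonneg)
    then show ?thesis by (rule min.coboundedI1)
   qed
  qed
  have "tmom 2 (u 0) (sqrt r) \<le> expectation (%om. 2 * ((u 0 om)\<^sup>2 / (r + (u 0 om)\<^sup>2)))"
   unfolding tmom_def using that by (intro integral_mono pt tmom_integrable integrable_mult_right share_integrable) auto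
  then show ?thesis by (simp only: integral_mult_right_zero share_def)
 qed
 have inv: "1 / r \<le> 2 / tu * share r" if "1 \<le> r" for r
 proof -
  have "min 1 (1 / (sqrt r)\<^sup>2) * tu \<le> tmom 2 (u 0) (sqrt r)" unfolding tu_def using that by (intro tmom_lower_scaling) auto
  also have "\<dots> \<le> 2 * share r" using tmom_share[OF that] .
  also have "min 1 (1 / (sqrt r)\<^sup>2) = 1 / r" using that by (simp add: min_absorb2)
  finally show ?thesis using \<open>0 < tu\<close> by (simp add: pos_le_divide_eq field_simps)
 qed
 define C1 where "C1 = K\<^sup>2 * (2 / tu) + A * 2"
 have "0 < C1" using KA \<open>0 < tu\<close> by (auto simp: C1_def intro!: add_nonneg_pos)
 have \<xi>_share: "tmom 2 (\<xi> 0) (sqrt r) \<le> C1 * share r" if "1 \<le> r" for r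
 proof -
  have "tmom 2 (\<xi> 0) (sqrt r) \<le> (K / sqrt r)\<^sup>2 + A * tmom 2 (u 0) (sqrt r)" using KA(3)[of 2 "sqrt r"] that by simp
  also have "(K / sqrt r)\<^sup>2 = K\<^sup>2 * (1 / r)" using that by (simp add: power_divide)
  also have "K\<^sup>2 * (1 / r) + A * tmom 2 (u 0) (sqrt r) \<le> K\<^sup>2 * (2 / tu * share r) + A * (2 * share r)"
   using inv[OF that] tmom_share[OF that] KA by (intro add_mono mult_left_mono) auto
  finally show ?thesis by (simp add: C1_def algebra_simps)
 qed
 define E2 where "E2 = expectation (%om. (\<eta> 0 om)\<^sup>2)"
 define Z2 where "Z2 = expectation (%om. (\<zeta> 0 om)\<^sup>2)"
 have "0 \<le> E2" "0 \<le> Z2" unfolding E2_def Z2_def by (intro integral_nonneg_AE AE_I2; simp)+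
 define C where "C = C1 + 2 * E2 * C1 + 2 * Z2 * (2 / tu)"
 have C: "0 < C" "C1 \<le> C" "2 * E2 * C1 + 2 * Z2 * (2 / tu) \<le> C"
  using \<open>0 < C1\<close> \<open>0 \<le> E2\<close> \<open>0 \<le> Z2\<close> \<open>0 < tu\<close> by (auto simp: C_def intro!: add_pos_nonneg add_nonneg_nonneg mult_nonneg_nonneg)
 show ?thesis
 proof (rule that[OF C(1)])
  fix r :: real assume r: "1 \<le> r"
  have sh: "0 \<le> share r" using r by (intro share_nonneg) simp
  have "prob {om\<in>space M. sqrt r < \<bar>\<xi> 0 om\<bar>} \<le> tmom 2 (\<xi> 0) (sqrt r)" using r by (intro prob_le_tmom) auto
  also have "\<dots> \<le> C1 * share r" by (rule \<xi>_share[OF r])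
  also have "\<dots> \<le> C * share r" using C sh by (intro mult_right_mono)
  finally show "prob {om\<in>space M. sqrt r < \<bar>\<xi> 0 om\<bar>} \<le> C * share r" .
  have trunc: "expectation (%om. \<xi> 0 om ^ 2 * indicator {..sqrt r} \<bar>\<xi> 0 om\<bar>) \<le> r * tmom 2 (\<xi> 0) (sqrt r)"
  proof -
   have "expectation (%om. \<xi> 0 om ^ 2 * indicator {..sqrt r} \<bar>\<xi> 0 om\<bar>) \<le> expectation (%om. r * min 1 (\<bar>\<xi> 0 om / sqrt r\<bar>\<^sup>2))"
   proof (rule integral_mono[OF truncated_integrable[OF rv(1)] integrable_mult_right[OF tmom_integrable[OF rv(1)]]])
    fix om
    show "\<xi> 0 om ^ 2 * indicator {..sqrt r} \<bar>\<xi> 0 om\<bar> \<le> r * min 1 (\<bar>\<xi> 0 om / sqrt r\<bar>\<^sup>2)"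
    proof (cases "\<bar>\<xi> 0 om\<bar> \<le> sqrt r")
     case True
     then have "\<bar>\<xi> 0 om\<bar>\<^sup>2 \<le> (sqrt r)\<^sup>2" by (intro power_mono) auto
     then have "(\<xi> 0 om)\<^sup>2 \<le> r" using r by simp
     moreover have "\<bar>\<xi> 0 om / sqrt r\<bar>\<^sup>2 = (\<xi> 0 om)\<^sup>2 / r" using r by (simp add: power_divide)
     ultimately show ?thesis using r True by (simp add: min_absorb2)
    qed (use r in auto)
   qed
   then show ?thesis by (simp only: integral_mult_right_zero tmom_def)
  qed
  have "expectation (%om. (u 0 om)\<^sup>2 * indicator {..sqrt r} \<bar>\<xi> 0 om\<bar>) \<le>
    2 * E2 * expectation (%om. \<xi> 0 om ^ 2 * indicator {..sqrt r} \<bar>\<xi> 0 om\<bar>) + 2 * Z2" unfolding E2_def Z2_def by (rule u_truncated_square(2))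
  also have "\<dots> \<le> 2 * E2 * (r * (C1 * share r)) + 2 * Z2"
  proof (intro add_right_mono mult_left_mono)
   have "r * tmom 2 (\<xi> 0) (sqrt r) \<le> r * (C1 * share r)" using \<xi>_share[OF r] r by (intro mult_left_mono) auto
   then show "expectation (%om. \<xi> 0 om ^ 2 * indicator {..sqrt r} \<bar>\<xi> 0 om\<bar>) \<le> r * (C1 * share r)" using trunc by (rule order.trans[rotated])
  qed (use \<open>0 \<le> E2\<close> in simp)
  finally have "expectation (%om. (u 0 om)\<^sup>2 * indicator {..sqrt r} \<bar>\<xi> 0 om\<bar>) / r \<le> (2 * E2 * (r * (C1 * share r)) + 2 * Z2) / r"
   using r by (intro divide_right_mono) auto
  also have "\<dots> = 2 * E2 * (C1 * share r) + 2 * Z2 * (1 / r)" using r by (simp add: add_divide_distrib)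
  also have "\<dots> \<le> 2 * E2 * (C1 * share r) + 2 * Z2 * (2 / tu * share r)" using inv[OF r] \<open>0 \<le> Z2\<close> by (intro add_left_mono mult_left_mono) auto
  also have "\<dots> = (2 * E2 * C1 + 2 * Z2 * (2 / tu)) * share r" by (simp add: algebra_simps)
  also have "\<dots> \<le> C * share r" using C sh by (intro mult_right_mono)
  finally show "expectation (%om. (u 0 om)\<^sup>2 * indicator {..sqrt r} \<bar>\<xi> 0 om\<bar>) / r \<le> C * share r" .
 qed
qed

text \<open>Truncate both factors where \<open>|\<xi>| \<le> sqrt r\<close>. The truncated \<open>u\<close> still has
  mean zero, so every term linear in a truncated factor integrates to zero, and what is left is bounded by
  products of truncated second moments over \<open>r\<close> and tail probabilities. Each of these is at
  most a constant times \<open>share r\<close>. For \<open>r < 1\<close> the trivial bound suffices.\<close>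
lemma pair_ratio_expectation:
 obtains C where "0 < C" "\<And>r i j. 0 \<le> r \<Longrightarrow> i \<noteq> j \<Longrightarrow>
  \<bar>expectation (%om. u i om * u j om / (r + (u i om)\<^sup>2 + (u j om)\<^sup>2))\<bar> \<le> C * (share r)\<^sup>2"
proof -
 let ?N = "borel \<Otimes>\<^sub>M (borel \<Otimes>\<^sub>M borel) :: (real \<times> real \<times> real) measure"
 let ?W = "%i om. (\<xi> i om, \<eta> i om, \<zeta> i om)"
 obtain C where "0 < C" and tail: "\<And>r. 1 \<le> r \<Longrightarrow> prob {om\<in>space M. sqrt r < \<bar>\<xi> 0 om\<bar>} \<le> C * share r"
  and head: "\<And>r. 1 \<le> r \<Longrightarrow> expectation (%om. (u 0 om)\<^sup>2 * indicator {..sqrt r} \<bar>\<xi> 0 om\<bar>) / r \<le> C * share r" by (rule truncation_le_share) blast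
 have large: "\<bar>expectation (%om. u i om * u j om / (r + (u i om)\<^sup>2 + (u j om)\<^sup>2))\<bar> \<le> 4 * C\<^sup>2 * (share r)\<^sup>2"
  if r: "1 \<le> r" and "i \<noteq> j" for r i j
 proof -
  have r0: "0 < r" using r by simp
  define U where "U w = fst w * fst (snd w) + snd (snd w)" for w :: "real \<times> real \<times> real"
  define a where "a w = (indicator {..sqrt r} \<bar>fst w\<bar> :: real)" for w :: "real \<times> real \<times> real"
  have [measurable]: "U \<in> borel_measurable ?N" "a \<in> borel_measurable ?N" unfolding U_def[abs_def] a_def[abs_def] by measurable
  have UW: "U (?W i om) = u i om" for i om by (simp add: U_def u_def)
  have a01: "a w = 0 \<or> a w = 1" for w by (auto simp: a_def indicator_def)
  define h where "h om = u i om * u j om / (r + (u i om)\<^sup>2 + (u j om)\<^sup>2)" for om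
  let ?ai = "%om. a (?W i om)" and ?aj = "%om. a (?W j om)"
  have aW[measurable]: "(%om. a (?W i om)) \<in> borel_measurable M" for i by (rule measurable_compose[OF iid_measurable[OF iid_W]]) measurable
  have h_le: "\<bar>h om\<bar> \<le> 1" for om unfolding h_def using r0 by (intro pair_ratio_bound) simp
  have h_meas[measurable]: "h \<in> borel_measurable M" unfolding h_def[abs_def] by measurable
  have prod: "integrable M (%om. f (?W i om) * g (?W j om))"
   "expectation (%om. f (?W i om) * g (?W j om)) = expectation (%om. f (?W 0 om)) * expectation (%om. g (?W 0 om))"
   if [measurable]: "f \<in> borel_measurable ?N" "g \<in> borel_measurable ?N"
    and int: "integrable M (%om. f (?W 0 om))" "integrable M (%om. g (?W 0 om))" for f g :: "real \<times> real \<times> real \<Rightarrow> real"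
  proof -
   let ?k = "%l. if l = i then f else g"
   have m: "?k l \<in> borel_measurable ?N" for l by simp
   have I: "integrable M (%om. ?k l (?W 0 om))" for l using int by simp
   have eq: "(\<Prod>l\<in>{i, j}. ?k l (?W l om)) = f (?W i om) * g (?W j om)" for om using \<open>i \<noteq> j\<close> by simp
   show "integrable M (%om. f (?W i om) * g (?W j om))" using iid_prod_integrable[OF iid_W, of "{i, j}" ?k, OF _ m I] unfolding eq by simp
   have "expectation (%om. f (?W i om) * g (?W j om)) = (\<Prod>l\<in>{i, j}. expectation (%om. ?k l (?W 0 om)))"
    using iid_prod_expectation[OF iid_W, of "{i, j}" ?k, OF _ m I] unfolding eq by simp
   then show "expectation (%om. f (?W i om) * g (?W j om)) = expectation (%om. f (?W 0 om)) * expectation (%om. g (?W 0 om))" using \<open>i \<noteq> j\<close> by simp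
  qed
  have Ua_int: "integrable M (%om. U (?W 0 om) * a (?W 0 om))" unfolding UW by (rule L_integrable_bound[OF u_int]) (auto simp: a_def indicator_def)
  have Ua_mean: "expectation (%om. U (?W 0 om) * a (?W 0 om)) = 0" unfolding UW a_def using u_truncated_mean[of "sqrt r"] by simp
  define s where "s = expectation (%om. (U (?W 0 om))\<^sup>2 / r * a (?W 0 om))"
  define p where "p = expectation (%om. 1 - a (?W 0 om))"
  have sq_int: "integrable M (%om. (U (?W 0 om))\<^sup>2 / r * a (?W 0 om))"
   using integrable_divide_zero[OF u_truncated_square(1)[of "sqrt r"], of r] unfolding UW a_def by simp
  have q_int: "integrable M (%om. 1 - a (?W 0 om))" by (rule integrable_const_bound[where B = 1]) (auto simp: a_def indicator_def)
  have s: "0 \<le> s" "s \<le> C * share r"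
  proof -
   show "0 \<le> s" unfolding s_def using r0 a01 by (intro integral_nonneg_AE AE_I2 mult_nonneg_nonneg) (auto simp: a_def)
   have "s = expectation (%om. (u 0 om)\<^sup>2 * indicator {..sqrt r} \<bar>\<xi> 0 om\<bar> / r)" unfolding s_def UW a_def by (intro L_integral_cong refl) simp
   also have "\<dots> = expectation (%om. (u 0 om)\<^sup>2 * indicator {..sqrt r} \<bar>\<xi> 0 om\<bar>) / r" by (rule integral_divide_zero)
   finally show "s \<le> C * share r" using head[OF r] by simp
  qed
  have p: "0 \<le> p" "p \<le> C * share r"
  proof -
   show "0 \<le> p" unfolding p_def by (intro integral_nonneg_AE AE_I2) (auto simp: a_def indicator_def)
   have "p = expectation (indicator {om\<in>space M. sqrt r < \<bar>\<xi> 0 om\<bar>})"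
    unfolding p_def by (intro L_integral_cong refl) (auto simp: a_def indicator_def)
   then show "p \<le> C * share r" using tail[OF r] by simp
  qed
  have dom: "\<bar>expectation F\<bar> \<le> expectation G" if "integrable M F" "integrable M G" "\<And>om. \<bar>F om\<bar> \<le> G om" for F G :: "'a \<Rightarrow> real"
  proof -
   have "\<bar>expectation F\<bar> \<le> expectation (%om. \<bar>F om\<bar>)" by (rule integral_abs_bound)
   also have "\<dots> \<le> expectation G" by (intro integral_mono integrable_abs that)
   finally show ?thesis .
  qed
  have h_int: "integrable M (%om. h om * x om)" if [measurable]: "x \<in> borel_measurable M" and "\<And>om. \<bar>x om\<bar> \<le> 1" for x :: "'a \<Rightarrow> real"
   by (rule integrable_const_bound[where B = 1]) (use h_le that(2) in \<open>auto simp: abs_mult intro!: mult_le_one\<close>)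
  have a_abs: "\<bar>a w\<bar> \<le> 1" "\<bar>1 - a w\<bar> \<le> 1" "\<bar>a w * a w'\<bar> \<le> 1" "\<bar>a w * (1 - a w')\<bar> \<le> 1" "\<bar>(1 - a w) * (1 - a w')\<bar> \<le> 1" "\<bar>(1 - a w) * a w'\<bar> \<le> 1" for w w'
   using a01[of w] a01[of w'] by auto
  have i1: "integrable M (%om. h om * (?ai om * ?aj om))" by (intro h_int a_abs) measurable
  have i2: "integrable M (%om. h om * (?ai om * (1 - ?aj om)))" by (intro h_int a_abs) measurable
  have i3: "integrable M (%om. h om * ((1 - ?ai om) * ?aj om))" by (intro h_int a_abs) measurable
  have i4: "integrable M (%om. h om * ((1 - ?ai om) * (1 - ?aj om)))" by (intro h_int a_abs) measurable
  have Uq_int: "integrable M (%om. U (?W 0 om) / (r + (U (?W 0 om))\<^sup>2) * x (?W 0 om))"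
   if [measurable]: "x \<in> borel_measurable ?N" and "\<And>w. \<bar>x w\<bar> \<le> 1" for x
  proof (rule L_integrable_bound[OF integrable_abs[OF integrable_divide_zero[OF u_int, of r]]])
   show "AE om in M. norm (U (?W 0 om) / (r + (U (?W 0 om))\<^sup>2) * x (?W 0 om)) \<le> norm \<bar>u 0 om / r\<bar>"
   proof (intro AE_I2)
    fix om
    have "\<bar>u 0 om\<bar> / (r + (u 0 om)\<^sup>2) \<le> \<bar>u 0 om\<bar> / r" using r0 by (intro divide_left_mono) (auto intro!: mult_pos_pos add_pos_nonneg)
    then have "\<bar>u 0 om\<bar> / (r + (u 0 om)\<^sup>2) * \<bar>x (?W 0 om)\<bar> \<le> \<bar>u 0 om\<bar> / r * 1" using r0 that(2)[of "?W 0 om"] by (intro mult_mono) auto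
    then show "norm (U (?W 0 om) / (r + (U (?W 0 om))\<^sup>2) * x (?W 0 om)) \<le> norm \<bar>u 0 om / r\<bar>"
     using r0 by (simp add: UW abs_mult abs_divide add_pos_nonneg abs_of_pos)
   qed
   show "(%om. U (?W 0 om) / (r + (U (?W 0 om))\<^sup>2) * x (?W 0 om)) \<in> borel_measurable M"
    using measurable_compose[OF iid_measurable[OF iid_W, of 0], of "%w. U w / (r + (U w)\<^sup>2) * x w" borel] by simp
  qed
  let ?G = "%w. U w * a w" and ?Q = "%w. U w / (r + (U w)\<^sup>2) * a w" and ?Q' = "%w. U w / (r + (U w)\<^sup>2) * (1 - a w)"
  have GQ: "integrable M (%om. ?G (?W i om) * ?Q (?W j om))" "expectation (%om. ?G (?W i om) * ?Q (?W j om)) = 0"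
   "integrable M (%om. ?Q (?W i om) * ?G (?W j om))" "expectation (%om. ?Q (?W i om) * ?G (?W j om)) = 0"
   "integrable M (%om. ?G (?W i om) * ?G (?W j om))" "expectation (%om. ?G (?W i om) * ?G (?W j om)) = 0"
   "integrable M (%om. ?G (?W i om) * ?Q' (?W j om))" "expectation (%om. ?G (?W i om) * ?Q' (?W j om)) = 0"
   "integrable M (%om. ?Q' (?W i om) * ?G (?W j om))" "expectation (%om. ?Q' (?W i om) * ?G (?W j om)) = 0"
   using prod[of ?G ?Q] prod[of ?Q ?G] prod[of ?G ?G] prod[of ?G ?Q'] prod[of ?Q' ?G]
    Ua_int Ua_mean Uq_int[of a] Uq_int[of "%w. 1 - a w"] a_abs by simp_all
  define S where "S w = (U w)\<^sup>2 / r * a w" for w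
  have [measurable]: "S \<in> borel_measurable ?N" unfolding S_def[abs_def] by measurable
  have S_int: "integrable M (%om. S (?W 0 om))" using sq_int by (simp add: S_def)
  have SS: "integrable M (%om. S (?W i om) * S (?W j om))" "expectation (%om. S (?W i om) * S (?W j om)) = s * s"
   and Sp: "integrable M (%om. S (?W i om) * (1 - ?aj om))" "expectation (%om. S (?W i om) * (1 - ?aj om)) = s * p"
   and pS: "integrable M (%om. (1 - ?ai om) * S (?W j om))" "expectation (%om. (1 - ?ai om) * S (?W j om)) = p * s"
   and pp: "integrable M (%om. (1 - ?ai om) * (1 - ?aj om))" "expectation (%om. (1 - ?ai om) * (1 - ?aj om)) = p * p"
   using prod[of S S] prod[of S "%w. 1 - a w"] prod[of "%w. 1 - a w" S] prod[of "%w. 1 - a w" "%w. 1 - a w"] S_int q_int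
   by (simp_all add: s_def p_def S_def)
    \<comment> \<open>The subtracted products contain a truncated factor of mean zero.\<close>
  have b1: "\<bar>expectation (%om. h om * (?ai om * ?aj om))\<bar> \<le> s * s"
  proof -
   let ?F = "%om. h om * (?ai om * ?aj om) - ?Q (?W i om) * ?G (?W j om) - ?G (?W i om) * ?Q (?W j om) + 1 / r * (?G (?W i om) * ?G (?W j om))"
   have F_int: "integrable M ?F" by (intro L_integrable_add L_integrable_diff integrable_mult_right i1 GQ)
   have "expectation ?F = expectation (%om. h om * (?ai om * ?aj om)) - expectation (%om. ?Q (?W i om) * ?G (?W j om))
     - expectation (%om. ?G (?W i om) * ?Q (?W j om)) + 1 / r * expectation (%om. ?G (?W i om) * ?G (?W j om))"
    by (simp only: L_integral_add[OF L_integrable_diff[OF L_integrable_diff[OF i1 GQ(3)] GQ(1)] integrable_mult_right[OF GQ(5)]]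
      L_integral_diff[OF L_integrable_diff[OF i1 GQ(3)] GQ(1)]
      L_integral_diff[OF i1 GQ(3)] integral_mult_right_zero)
   then have e: "expectation (%om. h om * (?ai om * ?aj om)) = expectation ?F" by (simp only: GQ; simp)
   have d: "\<bar>expectation ?F\<bar> \<le> expectation (%om. S (?W i om) * S (?W j om))"
   proof (rule dom[OF F_int SS(1)])
    fix om
    have "?F om = (u i om * u j om / (r + (u i om)\<^sup>2 + (u j om)\<^sup>2) - (u i om / (r + (u i om)\<^sup>2)) * u j om
      - u i om * (u j om / (r + (u j om)\<^sup>2)) + u i om * (u j om / r)) * (?ai om * ?aj om)" by (simp add: h_def UW algebra_simps)
    then have "\<bar>?F om\<bar> \<le> (u i om)\<^sup>2 / r * ((u j om)\<^sup>2 / r) * \<bar>?ai om * ?aj om\<bar>"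
     using pair_ratio_second_difference[OF r0, of "u i om" "u j om"] by (simp only: abs_mult[of _ "?ai om * ?aj om"]) (intro mult_right_mono; simp)
    also have "\<dots> = S (?W i om) * S (?W j om)" using a01[of "?W i om"] a01[of "?W j om"] by (auto simp: S_def UW)
    finally show "\<bar>?F om\<bar> \<le> S (?W i om) * S (?W j om)" .
   qed
   show ?thesis using d unfolding e SS(2) .
  qed
  have b2: "\<bar>expectation (%om. h om * (?ai om * (1 - ?aj om)))\<bar> \<le> s * p"
  proof -
   let ?F = "%om. h om * (?ai om * (1 - ?aj om)) - ?G (?W i om) * ?Q' (?W j om)"
   have F_int: "integrable M ?F" by (intro L_integrable_diff i2 GQ)
   have "expectation ?F = expectation (%om. h om * (?ai om * (1 - ?aj om))) - expectation (%om. ?G (?W i om) * ?Q' (?W j om))"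
    by (rule L_integral_diff[OF i2 GQ(7)])
   then have e: "expectation (%om. h om * (?ai om * (1 - ?aj om))) = expectation ?F" by (simp only: GQ; simp)
   have d: "\<bar>expectation ?F\<bar> \<le> expectation (%om. S (?W i om) * (1 - ?aj om))"
   proof (rule dom[OF F_int Sp(1)])
    fix om
    have "?F om = (u i om * u j om / (r + (u i om)\<^sup>2 + (u j om)\<^sup>2) - u i om * (u j om / (r + (u j om)\<^sup>2))) * (?ai om * (1 - ?aj om))"
    proof -
     have "H * (p * q) - (x * p) * (y * q) = (H - x * y) * (p * q)" for H p q x y :: real by (simp add: algebra_simps)
     then show ?thesis unfolding h_def UW .
    qed
    then have "\<bar>?F om\<bar> \<le> (u i om)\<^sup>2 / r * \<bar>?ai om * (1 - ?aj om)\<bar>"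
     using pair_ratio_first_difference[OF r0, of "u i om" "u j om"] by (simp only: abs_mult[of _ "?ai om * (1 - ?aj om)"]) (intro mult_right_mono; simp)
    also have "\<dots> = S (?W i om) * (1 - ?aj om)" using a01[of "?W i om"] a01[of "?W j om"] by (auto simp: S_def UW)
    finally show "\<bar>?F om\<bar> \<le> S (?W i om) * (1 - ?aj om)" .
   qed
   show ?thesis using d unfolding e Sp(2) .
  qed
  have b3: "\<bar>expectation (%om. h om * ((1 - ?ai om) * ?aj om))\<bar> \<le> p * s"
  proof -
   let ?F = "%om. h om * ((1 - ?ai om) * ?aj om) - ?Q' (?W i om) * ?G (?W j om)"
   have F_int: "integrable M ?F" by (intro L_integrable_diff i3 GQ)
   have "expectation ?F = expectation (%om. h om * ((1 - ?ai om) * ?aj om)) - expectation (%om. ?Q' (?W i om) * ?G (?W j om))"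
    by (rule L_integral_diff[OF i3 GQ(9)])
   then have e: "expectation (%om. h om * ((1 - ?ai om) * ?aj om)) = expectation ?F" by (simp only: GQ; simp)
   have d: "\<bar>expectation ?F\<bar> \<le> expectation (%om. (1 - ?ai om) * S (?W j om))"
   proof (rule dom[OF F_int pS(1)])
    fix om
    have "?F om = (u j om * u i om / (r + (u j om)\<^sup>2 + (u i om)\<^sup>2) - u j om * (u i om / (r + (u i om)\<^sup>2))) * ((1 - ?ai om) * ?aj om)"
    proof -
     have "H * (p * q) - (x * p) * (y * q) = (H - y * x) * (p * q)" for H p q x y :: real by (simp add: algebra_simps)
     moreover have "h om = u j om * u i om / (r + (u j om)\<^sup>2 + (u i om)\<^sup>2)" by (simp add: h_def add_ac mult.commute)
     ultimately show ?thesis unfolding UW by (simp only:)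
    qed
    then have "\<bar>?F om\<bar> \<le> (u j om)\<^sup>2 / r * \<bar>(1 - ?ai om) * ?aj om\<bar>"
     using pair_ratio_first_difference[OF r0, of "u j om" "u i om"] by (simp only: abs_mult[of _ "(1 - ?ai om) * ?aj om"]) (intro mult_right_mono; simp)
    also have "\<dots> = (1 - ?ai om) * S (?W j om)" using a01[of "?W i om"] a01[of "?W j om"] by (auto simp: S_def UW)
    finally show "\<bar>?F om\<bar> \<le> (1 - ?ai om) * S (?W j om)" .
   qed
   show ?thesis using d unfolding e pS(2) .
  qed
  have b4: "\<bar>expectation (%om. h om * ((1 - ?ai om) * (1 - ?aj om)))\<bar> \<le> p * p"
  proof -
   have "\<bar>expectation (%om. h om * ((1 - ?ai om) * (1 - ?aj om)))\<bar> \<le> expectation (%om. (1 - ?ai om) * (1 - ?aj om))"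
   proof (rule dom[OF i4 pp(1)])
    fix om
    show "\<bar>h om * ((1 - ?ai om) * (1 - ?aj om))\<bar> \<le> (1 - ?ai om) * (1 - ?aj om)" using a01[of "?W i om"] a01[of "?W j om"] h_le[of om] by auto
   qed
   then show ?thesis by (simp only: pp(2))
  qed
  have "h om = h om * (?ai om * ?aj om) + h om * (?ai om * (1 - ?aj om)) + (h om * ((1 - ?ai om) * ?aj om) + h om * ((1 - ?ai om) * (1 - ?aj om)))" for om
   by (simp add: algebra_simps)
  then have "expectation h = expectation (%om. h om * (?ai om * ?aj om) + h om * (?ai om * (1 - ?aj om)) + (h om * ((1 - ?ai om) * ?aj om) + h om * ((1 - ?ai om) * (1 - ?aj om))))"
   by presburger
  also have "\<dots> = expectation (%om. h om * (?ai om * ?aj om)) + expectation (%om. h om * (?ai om * (1 - ?aj om)))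
    + (expectation (%om. h om * ((1 - ?ai om) * ?aj om)) + expectation (%om. h om * ((1 - ?ai om) * (1 - ?aj om))))"
   by (simp only: L_integral_add[OF L_integrable_add[OF i1 i2] L_integrable_add[OF i3 i4]]
     L_integral_add[OF i1 i2] L_integral_add[OF i3 i4])
  finally have "\<bar>expectation h\<bar> \<le> s * s + s * p + (p * s + p * p)" using b1 b2 b3 b4 by linarith
  also have "\<dots> = (s + p)\<^sup>2" by (simp add: power2_eq_square algebra_simps)
  also have "\<dots> \<le> (2 * (C * share r))\<^sup>2" using s p by (intro power_mono) auto
  finally show ?thesis by (simp add: h_def[abs_def] power_mult_distrib)
 qed
 define C' where "C' = 4 * C\<^sup>2 + 1 / (share 1)\<^sup>2"
 have sh1: "0 < share 1" by (rule share_pos) simp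
 have "0 < C'" using \<open>0 < C\<close> sh1 by (auto simp: C'_def intro!: add_pos_pos)
 moreover have "\<bar>expectation (%om. u i om * u j om / (r + (u i om)\<^sup>2 + (u j om)\<^sup>2))\<bar> \<le> C' * (share r)\<^sup>2"
  if "0 \<le> r" "i \<noteq> j" for r i j
 proof (cases "1 \<le> r")
  case True
  have "4 * C\<^sup>2 * (share r)\<^sup>2 \<le> C' * (share r)\<^sup>2" by (intro mult_right_mono) (auto simp: C'_def)
  then show ?thesis using large[OF True \<open>i \<noteq> j\<close>] by linarith
 next
  case False
  have "\<bar>expectation (%om. u i om * u j om / (r + (u i om)\<^sup>2 + (u j om)\<^sup>2))\<bar> \<le> expectation (%om. \<bar>u i om * u j om / (r + (u i om)\<^sup>2 + (u j om)\<^sup>2)\<bar>)"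
   by (rule integral_abs_bound)
  also have "\<dots> \<le> 1" using pair_ratio_bound[OF \<open>0 \<le> r\<close>] by (intro integral_le_const integrable_const_bound[where B = 1] AE_I2) auto
  also have "1 \<le> 1 / (share 1)\<^sup>2 * (share r)\<^sup>2"
   using power_mono[OF share_antimono[of r 1], of 2] False \<open>0 \<le> r\<close> sh1 share_nonneg[of 1] by (simp add: pos_le_divide_eq)
  also have "\<dots> \<le> C' * (share r)\<^sup>2" by (intro mult_right_mono) (auto simp: C'_def)
  finally show ?thesis .
 qed
 ultimately show ?thesis by (rule that)
qed

end

section \<open>Symmetrization by consecutive pairs\<close>

text \<open>Induction on \<open>n\<close>: the product formula for cosines turns \<open>cos x cos y\<close> into the
  mean over \<open>x + y\<close> and \<open>x - y\<close>, and the right-hand side, which is the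
  fourth-order Taylor polynomial averaged over random signs, has the same mean value property. The single
  cosine is the base case.\<close>
lemma cos_prod_le:
 fixes y :: "nat \<Rightarrow> real"
 shows "cos x * (\<Prod>k<n. cos (y k)) \<le> 1 - (x\<^sup>2 + (\<Sum>k<n. (y k)\<^sup>2)) / 2
  + (x ^ 4 + 6 * x\<^sup>2 * (\<Sum>k<n. (y k)\<^sup>2) + 3 * (\<Sum>k<n. (y k)\<^sup>2)\<^sup>2 - 2 * (\<Sum>k<n. (y k) ^ 4)) / 24"
proof (induction n arbitrary: x)
 case 0
 then show ?case using cos_le_taylor4[of x] by simp
next
 case (Suc n)
 let ?P = "\<Prod>k<n. cos (y k)" and ?S = "\<Sum>k<n. (y k)\<^sup>2" and ?Q = "\<Sum>k<n. (y k) ^ 4"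
 define R where "R x s q = 1 - (x\<^sup>2 + s) / 2 + (x ^ 4 + 6 * x\<^sup>2 * s + 3 * s\<^sup>2 - 2 * q) / 24" for x s q :: real
 have "cos x * (\<Prod>k<Suc n. cos (y k)) = (cos (x + y n) * ?P + cos (x - y n) * ?P) / 2" by (simp add: cos_add cos_diff algebra_simps)
 also have "\<dots> \<le> (R (x + y n) ?S ?Q + R (x - y n) ?S ?Q) / 2"
  using Suc.IH[of "x + y n"] Suc.IH[of "x - y n"] unfolding R_def by (intro divide_right_mono add_mono) auto
 also have "\<dots> = R x (?S + (y n)\<^sup>2) (?Q + y n ^ 4)" unfolding R_def by (simp add: power2_eq_square power4_eq_xxxx field_simps)
 finally show ?case by (simp add: R_def)
qed

lemma sum_consecutive_pairs:
 fixes f :: "nat \<Rightarrow> real"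
 shows "(\<Sum>i=1..2 * n. f i) = (\<Sum>k<n. f (2 * k + 1) + f (2 * k + 2))" by (induction n) (simp_all add: numeral_2_eq_2)

lemma exp_neg_sum:
 fixes f :: "'i \<Rightarrow> real"
 assumes "finite I"
 shows "exp (- (c * sum f I)) = (\<Prod>i\<in>I. exp (- (c * f i)))" using assms
proof (induction I rule: finite_induct)
 case (insert x I)
 have "- (c * sum f (insert x I)) = - (c * f x) + - (c * sum f I)" using insert by (simp add: distrib_left)
 then show ?case by (simp only: exp_add prod.insert[OF insert.hyps] insert.IH)
qed simp

lemma Re_of_real_iexp: "Re (of_real e * iexp x) = e * cos x" by (simp add: Re_exp)

text \<open>The measure \<open>ds / s\<close> is invariant under dilations.\<close>
lemma scale_invariant_nn_integral:
 fixes F :: "real \<Rightarrow> real"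
 assumes [measurable]: "F \<in> borel_measurable borel" and "0 < c" and nn: "\<And>s. 0 \<le> F s"
 shows "(\<integral>\<^sup>+s. ennreal (indicator {0<..} s * (F (c * s) / s)) \<partial>lborel) = (\<integral>\<^sup>+s. ennreal (indicator {0<..} s * (F s / s)) \<partial>lborel)"
proof -
 have "(\<integral>\<^sup>+s. ennreal (indicator {0<..} s * (F s / s)) \<partial>lborel) =
   ennreal c * (\<integral>\<^sup>+s. ennreal (indicator {0<..} (c * s) * (F (c * s) / (c * s))) \<partial>lborel)"
  using nn_integral_real_affine[of "%s. ennreal (indicator {0<..} s * (F s / s))" c 0] \<open>0 < c\<close> by simp
 also have "\<dots> = (\<integral>\<^sup>+s. ennreal c * ennreal (indicator {0<..} (c * s) * (F (c * s) / (c * s))) \<partial>lborel)" by (rule nn_integral_cmult[symmetric]) simp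
 also have "\<dots> = (\<integral>\<^sup>+s. ennreal (indicator {0<..} s * (F (c * s) / s)) \<partial>lborel)"
 proof (intro nn_integral_cong)
  fix s
  have "c * (indicator {0<..} (c * s) * (F (c * s) / (c * s))) = indicator {0<..} s * (F (c * s) / s)"
   using \<open>0 < c\<close> by (auto simp: indicator_def zero_less_mult_iff)
  then show "ennreal c * ennreal (indicator {0<..} (c * s) * (F (c * s) / (c * s))) = ennreal (indicator {0<..} s * (F (c * s) / s))"
   using \<open>0 < c\<close> nn[of "c * s"] by (subst ennreal_mult'[symmetric]) auto
 qed
 finally show ?thesis by simp
qed

lemma gaussian_odd_nn_integral:
 "(\<integral>\<^sup>+s. ennreal (indicator {0<..} s * (exp (- s\<^sup>2) * s ^ (2 * k + 2) / s)) \<partial>lborel) = ennreal (fact k / 2)"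
proof -
 have *: "has_bochner_integral lborel (%x::real. indicator {0..} x *\<^sub>R (exp (- x\<^sup>2) * x ^ (2 * k + 1))) (fact k / 2)"
  by (rule gaussian_moment_odd_pos)
 have "(\<integral>\<^sup>+s. ennreal (indicator {0<..} s * (exp (- s\<^sup>2) * s ^ (2 * k + 2) / s)) \<partial>lborel) =
   (\<integral>\<^sup>+x. ennreal (indicator {0..} x *\<^sub>R (exp (- x\<^sup>2) * x ^ (2 * k + 1))) \<partial>lborel)" by (intro nn_integral_cong) (auto simp: indicator_def)
 also have "\<dots> = ennreal (\<integral>x. indicator {0..} x *\<^sub>R (exp (- x\<^sup>2) * x ^ (2 * k + 1)) \<partial>lborel)"
  using * by (intro nn_integral_eq_integral) (auto simp: has_bochner_integral_iff indicator_def)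
 also have "\<dots> = ennreal (fact k / 2)" using has_bochner_integral_integral_eq[OF *] by (simp only:)
 finally show ?thesis .
qed

context prob_space
begin

text \<open>The left-hand side is the real part of \<open>\<psi>^(2 n)\<close> with \<open>\<psi> = E exp(- s\<^sup>2
  X\<^sup>2 + i w X)\<close>, and the right-hand side is \<open>|\<psi>|^(2 n)\<close>. The Gaussian weight
  is what makes the sum of squares multiplicative.\<close>
lemma iid_pair_cos_bound:
 fixes X :: "nat \<Rightarrow> 'a \<Rightarrow> real"
 assumes iid: "iid borel X"
 shows "expectation (%om. exp (- (s\<^sup>2 * (\<Sum>i=1..2 * n. (X i om)\<^sup>2))) * cos (w * (\<Sum>i=1..2 * n. X i om))) \<le>
   expectation (%om. exp (- (s\<^sup>2 * (\<Sum>i=1..2 * n. (X i om)\<^sup>2))) * (\<Prod>k<n. cos (w * (X (2 * k + 1) om - X (2 * k + 2) om))))"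
proof -
 note [measurable] = iid_measurable[OF iid]
 define g where "g x = of_real (exp (- (s\<^sup>2 * x\<^sup>2))) * iexp (w * x)" for x :: real
 have [measurable]: "g \<in> borel_measurable borel" unfolding g_def[abs_def] by measurable
 have g_norm: "norm (g x) \<le> 1" for x by (simp add: g_def norm_mult)
 have int_g: "integrable M (%om. g (X 0 om))" by (rule integrable_const_bound[where B = 1]) (use g_norm in auto)
 define \<psi> where "\<psi> = expectation (%om. g (X 0 om))"
 have prod_g: "(\<Prod>i\<in>{1..2 * n}. g (X i om)) = of_real (exp (- (s\<^sup>2 * (\<Sum>i=1..2 * n. (X i om)\<^sup>2)))) * iexp (w * (\<Sum>i=1..2 * n. X i om))" for om
 proof -
  have "iexp (w * (\<Sum>i=1..2 * n. X i om)) = (\<Prod>i\<in>{1..2 * n}. iexp (w * X i om))" by (simp add: exp_sum sum_distrib_left)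
  then show ?thesis unfolding g_def prod.distrib exp_neg_sum[OF finite_atLeastAtMost] of_real_prod by simp
 qed
 have E1: "expectation (%om. of_real (exp (- (s\<^sup>2 * (\<Sum>i=1..2 * n. (X i om)\<^sup>2)))) * iexp (w * (\<Sum>i=1..2 * n. X i om))) = \<psi> ^ (2 * n)"
  using iid_prod_expectation[OF iid, of "{1..2 * n}" "%_. g"] int_g unfolding prod_g by (simp add: \<psi>_def)
 have I1: "integrable M (%om. of_real (exp (- (s\<^sup>2 * (\<Sum>i=1..2 * n. (X i om)\<^sup>2)))) * iexp (w * (\<Sum>i=1..2 * n. X i om)))"
  using iid_prod_integrable[OF iid, of "{1..2 * n}" "%_. g"] int_g unfolding prod_g by simp
 have "expectation (%om. exp (- (s\<^sup>2 * (\<Sum>i=1..2 * n. (X i om)\<^sup>2))) * cos (w * (\<Sum>i=1..2 * n. X i om))) =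
   expectation (%om. Re (of_real (exp (- (s\<^sup>2 * (\<Sum>i=1..2 * n. (X i om)\<^sup>2)))) * iexp (w * (\<Sum>i=1..2 * n. X i om))))" by (simp only: Re_of_real_iexp)
 also have "\<dots> = Re (\<psi> ^ (2 * n))" unfolding E1[symmetric] by (rule integral_Re[OF I1])
 also have "\<dots> \<le> norm (\<psi> ^ (2 * n))" by (rule complex_Re_le_cmod)
 also have "\<dots> = ((norm \<psi>)\<^sup>2) ^ n" by (simp add: norm_power power_mult)
 finally have L: "expectation (%om. exp (- (s\<^sup>2 * (\<Sum>i=1..2 * n. (X i om)\<^sup>2))) * cos (w * (\<Sum>i=1..2 * n. X i om))) \<le> ((norm \<psi>)\<^sup>2) ^ n" .
 define q where "q p = exp (- (s\<^sup>2 * ((fst p)\<^sup>2 + (snd p)\<^sup>2))) * cos (w * (fst p - snd p))" for p :: "real \<times> real"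
 have [measurable]: "q \<in> borel_measurable (borel \<Otimes>\<^sub>M borel)" unfolding q_def[abs_def] by measurable
 have gg: "g (X 1 om) * cnj (g (X 2 om)) = of_real (exp (- (s\<^sup>2 * ((X 1 om)\<^sup>2 + (X 2 om)\<^sup>2)))) * iexp (w * (X 1 om - X 2 om))" for om
 proof -
  have "g (X 1 om) * cnj (g (X 2 om)) = of_real (exp (- (s\<^sup>2 * (X 1 om)\<^sup>2)) * exp (- (s\<^sup>2 * (X 2 om)\<^sup>2))) * (iexp (w * X 1 om) * cnj (iexp (w * X 2 om)))"
   by (simp add: g_def)
  also have "iexp (w * X 1 om) * cnj (iexp (w * X 2 om)) = iexp (w * (X 1 om - X 2 om))" by (simp add: exp_cnj right_diff_distrib flip: exp_add)
  also have "exp (- (s\<^sup>2 * (X 1 om)\<^sup>2)) * exp (- (s\<^sup>2 * (X 2 om)\<^sup>2)) = exp (- (s\<^sup>2 * ((X 1 om)\<^sup>2 + (X 2 om)\<^sup>2)))"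
   by (simp add: distrib_left flip: exp_add)
  finally show ?thesis .
 qed
 have "expectation (%om. q (X 1 om, X 2 om)) = expectation (%om. Re (g (X 1 om) * cnj (g (X 2 om))))"
  by (simp only: gg Re_of_real_iexp q_def fst_conv snd_conv)
 also have "\<dots> = Re (expectation (%om. g (X 1 om) * cnj (g (X 2 om))))" by (intro integral_Re iid_symmetrized_product(1)[OF iid _ int_g]) auto
 also have "\<dots> = (norm \<psi>)\<^sup>2" by (subst iid_symmetrized_product(2)[OF iid _ int_g]) (auto simp: \<psi>_def)
 finally have Eq: "expectation (%om. q (X 1 om, X 2 om)) = (norm \<psi>)\<^sup>2" .
 have prod_q: "(\<Prod>k\<in>{..<n}. q (X (2 * k + 1) om, X (2 * k + 2) om)) =
   exp (- (s\<^sup>2 * (\<Sum>i=1..2 * n. (X i om)\<^sup>2))) * (\<Prod>k<n. cos (w * (X (2 * k + 1) om - X (2 * k + 2) om)))" for om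
  unfolding sum_consecutive_pairs q_def by (simp only: prod.distrib exp_neg_sum[OF finite_lessThan] fst_conv snd_conv)
 have int_q: "integrable M (%om. q (X (2 * 0 + 1) om, X (2 * 0 + 2) om))"
  by (rule integrable_const_bound[where B = 1]) (auto simp: q_def abs_mult intro!: mult_le_one)
 have "expectation (%om. \<Prod>k\<in>{..<n}. q (X (2 * k + 1) om, X (2 * k + 2) om)) = ((norm \<psi>)\<^sup>2) ^ n"
  using iid_prod_expectation[OF iid_consecutive_pairs[OF iid], of "{..<n}" "%_. q"] int_q Eq by (simp add: numeral_2_eq_2)
 then show ?thesis using L unfolding prod_q by simp
qed

text \<open>The squares of the differences within consecutive pairs; index 0 stays unpaired.\<close>
definition pair_sq :: "(nat \<Rightarrow> 'a \<Rightarrow> real) \<Rightarrow> nat \<Rightarrow> 'a \<Rightarrow> real" where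
 "pair_sq X n om = (\<Sum>k<n. (X (2 * k + 1) om - X (2 * k + 2) om)\<^sup>2)"

definition pair_fourth :: "(nat \<Rightarrow> 'a \<Rightarrow> real) \<Rightarrow> nat \<Rightarrow> 'a \<Rightarrow> real" where
 "pair_fourth X n om = (\<Sum>k<n. (X (2 * k + 1) om - X (2 * k + 2) om) ^ 4)"

lemma pair_sq_le: "0 \<le> pair_sq X n om" "pair_sq X n om \<le> 2 * (\<Sum>i=1..2 * n. (X i om)\<^sup>2)"
proof -
 show "0 \<le> pair_sq X n om" by (simp add: pair_sq_def sum_nonneg)
 have "(x - y)\<^sup>2 \<le> 2 * (x\<^sup>2 + y\<^sup>2)" for x y :: real using zero_le_power2[of "x + y"] by (simp add: power2_sum power2_diff)
 then show "pair_sq X n om \<le> 2 * (\<Sum>i=1..2 * n. (X i om)\<^sup>2)" unfolding pair_sq_def sum_consecutive_pairs sum_distrib_left by (rule sum_mono)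
qed

lemma pair_fourth_le: "0 \<le> pair_fourth X n om" "pair_fourth X n om \<le> (pair_sq X n om)\<^sup>2"
proof -
 show "0 \<le> pair_fourth X n om" by (simp add: pair_fourth_def sum_nonneg)
 have "pair_fourth X n om = (\<Sum>k<n. (X (2 * k + 1) om - X (2 * k + 2) om)\<^sup>2 * (X (2 * k + 1) om - X (2 * k + 2) om)\<^sup>2)"
  unfolding pair_fourth_def by (simp add: power4_eq_xxxx power2_eq_square mult.assoc)
 also have "\<dots> \<le> (\<Sum>k<n. (X (2 * k + 1) om - X (2 * k + 2) om)\<^sup>2 * pair_sq X n om)"
  unfolding pair_sq_def by (intro sum_mono mult_left_mono member_le_sum) auto
 also have "\<dots> = (pair_sq X n om)\<^sup>2" by (simp add: pair_sq_def power2_eq_square sum_distrib_right)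
 finally show "pair_fourth X n om \<le> (pair_sq X n om)\<^sup>2" .
qed

lemma mult_exp_neg_le: "0 \<le> x \<Longrightarrow> x * exp (- x) \<le> (1::real)" "0 \<le> x \<Longrightarrow> x\<^sup>2 * exp (- x) \<le> (4::real)"
proof -
 assume x: "0 \<le> x"
 have *: "y * exp (- y) \<le> 1" for y :: real
 proof -
  have "y \<le> exp y" using exp_ge_add_one_self[of y] by linarith
  then show ?thesis by (simp add: exp_minus field_simps)
 qed
 show "x * exp (- x) \<le> 1" by (rule *)
 have "x\<^sup>2 * exp (- x) = 4 * (x / 2 * exp (- (x / 2)))\<^sup>2" by (simp add: power_mult_distrib power_divide exp_double[symmetric])
 also have "\<dots> \<le> 4 * 1\<^sup>2" by (intro mult_left_mono power_mono *) (use x in auto)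
 finally show "x\<^sup>2 * exp (- x) \<le> 4" by simp
qed

text \<open>Both sides are finite since the weight dominates powers of the sum of squares. Nonnegative integrals are
  used so that the scale parameter can be integrated out next.\<close>
lemma pair_fourth_order_inequality:
 fixes X :: "nat \<Rightarrow> 'a \<Rightarrow> real"
 assumes iid: "iid borel X"
 defines "V2 \<equiv> %n om. \<Sum>i=1..2 * n. (X i om)\<^sup>2" and "S \<equiv> %n om. \<Sum>i=1..2 * n. X i om"
 shows "(\<integral>\<^sup>+om. ennreal (exp (- (s\<^sup>2 * V2 n om)) * ((a * s)\<^sup>2 * pair_sq X n om / 2 + (a * s) ^ 4 * pair_fourth X n om / 12)) \<partial>M) \<le>
   (\<integral>\<^sup>+om. ennreal (exp (- (s\<^sup>2 * V2 n om)) * (1 - cos (a * s * S n om))) \<partial>M) +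
   (\<integral>\<^sup>+om. ennreal (exp (- (s\<^sup>2 * V2 n om)) * ((a * s) ^ 4 * (pair_sq X n om)\<^sup>2 / 8)) \<partial>M)"
proof -
 note [measurable] = iid_measurable[OF iid]
 have [measurable]: "random_variable borel (V2 n)" "random_variable borel (S n)" "random_variable borel (pair_sq X n)" "random_variable borel (pair_fourth X n)"
  unfolding V2_def S_def pair_sq_def[abs_def] pair_fourth_def[abs_def] by measurable
 let ?e = "%om. exp (- (s\<^sup>2 * V2 n om))"
 have V2_nn: "0 \<le> V2 n om" for om by (simp add: V2_def sum_nonneg)
 have e_le: "?e om \<le> 1" for om using V2_nn[of om] by simp
 have sq_le: "pair_sq X n om \<le> 2 * V2 n om" for om unfolding V2_def by (rule pair_sq_le)
 have fourth_le: "pair_fourth X n om \<le> 4 * (V2 n om)\<^sup>2" "(pair_sq X n om)\<^sup>2 \<le> 4 * (V2 n om)\<^sup>2" for om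
 proof -
  have "(pair_sq X n om)\<^sup>2 \<le> (2 * V2 n om)\<^sup>2" using sq_le pair_sq_le(1) by (intro power_mono)
  then show "(pair_sq X n om)\<^sup>2 \<le> 4 * (V2 n om)\<^sup>2" by (simp add: power_mult_distrib)
  then show "pair_fourth X n om \<le> 4 * (V2 n om)\<^sup>2" using pair_fourth_le(2)[of X n om] by linarith
 qed
 have ie: "integrable M ?e" by (rule integrable_const_bound[where B = 1]) (use e_le in auto)
 have ic: "integrable M (%om. ?e om * cos (a * s * S n om))"
  by (rule integrable_const_bound[where B = 1]) (use e_le in \<open>auto simp: abs_mult intro!: mult_le_one\<close>)
 have isq: "integrable M (%om. ?e om * (s\<^sup>2 * pair_sq X n om))"
 proof (rule integrable_const_bound[where B = 2])
  show "AE om in M. norm (?e om * (s\<^sup>2 * pair_sq X n om)) \<le> 2"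
  proof (intro AE_I2)
   fix om
   have "?e om * (s\<^sup>2 * pair_sq X n om) \<le> ?e om * (s\<^sup>2 * (2 * V2 n om))" using sq_le by (intro mult_left_mono) auto
   also have "\<dots> = 2 * (s\<^sup>2 * V2 n om * ?e om)" by (simp add: mult_ac)
   also have "\<dots> \<le> 2 * 1" using V2_nn by (intro mult_left_mono mult_exp_neg_le) auto
   finally show "norm (?e om * (s\<^sup>2 * pair_sq X n om)) \<le> 2" using pair_sq_le(1)[of X n om] by simp
  qed
 qed simp
 have i4: "integrable M (%om. ?e om * (s ^ 4 * f om))" if [measurable]: "f \<in> borel_measurable M" and f: "\<And>om. 0 \<le> f om" "\<And>om. f om \<le> 4 * (V2 n om)\<^sup>2" for f
 proof (rule integrable_const_bound[where B = 16])
  show "AE om in M. norm (?e om * (s ^ 4 * f om)) \<le> 16"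
  proof (intro AE_I2)
   fix om
   have "?e om * (s ^ 4 * f om) \<le> ?e om * (s ^ 4 * (4 * (V2 n om)\<^sup>2))" using f by (intro mult_left_mono) auto
   also have "\<dots> = 4 * ((s\<^sup>2 * V2 n om)\<^sup>2 * ?e om)" by (simp add: power_mult_distrib mult_ac flip: power_mult)
   also have "\<dots> \<le> 4 * 4" using V2_nn by (intro mult_left_mono mult_exp_neg_le) auto
   finally show "norm (?e om * (s ^ 4 * f om)) \<le> 16" using f(1)[of om] by simp
  qed
 qed simp
 have i4a: "integrable M (%om. ?e om * (s ^ 4 * pair_fourth X n om))" and i4b: "integrable M (%om. ?e om * (s ^ 4 * (pair_sq X n om)\<^sup>2))"
  using fourth_le pair_fourth_le(1)[of X n] by (auto intro!: i4)
 let ?P = "%om. ?e om * ((a * s)\<^sup>2 * pair_sq X n om / 2 + (a * s) ^ 4 * pair_fourth X n om / 12)"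
 let ?L = "%om. ?e om * (1 - cos (a * s * S n om))"
 let ?Q = "%om. ?e om * ((a * s) ^ 4 * (pair_sq X n om)\<^sup>2 / 8)"
 have P_eq: "?P om = a\<^sup>2 / 2 * (?e om * (s\<^sup>2 * pair_sq X n om)) + a ^ 4 / 12 * (?e om * (s ^ 4 * pair_fourth X n om))" for om
  by (simp add: power_mult_distrib algebra_simps)
 have Q_eq: "?Q om = a ^ 4 / 8 * (?e om * (s ^ 4 * (pair_sq X n om)\<^sup>2))" for om by (simp add: power_mult_distrib algebra_simps)
 have L_eq: "?L om = ?e om - ?e om * cos (a * s * S n om)" for om by (simp add: algebra_simps)
 have iP: "integrable M ?P" unfolding P_eq by (intro L_integrable_add integrable_mult_right isq i4a)
 have iQ: "integrable M ?Q" unfolding Q_eq by (intro integrable_mult_right i4b)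
 have iL: "integrable M ?L" unfolding L_eq by (intro L_integrable_diff ie ic)
 have "expectation (%om. ?e om * cos (a * s * S n om)) \<le>
   expectation (%om. ?e om * (\<Prod>k<n. cos (a * s * (X (2 * k + 1) om - X (2 * k + 2) om))))"
  unfolding V2_def S_def by (rule iid_pair_cos_bound[OF iid])
 also have "\<dots> \<le> expectation (%om. ?e om - ?P om + ?Q om)"
 proof (rule integral_mono)
  show "integrable M (%om. ?e om * (\<Prod>k<n. cos (a * s * (X (2 * k + 1) om - X (2 * k + 2) om))))"
  proof (rule integrable_const_bound[where B = 1])
   have "\<bar>\<Prod>k<n. cos (f k)\<bar> \<le> 1" for f :: "nat \<Rightarrow> real" unfolding abs_prod by (intro prod_le_1) auto
   then show "AE om in M. norm (?e om * (\<Prod>k<n. cos (a * s * (X (2 * k + 1) om - X (2 * k + 2) om)))) \<le> 1"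
    using e_le by (intro AE_I2) (simp only: real_norm_def abs_mult abs_exp_cancel, intro mult_le_one, auto)
  qed simp
  show "integrable M (%om. ?e om - ?P om + ?Q om)" by (intro L_integrable_add L_integrable_diff ie iP iQ)
  fix om
  let ?w = "a * s"
  have sq: "(\<Sum>k<n. (?w * (X (2 * k + 1) om - X (2 * k + 2) om))\<^sup>2) = ?w\<^sup>2 * pair_sq X n om"
   unfolding pair_sq_def by (simp only: power_mult_distrib sum_distrib_left)
  have fo: "(\<Sum>k<n. (?w * (X (2 * k + 1) om - X (2 * k + 2) om)) ^ 4) = ?w ^ 4 * pair_fourth X n om"
   unfolding pair_fourth_def by (simp only: power_mult_distrib sum_distrib_left)
  have "(\<Prod>k<n. cos (?w * (X (2 * k + 1) om - X (2 * k + 2) om))) \<le>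
    1 - (?w\<^sup>2 * pair_sq X n om) / 2 + (3 * (?w\<^sup>2 * pair_sq X n om)\<^sup>2 - 2 * (?w ^ 4 * pair_fourth X n om)) / 24"
   using cos_prod_le[of 0 "%k. ?w * (X (2 * k + 1) om - X (2 * k + 2) om)" n] unfolding sq fo by simp
  also have "\<dots> = 1 - (?w\<^sup>2 * pair_sq X n om / 2 + ?w ^ 4 * pair_fourth X n om / 12) + ?w ^ 4 * (pair_sq X n om)\<^sup>2 / 8"
   by (simp add: power_mult_distrib diff_divide_distrib mult_ac flip: power_mult)
  finally have "?e om * (\<Prod>k<n. cos (?w * (X (2 * k + 1) om - X (2 * k + 2) om))) \<le>
    ?e om * (1 - (?w\<^sup>2 * pair_sq X n om / 2 + ?w ^ 4 * pair_fourth X n om / 12) + ?w ^ 4 * (pair_sq X n om)\<^sup>2 / 8)" by (intro mult_left_mono) auto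
  then show "?e om * (\<Prod>k<n. cos (?w * (X (2 * k + 1) om - X (2 * k + 2) om))) \<le> ?e om - ?P om + ?Q om"
   by (simp only: distrib_left right_diff_distrib mult_1_right)
 qed
 also have "\<dots> = expectation ?e - expectation ?P + expectation ?Q"
  by (simp only: L_integral_add[OF L_integrable_diff[OF ie iP] iQ] L_integral_diff[OF ie iP])
 finally have "expectation ?P \<le> expectation ?L + expectation ?Q" unfolding L_eq L_integral_diff[OF ie ic] by linarith
 moreover have P_nn: "0 \<le> ?P om" and L_nn: "0 \<le> ?L om" and Q_nn: "0 \<le> ?Q om" for om
  using pair_sq_le(1)[of X n om] pair_fourth_le(1)[of X n om] by (auto intro!: mult_nonneg_nonneg add_nonneg_nonneg)
 ultimately have "ennreal (expectation ?P) \<le> ennreal (expectation ?L) + ennreal (expectation ?Q)"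
  by (subst ennreal_plus[symmetric]) (auto intro!: integral_nonneg_AE AE_I2 ennreal_leI simp del: ennreal_plus)
 moreover have "(\<integral>\<^sup>+om. ennreal (?P om) \<partial>M) = ennreal (expectation ?P)" by (rule nn_integral_eq_integral[OF iP]) (use P_nn in auto)
 moreover have "(\<integral>\<^sup>+om. ennreal (?L om) \<partial>M) = ennreal (expectation ?L)" by (rule nn_integral_eq_integral[OF iL]) (use L_nn in auto)
 moreover have "(\<integral>\<^sup>+om. ennreal (?Q om) \<partial>M) = ennreal (expectation ?Q)" by (rule nn_integral_eq_integral[OF iQ]) (use Q_nn in auto)
 ultimately show ?thesis by simp
qed

end

section \<open>Mixing over Gaussian scales\<close>

lemma gaussian_quartic_nn_integral:
 assumes "0 \<le> A" "0 \<le> B"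
 shows "(\<integral>\<^sup>+s. ennreal (indicator {0<..} s * (exp (- s\<^sup>2) * (A * s\<^sup>2 + B * s ^ 4) / s)) \<partial>lborel) = ennreal ((A + B) / 2)"
proof -
 let ?h = "%k s. indicator {0<..} s * (exp (- s\<^sup>2) * s ^ (2 * k + 2) / s) :: real"
 have nn: "0 \<le> ?h k s" for k s by (auto simp: indicator_def)
 have "(\<integral>\<^sup>+s. ennreal (indicator {0<..} s * (exp (- s\<^sup>2) * (A * s\<^sup>2 + B * s ^ 4) / s)) \<partial>lborel) =
   (\<integral>\<^sup>+s. ennreal A * ennreal (?h 0 s) + ennreal B * ennreal (?h 1 s) \<partial>lborel)"
 proof (intro nn_integral_cong)
  fix s :: real
  have "indicator {0<..} s * (exp (- s\<^sup>2) * (A * s\<^sup>2 + B * s ^ 4) / s) = A * ?h 0 s + B * ?h 1 s"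
  proof -
   have "2 * 0 + 2 = (2::nat)" "2 * 1 + 2 = (4::nat)" by auto
   then show ?thesis by (simp only:) (simp only: times_divide_eq_right distrib_left add_divide_distrib mult_ac)
  qed
  also have "ennreal \<dots> = ennreal (A * ?h 0 s) + ennreal (B * ?h 1 s)"
   by (intro ennreal_plus mult_nonneg_nonneg[OF assms(1)] mult_nonneg_nonneg[OF assms(2)] nn)
  finally show "ennreal (indicator {0<..} s * (exp (- s\<^sup>2) * (A * s\<^sup>2 + B * s ^ 4) / s)) = ennreal A * ennreal (?h 0 s) + ennreal B * ennreal (?h 1 s)"
   using assms by (simp only: ennreal_mult'[OF assms(1)] ennreal_mult'[OF assms(2)])
 qed
 also have "\<dots> = (\<integral>\<^sup>+s. ennreal A * ennreal (?h 0 s) \<partial>lborel) + (\<integral>\<^sup>+s. ennreal B * ennreal (?h 1 s) \<partial>lborel)" by (rule nn_integral_add) measurable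
 also have "\<dots> = ennreal A * (\<integral>\<^sup>+s. ennreal (?h 0 s) \<partial>lborel) + ennreal B * (\<integral>\<^sup>+s. ennreal (?h 1 s) \<partial>lborel)"
  by (intro arg_cong2[where f = "(+)"] nn_integral_cmult) measurable
 also have "\<dots> = ennreal A * ennreal (1 / 2) + ennreal B * ennreal (1 / 2)" unfolding gaussian_odd_nn_integral by simp
 also have "\<dots> = ennreal (A * (1 / 2)) + ennreal (B * (1 / 2))" using assms by (simp only: ennreal_mult'[symmetric])
 also have "\<dots> = ennreal (A * (1 / 2) + B * (1 / 2))" using assms by (intro ennreal_plus[symmetric]) auto
 also have "A * (1 / 2) + B * (1 / 2) = (A + B) / 2" by simp
 finally show ?thesis .
qed

lemma gaussian_quartic_scaled_nn_integral:
 assumes "0 \<le> A" "0 \<le> B" "0 < v"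
 shows "(\<integral>\<^sup>+s. ennreal (indicator {0<..} s * (exp (- (s\<^sup>2 * v)) * (A * s\<^sup>2 + B * s ^ 4) / s)) \<partial>lborel) = ennreal ((A / v + B / v\<^sup>2) / 2)"
proof -
 define F where "F s = exp (- s\<^sup>2) * (A / v * s\<^sup>2 + B / v\<^sup>2 * s ^ 4)" for s
 have [measurable]: "F \<in> borel_measurable borel" unfolding F_def[abs_def] by measurable
 have "F (sqrt v * s) = exp (- (s\<^sup>2 * v)) * (A * s\<^sup>2 + B * s ^ 4)" for s
 proof -
  have "(sqrt v * s)\<^sup>2 = v * s\<^sup>2" using assms by (simp add: power_mult_distrib)
  moreover have e: "y ^ 4 = (y\<^sup>2)\<^sup>2" for y :: real by (simp flip: power_mult)
  ultimately have "(sqrt v * s) ^ 4 = v\<^sup>2 * s ^ 4" by (simp only: e[of "sqrt v * s"] e[of s] power_mult_distrib[of v])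
  moreover note \<open>(sqrt v * s)\<^sup>2 = v * s\<^sup>2\<close>
  ultimately show ?thesis using assms by (simp add: F_def mult.commute)
 qed
 then have "(\<integral>\<^sup>+s. ennreal (indicator {0<..} s * (exp (- (s\<^sup>2 * v)) * (A * s\<^sup>2 + B * s ^ 4) / s)) \<partial>lborel) =
   (\<integral>\<^sup>+s. ennreal (indicator {0<..} s * (F s / s)) \<partial>lborel)" using scale_invariant_nn_integral[of F "sqrt v"] assms by (simp add: F_def)
 also have "\<dots> = ennreal ((A / v + B / v\<^sup>2) / 2)" unfolding F_def using assms by (intro gaussian_quartic_nn_integral) auto
 finally show ?thesis .
qed

lemma one_minus_exp_neg_le:
 assumes "0 \<le> (v::real)"
 shows "1 - exp (- v) \<le> v - v\<^sup>2 / 2 + v ^ 3 / 6"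
proof -
 obtain t where "exp (- v) = (\<Sum>m<4. (- v) ^ m / fact m) + exp t / fact 4 * (- v) ^ 4" using Maclaurin_exp_le[of "- v" 4] by blast
 moreover have "(\<Sum>m<4. (- v) ^ m / fact m) = 1 - v + v\<^sup>2 / 2 - v ^ 3 / 6" by (simp add: eval_nat_numeral)
 moreover have "0 \<le> exp t / fact 4 * (- v) ^ 4" by simp
 ultimately show ?thesis by linarith
qed

lemma gaussian_odd_integral:
 "has_bochner_integral lborel (%s::real. indicator {0<..} s * (exp (- s\<^sup>2) * s ^ (2 * k + 2) / s)) (fact k / 2)"
proof (rule has_bochner_integral_nn_integral)
 show "(\<integral>\<^sup>+s. ennreal (indicator {0<..} s * (exp (- s\<^sup>2) * s ^ (2 * k + 2) / s)) \<partial>lborel) = ennreal (fact k / 2)" by (rule gaussian_odd_nn_integral)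
qed (auto simp: indicator_def)

context prob_space
begin

text \<open>Integrate the previous inequality over \<open>ds / s\<close> and exchange the integrals. For fixed
  outcome the substitution \<open>s V \<mapsto> s\<close> removes \<open>V\<close>, so that only ratios
  survive; the polynomial terms become Gaussian moments. If \<open>V = 0\<close>, all terms vanish.\<close>
lemma self_normalized_pair_inequality:
 fixes X :: "nat \<Rightarrow> 'a \<Rightarrow> real"
 assumes iid: "iid borel X"
 defines "V2 \<equiv> %n om. \<Sum>i=1..2 * n. (X i om)\<^sup>2" and "S \<equiv> %n om. \<Sum>i=1..2 * n. X i om"
 defines "T \<equiv> %n om. S n om * V2 n om powr (- 1 / 2)"
  and "Q \<equiv> %n om. pair_sq X n om / V2 n om" and "K \<equiv> %n om. pair_fourth X n om / (V2 n om)\<^sup>2"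
 shows "(\<integral>\<^sup>+om. ennreal (a\<^sup>2 / 4 * Q n om + a ^ 4 / 24 * K n om) \<partial>M) \<le>
   (\<integral>\<^sup>+s. ennreal (indicator {0<..} s * (exp (- s\<^sup>2) * (1 - expectation (%om. cos (a * s * T n om))) / s)) \<partial>lborel) +
   (\<integral>\<^sup>+om. ennreal (a ^ 4 / 16 * (Q n om)\<^sup>2) \<partial>M)"
proof -
 interpret pair_sigma_finite lborel M by (intro pair_sigma_finite.intro sigma_finite_lborel sigma_finite_measure_axioms)
 note [measurable] = iid_measurable[OF iid]
 have [measurable]: "random_variable borel (V2 n)" "random_variable borel (S n)" "random_variable borel (pair_sq X n)" "random_variable borel (pair_fourth X n)"
  unfolding V2_def S_def pair_sq_def[abs_def] pair_fourth_def[abs_def] by measurable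
 have [measurable]: "random_variable borel (T n)" unfolding T_def by measurable
 have V2_nn: "0 \<le> V2 n om" for om by (simp add: V2_def sum_nonneg)
 have sq: "0 \<le> pair_sq X n om" "pair_sq X n om \<le> 2 * V2 n om" for om unfolding V2_def by (rule pair_sq_le)+
 have zero: "pair_sq X n om = 0 \<and> pair_fourth X n om = 0 \<and> S n om = 0" if "V2 n om = 0" for om
 proof -
  have p: "pair_sq X n om = 0" using sq[of om] that by simp
  then have "pair_fourth X n om = 0" using pair_fourth_le[of X n om] by simp
  moreover have "\<forall>i\<in>{1..2 * n}. (X i om)\<^sup>2 = 0" using that unfolding V2_def by (subst (asm) sum_nonneg_eq_0_iff) auto
  then have "S n om = 0" unfolding S_def by (intro sum.neutral) simp
  ultimately show ?thesis using p by simp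
 qed
 define P where "P s om = exp (- (s\<^sup>2 * V2 n om)) * ((a * s)\<^sup>2 * pair_sq X n om / 2 + (a * s) ^ 4 * pair_fourth X n om / 12)" for s om
 define L where "L s om = exp (- (s\<^sup>2 * V2 n om)) * (1 - cos (a * s * S n om))" for s om
 define R where "R s om = exp (- (s\<^sup>2 * V2 n om)) * ((a * s) ^ 4 * (pair_sq X n om)\<^sup>2 / 8)" for s om
 define G where "G s om = exp (- s\<^sup>2) * (1 - cos (a * s * T n om))" for s om
 have nn: "0 \<le> P s om" "0 \<le> L s om" "0 \<le> R s om" "0 \<le> G s om" for s om
  using sq(1)[of om] pair_fourth_le(1)[of X n om] by (auto simp: P_def L_def R_def G_def intro!: mult_nonneg_nonneg add_nonneg_nonneg)
 have meas[measurable]: "case_prod P \<in> borel_measurable (lborel \<Otimes>\<^sub>M M)" "case_prod L \<in> borel_measurable (lborel \<Otimes>\<^sub>M M)"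
   "case_prod R \<in> borel_measurable (lborel \<Otimes>\<^sub>M M)" "case_prod G \<in> borel_measurable (lborel \<Otimes>\<^sub>M M)"
  unfolding P_def[abs_def] L_def[abs_def] R_def[abs_def] G_def[abs_def] by measurable
 let ?w = "%F s om. ennreal (indicator {0<..} s * (F s om / s)) :: ennreal"
 have inner: "(\<integral>\<^sup>+om. ?w F s om \<partial>M) = ennreal (indicator {0<..} s / s) * (\<integral>\<^sup>+om. ennreal (F s om) \<partial>M)"
  if [measurable]: "case_prod F \<in> borel_measurable (lborel \<Otimes>\<^sub>M M)" for F s
 proof -
  have [measurable]: "F s \<in> borel_measurable M" using measurable_Pair2[OF that, of s] by simp
  have "(\<integral>\<^sup>+om. ?w F s om \<partial>M) = (\<integral>\<^sup>+om. ennreal (indicator {0<..} s / s) * ennreal (F s om) \<partial>M)"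
  proof (intro nn_integral_cong)
   fix om
   have "indicator {0<..} s * (F s om / s) = indicator {0<..} s / s * F s om" by simp
   moreover have "0 \<le> indicator {0<..} s / s" by (auto simp: indicator_def)
   ultimately show "?w F s om = ennreal (indicator {0<..} s / s) * ennreal (F s om)" by (simp only: ennreal_mult')
  qed
  also have "\<dots> = ennreal (indicator {0<..} s / s) * (\<integral>\<^sup>+om. ennreal (F s om) \<partial>M)" by (rule nn_integral_cmult) measurable
  finally show ?thesis .
 qed
 have swap: "(\<integral>\<^sup>+s. (\<integral>\<^sup>+om. ?w F s om \<partial>M) \<partial>lborel) = (\<integral>\<^sup>+om. (\<integral>\<^sup>+s. ?w F s om \<partial>lborel) \<partial>M)"
  if [measurable]: "case_prod F \<in> borel_measurable (lborel \<Otimes>\<^sub>M M)" for F by (rule Fubini'[symmetric]) measurable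
 have mw: "(%s. \<integral>\<^sup>+om. ?w F s om \<partial>M) \<in> borel_measurable lborel"
  if [measurable]: "case_prod F \<in> borel_measurable (lborel \<Otimes>\<^sub>M M)" for F by measurable
 have "(\<integral>\<^sup>+om. (\<integral>\<^sup>+s. ?w P s om \<partial>lborel) \<partial>M) = (\<integral>\<^sup>+s. (\<integral>\<^sup>+om. ?w P s om \<partial>M) \<partial>lborel)" by (rule swap[symmetric]) (rule meas)
 also have "\<dots> \<le> (\<integral>\<^sup>+s. (\<integral>\<^sup>+om. ?w L s om \<partial>M) + (\<integral>\<^sup>+om. ?w R s om \<partial>M) \<partial>lborel)"
 proof (intro nn_integral_mono)
  fix s
  show "(\<integral>\<^sup>+om. ?w P s om \<partial>M) \<le> (\<integral>\<^sup>+om. ?w L s om \<partial>M) + (\<integral>\<^sup>+om. ?w R s om \<partial>M)"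
   unfolding inner[OF meas(1)] inner[OF meas(2)] inner[OF meas(3)] distrib_left[symmetric] unfolding P_def L_def R_def V2_def S_def
   by (intro mult_left_mono pair_fourth_order_inequality[OF iid]) simp
 qed
 also have "\<dots> = (\<integral>\<^sup>+s. (\<integral>\<^sup>+om. ?w L s om \<partial>M) \<partial>lborel) + (\<integral>\<^sup>+s. (\<integral>\<^sup>+om. ?w R s om \<partial>M) \<partial>lborel)" by (intro nn_integral_add mw meas)
 also have "\<dots> = (\<integral>\<^sup>+om. (\<integral>\<^sup>+s. ?w L s om \<partial>lborel) \<partial>M) + (\<integral>\<^sup>+om. (\<integral>\<^sup>+s. ?w R s om \<partial>lborel) \<partial>M)" by (simp only: swap[OF meas(2)] swap[OF meas(3)])
 finally have main: "(\<integral>\<^sup>+om. (\<integral>\<^sup>+s. ?w P s om \<partial>lborel) \<partial>M) \<le>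
   (\<integral>\<^sup>+om. (\<integral>\<^sup>+s. ?w L s om \<partial>lborel) \<partial>M) + (\<integral>\<^sup>+om. (\<integral>\<^sup>+s. ?w R s om \<partial>lborel) \<partial>M)" .
 have eR: "(\<integral>\<^sup>+om. (\<integral>\<^sup>+s. ?w R s om \<partial>lborel) \<partial>M) = (\<integral>\<^sup>+om. ennreal (a ^ 4 / 16 * (Q n om)\<^sup>2) \<partial>M)"
 proof (intro nn_integral_cong)
  fix om
  have *: "R s om / s = exp (- (s\<^sup>2 * V2 n om)) * (0 * s\<^sup>2 + a ^ 4 * (pair_sq X n om)\<^sup>2 / 8 * s ^ 4) / s" for s
   by (simp add: R_def power_mult_distrib mult_ac)
  show "(\<integral>\<^sup>+s. ?w R s om \<partial>lborel) = ennreal (a ^ 4 / 16 * (Q n om)\<^sup>2)"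
  proof (cases "V2 n om = 0")
   case True
   then show ?thesis using zero[OF True] by (simp add: R_def Q_def)
  next
   case False
   then have "0 < V2 n om" using V2_nn[of om] by simp
   have "(\<integral>\<^sup>+s. ?w R s om \<partial>lborel) = ennreal ((0 / V2 n om + a ^ 4 * (pair_sq X n om)\<^sup>2 / 8 / (V2 n om)\<^sup>2) / 2)"
    unfolding * by (rule gaussian_quartic_scaled_nn_integral) (use \<open>0 < V2 n om\<close> in auto)
   also have "(0 / V2 n om + a ^ 4 * (pair_sq X n om)\<^sup>2 / 8 / (V2 n om)\<^sup>2) / 2 = a ^ 4 / 16 * (Q n om)\<^sup>2" by (simp add: Q_def power_divide)
   finally show ?thesis .
  qed
 qed
 have eP: "(\<integral>\<^sup>+om. (\<integral>\<^sup>+s. ?w P s om \<partial>lborel) \<partial>M) = (\<integral>\<^sup>+om. ennreal (a\<^sup>2 / 4 * Q n om + a ^ 4 / 24 * K n om) \<partial>M)"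
 proof (intro nn_integral_cong)
  fix om
  have *: "P s om / s = exp (- (s\<^sup>2 * V2 n om)) * (a\<^sup>2 * pair_sq X n om / 2 * s\<^sup>2 + a ^ 4 * pair_fourth X n om / 12 * s ^ 4) / s" for s
   by (simp add: P_def power_mult_distrib mult_ac)
  show "(\<integral>\<^sup>+s. ?w P s om \<partial>lborel) = ennreal (a\<^sup>2 / 4 * Q n om + a ^ 4 / 24 * K n om)"
  proof (cases "V2 n om = 0")
   case True
   then show ?thesis using zero[OF True] by (simp add: P_def Q_def K_def)
  next
   case False
   then have "0 < V2 n om" using V2_nn[of om] by simp
   have "(\<integral>\<^sup>+s. ?w P s om \<partial>lborel) = ennreal ((a\<^sup>2 * pair_sq X n om / 2 / V2 n om + a ^ 4 * pair_fourth X n om / 12 / (V2 n om)\<^sup>2) / 2)"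
    unfolding * by (rule gaussian_quartic_scaled_nn_integral) (use \<open>0 < V2 n om\<close> sq(1) pair_fourth_le(1) in auto)
   also have "(a\<^sup>2 * pair_sq X n om / 2 / V2 n om + a ^ 4 * pair_fourth X n om / 12 / (V2 n om)\<^sup>2) / 2 = a\<^sup>2 / 4 * Q n om + a ^ 4 / 24 * K n om"
    by (simp add: Q_def K_def add_divide_distrib)
   finally show ?thesis .
  qed
 qed
 have "(\<integral>\<^sup>+om. (\<integral>\<^sup>+s. ?w L s om \<partial>lborel) \<partial>M) = (\<integral>\<^sup>+om. (\<integral>\<^sup>+s. ?w G s om \<partial>lborel) \<partial>M)"
 proof (rule nn_integral_cong)
  fix om
  show "(\<integral>\<^sup>+s. ?w L s om \<partial>lborel) = (\<integral>\<^sup>+s. ?w G s om \<partial>lborel)"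
  proof (cases "V2 n om = 0")
   case True
   then show ?thesis using zero[OF True] by (simp add: L_def G_def T_def)
  next
   case False
   then have pos: "0 < V2 n om" using V2_nn[of om] by simp
   have "V2 n om powr (- 1 / 2) = 1 / sqrt (V2 n om)" using pos powr_half_sqrt[of "V2 n om"] powr_minus_divide[of "V2 n om" "1 / 2"] by simp
   then have "L s om = G (sqrt (V2 n om) * s) om" for s using pos by (simp add: L_def G_def T_def power_mult_distrib mult_ac)
   then show ?thesis using scale_invariant_nn_integral[of "%s. G s om" "sqrt (V2 n om)"] pos nn(4) by (simp add: G_def)
  qed
 qed
 also have "\<dots> = (\<integral>\<^sup>+s. (\<integral>\<^sup>+om. ?w G s om \<partial>M) \<partial>lborel)" by (rule swap[symmetric]) (rule meas)
 also have "\<dots> = (\<integral>\<^sup>+s. ennreal (indicator {0<..} s * (exp (- s\<^sup>2) * (1 - expectation (%om. cos (a * s * T n om))) / s)) \<partial>lborel)"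
 proof (intro nn_integral_cong)
  fix s
  have ic: "integrable M (%om. cos (a * s * T n om))" by (rule integrable_const_bound[where B = 1]) auto
  have iG: "integrable M (G s)" unfolding G_def[abs_def] by (intro integrable_mult_right L_integrable_diff ic) auto
  have EG: "expectation (G s) = exp (- s\<^sup>2) * (1 - expectation (%om. cos (a * s * T n om)))"
   unfolding G_def[abs_def] integral_mult_right_zero using ic by (subst L_integral_diff) (auto simp: prob_space)
  have "(\<integral>\<^sup>+om. ennreal (G s om) \<partial>M) = ennreal (expectation (G s))" by (rule nn_integral_eq_integral[OF iG]) (use nn in auto)
  moreover have "0 \<le> indicator {0<..} s / s" by (auto simp: indicator_def)
  ultimately have "(\<integral>\<^sup>+om. ?w G s om \<partial>M) = ennreal (indicator {0<..} s / s * expectation (G s))"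
   unfolding inner[OF meas(4)] by (simp only: ennreal_mult')
  also have "indicator {0<..} s / s * expectation (G s) = indicator {0<..} s * (exp (- s\<^sup>2) * (1 - expectation (%om. cos (a * s * T n om))) / s)"
   unfolding EG by simp
  finally show "(\<integral>\<^sup>+om. ?w G s om \<partial>M) = ennreal (indicator {0<..} s * (exp (- s\<^sup>2) * (1 - expectation (%om. cos (a * s * T n om))) / s))" .
 qed
 finally show ?thesis using main unfolding eP eR by simp
qed

text \<open>Boundedness of \<open>E T\<^sup>2\<close> supplies the integrable majorant \<open>s exp(-
  s\<^sup>2)\<close> near zero, where \<open>ds / s\<close> is singular. The limit is computed with
  \<open>E cos(a s N) = exp(- a\<^sup>2 s\<^sup>2 / 2)\<close> and bounded by the third-order expansion of
  the exponential.\<close>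
lemma gaussian_mixture_limit:
 fixes T :: "nat \<Rightarrow> 'a \<Rightarrow> real"
 assumes T: "conv_std_normal T" and int: "\<And>n. integrable M (%om. (T n om)\<^sup>2)" and bd: "\<And>n. expectation (%om. (T n om)\<^sup>2) \<le> C"
 obtains r R where "r \<longlonglongrightarrow> R" "R \<le> a\<^sup>2 / 4 - a ^ 4 / 16 + a ^ 6 / 48" "\<And>n. 0 \<le> r n"
  "\<And>n. (\<integral>\<^sup>+s. ennreal (indicator {0<..} s * (exp (- s\<^sup>2) * (1 - expectation (%om. cos (a * s * T n om))) / s)) \<partial>lborel) = ennreal (r n)"
proof -
 have [measurable]: "random_variable borel (T n)" for n using conv_std_normal_measurable[OF T] .
 interpret pair_sigma_finite lborel M by (intro pair_sigma_finite.intro sigma_finite_lborel sigma_finite_measure_axioms)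
 define g where "g n s = indicator {0<..} s * (exp (- s\<^sup>2) * (1 - expectation (%om. cos (a * s * T n om))) / s)" for n s
 define g' where "g' s = indicator {0<..} s * (exp (- s\<^sup>2) * (1 - exp (- ((a * s)\<^sup>2) / 2)) / s)" for s :: real
 let ?h = "%k s. indicator {0<..} s * (exp (- s\<^sup>2) * s ^ (2 * k + 2) / s) :: real"
 note h = gaussian_odd_integral
 have ih: "integrable lborel (?h k)" for k using h[of k] by (simp only: has_bochner_integral_iff)
 have ic: "integrable M (%om. cos (t * T n om))" for t n by (rule integrable_const_bound[where B = 1]) auto
 have cos_le: "expectation (%om. cos (t * T n om)) \<le> 1" for t n using integral_mono[OF ic[of t n], of "%_. 1"] by (simp add: prob_space)
 have cos_ge: "1 - expectation (%om. cos (t * T n om)) \<le> t\<^sup>2 * C / 2" for t n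
 proof -
  have "1 - expectation (%om. cos (t * T n om)) = expectation (%om. 1 - cos (t * T n om))"
   using ic by (subst L_integral_diff) (auto simp: prob_space)
  also have "\<dots> \<le> expectation (%om. t\<^sup>2 / 2 * (T n om)\<^sup>2)"
  proof (rule integral_mono)
   show "integrable M (%om. 1 - cos (t * T n om))" using ic by (intro L_integrable_diff) auto
   show "integrable M (%om. t\<^sup>2 / 2 * (T n om)\<^sup>2)" by (intro integrable_mult_right int)
   show "1 - cos (t * T n om) \<le> t\<^sup>2 / 2 * (T n om)\<^sup>2" for om using one_minus_cos_le[of "t * T n om"] by (simp add: power_mult_distrib)
  qed
  also have "\<dots> = t\<^sup>2 / 2 * expectation (%om. (T n om)\<^sup>2)" by (rule integral_mult_right_zero)
  also have "\<dots> \<le> t\<^sup>2 / 2 * C" by (intro mult_left_mono bd) simp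
  finally show ?thesis by simp
 qed
 have g_nn: "0 \<le> g n s" for n s using cos_le[of "a * s" n] by (auto simp: g_def indicator_def)
 have g_le: "g n s \<le> a\<^sup>2 * C / 2 * ?h 0 s" for n s
 proof (cases "0 < s")
  case True
  have "exp (- s\<^sup>2) * (1 - expectation (%om. cos (a * s * T n om))) / s \<le> exp (- s\<^sup>2) * ((a * s)\<^sup>2 * C / 2) / s"
   using True by (intro divide_right_mono mult_left_mono cos_ge) auto
  then show ?thesis using True by (simp add: g_def power_mult_distrib power2_eq_square mult_ac)
 qed (simp add: g_def)
 have [measurable]: "g n \<in> borel_measurable lborel" for n unfolding g_def[abs_def] by measurable
 have [measurable]: "g' \<in> borel_measurable lborel" unfolding g'_def[abs_def] by measurable
 have lim: "(%n. g n s) \<longlonglongrightarrow> g' s" for s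
 proof -
  have "(%n. Re (expectation (%om. iexp (a * s * T n om)))) \<longlonglongrightarrow> Re (complex_of_real (exp (- ((a * s)\<^sup>2) / 2)))"
   using T unfolding conv_std_normal_iff_char[of T, OF conv_std_normal_measurable[OF T]] by (intro tendsto_Re) blast
  moreover have "Re (expectation (%om. iexp (a * s * T n om))) = expectation (%om. cos (a * s * T n om))" for n
  proof -
   have "integrable M (%om. iexp (a * s * T n om))" by (rule integrable_const_bound[where B = 1]) auto
   then have "Re (expectation (%om. iexp (a * s * T n om))) = expectation (%om. Re (iexp (a * s * T n om)))" by (rule integral_Re[symmetric])
   then show ?thesis by (simp add: Re_exp)
  qed
  ultimately have c: "(%n. expectation (%om. cos (a * s * T n om))) \<longlonglongrightarrow> exp (- ((a * s)\<^sup>2) / 2)" by simp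
  have "(%n. indicator {0<..} s / s * exp (- s\<^sup>2) * (1 - expectation (%om. cos (a * s * T n om)))) \<longlonglongrightarrow>
    indicator {0<..} s / s * exp (- s\<^sup>2) * (1 - exp (- ((a * s)\<^sup>2) / 2))" by (intro tendsto_mult tendsto_const tendsto_diff c)
  then show ?thesis by (simp add: g_def g'_def mult.assoc)
 qed
 have dom: "AE s in lborel. norm (g n s) \<le> a\<^sup>2 * C / 2 * ?h 0 s" for n using g_nn g_le by (intro AE_I2) (simp only: real_norm_def abs_of_nonneg)
 have id: "integrable lborel (%s. a\<^sup>2 * C / 2 * ?h 0 s)" by (intro integrable_mult_right ih)
 have ig': "integrable lborel g'" by (rule integrable_dominated_convergence[where s = g and w = "%s. a\<^sup>2 * C / 2 * ?h 0 s"]) (use id lim dom in auto)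
 have ign: "integrable lborel (g n)" for n
  by (rule integrable_dominated_convergence2[where f = g' and w = "%s. a\<^sup>2 * C / 2 * ?h 0 s"]) (use id lim dom in auto)
 have "(%n. integral\<^sup>L lborel (g n)) \<longlonglongrightarrow> integral\<^sup>L lborel g'"
  by (rule integral_dominated_convergence[where w = "%s. a\<^sup>2 * C / 2 * ?h 0 s"]) (use id lim dom in auto)
 moreover have "integral\<^sup>L lborel g' \<le> a\<^sup>2 / 4 - a ^ 4 / 16 + a ^ 6 / 48"
 proof -
  have hb: "has_bochner_integral lborel (%s. a\<^sup>2 / 2 * ?h 0 s - a ^ 4 / 8 * ?h 1 s + a ^ 6 / 48 * ?h 2 s)
    (a\<^sup>2 / 2 * (fact 0 / 2) - a ^ 4 / 8 * (fact 1 / 2) + a ^ 6 / 48 * (fact 2 / 2))"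
   by (intro has_bochner_integral_add has_bochner_integral_diff has_bochner_integral_mult_right h)
  have "g' s \<le> a\<^sup>2 / 2 * ?h 0 s - a ^ 4 / 8 * ?h 1 s + a ^ 6 / 48 * ?h 2 s" for s
  proof (cases "0 < s")
   case True
   let ?v = "(a * s)\<^sup>2 / 2"
   have "exp (- s\<^sup>2) * (1 - exp (- ?v)) / s \<le> exp (- s\<^sup>2) * (?v - ?v\<^sup>2 / 2 + ?v ^ 3 / 6) / s"
    using True by (intro divide_right_mono mult_left_mono one_minus_exp_neg_le) auto
   also have "?v - ?v\<^sup>2 / 2 + ?v ^ 3 / 6 = a\<^sup>2 / 2 * s ^ 2 - a ^ 4 / 8 * s ^ 4 + a ^ 6 / 48 * s ^ 6"
    by (simp add: power_mult_distrib power_divide flip: power_mult)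
   also have "exp (- s\<^sup>2) * (a\<^sup>2 / 2 * s ^ 2 - a ^ 4 / 8 * s ^ 4 + a ^ 6 / 48 * s ^ 6) / s =
     a\<^sup>2 / 2 * ?h 0 s - a ^ 4 / 8 * ?h 1 s + a ^ 6 / 48 * ?h 2 s"
   proof -
    have "2 * 0 + 2 = (2::nat)" "2 * 1 + 2 = (4::nat)" "2 * 2 + 2 = (6::nat)" "indicator {0<..} s = (1::real)" using True by auto
    then show ?thesis
     by (simp only: mult_1_left) (simp only: distrib_left right_diff_distrib add_divide_distrib diff_divide_distrib times_divide_eq_left times_divide_eq_right mult_ac divide_divide_eq_left)
   qed
   finally show ?thesis using True by (simp add: g'_def)
  qed (simp add: g'_def)
  moreover have "integrable lborel (%s. a\<^sup>2 / 2 * ?h 0 s - a ^ 4 / 8 * ?h 1 s + a ^ 6 / 48 * ?h 2 s)"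
   using hb by (simp only: has_bochner_integral_iff)
  ultimately have "integral\<^sup>L lborel g' \<le> (\<integral>s. a\<^sup>2 / 2 * ?h 0 s - a ^ 4 / 8 * ?h 1 s + a ^ 6 / 48 * ?h 2 s \<partial>lborel)" by (intro integral_mono ig')
  also have "\<dots> = a\<^sup>2 / 2 * (fact 0 / 2) - a ^ 4 / 8 * (fact 1 / 2) + a ^ 6 / 48 * (fact 2 / 2)" by (rule has_bochner_integral_integral_eq[OF hb])
  finally show ?thesis by simp
 qed
 moreover have "0 \<le> integral\<^sup>L lborel (g n)" for n by (rule integral_nonneg_AE) (use g_nn in auto)
 moreover have "(\<integral>\<^sup>+s. ennreal (indicator {0<..} s * (exp (- s\<^sup>2) * (1 - expectation (%om. cos (a * s * T n om))) / s)) \<partial>lborel) = ennreal (integral\<^sup>L lborel (g n))" for n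
  using nn_integral_eq_integral[OF ign[of n]] g_nn unfolding g_def by simp
 ultimately show ?thesis by (rule that)
qed

end

section \<open>Fourth-order shares of the pairs\<close>

context prob_space
begin

lemma pair_ratio_le:
 shows "0 \<le> pair_sq X n om / (\<Sum>i=1..2 * n. (X i om)\<^sup>2)" "pair_sq X n om / (\<Sum>i=1..2 * n. (X i om)\<^sup>2) \<le> 2"
  and "0 \<le> pair_fourth X n om / (\<Sum>i=1..2 * n. (X i om)\<^sup>2)\<^sup>2" "pair_fourth X n om / (\<Sum>i=1..2 * n. (X i om)\<^sup>2)\<^sup>2 \<le> 4"
proof -
 let ?V = "\<Sum>i=1..2 * n. (X i om)\<^sup>2"
 have V: "0 \<le> ?V" by (simp add: sum_nonneg)
 show 1: "0 \<le> pair_sq X n om / ?V" using V pair_sq_le(1) by (intro divide_nonneg_nonneg)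
 show 2: "pair_sq X n om / ?V \<le> 2" using V pair_sq_le(2)[of X n om] by (cases "?V = 0") (auto simp: divide_le_eq)
 show "0 \<le> pair_fourth X n om / ?V\<^sup>2" using pair_fourth_le(1) by (intro divide_nonneg_nonneg) auto
 have "pair_fourth X n om / ?V\<^sup>2 \<le> (pair_sq X n om)\<^sup>2 / ?V\<^sup>2" by (intro divide_right_mono pair_fourth_le(2)) auto
 also have "\<dots> = (pair_sq X n om / ?V)\<^sup>2" by (simp add: power_divide)
 also have "\<dots> \<le> 2\<^sup>2" using 1 2 by (intro power_mono)
 finally show "pair_fourth X n om / ?V\<^sup>2 \<le> 4" by simp
qed

lemma pair_measurable:
 fixes X :: "nat \<Rightarrow> 'a \<Rightarrow> real"
 assumes iid: "iid borel X"
 shows "random_variable borel (pair_sq X n)" "random_variable borel (pair_fourth X n)" "random_variable borel (%om. \<Sum>i=1..2 * n. (X i om)\<^sup>2)"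
proof -
 note [measurable] = iid_measurable[OF iid]
 show "random_variable borel (pair_sq X n)" "random_variable borel (pair_fourth X n)" "random_variable borel (%om. \<Sum>i=1..2 * n. (X i om)\<^sup>2)"
  unfolding pair_sq_def[abs_def] pair_fourth_def[abs_def] by measurable
qed

text \<open>The ratio differs from one by twice the sum of the products within pairs, divided by
  \<open>V\<^sup>2\<close>. These products have mean \<open>(E |X|)\<^sup>2\<close> in absolute value, so
  their sum is of order \<open>n\<close>, whereas \<open>V\<^sup>2 / n\<close> exceeds every constant by
  the weak law for truncated squares.\<close>
lemma pair_sq_ratio_tendsto_1:
 fixes X :: "nat \<Rightarrow> 'a \<Rightarrow> real"
 assumes iid: "iid borel X" and int: "integrable M (X 0)" and heavy: "\<not> integrable M (%om. (X 0 om)\<^sup>2)"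
 shows "(%n. expectation (%om. \<bar>pair_sq X n om / (\<Sum>i=1..2 * n. (X i om)\<^sup>2) - 1\<bar>)) \<longlonglongrightarrow> 0"
proof -
 note [measurable] = iid_measurable[OF iid] pair_measurable[OF iid]
 define V2 where "V2 n om = (\<Sum>i=1..2 * n. (X i om)\<^sup>2)" for n om
 define m where "m = expectation (%om. \<bar>X 0 om\<bar>)"
 define P where "P n om = (\<Sum>k<n. \<bar>X (2 * k + 1) om\<bar> * \<bar>X (2 * k + 2) om\<bar>)" for n om
 have V2m[measurable]: "random_variable borel (V2 n)" for n unfolding V2_def[abs_def] by measurable
 have V2_nn: "0 \<le> V2 n om" for n om by (simp add: V2_def sum_nonneg)
 have m_nn: "0 \<le> m" by (simp add: m_def)
 have abs_int: "integrable M (%om. \<bar>X 0 om\<bar>)" using int by simp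
 have pair: "integrable M (%om. \<bar>X i om\<bar> * \<bar>X j om\<bar>) \<and> expectation (%om. \<bar>X i om\<bar> * \<bar>X j om\<bar>) = m\<^sup>2" if "i \<noteq> j" for i j
  using iid_prod_integrable[OF iid, of "{i, j}" "%_ x. \<bar>x\<bar>"] iid_prod_expectation[OF iid, of "{i, j}" "%_ x. \<bar>x\<bar>"] abs_int that
  by (simp add: m_def power2_eq_square)
 have P_int: "integrable M (P n)" for n unfolding P_def[abs_def] using pair by (intro L_integrable_sum) simp
 have P_exp: "expectation (P n) = real n * m\<^sup>2" for n unfolding P_def[abs_def] using pair by (subst L_integral_sum) simp_all
 have P_nn: "0 \<le> P n om" for n om by (simp add: P_def sum_nonneg)
 have sq_eq: "pair_sq X n om = V2 n om - 2 * (\<Sum>k<n. X (2 * k + 1) om * X (2 * k + 2) om)" for n om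
 proof -
  have "pair_sq X n om = (\<Sum>k<n. ((X (2 * k + 1) om)\<^sup>2 + (X (2 * k + 2) om)\<^sup>2) - 2 * (X (2 * k + 1) om * X (2 * k + 2) om))"
   unfolding pair_sq_def by (intro sum.cong refl) (simp add: power2_diff)
  also have "\<dots> = V2 n om - 2 * (\<Sum>k<n. X (2 * k + 1) om * X (2 * k + 2) om)" unfolding sum_subtractf V2_def sum_consecutive_pairs sum_distrib_left ..
  finally show ?thesis .
 qed
 have cross: "\<bar>\<Sum>k<n. X (2 * k + 1) om * X (2 * k + 2) om\<bar> \<le> P n om" for n om unfolding P_def abs_mult[symmetric] by (rule sum_abs)
 let ?D = "%n om. \<bar>pair_sq X n om / V2 n om - 1\<bar>"
 have D_le1: "?D n om \<le> 1" for n om using pair_ratio_le(1,2)[of X n om] unfolding V2_def[symmetric] by (simp add: abs_le_iff)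
 have D_int: "integrable M (?D n)" for n by (rule integrable_const_bound[where B = 1]) (use D_le1 in auto)
 have bound: "?D n om \<le> 2 / (L * real n) * P n om + indicator {..<L * real n} (V2 n om)" if "0 < L" "0 < n" for L n om
 proof (cases "V2 n om < L * real n")
  case True
  then show ?thesis using D_le1[of n om] P_nn[of n om] that by (simp add: add_increasing)
 next
  case False
  have Ln: "0 < L * real n" using that by simp
  then have V: "0 < V2 n om" using False by linarith
  have "pair_sq X n om / V2 n om - 1 = - 2 * (\<Sum>k<n. X (2 * k + 1) om * X (2 * k + 2) om) / V2 n om"
   unfolding sq_eq using V by (simp add: field_simps)
  then have "?D n om = 2 * \<bar>\<Sum>k<n. X (2 * k + 1) om * X (2 * k + 2) om\<bar> / V2 n om" using V by (simp add: abs_mult)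
  also have "\<dots> \<le> 2 * P n om / (L * real n)" using False Ln by (intro frac_le mult_left_mono cross) (auto simp: P_nn)
  finally show ?thesis using False by simp
 qed
 have bound_E: "expectation (?D n) \<le> 2 * m\<^sup>2 / L + prob {om\<in>space M. V2 n om < L * real n}" if "0 < L" "0 < n" for L n
 proof -
  have ind: "(%om. indicator {..<L * real n} (V2 n om) :: real) \<in> borel_measurable M" by measurable
  have iind: "integrable M (%om. indicator {..<L * real n} (V2 n om) :: real)" by (rule integrable_const_bound[where B = 1]) (use ind in auto)
  have "expectation (?D n) \<le> expectation (%om. 2 / (L * real n) * P n om + indicator {..<L * real n} (V2 n om))"
   by (intro integral_mono D_int L_integrable_add integrable_mult_right P_int iind bound[OF that])
  also have "\<dots> = 2 / (L * real n) * expectation (P n) + expectation (%om. indicator {..<L * real n} (V2 n om))"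
   by (simp only: L_integral_add[OF integrable_mult_right[OF P_int] iind] integral_mult_right_zero)
  also have "expectation (%om. indicator {..<L * real n} (V2 n om)) = prob {om\<in>space M. V2 n om < L * real n}"
  proof -
   have "expectation (%om. indicator {..<L * real n} (V2 n om)) = expectation (indicator {om\<in>space M. V2 n om < L * real n})"
    by (intro L_integral_cong) (auto simp: indicator_def)
   also have "\<dots> = prob ({om\<in>space M. V2 n om < L * real n} \<inter> space M)" by (rule L_integral_indicator)
   also have "{om\<in>space M. V2 n om < L * real n} \<inter> space M = {om\<in>space M. V2 n om < L * real n}" by blast
   finally show ?thesis .
  qed
  also have "2 / (L * real n) * expectation (P n) = 2 * m\<^sup>2 / L" unfolding P_exp using that by (simp add: field_simps)
  finally show ?thesis .
 qed
 have small: "(%n. prob {om\<in>space M. V2 n om < L * real n}) \<longlonglongrightarrow> 0" if "0 < L" for L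
 proof -
  have "\<exists>k::nat. L < expectation (%om. (X 0 om)\<^sup>2 * indicator {..real k} \<bar>X 0 om\<bar>)"
  proof (rule ccontr)
   assume "\<not> ?thesis"
   then have le: "expectation (%om. (X 0 om)\<^sup>2 * indicator {..real k} \<bar>X 0 om\<bar>) \<le> L" for k :: nat by (meson not_le)
   have int: "integrable M (%om. (X 0 om)\<^sup>2 * indicator {..real k} \<bar>X 0 om\<bar>)" for k :: nat by (rule truncated_integrable) measurable
   have meas: "random_variable borel (%om. (X 0 om)\<^sup>2)" "random_variable borel (X 0)" by measurable
   have "integrable M (%om. (X 0 om)\<^sup>2)" by (rule integrable_of_bounded_truncations[OF meas _ int le]) simp
   then show False using heavy by simp
  qed
  then obtain k :: nat where k: "L < expectation (%om. (X 0 om)\<^sup>2 * indicator {..real k} \<bar>X 0 om\<bar>)" by blast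
  define Y where "Y i om = (X i om)\<^sup>2 * indicator {..real k} \<bar>X i om\<bar>" for i om
  have iidY: "iid borel Y" using iid_compose[OF iid, of "%x. x\<^sup>2 * indicator {..real k} \<bar>x\<bar>"] unfolding Y_def[abs_def] by simp
  note [measurable] = iid_measurable[OF iidY]
  have "integrable M (Y 0)" unfolding Y_def[abs_def] by (rule truncated_integrable) simp
  then have wl: "vanishes (%n om. (\<Sum>i=1..n. Y i om) / real n - expectation (Y 0))" by (rule weak_law[OF iidY])
  define e where "e = expectation (Y 0) - L / 2"
  have e: "0 < e" using k that by (simp add: e_def Y_def[abs_def])
  have "(%n. prob {om\<in>space M. e \<le> \<bar>(\<Sum>i=1..2 * n. Y i om) / real (2 * n) - expectation (Y 0)\<bar>}) \<longlonglongrightarrow> 0"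
   using LIMSEQ_subseq_LIMSEQ[OF vanishesD[OF wl e], of "%n. 2 * n"] by (simp add: o_def strict_mono_def)
  then show ?thesis
  proof (rule prob_le_tendsto_0)
   show "\<forall>\<^sub>F n in sequentially. {om\<in>space M. V2 n om < L * real n} \<subseteq> {om\<in>space M. e \<le> \<bar>(\<Sum>i=1..2 * n. Y i om) / real (2 * n) - expectation (Y 0)\<bar>} \<and>
     {om\<in>space M. e \<le> \<bar>(\<Sum>i=1..2 * n. Y i om) / real (2 * n) - expectation (Y 0)\<bar>} \<in> events" using eventually_gt_at_top[of 0]
   proof eventually_elim
    case (elim n)
    have "e \<le> \<bar>(\<Sum>i=1..2 * n. Y i om) / real (2 * n) - expectation (Y 0)\<bar>" if lt: "V2 n om < L * real n" for om
    proof -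
     have "(\<Sum>i=1..2 * n. Y i om) \<le> V2 n om" unfolding V2_def Y_def by (intro sum_mono) (auto simp: indicator_def)
     then have "(\<Sum>i=1..2 * n. Y i om) / real (2 * n) \<le> L * real n / real (2 * n)" using lt by (intro divide_right_mono) auto
     also have "\<dots> = L / 2" using elim by simp
     finally show ?thesis unfolding e_def by linarith
    qed
    then show ?case by auto
   qed
  qed
 qed
 have "(%n. expectation (?D n)) \<longlonglongrightarrow> 0"
 proof (rule order_tendstoI)
  fix y :: real assume "y < 0"
  have "y < expectation (?D n)" for n by (rule less_le_trans[OF \<open>y < 0\<close>], rule integral_nonneg_AE) simp
  then show "\<forall>\<^sub>F n in sequentially. y < expectation (?D n)" by (rule always_eventually[OF allI])
 next
  fix y :: real assume y: "0 < y"
    \<comment> \<open>With this level the cross terms contribute at most \<open>y / 2\<close>.\<close>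
  define L where "L = 4 * m\<^sup>2 / y + 1"
  have L: "0 < L" using y by (simp add: L_def add_nonneg_pos)
  have "4 * m\<^sup>2 \<le> L * y" using y by (simp add: L_def field_simps)
  then have Lm: "2 * m\<^sup>2 / L \<le> y / 2" using L by (simp add: field_simps)
  have "\<forall>\<^sub>F n in sequentially. prob {om\<in>space M. V2 n om < L * real n} < y / 2" using order_tendstoD(2)[OF small[OF L], of "y / 2"] y by simp
  then show "\<forall>\<^sub>F n in sequentially. expectation (?D n) < y" using eventually_gt_at_top[of 0]
  proof eventually_elim
   case (elim n)
   have "expectation (?D n) \<le> y / 2 + prob {om\<in>space M. V2 n om < L * real n}" using bound_E[OF L elim(2)] Lm by linarith
   also have "\<dots> < y / 2 + y / 2" using elim(1) by linarith
   finally show ?case by simp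
  qed
 qed
 then show ?thesis by (simp only: V2_def)
qed

lemma conv_std_normal_subseq:
 assumes T: "conv_std_normal T" and f: "strict_mono f"
 shows "conv_std_normal (%n. T (f n))"
proof -
 have m: "random_variable borel (T n)" for n using conv_std_normal_measurable[OF T] .
 show ?thesis unfolding conv_std_normal_iff_char[of "%n. T (f n)", OF m]
 proof
  fix t
  have "(%n. expectation (%om. iexp (t * T n om))) \<longlonglongrightarrow> complex_of_real (exp (- (t\<^sup>2) / 2))"
   using T unfolding conv_std_normal_iff_char[of T, OF m] by blast
  from LIMSEQ_subseq_LIMSEQ[OF this f]
  show "(%n. expectation (%om. iexp (t * T (f n) om))) \<longlonglongrightarrow> complex_of_real (exp (- (t\<^sup>2) / 2))" by (simp add: o_def)
 qed
qed

text \<open>In the limit the second-order terms of both sides agree, and so do the \<open>a^4\<close> terms: for the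
  normal law the contribution \<open>- a^4 / 16\<close> is matched by the square of the pair ratio. What
  remains is \<open>a^4 / 24\<close> times the fourth-order share, bounded by \<open>a^6 / 48\<close>;
  hence its upper limit is at most \<open>a\<^sup>2 / 2\<close> for every \<open>a\<close>.\<close>
lemma pair_fourth_ratio_tendsto_0:
 fixes X :: "nat \<Rightarrow> 'a \<Rightarrow> real"
 assumes iid: "iid borel X"
 defines "V2 \<equiv> %n om. \<Sum>i=1..2 * n. (X i om)\<^sup>2"
 defines "T \<equiv> %n om. (\<Sum>i=1..2 * n. X i om) * V2 n om powr (- 1 / 2)"
 assumes T: "conv_std_normal T" and int: "\<And>n. integrable M (%om. (T n om)\<^sup>2)" and bd: "\<And>n. expectation (%om. (T n om)\<^sup>2) \<le> C"
  and sq: "(%n. expectation (%om. \<bar>pair_sq X n om / V2 n om - 1\<bar>)) \<longlonglongrightarrow> 0"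
 shows "(%n. expectation (%om. pair_fourth X n om / (V2 n om)\<^sup>2)) \<longlonglongrightarrow> 0"
proof -
 note [measurable] = iid_measurable[OF iid] pair_measurable[OF iid]
 have [measurable]: "random_variable borel (V2 n)" for n unfolding V2_def by measurable
 define Q where "Q n om = pair_sq X n om / V2 n om" for n om
 define K where "K n om = pair_fourth X n om / (V2 n om)\<^sup>2" for n om
 have [measurable]: "random_variable borel (Q n)" "random_variable borel (K n)" for n unfolding Q_def[abs_def] K_def[abs_def] by measurable
 have Qb: "0 \<le> Q n om" "Q n om \<le> 2" and Kb: "0 \<le> K n om" "K n om \<le> 4" for n om unfolding Q_def K_def V2_def by (rule pair_ratio_le)+
 have Q2b: "(Q n om)\<^sup>2 \<le> 4" for n om using power_mono[OF Qb(2) Qb(1), of n om 2] by simp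
 have iQ: "integrable M (Q n)" for n by (rule integrable_const_bound[where B = 2]) (use Qb in auto)
 have iK: "integrable M (K n)" for n by (rule integrable_const_bound[where B = 4]) (use Kb in auto)
 have iQ2: "integrable M (%om. (Q n om)\<^sup>2)" for n by (rule integrable_const_bound[where B = 4]) (use Q2b in auto)
 have iD: "integrable M (%om. \<bar>Q n om - 1\<bar>)" for n using iQ[of n] by (intro integrable_abs L_integrable_diff) auto
 have sq': "(%n. expectation (%om. \<bar>Q n om - 1\<bar>)) \<longlonglongrightarrow> 0" using sq unfolding Q_def .
 have EQ: "(%n. expectation (Q n)) \<longlonglongrightarrow> 1"
 proof (rule LIM_zero_cancel, rule Lim_null_comparison[OF _ sq'], intro always_eventually allI)
  fix n
  have "expectation (Q n) - 1 = expectation (%om. Q n om - 1)" using iQ by (simp add: prob_space)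
  then show "norm (expectation (Q n) - 1) \<le> expectation (%om. \<bar>Q n om - 1\<bar>)" using integral_norm_bound[of M "%om. Q n om - 1"] by simp
 qed
 have EQ2: "(%n. expectation (%om. (Q n om)\<^sup>2)) \<longlonglongrightarrow> 1"
 proof (rule LIM_zero_cancel, rule Lim_null_comparison[OF _ tendsto_mult_right_zero[OF sq', of 3]], intro always_eventually allI)
  fix n
  have "expectation (%om. (Q n om)\<^sup>2) - 1 = expectation (%om. (Q n om)\<^sup>2 - 1)" using iQ2 by (simp add: prob_space)
  then have "norm (expectation (%om. (Q n om)\<^sup>2) - 1) \<le> expectation (%om. \<bar>(Q n om)\<^sup>2 - 1\<bar>)"
   using integral_norm_bound[of M "%om. (Q n om)\<^sup>2 - 1"] by simp
  also have "\<dots> \<le> expectation (%om. 3 * \<bar>Q n om - 1\<bar>)"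
  proof (rule integral_mono)
   show "integrable M (%om. \<bar>(Q n om)\<^sup>2 - 1\<bar>)" using iQ2 by (intro integrable_abs L_integrable_diff) auto
   show "integrable M (%om. 3 * \<bar>Q n om - 1\<bar>)" by (intro integrable_mult_right iD)
   fix om
   have "(Q n om)\<^sup>2 - 1 = (Q n om + 1) * (Q n om - 1)" by (simp add: power2_eq_square algebra_simps)
   then have "\<bar>(Q n om)\<^sup>2 - 1\<bar> = \<bar>Q n om + 1\<bar> * \<bar>Q n om - 1\<bar>" by (simp add: abs_mult)
   also have "\<dots> \<le> 3 * \<bar>Q n om - 1\<bar>" using Qb[of n om] by (intro mult_right_mono) auto
   finally show "\<bar>(Q n om)\<^sup>2 - 1\<bar> \<le> 3 * \<bar>Q n om - 1\<bar>" .
  qed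
  finally show "norm (expectation (%om. (Q n om)\<^sup>2) - 1) \<le> 3 * expectation (%om. \<bar>Q n om - 1\<bar>)" by simp
 qed
 have "(%n. expectation (K n)) \<longlonglongrightarrow> 0"
 proof (rule order_tendstoI)
  fix y :: real assume "y < 0"
  have "y < expectation (K n)" for n by (rule less_le_trans[OF \<open>y < 0\<close>], rule integral_nonneg_AE) (simp add: Kb)
  then show "\<forall>\<^sub>F n in sequentially. y < expectation (K n)" by (rule always_eventually[OF allI])
 next
  fix y :: real assume y: "0 < y"
    \<comment> \<open>The limiting bound is \<open>a\<^sup>2 / 2\<close>, which then is below \<open>y\<close>.\<close>
  define a where "a = sqrt y"
  have a: "0 < a" "a\<^sup>2 = y" using y by (auto simp: a_def)
  obtain r R where r: "r \<longlonglongrightarrow> R" "R \<le> a\<^sup>2 / 4 - a ^ 4 / 16 + a ^ 6 / 48" "\<And>n. 0 \<le> r n"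
   "\<And>n. (\<integral>\<^sup>+s. ennreal (indicator {0<..} s * (exp (- s\<^sup>2) * (1 - expectation (%om. cos (a * s * T n om))) / s)) \<partial>lborel) = ennreal (r n)"
   by (rule gaussian_mixture_limit[OF T int bd]) blast
  define m where "m n = 24 / a ^ 4 * (r n + a ^ 4 / 16 * expectation (%om. (Q n om)\<^sup>2) - a\<^sup>2 / 4 * expectation (Q n))" for n
  have K_le: "expectation (K n) \<le> m n" for n
  proof -
   have i1: "integrable M (%om. a\<^sup>2 / 4 * Q n om + a ^ 4 / 24 * K n om)" by (intro L_integrable_add integrable_mult_right iQ iK)
   have i2: "integrable M (%om. a ^ 4 / 16 * (Q n om)\<^sup>2)" by (intro integrable_mult_right iQ2)
   have "(\<integral>\<^sup>+om. ennreal (a\<^sup>2 / 4 * Q n om + a ^ 4 / 24 * K n om) \<partial>M) \<le> ennreal (r n) + (\<integral>\<^sup>+om. ennreal (a ^ 4 / 16 * (Q n om)\<^sup>2) \<partial>M)"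
    unfolding r(4)[symmetric] using self_normalized_pair_inequality[OF iid, of a n] unfolding Q_def K_def T_def V2_def .
   moreover have "(\<integral>\<^sup>+om. ennreal (a\<^sup>2 / 4 * Q n om + a ^ 4 / 24 * K n om) \<partial>M) = ennreal (expectation (%om. a\<^sup>2 / 4 * Q n om + a ^ 4 / 24 * K n om))"
    by (rule nn_integral_eq_integral[OF i1]) (use Qb Kb in auto)
   moreover have "(\<integral>\<^sup>+om. ennreal (a ^ 4 / 16 * (Q n om)\<^sup>2) \<partial>M) = ennreal (expectation (%om. a ^ 4 / 16 * (Q n om)\<^sup>2))"
    by (rule nn_integral_eq_integral[OF i2]) auto
   moreover have nn: "0 \<le> expectation (%om. a ^ 4 / 16 * (Q n om)\<^sup>2)" by (rule integral_nonneg_AE) auto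
   ultimately have "ennreal (expectation (%om. a\<^sup>2 / 4 * Q n om + a ^ 4 / 24 * K n om)) \<le> ennreal (r n + expectation (%om. a ^ 4 / 16 * (Q n om)\<^sup>2))"
    by (simp only: ennreal_plus[OF r(3) nn])
   then have "expectation (%om. a\<^sup>2 / 4 * Q n om + a ^ 4 / 24 * K n om) \<le> r n + expectation (%om. a ^ 4 / 16 * (Q n om)\<^sup>2)"
    using r(3)[of n] nn by (subst (asm) ennreal_le_iff) auto
   then have "a\<^sup>2 / 4 * expectation (Q n) + a ^ 4 / 24 * expectation (K n) \<le> r n + a ^ 4 / 16 * expectation (%om. (Q n om)\<^sup>2)"
    by (simp only: L_integral_add[OF integrable_mult_right[OF iQ] integrable_mult_right[OF iK]] integral_mult_right_zero)
   then show ?thesis using a(1) unfolding m_def by (simp add: field_simps)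
  qed
  have "m \<longlonglongrightarrow> 24 / a ^ 4 * (R + a ^ 4 / 16 * 1 - a\<^sup>2 / 4 * 1)" unfolding m_def[abs_def] by (intro tendsto_intros r(1) EQ EQ2)
  moreover have "24 / a ^ 4 * (R + a ^ 4 / 16 * 1 - a\<^sup>2 / 4 * 1) < y"
  proof -
   have "24 / a ^ 4 * (R + a ^ 4 / 16 * 1 - a\<^sup>2 / 4 * 1) \<le> 24 / a ^ 4 * (a ^ 6 / 48)" using r(2) by (intro mult_left_mono) auto
   also have "\<dots> = a\<^sup>2 / 2" using a(1) by (simp add: eval_nat_numeral field_simps)
   also have "\<dots> < y" using a(2) y by simp
   finally show ?thesis .
  qed
  ultimately have "\<forall>\<^sub>F n in sequentially. m n < y" by (rule order_tendstoD(2))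
  then show "\<forall>\<^sub>F n in sequentially. expectation (K n) < y" by eventually_elim (use K_le in \<open>auto intro: le_less_trans\<close>)
 qed
 then show ?thesis unfolding K_def .
qed

end

section \<open>Recovery of the scale\<close>

text \<open>Uses \<open>v + r \<le> (1 + v) (1 + r)\<close> and \<open>(1 - 2 r) (1 + r)\<^sup>2 \<le> 1\<close>.\<close>
lemma ratio_square_lower:
 fixes D v r g :: real
 assumes "0 \<le> v" "0 \<le> r" "0 < v + r" and g: "g \<le> 0 \<or> g \<le> 1 - 2 * r"
 shows "D ^ 4 / (1 + v)\<^sup>2 * g \<le> D ^ 4 / (v + r)\<^sup>2"
proof (cases "g \<le> 0")
 case True
 then have "D ^ 4 / (1 + v)\<^sup>2 * g \<le> 0" by (intro mult_nonneg_nonpos) auto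
 also have "0 \<le> D ^ 4 / (v + r)\<^sup>2" by simp
 finally show ?thesis .
next
 case False
 then have g: "0 \<le> g" "g \<le> 1 - 2 * r" using g by auto
 have "g * (1 + r)\<^sup>2 \<le> (1 - 2 * r) * (1 + r)\<^sup>2" using g by (intro mult_right_mono) auto
 also have "\<dots> = 1 - (3 * r\<^sup>2 + 2 * r ^ 3)" by (simp add: power2_eq_square power3_eq_cube algebra_simps)
 also have "\<dots> \<le> 1"
 proof -
  have "0 \<le> 3 * r\<^sup>2 + 2 * r ^ 3" using assms(2) by (intro add_nonneg_nonneg) auto
  then show ?thesis by linarith
 qed
 finally have *: "g * (1 + r)\<^sup>2 \<le> 1" .
 have "v + r \<le> (1 + v) * (1 + r)" using assms by (simp add: algebra_simps)
 then have "(v + r)\<^sup>2 \<le> ((1 + v) * (1 + r))\<^sup>2" using assms by (intro power_mono) auto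
 then have "g * (v + r)\<^sup>2 \<le> g * ((1 + v) * (1 + r))\<^sup>2" using g by (intro mult_left_mono) auto
 also have "\<dots> = (1 + v)\<^sup>2 * (g * (1 + r)\<^sup>2)" by (simp add: power_mult_distrib mult_ac)
 also have "\<dots> \<le> (1 + v)\<^sup>2 * 1" using * by (intro mult_left_mono) auto
 finally have "g * (v + r)\<^sup>2 \<le> (1 + v)\<^sup>2" by simp
 then have "g / (1 + v)\<^sup>2 \<le> 1 / (v + r)\<^sup>2" using assms by (simp add: divide_le_eq le_divide_eq)
 then have "D ^ 4 * (g / (1 + v)\<^sup>2) \<le> D ^ 4 * (1 / (v + r)\<^sup>2)" by (intro mult_left_mono) auto
 then show ?thesis by simp
qed

text \<open>As soon as one term is truncated, the left-hand side is negative, so a bound by an expression in the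
  untruncated sum is available in all relevant cases.\<close>
lemma truncated_sum_dichotomy:
 fixes z :: "'i \<Rightarrow> real"
 assumes "finite I" "\<And>i. i \<in> I \<Longrightarrow> 0 \<le> z i"
 shows "1 - 2 * (\<Sum>i\<in>I. min 1 (z i)) \<le> 0 \<or> 1 - 2 * (\<Sum>i\<in>I. min 1 (z i)) \<le> 1 - 2 * (\<Sum>i\<in>I. z i)"
proof (cases "\<exists>i\<in>I. 1 \<le> z i")
 case True
 then obtain i where i: "i \<in> I" "1 \<le> z i" by blast
 have "min 1 (z i) \<le> (\<Sum>i\<in>I. min 1 (z i))" using assms i by (intro member_le_sum) auto
 then show ?thesis using i by simp
next
 case False
 then have "(\<Sum>i\<in>I. min 1 (z i)) = (\<Sum>i\<in>I. z i)" by (intro sum.cong) auto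
 then show ?thesis by simp
qed

lemma separated_pair_ratio_lower:
 fixes s t :: real
 assumes "2 * \<bar>t\<bar> \<le> \<bar>s\<bar>"
 shows "min 1 (\<bar>s\<bar> ^ 4) / 81 \<le> (s - t) ^ 4 / (1 + s\<^sup>2 + t\<^sup>2)\<^sup>2"
proof -
 let ?q = "s\<^sup>2"
 have t2: "t\<^sup>2 \<le> ?q / 4"
 proof -
  have "(2 * \<bar>t\<bar>)\<^sup>2 \<le> \<bar>s\<bar>\<^sup>2" using assms by (intro power_mono) auto
  then show ?thesis by (simp add: power_mult_distrib)
 qed
 have "\<bar>s\<bar> / 2 \<le> \<bar>s - t\<bar>" using assms by linarith
 then have "(\<bar>s\<bar> / 2)\<^sup>2 \<le> \<bar>s - t\<bar>\<^sup>2" by (intro power_mono) auto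
 then have D: "?q / 4 \<le> (s - t)\<^sup>2" by (simp add: power_divide)
 have q: "0 \<le> ?q" by simp
 have m: "min 1 ?q * (1 + ?q + t\<^sup>2) \<le> 9 * (s - t)\<^sup>2"
 proof -
  have "min 1 ?q * (1 + ?q + t\<^sup>2) \<le> min 1 ?q * (1 + 5 / 4 * ?q)" using t2 by (intro mult_left_mono) auto
  also have "\<dots> \<le> 9 / 4 * ?q"
  proof (cases "?q \<le> 1")
   case True
   then have "?q * (1 + 5 / 4 * ?q) \<le> ?q * (1 + 5 / 4 * 1)" by (intro mult_left_mono add_left_mono) auto
   then show ?thesis using True by simp
  qed simp
  finally show ?thesis using D by linarith
 qed
 have pos: "0 < 1 + ?q + t\<^sup>2" using q zero_le_power2[of t] by linarith
 have "min 1 ?q / 9 \<le> (s - t)\<^sup>2 / (1 + ?q + t\<^sup>2)" using m pos by (simp add: field_simps)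
 then have "(min 1 ?q / 9)\<^sup>2 \<le> ((s - t)\<^sup>2 / (1 + ?q + t\<^sup>2))\<^sup>2" by (intro power_mono) auto
 then have "(min 1 ?q)\<^sup>2 / 81 \<le> (s - t) ^ 4 / (1 + ?q + t\<^sup>2)\<^sup>2" by (simp add: power_divide flip: power_mult)
 moreover have "(min 1 ?q)\<^sup>2 = min 1 (\<bar>s\<bar> ^ 4)"
 proof (cases "?q \<le> 1")
  case True
  then have "?q\<^sup>2 \<le> 1" using q power_le_one by blast
  then show ?thesis using True by (simp flip: power_mult)
 next
  case False
  then have "1 \<le> ?q\<^sup>2" using one_le_power[of "s\<^sup>2" 2] by linarith
  then show ?thesis using False by (simp flip: power_mult)
 qed
 ultimately show ?thesis by simp
qed

context prob_space
begin

lemma tmom_scale_le: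
 fixes X :: "'a \<Rightarrow> real"
 assumes X: "random_variable borel X" and "0 < b'" "0 < b" "b \<le> 2 * b'"
 shows "tmom 2 X b' \<le> 4 * tmom 2 X b"
proof -
 have "tmom 2 X b' \<le> expectation (%om. 4 * min 1 (\<bar>X om / b\<bar> ^ 2))" unfolding tmom_def
 proof (rule integral_mono)
  show "integrable M (%om. min 1 (\<bar>X om / b'\<bar> ^ 2))" by (rule tmom_integrable[OF X])
  show "integrable M (%om. 4 * min 1 (\<bar>X om / b\<bar> ^ 2))" by (intro integrable_mult_right tmom_integrable[OF X])
  fix om
  have "\<bar>X om\<bar> / b' \<le> 2 * (\<bar>X om\<bar> / b)" using assms mult_left_mono[OF assms(4), of "\<bar>X om\<bar>"] by (simp add: field_simps)
  then have "(\<bar>X om\<bar> / b') ^ 2 \<le> (2 * (\<bar>X om\<bar> / b)) ^ 2" using assms by (intro power_mono) auto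
  then have "\<bar>X om / b'\<bar> ^ 2 \<le> 4 * \<bar>X om / b\<bar> ^ 2" using assms by (simp add: power_mult_distrib power_divide)
  then show "min 1 (\<bar>X om / b'\<bar> ^ 2) \<le> 4 * min 1 (\<bar>X om / b\<bar> ^ 2)" by linarith
 qed
 also have "\<dots> = 4 * tmom 2 X b" unfolding tmom_def by (rule integral_mult_right_zero)
 finally show ?thesis .
qed

lemma tmom_tendsto_0:
 fixes X :: "'a \<Rightarrow> real"
 assumes X[measurable]: "random_variable borel X"
 shows "(%k::nat. tmom 2 X (real k)) \<longlonglongrightarrow> 0"
proof -
 have "(%k::nat. expectation (%om. min 1 (\<bar>X om / real k\<bar> ^ 2))) \<longlonglongrightarrow> expectation (%om. 0)"
 proof (rule integral_dominated_convergence[where w = "%_. 1"])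
  show "AE om in M. (%k. min 1 (\<bar>X om / real k\<bar> ^ 2)) \<longlonglongrightarrow> 0"
  proof (intro AE_I2)
   fix om
   have "(%k. min 1 (\<bar>X om / real k\<bar> ^ 2)) \<longlonglongrightarrow> min 1 (\<bar>0\<bar> ^ 2)" by (intro tendsto_min tendsto_const tendsto_power tendsto_rabs lim_const_over_n)
   then show "(%k. min 1 (\<bar>X om / real k\<bar> ^ 2)) \<longlonglongrightarrow> 0" by simp
  qed
 qed auto
 then show ?thesis by (simp add: tmom_def)
qed

text \<open>The least natural number with \<open>n tmom 2 X b \<le> 1 / 8\<close>. It is not too large, because
  halving the scale increases the truncated moment at most fourfold.\<close>
lemma quantile_scale:
 fixes X :: "'a \<Rightarrow> real"
 assumes X: "random_variable borel X" and nz: "\<not> (AE om in M. X om = 0)"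
 obtains b where "\<And>n. 1 \<le> b n" "\<And>n. real n * tmom 2 X (b n) \<le> 1 / 8"
  "\<forall>\<^sub>F n in sequentially. 1 / 32 \<le> real n * tmom 2 X (b n)"
proof -
 define P where "P n k \<longleftrightarrow> 1 \<le> k \<and> real n * tmom 2 X (real k) \<le> 1 / 8" for n k :: nat
 define N where "N n = (LEAST k. P n k)" for n
 have "\<exists>k. P n k" for n
 proof -
  have "(%k. real n * tmom 2 X (real k)) \<longlonglongrightarrow> 0" using tendsto_mult_right_zero[OF tmom_tendsto_0[OF X]] .
  then have "\<forall>\<^sub>F k in sequentially. real n * tmom 2 X (real k) < 1 / 8" by (rule order_tendstoD) simp
  then have "\<forall>\<^sub>F k in sequentially. P n k" using eventually_ge_at_top[of 1] by eventually_elim (simp add: P_def)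
  from eventually_happens'[OF sequentially_bot this] show ?thesis .
 qed
 then have PN: "P n (N n)" for n unfolding N_def by (rule LeastI_ex)
 have not: "\<not> P n k" if "k < N n" for n k using that unfolding N_def by (rule not_less_Least)
 have t1: "0 < tmom 2 X 1" by (rule tmom_pos[OF X nz]) simp
 have "\<forall>\<^sub>F n in sequentially. 1 / (8 * tmom 2 X 1) < real n" using filterlim_real_sequentially unfolding filterlim_at_top_dense by blast
 then have low: "\<forall>\<^sub>F n in sequentially. 1 / 32 \<le> real n * tmom 2 X (real (N n))"
 proof eventually_elim
  case (elim n)
  then have "\<not> P n 1" using t1 by (simp add: P_def field_simps)
  then have "N n \<noteq> 1" using PN[of n] by auto
  then have N2: "2 \<le> N n" using PN[of n] by (simp add: P_def)
  then have "\<not> P n (N n - 1)" by (intro not) simp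
  then have "1 / 8 < real n * tmom 2 X (real (N n - 1))" using N2 unfolding P_def by linarith
  also have "\<dots> \<le> real n * (4 * tmom 2 X (real (N n)))" using N2 by (intro mult_left_mono tmom_scale_le[OF X]) auto
  finally show ?case by simp
 qed
 show ?thesis by (rule that[of "%n. real (N n)"]) (use PN low in \<open>auto simp: P_def\<close>)
qed

text \<open>In the share of one pair the other squares are, on average, no larger than \<open>b\<^sup>2\<close>,
  since their truncated moments add up to at most \<open>1 / 4\<close>; their influence is a factor
  independent of the pair with mean at least \<open>1 / 2\<close>. For the pair itself, the second variable
  is small compared with a large first one with probability at least \<open>1 / 2\<close>, and then the
  ratio is bounded below by \<open>min(1, (x / b)^4) / 81\<close>. The constant is \<open>324 = 2 * 2 *
  81\<close>.\<close>
lemma pair_fourth_ratio_lower: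
 fixes X :: "nat \<Rightarrow> 'a \<Rightarrow> real"
 assumes iid: "iid borel X"
 obtains K where "0 < K" "\<And>n b. 0 < b \<Longrightarrow> real n * tmom 2 (X 0) b \<le> 1 / 8 \<Longrightarrow>
  real n * expectation (%om. min 1 (\<bar>X 0 om / b\<bar> ^ 4) * indicator {K..} \<bar>X 0 om\<bar>) \<le>
  324 * expectation (%om. pair_fourth X n om / (\<Sum>i=1..2 * n. (X i om)\<^sup>2)\<^sup>2)"
proof -
 note [measurable] = iid_measurable[OF iid] pair_measurable[OF iid]
 obtain K0 where K0: "0 < K0" "prob {om\<in>space M. K0 < \<bar>X 0 om\<bar>} < 1 / 2" by (rule prob_abs_gt_small[of "X 0" "1 / 2"]) auto
  \<comment> \<open>For \<open>|x| \<ge> K\<close> the bound \<open>2 |y| \<le> |x|\<close> holds on an event of probability at least one half.\<close>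
 define K where "K = 2 * K0"
 define F where "F x y = (if 2 * \<bar>y\<bar> \<le> \<bar>x\<bar> then x else 0)" for x y :: real
 have size: "1 / 2 \<le> prob {om\<in>space M. 1 / 2 * \<bar>x\<bar> \<le> \<bar>F x (X j om)\<bar>}" if x: "K \<le> \<bar>x\<bar>" for x j
 proof -
  have "prob {om\<in>space M. K0 < \<bar>X j om\<bar>} < 1 / 2" using K0(2) iid_prob[OF iid, of "%x. K0 < \<bar>x\<bar>" j] by simp
  then have "1 / 2 \<le> prob {om\<in>space M. \<not> K0 < \<bar>X j om\<bar>}" by (subst prob_neg) auto
  also have "\<dots> \<le> prob {om\<in>space M. 1 / 2 * \<bar>x\<bar> \<le> \<bar>F x (X j om)\<bar>}"
  proof (rule finite_measure_mono)
   show "{om\<in>space M. \<not> K0 < \<bar>X j om\<bar>} \<subseteq> {om\<in>space M. 1 / 2 * \<bar>x\<bar> \<le> \<bar>F x (X j om)\<bar>}" using x by (auto simp: F_def K_def)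
   show "{om\<in>space M. 1 / 2 * \<bar>x\<bar> \<le> \<bar>F x (X j om)\<bar>} \<in> events" unfolding F_def by measurable
  qed
  finally show ?thesis .
 qed
 define H where "H b x y = ((x - y) / b) ^ 4 / (1 + (x / b)\<^sup>2 + (y / b)\<^sup>2)\<^sup>2" for b x y :: real
 have Hm[measurable]: "(%(x, y). H b x y) \<in> borel_measurable (borel \<Otimes>\<^sub>M borel)" for b unfolding H_def by measurable
 have H_nn: "0 \<le> H b x y" for b x y by (simp add: H_def)
 have H_le: "H b x y \<le> 4" for b x y
 proof -
  let ?v = "(x / b)\<^sup>2 + (y / b)\<^sup>2"
  have "((x - y) / b)\<^sup>2 \<le> 2 * ?v" using zero_le_power2[of "x / b + y / b"] by (simp add: power2_sum power2_diff diff_divide_distrib)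
  then have "(((x - y) / b)\<^sup>2)\<^sup>2 \<le> (2 * (1 + ?v))\<^sup>2" by (intro power_mono) auto
  then have "((x - y) / b) ^ 4 \<le> 4 * (1 + ?v)\<^sup>2" by (simp only: power_mult_distrib) (simp flip: power_mult)
  moreover have "0 < 1 + ?v" by (simp add: add_pos_nonneg)
  ultimately show ?thesis unfolding H_def by (simp add: divide_le_eq add.assoc)
 qed
 have H_int: "integrable M (%om. H b (X i om) (X j om))" for b i j
 proof (rule integrable_const_bound[where B = 4])
  show "AE om in M. norm (H b (X i om) (X j om)) \<le> 4" using H_nn H_le by (intro AE_I2) simp
  show "random_variable borel (%om. H b (X i om) (X j om))" unfolding H_def by measurable
 qed
 let ?tail = "%b. expectation (%om. min 1 (\<bar>X 0 om / b\<bar> ^ 4) * indicator {K..} \<bar>X 0 om\<bar>)"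
 have E_H: "?tail b / 162 \<le> expectation (%om. H b (X i om) (X j om))" if "0 < b" "i \<noteq> j" for b i j
 proof -
  define h where "h x = min 1 (\<bar>x / b\<bar> ^ 4) / 81" for x
  have [measurable]: "h \<in> borel_measurable borel" unfolding h_def[abs_def] by measurable
  have "1 / 2 * expectation (%om. h (X i om) * indicator {K..} \<bar>X i om\<bar>) \<le> expectation (%om. H b (X i om) (X j om))"
  proof (rule expectation_ge_of_conditional_size[where F = F and \<kappa> = "1 / 2" and X = "X i" and Y = "X j" and H = "H b" and h = h and K = K and p = "1 / 2" and T = borel])
   show "indep_rv borel (X i) borel (X j)" by (rule iid_independent[OF iid \<open>i \<noteq> j\<close>])
   show "(%(x, y). F x y) \<in> borel_measurable (borel \<Otimes>\<^sub>M borel)" unfolding F_def by measurable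
   show "1 / 2 \<le> prob {om\<in>space M. 1 / 2 * \<bar>x\<bar> \<le> \<bar>F x (X j om)\<bar>}" if "K \<le> \<bar>x\<bar>" for x by (rule size[OF that])
   show "h x \<le> H b x y" if "K \<le> \<bar>x\<bar>" "1 / 2 * \<bar>x\<bar> \<le> \<bar>F x y\<bar>" for x y
   proof -
    have "0 < \<bar>x\<bar>" using that(1) K0(1) by (simp add: K_def)
    then have "2 * \<bar>y\<bar> \<le> \<bar>x\<bar>" using that(2) by (auto simp: F_def split: if_splits)
    then have "2 * \<bar>y / b\<bar> \<le> \<bar>x / b\<bar>" using \<open>0 < b\<close> by (simp add: field_simps)
    from separated_pair_ratio_lower[OF this] show ?thesis by (simp add: h_def H_def diff_divide_distrib)
   qed
   show "integrable M (%om. h (X i om) * indicator {K..} \<bar>X i om\<bar>)" by (rule integrable_const_bound[where B = 1]) (auto simp: h_def indicator_def)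
  qed (use H_nn H_int in \<open>auto simp: h_def\<close>)
  also have "expectation (%om. h (X i om) * indicator {K..} \<bar>X i om\<bar>) = expectation (%om. h (X 0 om) * indicator {K..} \<bar>X 0 om\<bar>)"
   by (rule iid_expectation[OF iid, of "%x. h x * indicator {K..} \<bar>x\<bar>"]) measurable
  also have "expectation (%om. h (X 0 om) * indicator {K..} \<bar>X 0 om\<bar>) = ?tail b / 81"
   unfolding h_def times_divide_eq_left by (rule integral_divide_zero)
  finally show ?thesis by simp
 qed
 have pair_term: "1 / 2 * expectation (%om. H b (X i om) (X j om)) \<le> expectation (%om. (X i om - X j om) ^ 4 / (\<Sum>i=1..2 * n. (X i om)\<^sup>2)\<^sup>2)
   \<and> integrable M (%om. (X i om - X j om) ^ 4 / (\<Sum>i=1..2 * n. (X i om)\<^sup>2)\<^sup>2)"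
  if b: "0 < b" "real n * tmom 2 (X 0) b \<le> 1 / 8" and ij: "i \<noteq> j" "i \<in> {1..2 * n}" "j \<in> {1..2 * n}" for b n i j
 proof -
  define I where "I = {1..2 * n} - {i, j}"
  have I: "finite I" "{i, j} \<inter> I = {}" by (auto simp: I_def)
  have split: "(\<Sum>l=1..2 * n. f l) = f i + f j + sum f I" for f :: "nat \<Rightarrow> real"
  proof -
   have "(\<Sum>l=1..2 * n. f l) = sum f ({i, j} \<union> I)" using ij by (intro sum.cong) (auto simp: I_def)
   also have "\<dots> = sum f {i, j} + sum f I" using I by (intro sum.union_disjoint) auto
   finally show ?thesis using ij(1) by simp
  qed
  define G where "G om = 1 - 2 * (\<Sum>l\<in>I. min 1 (\<bar>X l om / b\<bar> ^ 2))" for om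
  let ?R = "%om. (X i om - X j om) ^ 4 / (\<Sum>i=1..2 * n. (X i om)\<^sup>2)\<^sup>2"
  have pointwise: "H b (X i om) (X j om) * G om \<le> ?R om" for om
  proof -
   let ?v = "(X i om / b)\<^sup>2 + (X j om / b)\<^sup>2" and ?r = "\<Sum>l\<in>I. (X l om / b)\<^sup>2"
   have V: "(\<Sum>i=1..2 * n. (X i om)\<^sup>2) = b\<^sup>2 * (?v + ?r)" unfolding split using b(1) by (simp add: power_divide distrib_left sum_distrib_left)
   have nn: "0 \<le> ?v" "0 \<le> ?r" by (auto intro: sum_nonneg)
   show ?thesis
   proof (cases "?v + ?r = 0")
    case True
    then have "?v = 0" using nn by linarith
    then have "X i om = 0" "X j om = 0" using b(1) by (auto simp: add_nonneg_eq_0_iff)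
    then show ?thesis by (simp add: H_def)
   next
    case False
    have g: "G om \<le> 0 \<or> G om \<le> 1 - 2 * ?r" using truncated_sum_dichotomy[of I "%l. \<bar>X l om / b\<bar> ^ 2"] I by (simp add: G_def power_divide)
    have "((X i om - X j om) / b) ^ 4 / (1 + ?v)\<^sup>2 * G om \<le> ((X i om - X j om) / b) ^ 4 / (?v + ?r)\<^sup>2"
    proof (rule ratio_square_lower[OF nn _ g])
     show "0 < ?v + ?r" using nn False by linarith
    qed
    also have "\<dots> = ?R om"
    proof -
     have "b ^ 4 = (b\<^sup>2)\<^sup>2" by (simp flip: power_mult)
     then show ?thesis unfolding V using b(1) by (simp add: power_divide power_mult_distrib)
    qed
    finally show ?thesis by (simp add: H_def add.assoc)
   qed
  qed
  have tm_int: "integrable M (%om. min 1 (\<bar>X l om / b\<bar> ^ 2))" for l by (rule tmom_integrable) simp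
  have tm_eq: "expectation (%om. min 1 (\<bar>X l om / b\<bar> ^ 2)) = tmom 2 (X 0) b" for l
   unfolding tmom_def by (rule iid_expectation[OF iid, of "%x. min 1 (\<bar>x / b\<bar> ^ 2)"]) measurable
  have G_int: "integrable M G" unfolding G_def[abs_def] by (intro L_integrable_diff integrable_mult_right L_integrable_sum tm_int) auto
  have "expectation G = 1 - 2 * (\<Sum>l\<in>I. expectation (%om. min 1 (\<bar>X l om / b\<bar> ^ 2)))"
   unfolding G_def[abs_def] using tm_int by (subst L_integral_diff) (auto simp: prob_space L_integral_sum)
  then have EG: "expectation G = 1 - 2 * (real (card I) * tmom 2 (X 0) b)" unfolding tm_eq by simp
  have "card I \<le> card {1..2 * n}" unfolding I_def by (rule card_mono) auto
  then have "real (card I) \<le> 2 * real n" by simp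
  then have "real (card I) * tmom 2 (X 0) b \<le> 2 * real n * tmom 2 (X 0) b" by (intro mult_right_mono tmom_nonneg)
  also have "\<dots> \<le> 1 / 4" using b(2) by simp
  finally have EG_ge: "1 / 2 \<le> expectation G" unfolding EG by simp
  have ind: "indep_rv borel (%om. H b (X i om) (X j om)) borel G"
  proof -
   have m1: "(%w. H b (w i) (w j)) \<in> PiM {i, j} (%_. borel) \<rightarrow>\<^sub>M borel" unfolding H_def by measurable
   have m2: "(%w. 1 - 2 * (\<Sum>l\<in>I. min 1 (\<bar>w l / b\<bar> ^ 2))) \<in> PiM I (%_. borel) \<rightarrow>\<^sub>M (borel :: real measure)" by measurable
   have eG: "G om = 1 - 2 * (\<Sum>l\<in>I. min 1 (\<bar>(\<lambda>l\<in>I. X l om) l / b\<bar> ^ 2))" for om unfolding G_def by simp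
   show ?thesis using iid_blocks_independent[OF iid I(2) m1 m2] unfolding eG[symmetric] by simp
  qed
  have HG_int: "integrable M (%om. H b (X i om) (X j om) * G om)"
  proof (rule L_integrable_bound)
   show "integrable M (%om. 4 * G om)" by (intro integrable_mult_right G_int)
   show "random_variable borel (%om. H b (X i om) (X j om) * G om)" unfolding H_def G_def by measurable
   show "AE om in M. norm (H b (X i om) (X j om) * G om) \<le> norm (4 * G om)" using H_nn H_le by (intro AE_I2) (simp add: abs_mult mult_right_mono)
  qed
  have "expectation (%om. H b (X i om) (X j om) * G om) = (\<integral>om. (\<integral>om'. H b (X i om) (X j om) * G om' \<partial>M) \<partial>M)"
   by (rule indep_rv_expectation[OF ind, of "(*)"]) (use HG_int in auto)
  also have "\<dots> = expectation (%om. H b (X i om) (X j om)) * expectation G" by simp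
  finally have HG: "expectation (%om. H b (X i om) (X j om) * G om) = expectation (%om. H b (X i om) (X j om)) * expectation G" .
  have R_int: "integrable M ?R"
  proof (rule integrable_const_bound[where B = 4])
   show "AE om in M. norm (?R om) \<le> 4"
   proof (intro AE_I2)
    fix om
    let ?V = "\<Sum>i=1..2 * n. (X i om)\<^sup>2"
    have "(X i om - X j om)\<^sup>2 \<le> 2 * ((X i om)\<^sup>2 + (X j om)\<^sup>2)" using zero_le_power2[of "X i om + X j om"] by (simp add: power2_sum power2_diff)
    also have "\<dots> \<le> 2 * ?V" unfolding split by (simp add: sum_nonneg)
    finally have "((X i om - X j om)\<^sup>2)\<^sup>2 \<le> (2 * ?V)\<^sup>2" by (intro power_mono) auto
    then have "(X i om - X j om) ^ 4 \<le> 4 * ?V\<^sup>2" by (simp only: power_mult_distrib) (simp flip: power_mult)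
    then show "norm (?R om) \<le> 4" by (cases "?V = 0") (auto simp: divide_le_eq)
   qed
  qed measurable
  have "1 / 2 * expectation (%om. H b (X i om) (X j om)) \<le> expectation G * expectation (%om. H b (X i om) (X j om))"
   using EG_ge by (intro mult_right_mono integral_nonneg_AE) (auto simp: H_nn)
  also have "\<dots> = expectation (%om. H b (X i om) (X j om) * G om)" unfolding HG by (rule mult.commute)
  also have "\<dots> \<le> expectation ?R" by (rule integral_mono[OF HG_int R_int pointwise])
  finally show ?thesis using R_int by simp
 qed
 show ?thesis
 proof (rule that)
  show "0 < K" using K0 by (simp add: K_def)
  fix n b assume b: "0 < b" "real n * tmom 2 (X 0) b \<le> 1 / 8"
  let ?R = "%k om. (X (2 * k + 1) om - X (2 * k + 2) om) ^ 4 / (\<Sum>i=1..2 * n. (X i om)\<^sup>2)\<^sup>2"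
  have R: "integrable M (?R k)" "?tail b / 324 \<le> expectation (?R k)" if "k < n" for k
   using pair_term[OF b, of "2 * k + 1" "2 * k + 2"] E_H[OF b(1), of "2 * k + 1" "2 * k + 2"] that by auto
  have "real n * (?tail b / 324) = (\<Sum>k<n. ?tail b / 324)" by simp
  also have "\<dots> \<le> (\<Sum>k<n. expectation (?R k))" by (rule sum_mono) (use R in simp)
  also have "\<dots> = expectation (%om. \<Sum>k<n. ?R k om)" by (rule L_integral_sum[symmetric]) (use R in simp)
  also have "\<dots> = expectation (%om. pair_fourth X n om / (\<Sum>i=1..2 * n. (X i om)\<^sup>2)\<^sup>2)" by (simp only: pair_fourth_def sum_divide_distrib)
  finally show "real n * ?tail b \<le> 324 * expectation (%om. pair_fourth X n om / (\<Sum>i=1..2 * n. (X i om)\<^sup>2)\<^sup>2)" by simp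
 qed
qed

lemma normal_scale_of_finite_variance:
 fixes X :: "'a \<Rightarrow> real"
 assumes X[measurable]: "random_variable borel X" and int: "integrable M (%om. (X om)\<^sup>2)" and nz: "\<not> (AE om in M. X om = 0)"
 shows "normal_scale X (%n. sqrt (real n + 1))"
proof -
 define s2 where "s2 = expectation (%om. (X om)\<^sup>2)"
 have s2: "0 < s2"
 proof -
  have "s2 \<noteq> 0" using integral_nonneg_eq_0_iff_AE[OF int] nz unfolding s2_def by auto
  moreover have "0 \<le> s2" unfolding s2_def by (rule integral_nonneg_AE) auto
  ultimately show ?thesis by simp
 qed
 have sq: "\<bar>x / sqrt (real n + 1)\<bar> ^ 2 = x\<^sup>2 / (real n + 1)" for x n by (simp add: power_divide)
 have fo: "\<bar>x / sqrt (real n + 1)\<bar> ^ 4 = (x\<^sup>2 / (real n + 1))\<^sup>2" for x n unfolding sq[symmetric] by (simp flip: power_mult)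
 have le: "real n * min 1 (x\<^sup>2 / (real n + 1)) \<le> x\<^sup>2" for n and x :: real
 proof -
  have "real n * min 1 (x\<^sup>2 / (real n + 1)) \<le> real n * (x\<^sup>2 / (real n + 1))" by (intro mult_left_mono) auto
  also have "\<dots> = x\<^sup>2 * (real n / (real n + 1))" by simp
  also have "\<dots> \<le> x\<^sup>2 * 1" by (intro mult_left_mono) auto
  finally show ?thesis by simp
 qed
 have min_sq: "min 1 (t\<^sup>2) \<le> min 1 t" if "0 \<le> t" for t :: real
 proof (cases "t \<le> 1")
  case True
  then have "t * t \<le> t * 1" using that by (intro mult_left_mono) auto
  then show ?thesis by (simp add: power2_eq_square)
 qed simp
 have le4: "real n * min 1 ((x\<^sup>2 / (real n + 1))\<^sup>2) \<le> x\<^sup>2" for n and x :: real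
 proof -
  have "real n * min 1 ((x\<^sup>2 / (real n + 1))\<^sup>2) \<le> real n * min 1 (x\<^sup>2 / (real n + 1))" by (intro mult_left_mono min_sq) auto
  then show ?thesis using le[of n x] by linarith
 qed
 have "(%n. expectation (%om. real n * min 1 ((X om)\<^sup>2 / (real n + 1)))) \<longlonglongrightarrow> expectation (%om. (X om)\<^sup>2)"
 proof (rule integral_dominated_convergence[where w = "%om. (X om)\<^sup>2"])
  show "AE om in M. (%n. real n * min 1 ((X om)\<^sup>2 / (real n + 1))) \<longlonglongrightarrow> (X om)\<^sup>2"
  proof (intro AE_I2)
   fix om
   define x where "x = (X om)\<^sup>2"
   have "(%n. real n * (x / (real n + 1))) \<longlonglongrightarrow> x" by real_asymp
   moreover have "\<forall>\<^sub>F n in sequentially. real n * (x / (real n + 1)) = real n * min 1 (x / (real n + 1))" using eventually_ge_at_top[of "nat \<lceil>x\<rceil>"]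
   proof eventually_elim
    case (elim n)
    then have "x \<le> real n + 1" by linarith
    then show ?case by (simp add: min_def divide_le_eq)
   qed
   ultimately show "(%n. real n * min 1 ((X om)\<^sup>2 / (real n + 1))) \<longlonglongrightarrow> (X om)\<^sup>2" unfolding x_def[symmetric] by (rule Lim_transform_eventually)
  qed
  show "AE om in M. norm (real n * min 1 ((X om)\<^sup>2 / (real n + 1))) \<le> (X om)\<^sup>2" for n using le by (intro AE_I2) (simp add: abs_mult)
 qed (use int in auto)
 then have lim2: "(%n. real n * tmom 2 X (sqrt (real n + 1))) \<longlonglongrightarrow> s2" unfolding tmom_def sq s2_def integral_mult_right_zero .
 have "(%n. expectation (%om. real n * min 1 (((X om)\<^sup>2 / (real n + 1))\<^sup>2))) \<longlonglongrightarrow> expectation (%om. 0)"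
 proof (rule integral_dominated_convergence[where w = "%om. (X om)\<^sup>2"])
  show "AE om in M. (%n. real n * min 1 (((X om)\<^sup>2 / (real n + 1))\<^sup>2)) \<longlonglongrightarrow> 0"
  proof (intro AE_I2)
   fix om
   define x where "x = (X om)\<^sup>2"
   have "(%n. x\<^sup>2 * (real n / (real n + 1)\<^sup>2)) \<longlonglongrightarrow> x\<^sup>2 * 0" by (intro tendsto_mult tendsto_const) real_asymp
   then have up: "(%n. real n * (x / (real n + 1))\<^sup>2) \<longlonglongrightarrow> 0" by (simp add: power_divide mult.commute)
   have "(%n. real n * min 1 ((x / (real n + 1))\<^sup>2)) \<longlonglongrightarrow> 0"
    by (rule tendsto_sandwich[OF _ _ tendsto_const up]) (auto intro!: always_eventually mult_left_mono)
   then show "(%n. real n * min 1 (((X om)\<^sup>2 / (real n + 1))\<^sup>2)) \<longlonglongrightarrow> 0" unfolding x_def .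
  qed
  show "AE om in M. norm (real n * min 1 (((X om)\<^sup>2 / (real n + 1))\<^sup>2)) \<le> (X om)\<^sup>2" for n using le4 by (intro AE_I2) (simp add: abs_mult)
 qed (use int in auto)
 then have lim4: "(%n. real n * tmom 4 X (sqrt (real n + 1))) \<longlonglongrightarrow> 0" unfolding tmom_def fo integral_mult_right_zero by simp
 have lo: "\<forall>\<^sub>F n in sequentially. s2 / 2 \<le> real n * tmom 2 X (sqrt (real n + 1))"
  using order_tendstoD(1)[OF lim2, of "s2 / 2"] s2 by (auto elim: eventually_mono)
 have hi: "\<forall>\<^sub>F n in sequentially. real n * tmom 2 X (sqrt (real n + 1)) \<le> 2 * s2"
  using order_tendstoD(2)[OF lim2, of "2 * s2"] s2 by (auto elim: eventually_mono)
 show ?thesis unfolding normal_scale_def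
 proof (intro conjI allI lim4)
  show "\<exists>c>0. \<forall>\<^sub>F n in sequentially. c \<le> real n * tmom 2 X (sqrt (real n + 1))" using s2 by (intro exI[of _ "s2 / 2"] conjI lo) simp
  show "\<exists>C. \<forall>\<^sub>F n in sequentially. real n * tmom 2 X (sqrt (real n + 1)) \<le> C" by (intro exI[of _ "2 * s2"] hi)
 qed simp
qed

text \<open>With finite variance the square root of \<open>n + 1\<close> is a normal scale. Otherwise the quantile
  scale satisfies the two-sided bound by construction, and the fourth-order condition follows from the
  vanishing fourth-order share.\<close>
lemma self_normalized_clt_imp_normal_scale:
 fixes X :: "nat \<Rightarrow> 'a \<Rightarrow> real"
 assumes iid: "iid borel X" and intX: "integrable M (X 0)" and nz: "\<not> (AE om in M. X 0 om = 0)"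
 defines "T \<equiv> %n om. (\<Sum>i=1..n. X i om) * (\<Sum>i=1..n. (X i om)\<^sup>2) powr (- 1 / 2)"
 assumes T: "conv_std_normal T" and int: "\<And>n. integrable M (%om. (T n om)\<^sup>2)" and bd: "\<And>n. expectation (%om. (T n om)\<^sup>2) \<le> C"
 obtains b where "normal_scale (X 0) b" "\<And>n. 1 \<le> b n"
proof (cases "integrable M (%om. (X 0 om)\<^sup>2)")
 case True
 show ?thesis by (rule that[OF normal_scale_of_finite_variance[OF iid_measurable[OF iid] True nz]]) simp
next
 case heavy: False
 note Xm[measurable] = iid_measurable[OF iid]
 have T2: "conv_std_normal (%n. T (2 * n))" by (rule conv_std_normal_subseq[OF T]) (simp add: strict_mono_def)
 have lim: "(%n. expectation (%om. pair_fourth X n om / (\<Sum>i=1..2 * n. (X i om)\<^sup>2)\<^sup>2)) \<longlonglongrightarrow> 0" using T2 int bd unfolding T_def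
  by (intro pair_fourth_ratio_tendsto_0[OF iid, of C] pair_sq_ratio_tendsto_1[OF iid intX heavy])
 obtain b where b: "\<And>n. 1 \<le> b n" "\<And>n. real n * tmom 2 (X 0) (b n) \<le> 1 / 8"
  "\<forall>\<^sub>F n in sequentially. 1 / 32 \<le> real n * tmom 2 (X 0) (b n)" by (rule quantile_scale[OF Xm nz]) blast
 have b_pos: "0 < b n" for n using b(1)[of n] by linarith
 have bd8: "\<forall>\<^sub>F n in sequentially. real n * tmom 2 (X 0) (b n) \<le> 1 / 8" using b(2) by simp
 obtain C' where C': "0 < C'" "\<forall>\<^sub>F n in sequentially. real n / (b n)\<^sup>2 \<le> C'" "filterlim b at_top sequentially"
  by (rule scale_growth[OF Xm nz b_pos bd8]) blast
 obtain K where K: "0 < K" "\<And>n b. 0 < b \<Longrightarrow> real n * tmom 2 (X 0) b \<le> 1 / 8 \<Longrightarrow>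
  real n * expectation (%om. min 1 (\<bar>X 0 om / b\<bar> ^ 4) * indicator {K..} \<bar>X 0 om\<bar>) \<le>
  324 * expectation (%om. pair_fourth X n om / (\<Sum>i=1..2 * n. (X i om)\<^sup>2)\<^sup>2)" by (rule pair_fourth_ratio_lower[OF iid]) blast
 let ?m = "%n. real n * (K / b n) ^ 4 + 324 * expectation (%om. pair_fourth X n om / (\<Sum>i=1..2 * n. (X i om)\<^sup>2)\<^sup>2)"
 have up: "?m \<longlonglongrightarrow> 0" using tendsto_add[OF scale_power_tendsto_0[OF C'(2,3), of K] tendsto_mult_right_zero[OF lim, of 324]] by simp
 have le: "real n * tmom 4 (X 0) (b n) \<le> ?m n" for n
 proof -
  have i1: "integrable M (%om. min 1 (\<bar>X 0 om / b n\<bar> ^ 4) * indicator {K..} \<bar>X 0 om\<bar>)"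
   by (rule integrable_const_bound[where B = 1]) (auto simp: indicator_def)
  have "tmom 4 (X 0) (b n) \<le> expectation (%om. (K / b n) ^ 4 + min 1 (\<bar>X 0 om / b n\<bar> ^ 4) * indicator {K..} \<bar>X 0 om\<bar>)" unfolding tmom_def
  proof (rule integral_mono[OF tmom_integrable[OF Xm]])
   show "integrable M (%om. (K / b n) ^ 4 + min 1 (\<bar>X 0 om / b n\<bar> ^ 4) * indicator {K..} \<bar>X 0 om\<bar>)" using i1 by (intro L_integrable_add) auto
   fix om
   show "min 1 (\<bar>X 0 om / b n\<bar> ^ 4) \<le> (K / b n) ^ 4 + min 1 (\<bar>X 0 om / b n\<bar> ^ 4) * indicator {K..} \<bar>X 0 om\<bar>"
   proof (cases "K \<le> \<bar>X 0 om\<bar>")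
    case False
    then have "\<bar>X 0 om / b n\<bar> \<le> K / b n" using b_pos[of n] by (simp add: divide_right_mono)
    then have "\<bar>X 0 om / b n\<bar> ^ 4 \<le> (K / b n) ^ 4" by (intro power_mono) auto
    then show ?thesis using False by simp
   qed (use K(1) b_pos[of n] in simp)
  qed
  also have "\<dots> = (K / b n) ^ 4 + expectation (%om. min 1 (\<bar>X 0 om / b n\<bar> ^ 4) * indicator {K..} \<bar>X 0 om\<bar>)"
   using i1 by (subst L_integral_add) (auto simp: prob_space)
  finally have "real n * tmom 4 (X 0) (b n) \<le> real n * ((K / b n) ^ 4 + expectation (%om. min 1 (\<bar>X 0 om / b n\<bar> ^ 4) * indicator {K..} \<bar>X 0 om\<bar>))"
   by (intro mult_left_mono) auto
  then show ?thesis using K(2)[OF b_pos[of n] b(2)[of n]] unfolding distrib_left by linarith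
 qed
 have lim4: "(%n. real n * tmom 4 (X 0) (b n)) \<longlonglongrightarrow> 0"
  by (rule tendsto_sandwich[OF _ _ tendsto_const up]) (use le tmom_nonneg in \<open>auto intro!: always_eventually\<close>)
 have "normal_scale (X 0) b" unfolding normal_scale_def
 proof (intro conjI allI b_pos lim4)
  show "\<exists>c>0. \<forall>\<^sub>F n in sequentially. c \<le> real n * tmom 2 (X 0) (b n)" by (intro exI[of _ "1 / 32"] conjI b(3)) simp
  show "\<exists>C. \<forall>\<^sub>F n in sequentially. real n * tmom 2 (X 0) (b n) \<le> C" by (intro exI[of _ "1 / 8"] bd8)
 qed
 then show ?thesis by (rule that[OF _ b(1)])
qed

end

section \<open>Second moments of the self-normalized sum\<close>

context product_noise
begin

lemma squares_independent_of_pair: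
 assumes "finite I" "{i, j} \<inter> I = {}"
 shows "indep_rv borel (%om. \<Sum>l\<in>I. (u l om)\<^sup>2) (borel \<Otimes>\<^sub>M borel) (%om. (u i om, u j om))"
proof -
 have m1: "(%w. \<Sum>l\<in>I. (w l)\<^sup>2) \<in> PiM I (%_. borel) \<rightarrow>\<^sub>M (borel :: real measure)" by measurable
 have m2: "(%w. (w i, w j)) \<in> PiM {i, j} (%_. borel) \<rightarrow>\<^sub>M (borel \<Otimes>\<^sub>M borel :: (real \<times> real) measure)" by measurable
 have disj: "I \<inter> {i, j} = {}" using assms by blast
 show ?thesis using iid_blocks_independent[OF iid_u disj m1 m2] by simp
qed

lemma share_measurable[measurable]: "share \<in> borel_measurable borel" unfolding share_def[abs_def] by measurable

lemma share_le_one: "0 \<le> r \<Longrightarrow> share r \<le> 1" unfolding share_def using share_integrand[of r] share_integrable[of r 0] by (intro integral_le_const) auto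

lemma share_of_squares_le:
 assumes A: "finite A"
 shows "expectation (%om. share (\<Sum>l\<in>A. (u l om)\<^sup>2)) \<le> 1 / (real (card A) + 1)"
proof -
 obtain m where m: "m \<notin> A" using ex_new_if_finite[OF infinite_UNIV_nat A] by blast
 let ?R = "%om. \<Sum>l\<in>A. (u l om)\<^sup>2"
 have R_nn: "0 \<le> ?R om" for om by (simp add: sum_nonneg)
 have ind: "indep_rv borel ?R (borel \<Otimes>\<^sub>M borel) (%om. (u m om, u m om))" using A m by (intro squares_independent_of_pair) auto
 have int: "integrable M (%om. (u m om)\<^sup>2 / (?R om + (u m om)\<^sup>2))"
 proof (rule integrable_const_bound[where B = 1])
  show "AE om in M. norm ((u m om)\<^sup>2 / (?R om + (u m om)\<^sup>2)) \<le> 1"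
  proof (intro AE_I2)
   fix om
   show "norm ((u m om)\<^sup>2 / (?R om + (u m om)\<^sup>2)) \<le> 1"
    using share_integrand[OF R_nn[of om], of "u m om"] by (auto simp only: real_norm_def abs_of_nonneg)
  qed
 qed measurable
 define f where "f r p = (fst p)\<^sup>2 / (r + (fst p)\<^sup>2)" for r :: real and p :: "real \<times> real"
 have fm: "(%(r, p). f r p) \<in> borel_measurable (borel \<Otimes>\<^sub>M (borel \<Otimes>\<^sub>M borel))" unfolding f_def by measurable
 have "expectation (%om. f (?R om) (u m om, u m om)) = (\<integral>om. (\<integral>om'. f (?R om) (u m om', u m om') \<partial>M) \<partial>M)"
  by (rule indep_rv_expectation[OF ind fm]) (use int in \<open>simp add: f_def\<close>)
 moreover have "(\<integral>om'. f r (u m om', u m om') \<partial>M) = share r" for r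
  using iid_expectation[OF iid_u, of "%x. x\<^sup>2 / (r + x\<^sup>2)" m] by (simp add: f_def share_def)
 ultimately have "expectation (%om. share (?R om)) = expectation (%om. (u m om)\<^sup>2 / (?R om + (u m om)\<^sup>2))" by (simp add: f_def)
 also have "\<dots> \<le> 1 / (real (card A) + 1)" by (rule iid_share_expectation[OF iid_u A m])
 finally show ?thesis .
qed

text \<open>Splitting the index set into two halves dominates the square by a product of independent factors.\<close>
lemma share_square_expectation_le:
 assumes I: "finite I" "2 * k \<le> card I"
 shows "expectation (%om. (share (\<Sum>l\<in>I. (u l om)\<^sup>2))\<^sup>2) \<le> (1 / (real k + 1))\<^sup>2"
  and "integrable M (%om. (share (\<Sum>l\<in>I. (u l om)\<^sup>2))\<^sup>2)"
proof -
 let ?s = "%A om. share (\<Sum>l\<in>A. (u l om)\<^sup>2)"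
 have nn: "0 \<le> (\<Sum>l\<in>A. (u l om)\<^sup>2)" for A om by (simp add: sum_nonneg)
 have s: "0 \<le> ?s A om" "?s A om \<le> 1" for A om using share_nonneg[OF nn] share_le_one[OF nn] by auto
 have sm[measurable]: "random_variable borel (?s A)" for A by measurable
 have s_int: "integrable M (?s A)" for A by (rule integrable_const_bound[where B = 1]) (use s in auto)
 show sq_int: "integrable M (%om. (?s I om)\<^sup>2)" by (rule integrable_const_bound[where B = 1]) (use s in \<open>auto simp: power_le_one\<close>)
 have "k \<le> card I" using I by simp
 then obtain A where A: "A \<subseteq> I" "card A = k" "finite A" by (rule obtain_subset_with_card_n)
 have "k \<le> card (I - A)" using I A by (simp add: card_Diff_subset)
 then obtain B where B: "B \<subseteq> I - A" "card B = k" "finite B" by (rule obtain_subset_with_card_n)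
 have mono: "?s I om \<le> ?s A' om" if "A' \<subseteq> I" for A' om using that I by (intro share_antimono nn sum_mono2) auto
 have ind: "indep_rv borel (?s A) borel (?s B)"
 proof -
  have m1: "(%w. share (\<Sum>l\<in>A. (w l)\<^sup>2)) \<in> PiM A (%_. borel) \<rightarrow>\<^sub>M borel" by measurable
  have m2: "(%w. share (\<Sum>l\<in>B. (w l)\<^sup>2)) \<in> PiM B (%_. borel) \<rightarrow>\<^sub>M borel" by measurable
  have disj: "A \<inter> B = {}" using B by blast
  show ?thesis using iid_blocks_independent[OF iid_u disj m1 m2] by simp
 qed
 have prod_int: "integrable M (%om. ?s A om * ?s B om)"
  by (rule integrable_const_bound[where B = 1]) (use s in \<open>auto simp: abs_mult intro!: mult_le_one\<close>)
 have "expectation (%om. (?s I om)\<^sup>2) \<le> expectation (%om. ?s A om * ?s B om)"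
 proof (rule integral_mono[OF sq_int prod_int])
  fix om
  show "(?s I om)\<^sup>2 \<le> ?s A om * ?s B om" unfolding power2_eq_square[of "?s I om"] using A(1) B(1) s by (intro mult_mono mono) auto
 qed
 also have "\<dots> = (\<integral>om. (\<integral>om'. ?s A om * ?s B om' \<partial>M) \<partial>M)" by (rule indep_rv_expectation[OF ind, of "(*)"]) (use prod_int in auto)
 also have "\<dots> = expectation (?s A) * expectation (?s B)" by simp
 also have "\<dots> \<le> 1 / (real k + 1) * (1 / (real k + 1))" using share_of_squares_le[OF A(3)] share_of_squares_le[OF B(3)] s unfolding A(2) B(2)
  by (intro mult_mono) (auto intro!: integral_nonneg_AE AE_I2)
 finally show "expectation (%om. (?s I om)\<^sup>2) \<le> (1 / (real k + 1))\<^sup>2" by (simp add: power2_eq_square)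
qed

text \<open>Expand \<open>T\<^sup>2\<close> into the terms \<open>u\<^sub>i u\<^sub>j / V\<^sup>2\<close>. The
  diagonal adds up to at most one. Off the diagonal, conditioning on the remaining \<open>n - 2\<close>
  squares bounds the expectation by a constant times \<open>E (share R)\<^sup>2\<close>, which is of order
  \<open>1 / n\<^sup>2\<close>.\<close>
lemma self_normalized_sum_second_moment:
 obtains C where "\<And>n. integrable M (%om. (self_normalized_sum n om)\<^sup>2)" "\<And>n. expectation (%om. (self_normalized_sum n om)\<^sup>2) \<le> C"
proof -
 obtain C where C: "0 < C" "\<And>r i j. 0 \<le> r \<Longrightarrow> i \<noteq> j \<Longrightarrow>
  \<bar>expectation (%om. u i om * u j om / (r + (u i om)\<^sup>2 + (u j om)\<^sup>2))\<bar> \<le> C * (share r)\<^sup>2" by (rule pair_ratio_expectation) blast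
 define V where "V n om = (\<Sum>i=1..n. (u i om)\<^sup>2)" for n om
 have Vm[measurable]: "random_variable borel (V n)" for n unfolding V_def[abs_def] by measurable
 have V_nn: "0 \<le> V n om" for n om by (simp add: V_def sum_nonneg)
 define t where "t n i j om = u i om * u j om / V n om" for n i j om
 have tm[measurable]: "random_variable borel (t n i j)" for n i j unfolding t_def[abs_def] by measurable
 have t_le: "\<bar>t n i j om\<bar> \<le> 1" if "i \<in> {1..n}" "j \<in> {1..n}" for n i j om
 proof -
  have "(u k om)\<^sup>2 \<le> V n om" if "k \<in> {1..n}" for k unfolding V_def using that by (intro member_le_sum) auto
  from this[OF that(1)] this[OF that(2)] have "\<bar>u i om * u j om\<bar> \<le> V n om" using abs_mult_le_sum_squares[of "u i om" "u j om"] by simp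
  then have "\<bar>u i om * u j om\<bar> / V n om \<le> 1" by (intro fraction_le_one) auto
  then show ?thesis using V_nn[of n om] by (simp add: t_def abs_divide)
 qed
 have t_int: "integrable M (t n i j)" if "i \<in> {1..n}" "j \<in> {1..n}" for n i j
  by (rule integrable_const_bound[where B = 1]) (use t_le[OF that] in auto)
 have square: "(self_normalized_sum n om)\<^sup>2 = (\<Sum>i=1..n. \<Sum>j=1..n. t n i j om)" for n om
 proof -
  have "(V n om powr (- 1 / 2))\<^sup>2 = 1 / V n om"
  proof (cases "V n om = 0")
   case False
   then have "0 < V n om" using V_nn[of n om] by simp
   then show ?thesis by (simp add: power2_eq_square powr_minus_divide flip: powr_add)
  qed simp
  then have "(self_normalized_sum n om)\<^sup>2 = (\<Sum>i=1..n. u i om)\<^sup>2 / V n om"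
   unfolding self_normalized_sum_def V_def[symmetric] by (simp add: power_mult_distrib)
  also have "\<dots> = (\<Sum>i=1..n. \<Sum>j=1..n. t n i j om)" unfolding power2_eq_square sum_product sum_divide_distrib t_def ..
  finally show ?thesis .
 qed
 have off: "expectation (t n i j) \<le> 9 * C / (real n)\<^sup>2" if ij: "i \<noteq> j" "i \<in> {1..n}" "j \<in> {1..n}" for n i j
 proof -
  define I where "I = {1..n} - {i, j}"
  have I: "finite I" "{i, j} \<inter> I = {}" by (auto simp: I_def)
  have V_split: "V n om = (\<Sum>l\<in>I. (u l om)\<^sup>2) + (u i om)\<^sup>2 + (u j om)\<^sup>2" for om
  proof -
   have "V n om = (\<Sum>l\<in>I \<union> {i, j}. (u l om)\<^sup>2)" unfolding V_def using ij by (intro sum.cong) (auto simp: I_def)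
   also have "\<dots> = (\<Sum>l\<in>I. (u l om)\<^sup>2) + (\<Sum>l\<in>{i, j}. (u l om)\<^sup>2)" using I by (intro sum.union_disjoint) auto
   finally show ?thesis using ij(1) by simp
  qed
  have n2: "2 \<le> n" using ij by auto
  have "card I = n - 2" unfolding I_def using ij by (subst card_Diff_subset) auto
  then have k: "2 * ((n - 2) div 2) \<le> card I" by simp
  let ?R = "%om. \<Sum>l\<in>I. (u l om)\<^sup>2"
  have R_nn: "0 \<le> ?R om" for om by (simp add: sum_nonneg)
  define f where "f r p = fst p * snd p / (r + (fst p)\<^sup>2 + (snd p)\<^sup>2)" for r :: real and p :: "real \<times> real"
  have fm: "(%(r, p). f r p) \<in> borel_measurable (borel \<Otimes>\<^sub>M (borel \<Otimes>\<^sub>M borel))" unfolding f_def by measurable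
  have tf: "t n i j om = f (?R om) (u i om, u j om)" for om by (simp add: t_def f_def V_split)
  have int_f: "integrable M (%om. f (?R om) (u i om, u j om))" using t_int[OF ij(2,3)] unfolding tf[symmetric] by simp
  note ind = squares_independent_of_pair[OF I]
  have "expectation (t n i j) = (\<integral>om. (\<integral>om'. f (?R om) (u i om', u j om') \<partial>M) \<partial>M)"
   using indep_rv_expectation[OF ind fm int_f] unfolding tf[symmetric] by simp
  also have "\<dots> \<le> expectation (%om. C * (share (?R om))\<^sup>2)"
  proof (rule integral_mono)
   show "integrable M (%om. \<integral>om'. f (?R om) (u i om', u j om') \<partial>M)" by (rule indep_rv_integrable_inner[OF ind fm int_f])
   show "integrable M (%om. C * (share (?R om))\<^sup>2)" by (intro integrable_mult_right share_square_expectation_le(2)[OF I(1) k])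
   show "(\<integral>om'. f (?R om) (u i om', u j om') \<partial>M) \<le> C * (share (?R om))\<^sup>2" for om using C(2)[OF R_nn[of om] ij(1)] by (simp add: f_def)
  qed
  also have "\<dots> = C * expectation (%om. (share (?R om))\<^sup>2)" by (rule integral_mult_right_zero)
  also have "\<dots> \<le> C * (1 / (real ((n - 2) div 2) + 1))\<^sup>2" using C(1) by (intro mult_left_mono share_square_expectation_le(1)[OF I(1) k]) auto
  also have "\<dots> \<le> C * (3 / real n)\<^sup>2"
  proof -
   define k where "k = (n - 2) div 2"
   have "n \<le> 3 * (k + 1)" unfolding k_def using n2 by presburger
   then have "real n \<le> real (3 * (k + 1))" by (simp only: of_nat_le_iff)
   then have "1 / (real k + 1) \<le> 3 / real n" using n2 by (simp add: field_simps)
   then show ?thesis unfolding k_def[symmetric] using C(1) by (intro mult_left_mono power_mono) auto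
  qed
  finally show ?thesis by (simp add: power_divide mult.commute)
 qed
 show ?thesis
 proof (rule that[of "1 + 9 * C"])
  fix n
  show "integrable M (%om. (self_normalized_sum n om)\<^sup>2)" unfolding square by (intro L_integrable_sum t_int)
  have "expectation (%om. (self_normalized_sum n om)\<^sup>2) = (\<Sum>i=1..n. \<Sum>j=1..n. expectation (t n i j))"
  proof -
   have "expectation (%om. \<Sum>i=1..n. \<Sum>j=1..n. t n i j om) = (\<Sum>i=1..n. expectation (%om. \<Sum>j=1..n. t n i j om))"
    by (intro L_integral_sum L_integrable_sum t_int)
   also have "\<dots> = (\<Sum>i=1..n. \<Sum>j=1..n. expectation (t n i j))" by (intro sum.cong refl L_integral_sum t_int)
   finally show ?thesis unfolding square .
  qed
  also have "\<dots> = (\<Sum>i=1..n. expectation (t n i i) + (\<Sum>j\<in>{1..n} - {i}. expectation (t n i j)))" by (intro sum.cong refl sum.remove) auto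
  also have "\<dots> = (\<Sum>i=1..n. expectation (t n i i)) + (\<Sum>i=1..n. \<Sum>j\<in>{1..n} - {i}. expectation (t n i j))" by (rule sum.distrib)
  also have "\<dots> \<le> 1 + 9 * C"
  proof (rule add_mono)
   have "(\<Sum>i=1..n. expectation (t n i i)) = expectation (%om. \<Sum>i=1..n. t n i i om)" using t_int by (intro L_integral_sum[symmetric]) auto
   also have "\<dots> \<le> 1"
   proof (rule integral_le_const)
    show "integrable M (%om. \<Sum>i=1..n. t n i i om)" using t_int by (intro L_integrable_sum) auto
    show "AE om in M. (\<Sum>i=1..n. t n i i om) \<le> 1"
    proof (intro AE_I2)
     fix om
     have "(\<Sum>i=1..n. t n i i om) = V n om / V n om" by (simp add: t_def V_def power2_eq_square flip: sum_divide_distrib)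
     then show "(\<Sum>i=1..n. t n i i om) \<le> 1" by simp
    qed
   qed
   finally show "(\<Sum>i=1..n. expectation (t n i i)) \<le> 1" .
   have "(\<Sum>i=1..n. \<Sum>j\<in>{1..n} - {i}. expectation (t n i j)) \<le> (\<Sum>i=1..n. \<Sum>j\<in>{1..n} - {i}. 9 * C / (real n)\<^sup>2)" by (intro sum_mono off) auto
   also have "\<dots> \<le> (\<Sum>i=1..n. \<Sum>j\<in>{1..n}. 9 * C / (real n)\<^sup>2)" using C(1) by (intro sum_mono sum_mono2) auto
   also have "\<dots> \<le> 9 * C" using C(1) by (cases "n = 0") (auto simp: power2_eq_square)
   finally show "(\<Sum>i=1..n. \<Sum>j\<in>{1..n} - {i}. expectation (t n i j)) \<le> 9 * C" .
  qed
  finally show "expectation (%om. (self_normalized_sum n om)\<^sup>2) \<le> 1 + 9 * C" .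
 qed
qed

theorem DAN_iff_self_normalized_clt: "DAN \<xi> \<longleftrightarrow> conv_std_normal self_normalized_sum"
proof
 assume "DAN \<xi>"
 then obtain b where "normal_scale (\<xi> 0) b" by (rule DAN_imp_normal_scale[OF iid_\<xi>])
 then show "conv_std_normal self_normalized_sum" by (rule normal_scale_imp_clt)
next
 assume clt: "conv_std_normal self_normalized_sum"
 obtain C where C: "\<And>n. integrable M (%om. (self_normalized_sum n om)\<^sup>2)" "\<And>n. expectation (%om. (self_normalized_sum n om)\<^sup>2) \<le> C"
  by (rule self_normalized_sum_second_moment) blast
 obtain b where b: "normal_scale (u 0) b" "\<And>n. 1 \<le> b n"
 proof (rule self_normalized_clt_imp_normal_scale[OF iid_u u_int u_nonzero, of C])
  show "conv_std_normal (%n om. (\<Sum>i=1..n. u i om) * (\<Sum>i=1..n. (u i om)\<^sup>2) powr (- 1 / 2))" using clt unfolding self_normalized_sum_def[abs_def] .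
 qed (use C in \<open>auto simp: self_normalized_sum_def\<close>)
 obtain K A where KA: "0 < K" "0 < A" "\<And>k b. k \<in> {2, 4} \<Longrightarrow> 0 < b \<Longrightarrow> tmom k (\<xi> 0) b \<le> (K / b) ^ k + A * tmom k (u 0) b" by (rule tmom_\<xi>_le_u) blast
 obtain B where B: "0 < B" "\<And>b. 1 \<le> b \<Longrightarrow> tmom 2 (u 0) b \<le> B * tmom 2 (\<xi> 0) b" by (rule tmom_u_le_\<xi>) blast
 have "normal_scale (\<xi> 0) b" using KA(2) by (intro normal_scale_transfer[OF b(1) rv(1) u_measurable KA(3) B(2)[OF b(2)] _ B(1)]) auto
 then show "DAN \<xi>" by (rule normal_scale_imp_DAN[OF iid_\<xi> \<xi>_int \<xi>_nonconst])
qed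

end

section \<open>Studentization and the structural model\<close>

lemma powr_minus_half: "0 \<le> (x::real) \<Longrightarrow> x powr (- 1 / 2) = 1 / sqrt x"
 using powr_minus_divide[of x "1 / 2"] powr_half_sqrt[of x] by (cases "x = 0") auto

context prob_space
begin

lemma conv_std_normal_cong:
 assumes "\<And>n om. om \<in> space M \<Longrightarrow> S n om = T n om"
 shows "conv_std_normal S \<longleftrightarrow> conv_std_normal T"
proof -
 have "random_variable borel (S n) \<longleftrightarrow> random_variable borel (T n)" for n by (intro measurable_cong assms)
 moreover have "distr M borel (S n) = distr M borel (T n)" for n by (intro distr_cong refl assms)
 ultimately show ?thesis by (simp add: conv_std_normal_def)
qed

lemma conv_std_normal_slutsky_iff:
 assumes [measurable]: "\<And>n. random_variable borel (S n)" "\<And>n. random_variable borel (T n)"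
  and v: "vanishes (%n om. S n om - T n om)"
 shows "conv_std_normal S \<longleftrightarrow> conv_std_normal T"
proof
 assume "conv_std_normal T"
 then show "conv_std_normal S" by (rule conv_std_normal_slutsky) (use v in auto)
next
 have "vanishes (%n om. T n om - S n om)" using v unfolding vanishes_def by (simp only: abs_minus_commute)
 moreover assume "conv_std_normal S"
 ultimately show "conv_std_normal T" by (intro conv_std_normal_slutsky[of S T]) auto
qed

lemma indep_rv_sym:
 assumes "indep_rv S X T Y"
 shows "indep_rv T Y S X"
proof -
 have "indep_set B A" if "indep_set A B" for A B
 proof -
  have "prob (b \<inter> a) = prob b * prob a" if "a \<in> A" "b \<in> B" for a b
   using \<open>indep_set A B\<close> that unfolding indep_sets2_eq by (simp only: Int_commute[of b a] mult.commute[of "prob b"])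
  then show ?thesis using that unfolding indep_sets2_eq by blast
 qed
 then show ?thesis using assms unfolding indep_rv_def by blast
qed

text \<open>Independence of the two sequences lets the expectation of a product of indicators be integrated first
  over one sequence and then over the other; each of these expectations factors.\<close>
lemma
 assumes X: "iid N X" and Y: "iid K Y"
  and ind: "indep_rv (\<Pi>\<^sub>M i\<in>UNIV. N) (%om. \<lambda>i\<in>UNIV. X i om) (\<Pi>\<^sub>M i\<in>UNIV. K) (%om. \<lambda>i\<in>UNIV. Y i om)"
 shows iid_joint: "iid (N \<Otimes>\<^sub>M K) (%i om. (X i om, Y i om))" and iid_joint_indep: "indep_rv N (X i) K (Y i)"
proof -
 note [measurable] = iid_measurable[OF X] iid_measurable[OF Y]
 let ?Z = "%i om. (X i om, Y i om)"
 have ind1: "indep_rv N (X i) K (Y i)" for i using indep_rv_compose[OF ind, of "%f. f i" N "%f. f i" K] by simp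
 show "indep_rv N (X i) K (Y i)" by (rule ind1)
 define c where "c A = expectation (%om. \<integral>om'. (indicator A (X 0 om, Y 0 om') :: real) \<partial>M)" for A :: "('b \<times> 'c) set"
 have prod: "expectation (%om. \<Prod>i\<in>J. indicator (A i) (?Z i om) :: real) = (\<Prod>i\<in>J. c (A i))"
  if J: "finite J" and Aall: "\<And>i. A i \<in> sets (N \<Otimes>\<^sub>M K)" for J A
 proof -
  note [measurable] = Aall
  define f where "f w v = (\<Prod>i\<in>J. indicator (A i) (w i, v i) :: real)" for w :: "nat \<Rightarrow> 'b" and v :: "nat \<Rightarrow> 'c"
  have fm: "(%(w, v). f w v) \<in> borel_measurable ((\<Pi>\<^sub>M i\<in>UNIV. N) \<Otimes>\<^sub>M (\<Pi>\<^sub>M i\<in>UNIV. K))" unfolding f_def by measurable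
  have f_eq: "f (\<lambda>i\<in>UNIV. X i om) (\<lambda>i\<in>UNIV. Y i om') = (\<Prod>i\<in>J. indicator (A i) (X i om, Y i om'))" for om om' by (simp add: f_def)
  have "expectation (%om. f (\<lambda>i\<in>UNIV. X i om) (\<lambda>i\<in>UNIV. Y i om)) = (\<integral>om. (\<integral>om'. f (\<lambda>i\<in>UNIV. X i om) (\<lambda>i\<in>UNIV. Y i om') \<partial>M) \<partial>M)"
  proof (rule indep_rv_expectation[OF ind fm])
   show "integrable M (%om. f (\<lambda>i\<in>UNIV. X i om) (\<lambda>i\<in>UNIV. Y i om))"
    unfolding f_eq by (rule integrable_const_bound[where B = 1]) (auto simp: abs_prod intro!: prod_le_1)
  qed
  also have "\<dots> = (\<integral>om. (\<Prod>i\<in>J. \<integral>om'. indicator (A i) (X i om, Y 0 om') \<partial>M) \<partial>M)"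
  proof (rule L_integral_cong[OF refl])
   fix om assume w: "om \<in> space M"
   have [measurable]: "X i om \<in> space N" for i using measurable_space[OF iid_measurable[OF X] w] .
   show "(\<integral>om'. f (\<lambda>i\<in>UNIV. X i om) (\<lambda>i\<in>UNIV. Y i om') \<partial>M) = (\<Prod>i\<in>J. \<integral>om'. indicator (A i) (X i om, Y 0 om') \<partial>M)" unfolding f_eq
   proof (rule iid_prod_expectation[OF Y J])
    show "(%y. indicator (A i) (X i om, y) :: real) \<in> borel_measurable K" for i by measurable
    show "integrable M (%om'. indicator (A i) (X i om, Y 0 om') :: real)" for i by (rule integrable_const_bound[where B = 1]) auto
   qed
  qed
  also have "\<dots> = (\<Prod>i\<in>J. c (A i))" unfolding c_def
  proof (rule iid_prod_expectation[OF X J])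
   show m: "(%x. \<integral>om'. indicator (A i) (x, Y 0 om') \<partial>M :: real) \<in> borel_measurable N" for i by measurable
   show "integrable M (%om. \<integral>om'. indicator (A i) (X 0 om, Y 0 om') \<partial>M :: real)" for i
   proof (rule integrable_const_bound[where B = 1])
    show "AE om in M. norm (\<integral>om'. indicator (A i) (X 0 om, Y 0 om') \<partial>M :: real) \<le> 1"
    proof (intro AE_I2)
     fix om assume w: "om \<in> space M"
     have [measurable]: "X 0 om \<in> space N" using measurable_space[OF iid_measurable[OF X] w] .
     have "integrable M (%om'. indicator (A i) (X 0 om, Y 0 om') :: real)" by (rule integrable_const_bound[where B = 1]) auto
     then have "(\<integral>om'. indicator (A i) (X 0 om, Y 0 om') \<partial>M) \<le> (1::real)" by (rule integral_le_const) (auto simp: indicator_def)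
     moreover have "0 \<le> (\<integral>om'. indicator (A i) (X 0 om, Y 0 om') \<partial>M :: real)" by (rule integral_nonneg_AE) auto
     ultimately show "norm (\<integral>om'. indicator (A i) (X 0 om, Y 0 om') \<partial>M :: real) \<le> 1" by simp
    qed
    show "random_variable borel (%om. \<integral>om'. indicator (A i) (X 0 om, Y 0 om') \<partial>M :: real)" using measurable_compose[OF iid_measurable[OF X] m] .
   qed
  qed
  finally show ?thesis unfolding f_eq .
 qed
 have prob_eq: "prob (\<Inter>i\<in>J. ?Z i -` A i \<inter> space M) = (\<Prod>i\<in>J. c (A i))"
  if J: "finite J" "J \<noteq> {}" and Aall: "\<And>i. A i \<in> sets (N \<Otimes>\<^sub>M K)" for J A
 proof -
  have "prob (\<Inter>i\<in>J. ?Z i -` A i \<inter> space M) = expectation (indicator (\<Inter>i\<in>J. ?Z i -` A i \<inter> space M))"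
   using J by (subst L_integral_indicator) (auto intro!: arg_cong[where f = prob])
  also have "\<dots> = expectation (%om. \<Prod>i\<in>J. indicator (A i) (?Z i om))"
  proof (rule L_integral_cong[OF refl])
   fix om assume "om \<in> space M"
   then show "indicator (\<Inter>i\<in>J. ?Z i -` A i \<inter> space M) om = (\<Prod>i\<in>J. indicator (A i) (?Z i om) :: real)"
    using J by (auto simp: indicator_def prod_eq_1_iff intro!: prod_zero[symmetric] split: if_splits)
  qed
  finally show ?thesis unfolding prod[OF J(1) Aall] .
 qed
 have "indep_vars (%_. N \<Otimes>\<^sub>M K) ?Z UNIV" unfolding indep_vars_def2
 proof (intro conjI ballI indep_setsI)
  show "random_variable (N \<Otimes>\<^sub>M K) (?Z i)" for i by measurable
  then show "{?Z i -` A \<inter> space M |A. A \<in> sets (N \<Otimes>\<^sub>M K)} \<subseteq> events" for i by (auto intro: measurable_sets)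
  fix A J assume J: "J \<noteq> {}" "J \<subseteq> (UNIV :: nat set)" "finite J"
   and "\<forall>j\<in>J. A j \<in> {?Z j -` A \<inter> space M |A. A \<in> sets (N \<Otimes>\<^sub>M K)}"
  then have "\<forall>j\<in>J. \<exists>B. B \<in> sets (N \<Otimes>\<^sub>M K) \<and> A j = ?Z j -` B \<inter> space M" by blast
  then obtain B' where B': "\<And>j. j \<in> J \<Longrightarrow> B' j \<in> sets (N \<Otimes>\<^sub>M K) \<and> A j = ?Z j -` B' j \<inter> space M" by metis
  define B where "B j = (if j \<in> J then B' j else {})" for j
  have B: "B j \<in> sets (N \<Otimes>\<^sub>M K)" for j using B' by (simp add: B_def)
  have AB: "A j = ?Z j -` B j \<inter> space M" if "j \<in> J" for j using B'[OF that] that by (simp add: B_def)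
  have "prob (\<Inter>j\<in>J. A j) = prob (\<Inter>j\<in>J. ?Z j -` B j \<inter> space M)" using AB by simp
  also have "\<dots> = (\<Prod>j\<in>J. c (B j))" by (rule prob_eq[OF J(3,1) B])
  also have "\<dots> = (\<Prod>j\<in>J. prob (A j))" by (intro prod.cong refl) (use prob_eq[of "{_}" B, OF _ _ B] AB in simp)
  finally show "prob (\<Inter>j\<in>J. A j) = (\<Prod>j\<in>J. prob (A j))" .
 qed
 moreover have "distr M (N \<Otimes>\<^sub>M K) (?Z i) = distr M (N \<Otimes>\<^sub>M K) (?Z 0)" for i
  using ind1[of i] ind1[of 0] iid_distr[OF X, of i] iid_distr[OF Y, of i] unfolding indep_rv_iff_distr by simp
 ultimately show "iid (N \<Otimes>\<^sub>M K) ?Z" by (simp add: iid_def)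
qed

lemma prob_average_nonpos_tendsto_0:
 fixes Y :: "nat \<Rightarrow> 'a \<Rightarrow> real"
 assumes iid: "iid borel Y" and int: "integrable M (Y 0)" and pos: "0 < expectation (Y 0)"
  and sub: "\<And>n. 1 \<le> n \<Longrightarrow> A n \<subseteq> {om\<in>space M. (\<Sum>i=1..n. Y i om) / real n \<le> 0}"
 shows "(%n. prob (A n)) \<longlonglongrightarrow> 0"
proof (rule prob_le_tendsto_0[OF vanishesD[OF weak_law[OF iid int] pos]])
 note [measurable] = iid_measurable[OF iid]
 show "\<forall>\<^sub>F n in sequentially. A n \<subseteq> {om\<in>space M. expectation (Y 0) \<le> \<bar>(\<Sum>i=1..n. Y i om) / real n - expectation (Y 0)\<bar>} \<and>
   {om\<in>space M. expectation (Y 0) \<le> \<bar>(\<Sum>i=1..n. Y i om) / real n - expectation (Y 0)\<bar>} \<in> events" using eventually_ge_at_top[of 1]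
 proof eventually_elim
  case (elim n)
  have "{om\<in>space M. (\<Sum>i=1..n. Y i om) / real n \<le> 0} \<subseteq> {om\<in>space M. expectation (Y 0) \<le> \<bar>(\<Sum>i=1..n. Y i om) / real n - expectation (Y 0)\<bar>}" by auto
  then show ?case using sub[OF elim] by auto
 qed
qed

lemma min_square_expectation_pos:
 fixes X :: "'a \<Rightarrow> real"
 assumes [measurable]: "random_variable borel X" and nz: "\<not> (AE om in M. X om = 0)"
 shows "integrable M (%om. min 1 ((X om)\<^sup>2))" "0 < expectation (%om. min 1 ((X om)\<^sup>2))"
proof -
 show "integrable M (%om. min 1 ((X om)\<^sup>2))" by (rule integrable_const_bound[where B = 1]) auto
 show "0 < expectation (%om. min 1 ((X om)\<^sup>2))" using tmom_pos[of X 1 2, OF _ nz] by (simp add: tmom_def)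
qed

end

context product_noise
begin

text \<open>The two normalizations differ by a factor that tends to one in mean, because the second moments of the
  self-normalized sums are bounded. Multiplication by it changes neither the hypothesis nor the conclusion
  of a limit theorem.\<close>
lemma DAN_iff_studentized_clt:
 assumes Bad: "(%n. prob (Bad n)) \<longlonglongrightarrow> 0" "\<And>n. Bad n \<in> events"
  and A[measurable]: "\<And>n. random_variable borel (A n)"
  and eq: "\<And>n om. 2 \<le> n \<Longrightarrow> om \<in> space M \<Longrightarrow> om \<notin> Bad n \<Longrightarrow> A n om = (\<Sum>i=1..n. u i om) / sqrt (real n) *
    ((\<Sum>i=1..n. (u i om - (\<Sum>i=1..n. u i om) / real n)\<^sup>2) / (real n - 1)) powr (- 1 / 2)"
 shows "DAN \<xi> \<longleftrightarrow> conv_std_normal A"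
proof -
 obtain C where C: "\<And>n. integrable M (%om. (self_normalized_sum n om)\<^sup>2)" "\<And>n. expectation (%om. (self_normalized_sum n om)\<^sup>2) \<le> C"
  by (rule self_normalized_sum_second_moment) blast
 define T where "T = self_normalized_sum"
 have Tm[measurable]: "random_variable borel (T n)" for n by (simp add: T_def)
  \<comment> \<open>The sum of squared deviations is \<open>V\<^sup>2 (1 - T\<^sup>2 / n)\<close>, and \<open>n (1 - T\<^sup>2 / n) / (n - 1) = 1 + (1 - T\<^sup>2) / (n - 1)\<close>.\<close>
 define s where "s n om = 1 + (1 - (T n om)\<^sup>2) / (real n - 1)" for n om
 have sm[measurable]: "random_variable borel (s n)" for n unfolding s_def[abs_def] by measurable
 have s_lim: "vanishes (%n om. s n om - 1)"
 proof (rule vanishes_L1)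
  have i: "integrable M (%om. 1 - (T n om)\<^sup>2)" for n using C(1) unfolding T_def by (intro L_integrable_diff) auto
  then show "integrable M (%om. s n om - 1)" for n by (simp add: s_def)
  have E: "expectation (%om. \<bar>1 - (T n om)\<^sup>2\<bar>) \<le> 1 + C" for n
  proof -
   have "expectation (%om. \<bar>1 - (T n om)\<^sup>2\<bar>) \<le> expectation (%om. 1 + (T n om)\<^sup>2)"
   proof (rule integral_mono)
    show "integrable M (%om. \<bar>1 - (T n om)\<^sup>2\<bar>)" by (rule integrable_abs[OF i])
    show "integrable M (%om. 1 + (T n om)\<^sup>2)" using C(1) unfolding T_def by (intro L_integrable_add) auto
    show "\<bar>1 - (T n om)\<^sup>2\<bar> \<le> 1 + (T n om)\<^sup>2" for om using abs_triangle_ineq4[of 1 "(T n om)\<^sup>2"] by simp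
   qed
   also have "\<dots> = 1 + expectation (%om. (T n om)\<^sup>2)" using C(1) unfolding T_def by (subst L_integral_add) (auto simp: prob_space)
   finally show ?thesis using C(2)[of n] unfolding T_def by linarith
  qed
  have up: "(%n. (1 + C) / (real n - 1)) \<longlonglongrightarrow> 0" by real_asymp
  show "(%n. expectation (%om. \<bar>s n om - 1\<bar>)) \<longlonglongrightarrow> 0"
  proof (rule tendsto_sandwich[OF _ _ tendsto_const up])
   show "\<forall>\<^sub>F n in sequentially. 0 \<le> expectation (%om. \<bar>s n om - 1\<bar>)" by (intro always_eventually allI integral_nonneg_AE AE_I2) simp
   show "\<forall>\<^sub>F n in sequentially. expectation (%om. \<bar>s n om - 1\<bar>) \<le> (1 + C) / (real n - 1)" using eventually_ge_at_top[of 2]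
   proof eventually_elim
    case (elim n)
    then have n: "0 < real n - 1" by simp
    then have "\<bar>s n om - 1\<bar> = \<bar>1 - (T n om)\<^sup>2\<bar> / (real n - 1)" for om by (simp add: s_def)
    then have "expectation (%om. \<bar>s n om - 1\<bar>) = expectation (%om. \<bar>1 - (T n om)\<^sup>2\<bar>) / (real n - 1)" by (simp only: integral_divide_zero)
    also have "\<dots> \<le> (1 + C) / (real n - 1)" using n by (intro divide_right_mono E) simp
    finally show ?case .
   qed
  qed
 qed
 have key: "A n om = T n om * (1 / sqrt (s n om)) \<and> 0 \<le> s n om" if n: "2 \<le> n" and w: "om \<in> space M" "om \<notin> Bad n" for n om
 proof -
  define m where "m = (\<Sum>i=1..n. u i om)"
  define V where "V = (\<Sum>i=1..n. (u i om)\<^sup>2)"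
  have n1: "0 < real n - 1" "0 < real n" using n by auto
  have V: "0 \<le> V" by (simp add: V_def sum_nonneg)
  have T: "T n om = m / sqrt V" unfolding T_def self_normalized_sum_def m_def V_def by (subst powr_minus_half) (auto intro: sum_nonneg)
  have W: "(\<Sum>i=1..n. (u i om - m / real n)\<^sup>2) = V - m\<^sup>2 / real n"
  proof -
   have "(\<Sum>i=1..n. (u i om - m / real n)\<^sup>2) = (\<Sum>i=1..n. (u i om)\<^sup>2 - 2 * (m / real n) * u i om + (m / real n)\<^sup>2)"
    by (intro sum.cong refl) (simp add: power2_diff)
   also have "\<dots> = V - 2 * (m / real n) * m + real n * (m / real n)\<^sup>2"
    unfolding sum.distrib sum_subtractf sum_distrib_left[symmetric] m_def[symmetric] V_def[symmetric] by simp
   also have "\<dots> = V - m\<^sup>2 / real n" using n1 by (simp add: power2_eq_square field_simps)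
   finally show ?thesis .
  qed
  then have W_nn: "0 \<le> V - m\<^sup>2 / real n" using sum_nonneg[of "{1..n}" "%i. (u i om - m / real n)\<^sup>2"] by simp
  have A_eq: "A n om = m / sqrt (real n) * (1 / sqrt ((V - m\<^sup>2 / real n) / (real n - 1)))"
   using eq[OF n w] W_nn n1 unfolding m_def[symmetric] W by (subst (asm) powr_minus_half) auto
  show ?thesis
  proof (cases "V = 0")
   case True
   then have "m\<^sup>2 / real n \<le> 0" using W_nn by simp
   then have "m = 0" using n1 by (simp add: divide_le_0_iff)
   then show ?thesis using n1 T A_eq by (simp add: s_def)
  next
   case False
   then have Vp: "0 < V" using V by simp
   have T_sq: "(T n om)\<^sup>2 = m\<^sup>2 / V" unfolding T using V by (simp add: power_divide)
   have s_eq: "s n om = real n * ((V - m\<^sup>2 / real n) / (real n - 1)) / V" unfolding s_def T_sq using Vp n1 by (simp add: field_simps)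
   then have "0 \<le> s n om" using W_nn n1 Vp by simp
   moreover have "T n om * (1 / sqrt (s n om)) = m / sqrt (real n) * (1 / sqrt ((V - m\<^sup>2 / real n) / (real n - 1)))"
    unfolding T s_eq real_sqrt_divide real_sqrt_mult using Vp n1 by simp
   ultimately show ?thesis using A_eq by simp
  qed
 qed
 have half: "(%n. prob {om\<in>space M. 1 / 2 \<le> \<bar>s n om - 1\<bar>}) \<longlonglongrightarrow> 0" by (rule vanishesD[OF s_lim]) simp
 have ev: "\<forall>\<^sub>F n in sequentially. 2 \<le> (n::nat)" by (rule eventually_ge_at_top)
 have "conv_std_normal A" if "conv_std_normal T"
 proof (rule conv_std_normal_slutsky[OF that A])
  have c: "isCont (%x. 1 / sqrt x) (1::real)" by (intro continuous_intros) auto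
  have v: "vanishes (%n om. T n om * (1 / sqrt (s n om) - 1 / sqrt 1))"
   by (rule vanishes_mult_conv_std_normal[OF that vanishes_continuous[OF s_lim sm c]]) measurable
  show "vanishes (%n om. A n om - T n om)"
  proof (rule vanishes_cong_event[OF v _ Bad])
   show "\<forall>\<^sub>F n in sequentially. \<forall>om\<in>space M. om \<notin> Bad n \<longrightarrow> A n om - T n om = T n om * (1 / sqrt (s n om) - 1 / sqrt 1)"
    using ev by eventually_elim (use key in \<open>simp add: right_diff_distrib\<close>)
  qed measurable
 qed
 moreover have "conv_std_normal T" if "conv_std_normal A"
 proof (rule conv_std_normal_slutsky[OF that Tm])
  have c: "isCont sqrt (1::real)" by (intro continuous_intros)
  have v: "vanishes (%n om. A n om * (sqrt (s n om) - sqrt 1))"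
   by (rule vanishes_mult_conv_std_normal[OF that vanishes_continuous[OF s_lim sm c]]) measurable
  have ev2: "(%n. prob (Bad n \<union> {om\<in>space M. 1 / 2 \<le> \<bar>s n om - 1\<bar>})) \<longlonglongrightarrow> 0" by (rule prob_Un_tendsto_0[OF Bad(1) half Bad(2)]) measurable
  show "vanishes (%n om. T n om - A n om)"
  proof (rule vanishes_cong_event[OF v _ ev2])
   show "Bad n \<union> {om\<in>space M. 1 / 2 \<le> \<bar>s n om - 1\<bar>} \<in> events" for n by (rule sets.Un[OF Bad(2)]) measurable
   show "\<forall>\<^sub>F n in sequentially. \<forall>om\<in>space M. om \<notin> Bad n \<union> {om\<in>space M. 1 / 2 \<le> \<bar>s n om - 1\<bar>} \<longrightarrow> T n om - A n om = A n om * (sqrt (s n om) - sqrt 1)"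
    using ev
   proof eventually_elim
    case (elim n)
    show ?case
    proof (intro ballI impI)
     fix om assume w: "om \<in> space M" and nb: "om \<notin> Bad n \<union> {om\<in>space M. 1 / 2 \<le> \<bar>s n om - 1\<bar>}"
     then have "\<not> 1 / 2 \<le> \<bar>s n om - 1\<bar>" "om \<notin> Bad n" by auto
     then have "0 < sqrt (s n om)" by (simp add: abs_if split: if_splits)
     then show "T n om - A n om = A n om * (sqrt (s n om) - sqrt 1)" using key[OF elim w \<open>om \<notin> Bad n\<close>] by (simp add: field_simps)
    qed
   qed
  qed measurable
 qed
 ultimately show ?thesis using DAN_iff_self_normalized_clt unfolding T_def by blast
qed

lemma DAN_iff_clt_up_to_event:
 assumes Bad: "(%n. prob (Bad n)) \<longlonglongrightarrow> 0" "\<And>n. Bad n \<in> events"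
  and A[measurable]: "\<And>n. random_variable borel (A n)"
  and eq: "\<And>n om. 2 \<le> n \<Longrightarrow> om \<in> space M \<Longrightarrow> om \<notin> Bad n \<Longrightarrow> A n om = self_normalized_sum n om"
 shows "DAN \<xi> \<longleftrightarrow> conv_std_normal A"
proof -
 have "vanishes (%n om. A n om - self_normalized_sum n om)"
 proof (rule vanishes_cong_event[OF vanishes_zero _ Bad])
  have "\<forall>\<^sub>F n in sequentially. 2 \<le> (n::nat)" by (rule eventually_ge_at_top)
  then show "\<forall>\<^sub>F n in sequentially. \<forall>om\<in>space M. om \<notin> Bad n \<longrightarrow> A n om - self_normalized_sum n om = 0" by eventually_elim (use eq in simp)
 qed measurable
 then have "conv_std_normal A \<longleftrightarrow> conv_std_normal self_normalized_sum" by (intro conv_std_normal_slutsky_iff) auto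
 then show ?thesis using DAN_iff_self_normalized_clt by blast
qed

end


lemma S_mom_zero: "S_mom 0 a b n = (\<Sum>i=1..n. a i * b i) / real n" by (simp add: S_mom_def s_dev_def)

lemma average_minus_const:
 fixes f :: "nat \<Rightarrow> real"
 assumes "1 \<le> n"
 shows "(\<Sum>i=1..n. f i) / real n - c = (\<Sum>i=1..n. f i - c) / real n" using assms by (simp add: sum_subtractf diff_divide_distrib)

lemma estimator_error:
 assumes n: "1 \<le> n"
  and good: "if j = 1 then S_mom 0 x y n - mu \<noteq> 0 \<and> S_mom 0 y y n - lam * theta > 0 else S_mom 0 x x n - theta > 0"
 shows "U_stat 0 theta mu j x y n * (beta_hat 0 lam theta mu j x y n - beta) =
  (\<Sum>i=1..n. u_term 0 beta lam theta mu j x y n i) / real n"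
proof -
 have avg: "(\<Sum>i=1..n. s_dev 0 a b n i - c) / real n = S_mom 0 a b n - c" for a b c
  using average_minus_const[OF n, of "s_dev 0 a b n" c] by (simp add: S_mom_def)
 have combine: "(\<Sum>i=1..n. (s_dev 0 a b n i - c) - beta * (s_dev 0 a' b' n i - c')) / real n =
   (S_mom 0 a b n - c) - beta * (S_mom 0 a' b' n - c')" for a b c a' b' c'
  unfolding avg[symmetric] sum_subtractf[of "%i. s_dev 0 a b n i - c"] sum_distrib_left[symmetric] by (simp add: diff_divide_distrib)
 have err: "X * (Y / X - beta) = Y - beta * X" if "X \<noteq> 0" for X Y using that by (simp add: right_diff_distrib mult.commute)
 show ?thesis
 proof (cases "j = 1")
  case True
  have g: "S_mom 0 x y n - mu \<noteq> 0" "0 < S_mom 0 y y n - lam * theta" using good True by auto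
  show ?thesis unfolding u_term_def U_stat_def beta_hat_def by (simp only: True g if_True simp_thms combine err[OF g(1)])
 next
  case False
  have g: "0 < S_mom 0 x x n - theta" using good False by auto
  then have g': "S_mom 0 x x n - theta \<noteq> 0" by linarith
  show ?thesis unfolding u_term_def U_stat_def beta_hat_def by (simp only: False g if_True if_False combine err[OF g'])
 qed
qed

lemma stat_b_eq:
 assumes n: "1 \<le> n"
  and good: "if j = 1 then S_mom 0 x y n - mu \<noteq> 0 \<and> S_mom 0 y y n - lam * theta > 0 else S_mom 0 x x n - theta > 0"
  and v: "\<And>i. 1 \<le> i \<Longrightarrow> u_term 0 beta lam theta mu j x y n i = v i"
 shows "stat_b 0 beta lam theta mu j x y n = (\<Sum>i=1..n. v i) * (\<Sum>i=1..n. (v i)\<^sup>2) powr (- 1 / 2)"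
proof -
 have "(\<Sum>i=1..n. u_term 0 beta lam theta mu j x y n i) = (\<Sum>i=1..n. v i)" "(\<Sum>i=1..n. (u_term 0 beta lam theta mu j x y n i)\<^sup>2) = (\<Sum>i=1..n. (v i)\<^sup>2)"
  using v by (auto intro!: sum.cong)
 then show ?thesis using estimator_error[OF n good, of beta] n unfolding stat_b_def mult.assoc[of "real n"] by simp
qed

lemma stat_a_eq:
 assumes n: "1 \<le> n"
  and good: "if j = 1 then S_mom 0 x y n - mu \<noteq> 0 \<and> S_mom 0 y y n - lam * theta > 0 else S_mom 0 x x n - theta > 0"
  and v: "\<And>i. 1 \<le> i \<Longrightarrow> u_term 0 beta lam theta mu j x y n i = v i"
 shows "stat_a 0 beta lam theta mu j x y n = (\<Sum>i=1..n. v i) / sqrt (real n) *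
  ((\<Sum>i=1..n. (v i - (\<Sum>i=1..n. v i) / real n)\<^sup>2) / (real n - 1)) powr (- 1 / 2)"
proof -
 let ?S = "\<Sum>i=1..n. v i"
 have s: "(\<Sum>i=1..n. u_term 0 beta lam theta mu j x y n i) = ?S" using v by (auto intro!: sum.cong)
 have m: "smean (u_term 0 beta lam theta mu j x y n) n = ?S / real n" unfolding smean_def s by simp
 have q: "(\<Sum>i=1..n. (u_term 0 beta lam theta mu j x y n i - ?S / real n)\<^sup>2) = (\<Sum>i=1..n. (v i - ?S / real n)\<^sup>2)" using v by (auto intro!: sum.cong)
 have "sqrt (real n) * (?S / real n) * sqrt (real n) = ?S / real n * (sqrt (real n) * sqrt (real n))" by (simp only: mult_ac)
 also have "\<dots> = ?S" using n by simp
 finally have root: "sqrt (real n) * (?S / real n) = ?S / sqrt (real n)" using n by (simp add: eq_divide_eq)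
 have e: "U_stat 0 theta mu j x y n * (beta_hat 0 lam theta mu j x y n - beta) = ?S / real n" using estimator_error[OF n good, of beta] unfolding s .
 show ?thesis unfolding stat_a_def m q mult.assoc[of "sqrt (real n)"] e unfolding mult.assoc[symmetric] root ..
qed

lemma fourth_power_sum_le: "(a + b) ^ 4 \<le> 8 * (a ^ 4 + b ^ 4 :: real)"
proof -
 have 4: "x ^ 4 = (x\<^sup>2)\<^sup>2" for x :: real by (simp flip: power_mult)
 have "(a + b)\<^sup>2 \<le> 2 * (a\<^sup>2 + b\<^sup>2)" using zero_le_power2[of "a - b"] by (simp add: power2_sum power2_diff)
 then have "((a + b)\<^sup>2)\<^sup>2 \<le> (2 * (a\<^sup>2 + b\<^sup>2))\<^sup>2" by (intro power_mono) auto
 also have "\<dots> = 4 * (a\<^sup>2 + b\<^sup>2)\<^sup>2" by (simp only: power_mult_distrib) simp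
 also have "\<dots> \<le> 8 * ((a\<^sup>2)\<^sup>2 + (b\<^sup>2)\<^sup>2)" using zero_le_power2[of "a\<^sup>2 - b\<^sup>2"] by (simp add: power2_sum power2_diff)
 finally show ?thesis by (simp only: 4)
qed

locale structural_model = prob_space M for M :: "'a measure" +
 fixes xi delta eps :: "nat \<Rightarrow> 'a \<Rightarrow> real" and beta lam theta mu :: real
 assumes xi_iid: "iid borel xi" and xi_int: "integrable M (xi 0)" and xi_random: "\<not> (\<exists>c. AE om in M. xi 0 om = c)"
  and err_iid: "iid (borel \<Otimes>\<^sub>M borel) (%i om. (delta i om, eps i om))"
  and err_mean: "expectation (delta 0) = 0" "expectation (eps 0) = 0"
  and err_int4: "integrable M (%om. delta 0 om ^ 4)" "integrable M (%om. eps 0 om ^ 4)"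
  and err_cov: "variance (delta 0) = lam * theta" "variance (eps 0) = theta" "covariance (delta 0) (eps 0) = mu"
  and Gamma_pos: "pos_def_matrix (Gamma_matrix lam theta mu)"
  and indep: "indep_rv (\<Pi>\<^sub>M i\<in>UNIV. borel \<Otimes>\<^sub>M borel) (%om. \<lambda>i\<in>UNIV. (delta i om, eps i om))
   (\<Pi>\<^sub>M i\<in>UNIV. borel) (%om. \<lambda>i\<in>UNIV. xi i om)"
begin

lemma variables_measurable[measurable]:
 "random_variable borel (xi i)" "random_variable borel (delta i)" "random_variable borel (eps i)"
proof -
 note [measurable] = iid_measurable[OF err_iid, of i]
 show "random_variable borel (xi i)" by (rule iid_measurable[OF xi_iid])
 have "(%om. fst (delta i om, eps i om)) \<in> borel_measurable M" "(%om. snd (delta i om, eps i om)) \<in> borel_measurable M" by measurable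
 then show "random_variable borel (delta i)" "random_variable borel (eps i)" by simp_all
qed

lemma joint_iid: "iid (borel \<Otimes>\<^sub>M (borel \<Otimes>\<^sub>M borel)) (%i om. (xi i om, delta i om, eps i om))"
 by (rule iid_joint[OF xi_iid err_iid indep_rv_sym[OF indep]])

lemma joint_indep: "indep_rv borel (xi i) (borel \<Otimes>\<^sub>M borel) (%om. (delta i om, eps i om))"
 by (rule iid_joint_indep[OF xi_iid err_iid indep_rv_sym[OF indep]])

definition err :: "real \<Rightarrow> real \<Rightarrow> nat \<Rightarrow> 'a \<Rightarrow> real" where
 "err s t i om = s * delta i om + t * eps i om"

text \<open>The covariance form: \<open>err_form s t s' t'\<close> is the expectation of the product of \<open>s
  \<delta> + t \<epsilon>\<close> and \<open>s' \<delta> + t' \<epsilon>\<close>.\<close>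
definition err_form :: "real \<Rightarrow> real \<Rightarrow> real \<Rightarrow> real \<Rightarrow> real" where
 "err_form s t s' t' = s * s' * (lam * theta) + (s * t' + t * s') * mu + t * t' * theta"

lemma err_measurable[measurable]: "random_variable borel (err s t i)" unfolding err_def[abs_def] by measurable

lemma err_fourth: "integrable M (%om. err s t 0 om ^ 4)"
proof (rule L_integrable_bound)
 show "integrable M (%om. 8 * (s ^ 4 * delta 0 om ^ 4 + t ^ 4 * eps 0 om ^ 4))" by (intro integrable_mult_right L_integrable_add err_int4)
 show "AE om in M. norm (err s t 0 om ^ 4) \<le> norm (8 * (s ^ 4 * delta 0 om ^ 4 + t ^ 4 * eps 0 om ^ 4))"
 proof (intro AE_I2)
  fix om
  have "err s t 0 om ^ 4 \<le> 8 * (s ^ 4 * delta 0 om ^ 4 + t ^ 4 * eps 0 om ^ 4)"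
   using fourth_power_sum_le[of "s * delta 0 om" "t * eps 0 om"] unfolding err_def power_mult_distrib .
  moreover have "0 \<le> err s t 0 om ^ 4" by simp
  ultimately show "norm (err s t 0 om ^ 4) \<le> norm (8 * (s ^ 4 * delta 0 om ^ 4 + t ^ 4 * eps 0 om ^ 4))" by (simp only: real_norm_def abs_of_nonneg)
 qed
qed measurable

lemma err_product:
 shows err_product_square: "integrable M (%om. (err s t 0 om * err s' t' 0 om)\<^sup>2)"
  and err_product_int: "integrable M (%om. err s t 0 om * err s' t' 0 om)"
proof -
 show sq: "integrable M (%om. (err s t 0 om * err s' t' 0 om)\<^sup>2)"
 proof (rule L_integrable_bound)
  show "integrable M (%om. err s t 0 om ^ 4 + err s' t' 0 om ^ 4)" by (intro L_integrable_add err_fourth)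
  have 4: "x ^ 4 = (x\<^sup>2)\<^sup>2" for x :: real by (simp flip: power_mult)
  show "AE om in M. norm ((err s t 0 om * err s' t' 0 om)\<^sup>2) \<le> norm (err s t 0 om ^ 4 + err s' t' 0 om ^ 4)"
  proof (intro AE_I2)
   fix om
   have "\<bar>(err s t 0 om)\<^sup>2 * (err s' t' 0 om)\<^sup>2\<bar> \<le> (err s t 0 om ^ 4 + err s' t' 0 om ^ 4) / 2" unfolding 4 by (rule abs_mult_le_sum_squares)
   also have "\<dots> \<le> err s t 0 om ^ 4 + err s' t' 0 om ^ 4" by simp
   also have "\<dots> \<le> \<bar>err s t 0 om ^ 4 + err s' t' 0 om ^ 4\<bar>" by (rule abs_ge_self)
   finally show "norm ((err s t 0 om * err s' t' 0 om)\<^sup>2) \<le> norm (err s t 0 om ^ 4 + err s' t' 0 om ^ 4)"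
    unfolding real_norm_def power_mult_distrib .
  qed
 qed measurable
 show "integrable M (%om. err s t 0 om * err s' t' 0 om)" by (rule square_integrable_imp_integrable[OF _ sq]) measurable
qed

lemma err_int: "integrable M (err s t 0)"
 using square_integrable_imp_integrable[of "err s t 0"] err_product_int[of s t s t] by (simp add: power2_eq_square)

lemma err_expectation: "expectation (err s t 0) = 0"
proof -
 have d: "integrable M (delta 0)" and e: "integrable M (eps 0)" using err_int[of 1 0] err_int[of 0 1] by (simp_all add: err_def[abs_def])
 show ?thesis unfolding err_def[abs_def] using err_mean by (simp add: L_integral_add[OF integrable_mult_right[OF d] integrable_mult_right[OF e]])
qed

lemma err_product_expectation: "expectation (%om. err s t 0 om * err s' t' 0 om) = err_form s t s' t'"
proof -
 have dd: "has_bochner_integral M (%om. delta 0 om * delta 0 om) (lam * theta)"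
  using err_product_int[of 1 0 1 0] err_cov(1) err_mean(1) by (simp add: err_def has_bochner_integral_iff power2_eq_square)
 have de: "has_bochner_integral M (%om. delta 0 om * eps 0 om) mu"
  using err_product_int[of 1 0 0 1] err_cov(3) err_mean by (simp add: err_def has_bochner_integral_iff covariance_def)
 have ee: "has_bochner_integral M (%om. eps 0 om * eps 0 om) theta"
  using err_product_int[of 0 1 0 1] err_cov(2) err_mean(2) by (simp add: err_def has_bochner_integral_iff power2_eq_square)
 have "has_bochner_integral M (%om. s * s' * (delta 0 om * delta 0 om) + (s * t' + t * s') * (delta 0 om * eps 0 om) + t * t' * (eps 0 om * eps 0 om)) (err_form s t s' t')"
  unfolding err_form_def by (intro has_bochner_integral_add has_bochner_integral_mult_right dd de ee)
 moreover have "err s t 0 om * err s' t' 0 om = s * s' * (delta 0 om * delta 0 om) + (s * t' + t * s') * (delta 0 om * eps 0 om) + t * t' * (eps 0 om * eps 0 om)" for om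
  by (simp add: err_def algebra_simps)
 ultimately show ?thesis by (simp only: has_bochner_integral_iff)
qed

text \<open>The quadratic form of the covariance matrix at \<open>(1, - \<beta>)\<close> is the variance of
  \<open>\<delta> - \<beta> \<epsilon>\<close>.\<close>
lemma err_form_pos: "0 < err_form 1 (- beta) 1 (- beta)"
proof -
 define v :: "real ^ 2" where "v = vector [1, - beta]"
 have v: "v $ 1 = 1" "v $ 2 = - beta" by (simp_all add: v_def)
 have "v \<noteq> 0" using v(1) by auto
 then have "0 < v \<bullet> (Gamma_matrix lam theta mu *v v)" using Gamma_pos unfolding pos_def_matrix_def by blast
 also have "\<dots> = err_form 1 (- beta) 1 (- beta)"
  by (simp add: inner_vec_def matrix_vector_mult_def sum_2 Gamma_matrix_def v err_form_def algebra_simps)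
 finally show ?thesis .
qed

lemma xi_err:
 shows xi_err_int: "integrable M (%om. xi 0 om * err s t 0 om)" and xi_err_expectation: "expectation (%om. xi 0 om * err s t 0 om) = 0"
proof -
 have "indep_rv borel (xi 0) borel (err s t 0)"
  using indep_rv_compose[OF joint_indep[of 0], of "%x. x" borel "%w. s * fst w + t * snd w" borel] by (simp add: err_def[abs_def])
 then have ind: "indep_var borel (xi 0) borel (err s t 0)" by (simp add: indep_rv_iff_distr indep_var_distribution_eq)
 show "integrable M (%om. xi 0 om * err s t 0 om)" by (rule indep_var_integrable[OF ind xi_int err_int])
 show "expectation (%om. xi 0 om * err s t 0 om) = 0" using indep_var_lebesgue_integral[OF ind xi_int err_int] err_expectation by simp
qed

text \<open>Replacing \<open>\<xi>\<^sup>2\<close> by \<open>min(1, \<xi>\<^sup>2)\<close> lowers the average and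
  makes it integrable with positive mean, so the weak law applies although \<open>\<xi>\<close> may have
  infinite variance.\<close>
lemma prob_quadratic_average_nonpos_tendsto_0:
 assumes g: "0 < g"
  and sub: "\<And>n. 1 \<le> n \<Longrightarrow> A n \<subseteq> {om\<in>space M. (\<Sum>i=1..n. g * (xi i om)\<^sup>2 + xi i om * err a b i om + (err s t i om * err s' t' i om - err_form s t s' t')) / real n \<le> 0}"
 shows "(%n. prob (A n)) \<longlonglongrightarrow> 0"
proof -
 define Y where "Y i om = g * min 1 ((xi i om)\<^sup>2) + xi i om * err a b i om + (err s t i om * err s' t' i om - err_form s t s' t')" for i om
 have iidY: "iid borel Y"
  using iid_compose[OF joint_iid, of "%(x, d, e). g * min 1 (x\<^sup>2) + x * (a * d + b * e) + ((s * d + t * e) * (s' * d + t' * e) - err_form s t s' t')" borel]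
  by (simp add: Y_def[abs_def] err_def)
 have nz: "\<not> (AE om in M. xi 0 om = 0)" using xi_random by blast
 note m = min_square_expectation_pos[OF variables_measurable(1) nz]
 have hb: "has_bochner_integral M (Y 0) (g * expectation (%om. min 1 ((xi 0 om)\<^sup>2)) + 0 + (err_form s t s' t' - err_form s t s' t' * 1))"
  unfolding Y_def[abs_def]
 proof (intro has_bochner_integral_add has_bochner_integral_diff has_bochner_integral_mult_right)
  show "has_bochner_integral M (%om. min 1 ((xi 0 om)\<^sup>2)) (expectation (%om. min 1 ((xi 0 om)\<^sup>2)))" using m(1) by (simp add: has_bochner_integral_iff)
  show "has_bochner_integral M (%om. xi 0 om * err a b 0 om) 0" using xi_err by (simp add: has_bochner_integral_iff)
  show "has_bochner_integral M (%om. err s t 0 om * err s' t' 0 om) (err_form s t s' t')"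
   using err_product_int err_product_expectation by (simp add: has_bochner_integral_iff)
  show "has_bochner_integral M (%om. err_form s t s' t') (err_form s t s' t' * 1)" by (simp add: has_bochner_integral_iff prob_space)
 qed
 show ?thesis
 proof (rule prob_average_nonpos_tendsto_0[OF iidY])
  show "integrable M (Y 0)" "0 < expectation (Y 0)" using hb m(2) g by (simp_all add: has_bochner_integral_iff)
  fix n :: nat assume n: "1 \<le> n"
  have le: "(\<Sum>i=1..n. Y i om) / real n \<le> (\<Sum>i=1..n. g * (xi i om)\<^sup>2 + xi i om * err a b i om + (err s t i om * err s' t' i om - err_form s t s' t')) / real n" for om
   unfolding Y_def using g by (intro divide_right_mono sum_mono add_right_mono mult_left_mono) auto
  show "A n \<subseteq> {om\<in>space M. (\<Sum>i=1..n. Y i om) / real n \<le> 0}"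
  proof
   fix om assume "om \<in> A n"
   with sub[OF n] have "om \<in> {om\<in>space M. (\<Sum>i=1..n. g * (xi i om)\<^sup>2 + xi i om * err a b i om + (err s t i om * err s' t' i om - err_form s t s' t')) / real n \<le> 0}" by (rule subsetD)
   then show "om \<in> {om\<in>space M. (\<Sum>i=1..n. Y i om) / real n \<le> 0}" using order.trans[OF le[of om]] by blast
  qed
 qed
qed

text \<open>The first factor \<open>k \<xi> + s \<delta> + t \<epsilon>\<close> is multiplied out: \<open>k\<close>
  times the error difference is the noise \<open>\<eta>\<close>, the centred product of errors is
  \<open>\<zeta>\<close>.\<close>
lemma product_noise_model:
 assumes k: "k \<noteq> 0"
 shows "product_noise M xi (%i om. k * err 1 (- beta) i om) (%i om. err s t i om * err 1 (- beta) i om - err_form s t 1 (- beta))"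
proof (unfold_locales)
 let ?g = "%(d, e). (k * (1 * d + - beta * e), (s * d + t * e) * (1 * d + - beta * e) - err_form s t 1 (- beta))"
 show "iid (borel \<Otimes>\<^sub>M (borel \<Otimes>\<^sub>M borel)) (%i om. (xi i om, k * err 1 (- beta) i om, err s t i om * err 1 (- beta) i om - err_form s t 1 (- beta)))"
  using iid_compose[OF joint_iid, of "%(x, w). (x, ?g w)" "borel \<Otimes>\<^sub>M (borel \<Otimes>\<^sub>M borel)"] by (simp add: err_def)
 show "indep_rv borel (xi 0) (borel \<Otimes>\<^sub>M borel) (%om. (k * err 1 (- beta) 0 om, err s t 0 om * err 1 (- beta) 0 om - err_form s t 1 (- beta)))"
  using indep_rv_compose[OF joint_indep[of 0], of "%x. x" borel ?g "borel \<Otimes>\<^sub>M borel"] by (simp add: err_def)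
 show "integrable M (xi 0)" "\<not> (\<exists>c. AE om in M. xi 0 om = c)" by (rule xi_int xi_random)+
 show "expectation (%om. k * err 1 (- beta) 0 om) = 0" using err_expectation by simp
 show "integrable M (%om. (k * err 1 (- beta) 0 om) ^ 4)" unfolding power_mult_distrib by (intro integrable_mult_right err_fourth)
 show "\<not> (AE om in M. k * err 1 (- beta) 0 om = 0)"
 proof
  assume "AE om in M. k * err 1 (- beta) 0 om = 0"
  then have "AE om in M. err 1 (- beta) 0 om * err 1 (- beta) 0 om = 0" using k by (auto elim: AE_mp)
  then have "expectation (%om. err 1 (- beta) 0 om * err 1 (- beta) 0 om) = 0" by (rule integral_eq_zero_AE)
  then show False using err_form_pos by (simp add: err_product_expectation)
 qed
 show "expectation (%om. err s t 0 om * err 1 (- beta) 0 om - err_form s t 1 (- beta)) = 0"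
  using err_product_int err_product_expectation by (subst L_integral_diff) (auto simp: prob_space)
 show "integrable M (%om. (err s t 0 om * err 1 (- beta) 0 om - err_form s t 1 (- beta))\<^sup>2)"
  unfolding power2_diff using err_product_square err_product_int
  by (intro L_integrable_add L_integrable_diff integrable_mult_left integrable_mult_right) auto
qed

end

theorem theorem1:
  fixes M :: "'a measure"
    and xi delta eps x y :: "nat \<Rightarrow> 'a \<Rightarrow> real"
    and alpha beta lam theta mu :: real
    and j :: nat
  assumes M: "prob_space M"
    (* index 0 is reserved for the generic copies of xi, delta, eps *)
    and model_y: "\<And>i \<omega>. i \<ge> 1 \<Longrightarrow> \<omega> \<in> space M \<Longrightarrow> y i \<omega> = beta * xi i \<omega> + alpha + delta i \<omega>"
    and model_x: "\<And>i \<omega>. i \<ge> 1 \<Longrightarrow> \<omega> \<in> space M \<Longrightarrow> x i \<omega> = xi i \<omega> + eps i \<omega>"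
    and intercept: "alpha = 0"
    and xi_iid: "prob_space.iid M borel xi"
    and xi_mean: "integrable M (xi 0)"
    (* structural model: for constant nonzero xi the limit theorems hold, but xi is not in DAN *)
    and xi_random: "\<not> (\<exists>c. AE \<omega> in M. xi 0 \<omega> = c)"
    and err_iid: "prob_space.iid M (borel \<Otimes>\<^sub>M borel) (\<lambda>i \<omega>. (delta i \<omega>, eps i \<omega>))"
    and err_mean: "prob_space.expectation M (delta 0) = 0" "prob_space.expectation M (eps 0) = 0"
    and err_moment4: "integrable M (\<lambda>\<omega>. delta 0 \<omega> ^ 4)" "integrable M (\<lambda>\<omega>. eps 0 \<omega> ^ 4)"
    and err_cov: "prob_space.variance M (delta 0) = lam * theta"
      "prob_space.variance M (eps 0) = theta"
      "prob_space.covariance M (delta 0) (eps 0) = mu"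
    and Gamma_pos: "pos_def_matrix (Gamma_matrix lam theta mu)"
    and indep: "prob_space.indep_rv M
      (\<Pi>\<^sub>M i\<in>UNIV. borel \<Otimes>\<^sub>M borel) (\<lambda>\<omega>. \<lambda>i\<in>UNIV. (delta i \<omega>, eps i \<omega>))
      (\<Pi>\<^sub>M i\<in>UNIV. borel) (\<lambda>\<omega>. \<lambda>i\<in>UNIV. xi i \<omega>)"
    and j: "j = 1 \<or> j = 2"
    (* for beta = 0 the estimator with j = 1 is not defined with probability tending to 1,
       and u_i(1,n) does not involve xi *)
    and slope: "j = 1 \<Longrightarrow> beta \<noteq> 0"
  shows "(prob_space.DAN M xi \<longleftrightarrow>
            prob_space.conv_std_normal M
              (\<lambda>n \<omega>. stat_a 0 beta lam theta mu j (\<lambda>i. x i \<omega>) (\<lambda>i. y i \<omega>) n))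
       \<and> (prob_space.DAN M xi \<longleftrightarrow>
            prob_space.conv_std_normal M
              (\<lambda>n \<omega>. stat_b 0 beta lam theta mu j (\<lambda>i. x i \<omega>) (\<lambda>i. y i \<omega>) n))"
proof -
 interpret prob_space M by (rule M)
 interpret structural_model M xi delta eps beta lam theta mu by unfold_locales (use assms in auto)
  \<comment> \<open>The factor \<open>k \<xi> + s \<delta> + t \<epsilon>\<close> is \<open>y\<close> in the case \<open>j = 1\<close> and \<open>x\<close> in the case \<open>j = 2\<close>.\<close>
 define k where "k = (if j = 1 then beta else 1)"
 define s :: real where "s = (if j = 1 then 1 else 0)"
 define t :: real where "t = (if j = 1 then 0 else 1)"
 have k: "k \<noteq> 0" using slope by (simp add: k_def)
 interpret pn: product_noise M xi "%i om. k * err 1 (- beta) i om" "%i om. err s t i om * err 1 (- beta) i om - err_form s t 1 (- beta)"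
  by (rule product_noise_model[OF k])
  \<comment> \<open>The observations at index 0 need not satisfy the model; the statistics never use them.\<close>
 define x' where "x' i om = xi i om + eps i om" for i om
 define y' where "y' i om = beta * xi i om + delta i om" for i om
 have [measurable]: "random_variable borel (x' i)" "random_variable borel (y' i)" for i unfolding x'_def[abs_def] y'_def[abs_def] by measurable
 have pn_u: "pn.u i om = xi i om * (k * err 1 (- beta) i om) + (err s t i om * err 1 (- beta) i om - err_form s t 1 (- beta))" for i om
  by (simp only: pn.u_def)
 have term_eq: "u_term 0 beta lam theta mu j (%i. x' i om) (%i. y' i om) n i = pn.u i om" for n i om
  unfolding pn_u using j by (auto simp: u_term_def s_dev_def x'_def y'_def err_def err_form_def k_def s_def t_def algebra_simps)
 let ?good = "%n om. if j = 1 then S_mom 0 (%i. x' i om) (%i. y' i om) n - mu \<noteq> 0 \<and> S_mom 0 (%i. y' i om) (%i. y' i om) n - lam * theta > 0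
   else S_mom 0 (%i. x' i om) (%i. x' i om) n - theta > 0"
 have S_meas[measurable]: "random_variable borel (%om. S_mom 0 (%i. x' i om) (%i. y' i om) n)"
  "random_variable borel (%om. S_mom 0 (%i. y' i om) (%i. y' i om) n)" "random_variable borel (%om. S_mom 0 (%i. x' i om) (%i. x' i om) n)" for n
  unfolding S_mom_zero by measurable
 define Bad where "Bad n = {om\<in>space M. \<not> ?good n om}" for n
 have Bad_ev: "Bad n \<in> events" for n unfolding Bad_def by (cases "j = 1") simp_all
 have xx: "S_mom 0 (%i. x' i om) (%i. x' i om) n - theta =
   (\<Sum>i=1..n. 1 * (xi i om)\<^sup>2 + xi i om * err 0 2 i om + (err 0 1 i om * err 0 1 i om - err_form 0 1 0 1)) / real n" if "1 \<le> n" for n om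
  unfolding S_mom_zero average_minus_const[OF that]
  by (intro arg_cong2[where f = "(/)"] sum.cong refl) (simp add: x'_def err_def err_form_def power2_eq_square algebra_simps)
 have yy: "S_mom 0 (%i. y' i om) (%i. y' i om) n - lam * theta =
   (\<Sum>i=1..n. beta\<^sup>2 * (xi i om)\<^sup>2 + xi i om * err (2 * beta) 0 i om + (err 1 0 i om * err 1 0 i om - err_form 1 0 1 0)) / real n" if "1 \<le> n" for n om
  unfolding S_mom_zero average_minus_const[OF that]
  by (intro arg_cong2[where f = "(/)"] sum.cong refl) (simp add: y'_def err_def err_form_def power2_eq_square algebra_simps)
  \<comment> \<open>Multiplication by \<open>\<beta>\<close> gives \<open>\<xi>\<^sup>2\<close> the positive coefficient \<open>\<beta>\<^sup>2\<close>; the event \<open>S\<^sub>x\<^sub>y = \<mu>\<close> is not affected.\<close>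
 have xy: "beta * (S_mom 0 (%i. x' i om) (%i. y' i om) n - mu) =
   (\<Sum>i=1..n. beta\<^sup>2 * (xi i om)\<^sup>2 + xi i om * err beta (beta\<^sup>2) i om + (err 0 beta i om * err 1 0 i om - err_form 0 beta 1 0)) / real n" if "1 \<le> n" for n om
  unfolding S_mom_zero average_minus_const[OF that] times_divide_eq_right sum_distrib_left
  by (intro arg_cong2[where f = "(/)"] sum.cong refl) (simp add: x'_def y'_def err_def err_form_def power2_eq_square algebra_simps)
 have Bad_0: "(%n. prob (Bad n)) \<longlonglongrightarrow> 0"
 proof (cases "j = 1")
  case False
  show ?thesis
  proof (rule prob_quadratic_average_nonpos_tendsto_0[OF zero_less_one])
   fix n :: nat assume n: "1 \<le> n"
   show "Bad n \<subseteq> {om\<in>space M. (\<Sum>i=1..n. 1 * (xi i om)\<^sup>2 + xi i om * err 0 2 i om + (err 0 1 i om * err 0 1 i om - err_form 0 1 0 1)) / real n \<le> 0}"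
    unfolding xx[OF n, symmetric] Bad_def using False by auto
  qed
 next
  case True
  have b2: "0 < beta\<^sup>2" using slope[OF True] by simp
  let ?B1 = "%n. {om\<in>space M. S_mom 0 (%i. y' i om) (%i. y' i om) n - lam * theta \<le> 0}"
  let ?B2 = "%n. {om\<in>space M. S_mom 0 (%i. x' i om) (%i. y' i om) n - mu = 0}"
  have "(%n. prob (?B1 n)) \<longlonglongrightarrow> 0"
  proof (rule prob_quadratic_average_nonpos_tendsto_0[OF b2])
   fix n :: nat assume n: "1 \<le> n"
   show "?B1 n \<subseteq> {om\<in>space M. (\<Sum>i=1..n. beta\<^sup>2 * (xi i om)\<^sup>2 + xi i om * err (2 * beta) 0 i om + (err 1 0 i om * err 1 0 i om - err_form 1 0 1 0)) / real n \<le> 0}"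
    unfolding yy[OF n, symmetric] by simp
  qed
  moreover have "(%n. prob (?B2 n)) \<longlonglongrightarrow> 0"
  proof (rule prob_quadratic_average_nonpos_tendsto_0[OF b2])
   fix n :: nat assume n: "1 \<le> n"
   show "?B2 n \<subseteq> {om\<in>space M. (\<Sum>i=1..n. beta\<^sup>2 * (xi i om)\<^sup>2 + xi i om * err beta (beta\<^sup>2) i om + (err 0 beta i om * err 1 0 i om - err_form 0 beta 1 0)) / real n \<le> 0}"
    unfolding xy[OF n, symmetric] by auto
  qed
  ultimately have "(%n. prob (?B1 n \<union> ?B2 n)) \<longlonglongrightarrow> 0" by (rule prob_Un_tendsto_0) measurable
  moreover have "Bad n = ?B1 n \<union> ?B2 n" for n unfolding Bad_def using True by auto
  ultimately show ?thesis by simp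
 qed
 have meas: "random_variable borel (%om. stat_a 0 beta lam theta mu j (%i. x' i om) (%i. y' i om) n)"
  "random_variable borel (%om. stat_b 0 beta lam theta mu j (%i. x' i om) (%i. y' i om) n)" for n
  unfolding stat_a_def stat_b_def term_eq smean_def U_stat_def beta_hat_def by measurable
 have clt_a: "DAN xi \<longleftrightarrow> conv_std_normal (%n om. stat_a 0 beta lam theta mu j (%i. x' i om) (%i. y' i om) n)"
 proof (rule pn.DAN_iff_studentized_clt[OF Bad_0 Bad_ev meas(1)])
  fix n :: nat and om assume "2 \<le> n" "om \<in> space M" "om \<notin> Bad n"
  then have "1 \<le> n" "?good n om" by (auto simp: Bad_def)
  from stat_a_eq[OF this term_eq]
  show "stat_a 0 beta lam theta mu j (%i. x' i om) (%i. y' i om) n = (\<Sum>i=1..n. pn.u i om) / sqrt (real n) *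
    ((\<Sum>i=1..n. (pn.u i om - (\<Sum>i=1..n. pn.u i om) / real n)\<^sup>2) / (real n - 1)) powr (- 1 / 2)" .
 qed
 have clt_b: "DAN xi \<longleftrightarrow> conv_std_normal (%n om. stat_b 0 beta lam theta mu j (%i. x' i om) (%i. y' i om) n)"
 proof (rule pn.DAN_iff_clt_up_to_event[OF Bad_0 Bad_ev meas(2)])
  fix n :: nat and om assume "2 \<le> n" "om \<in> space M" "om \<notin> Bad n"
  then have "1 \<le> n" "?good n om" by (auto simp: Bad_def)
  from stat_b_eq[OF this term_eq]
  show "stat_b 0 beta lam theta mu j (%i. x' i om) (%i. y' i om) n = pn.self_normalized_sum n om" unfolding pn.self_normalized_sum_def .
 qed
 have eq: "stat_a 0 beta lam theta mu j (%i. x i om) (%i. y i om) n = stat_a 0 beta lam theta mu j (%i. x' i om) (%i. y' i om) n \<and>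
   stat_b 0 beta lam theta mu j (%i. x i om) (%i. y i om) n = stat_b 0 beta lam theta mu j (%i. x' i om) (%i. y' i om) n" if "om \<in> space M" for n om
 proof -
  have eq: "x i om = x' i om" "y i om = y' i om" if "1 \<le> i" for i
   using that \<open>om \<in> space M\<close> model_x model_y intercept by (simp_all add: x'_def y'_def)
  have S: "S_mom 0 (%i. x i om) (%i. y i om) n = S_mom 0 (%i. x' i om) (%i. y' i om) n"
   "S_mom 0 (%i. x i om) (%i. x i om) n = S_mom 0 (%i. x' i om) (%i. x' i om) n"
   "S_mom 0 (%i. y i om) (%i. y i om) n = S_mom 0 (%i. y' i om) (%i. y' i om) n"
   unfolding S_mom_zero by (auto intro!: arg_cong2[where f = "(/)"] sum.cong simp: eq)
  have U: "u_term 0 beta lam theta mu j (%i. x i om) (%i. y i om) n i = u_term 0 beta lam theta mu j (%i. x' i om) (%i. y' i om) n i" if "1 \<le> i" for i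
   using eq[OF that] by (simp add: u_term_def s_dev_def)
  have m: "smean (u_term 0 beta lam theta mu j (%i. x i om) (%i. y i om) n) n = smean (u_term 0 beta lam theta mu j (%i. x' i om) (%i. y' i om) n) n"
   unfolding smean_def by (intro arg_cong2[where f = "(*)"] sum.cong refl U) simp
  have sq: "(\<Sum>i=1..n. (u_term 0 beta lam theta mu j (%i. x i om) (%i. y i om) n i - c)\<^sup>2) =
    (\<Sum>i=1..n. (u_term 0 beta lam theta mu j (%i. x' i om) (%i. y' i om) n i - c)\<^sup>2)" for c by (intro sum.cong refl) (simp add: U)
  show ?thesis unfolding stat_a_def stat_b_def U_stat_def beta_hat_def S m sq sq[of 0, unfolded diff_0_right] by simp
 qed
 have "conv_std_normal (%n om. stat_a 0 beta lam theta mu j (%i. x i om) (%i. y i om) n) \<longleftrightarrow>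
   conv_std_normal (%n om. stat_a 0 beta lam theta mu j (%i. x' i om) (%i. y' i om) n)" by (rule conv_std_normal_cong) (rule conjunct1[OF eq])
 moreover have "conv_std_normal (%n om. stat_b 0 beta lam theta mu j (%i. x i om) (%i. y i om) n) \<longleftrightarrow>
   conv_std_normal (%n om. stat_b 0 beta lam theta mu j (%i. x' i om) (%i. y' i om) n)" by (rule conv_std_normal_cong) (rule conjunct2[OF eq])
 ultimately show ?thesis using clt_a clt_b by blast
qed

end
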